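(* In the setting of the context, with the degrees of freedom $\phi^\ast_{S,i}$ fixed there: for every $S,F\in\mathcal T$ with $\dim F=n-1$ and $S\subseteq F$, and every $i\in I(S)$, there exists $\mathring\xi_{F,S,i}\in C^\infty_c\Lambda^{n-k-1}(F)$ such that for every $T\in\Delta_n(\mathcal T)$ with $F\subseteq T$ $$\int_F\mathring\xi_{F,S,i}\wedge\operatorname{tr}_F\omega=\phi^\ast_{S,i}(\omega),\qquad\omega\in\mathcal P_r\Lambda^k(T).$$ Furthermore, for every $T\in\Delta_n(\mathcal T)$ with $F\subseteq T$ there exists $\Xi_{T,F,S,i}\in C^\infty\Lambda^{n-k-1}(T)$ such that $\operatorname{tr}_F\Xi_{T,F,S,i}=\mathring\xi_{F,S,i}$ and the support of $\Xi_{T,F,S,i}$ has positive distance from all facets of $T$ except $F$. Moreover, there exists $C_\Xi>0$, depending only on $n$, $p\in[1,\infty]$, the polynomial degree $r$, and the shape measure of the triangulation, such that $$\|\Xi_{T,F,S,i}\|_{L^p\Lambda^{n-k-1}(T)}\le C_\Xi\,h_S^{\frac np-n+k+1},\qquad\|d\Xi_{T,F,S,i}\|_{L^p\Lambda^{n-k}(T)}\le C_\Xi\,h_S^{\frac np-n+k}.$$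
   Context: Triangulation. $\mathcal T$ is a finite $n$-dimensional simplicial complex in $\mathbb R^n$ (every simplex is contained in an $n$-dimensional simplex of $\mathcal T$) that triangulates a domain $\Omega$: $\overline\Omega$ is the union of the simplices and $\Omega$ is the interior of that union. $\Delta_n(\mathcal T)$ is the set of $n$-dimensional simplices. $\mathcal T$ is face-connected: for all $T_0,T\in\Delta_n(\mathcal T)$ with $T_0\cap T\neq\emptyset$ there is a sequence $T_1,\dots,T_N=T$ in $\Delta_n(\mathcal T)$ such that each $F_i=T_i\cap T_{i-1}$ is a common facet of $T_i$ and $T_{i-1}$ with $T_0\cap T\subseteq F_i$. All simplices carry a fixed orientation. For a simplex $T$ of dimension $d\ge1$, $h_T$ is its diameter and $\mu(T)=h_T^d/\mathrm{vol}^d(T)$; for a vertex $V$, $h_V$ is the minimum length of an edge adjacent to $V$. The shape measure $\mu(\mathcal T)$ is $\sup\mu(T)$ over non-vertex simplices. Forms. $C^\infty\Lambda^l(T)$: smooth $l$-forms on $T$ (up to the boundary). $C^\infty_c\Lambda^l(F)$: smooth $l$-forms on $F$ with compact support in the relative interior of $F$. $\operatorname{tr}_F$: trace (pullback under inclusion) onto $F$. Finite element spaces. Fix $p\in[1,\infty]$, $k\in\mathbb N_0$, $r\in\mathbb N$. $\mathcal P_r\Lambda^k$: $k$-forms with polynomial coefficients of degree at most $r$ (zero for $r<0$ or $k<0$). For $r\ge1$, $\mathcal P^-_r\Lambda^k=\mathcal P_{r-1}\Lambda^k+\kappa\mathcal P_{r-1}\Lambda^{k+1}$ with $\kappa$ the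 contraction with the position vector field; zero for $r\le0$. $\mathcal P_r\Lambda^k(S),\mathcal P^-_r\Lambda^k(S)$ are the pullbacks to a simplex $S$; $\mathring{\mathcal P}_r\Lambda^k(S),\mathring{\mathcal P}^-_r\Lambda^k(S)$ are the subspaces with vanishing trace on all proper subsimplices of $S$. For $S\in\mathcal T$, $m=\dim S$, $\mathcal C_r\Lambda^k(S)$ is the space of functionals $\omega\mapsto\int_S\eta\wedge\operatorname{tr}_S\omega$ with $\eta\in\mathcal P^-_{r+k-m}\Lambda^{m-k}(S)$; $\mathcal C^-_r\Lambda^k(S)$ is the same with $\eta\in\mathcal P_{r+k-m-1}\Lambda^{m-k}(S)$. $\mathring{\mathcal P}\Lambda^k,\mathcal C\Lambda^k$ denote either consistently $\mathring{\mathcal P}_r\Lambda^k,\mathcal C_r\Lambda^k$ or consistently $\mathring{\mathcal P}^-_r\Lambda^k,\mathcal C^-_r\Lambda^k$ (first option if $k=0$, second if $k=n$). $I(S)=\{1,\dots,\dim\mathring{\mathcal P}\Lambda^k(S)\}$. Fixed degrees of freedom. $\{\phi^\ast_{S,i}\}_{i\in I(S)}$ is a basis of $\mathcal C\Lambda^k(S)$ obtained by pullback from a reference simplex: for each dimension $m$ one fixes a reference $m$-simplex $\hat\Delta^m$ and a fixed basis $\hat\eta_{m,1},\hat\eta_{m,2},\dots$ of $\mathcal P^-_{r+k-m}\Lambda^{m-k}(\hat\Delta^m)$ (resp. $\mathcal P_{r+k-m-1}\Lambda^{m-k}(\hat\Delta^m)$), and for $S$ of dimension $m$ one puts $\phi^\ast_{S,i}(\omega)=\int_S\big((A_S^{-1})^\ast\hat\eta_{m,i}\big)\wedge\operatorname{tr}_S\omega$,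 where $A_S:\hat\Delta^m\to S$ is an affine bijection. *)

theory Defs
  imports
    "HOL-Analysis.Analysis"
    "HOL-Library.Function_Algebras"
    "HOL-Probability.Essential_Supremum"
begin

instantiation "fun" :: (type, real_vector) real_vector
begin

definition scaleR_fun :: "real \<Rightarrow> ('a \<Rightarrow> 'b) \<Rightarrow> 'a \<Rightarrow> 'b"
  where "scaleR_fun c f = (\<lambda>x. c *\<^sub>R f x)"

instance
  by standard (auto simp: scaleR_fun_def fun_eq_iff algebra_simps)

end

section \<open>Differential forms on subsets of a Euclidean space\<close>

text \<open>
  An \<open>l\<close>-form \<open>\<omega>\<close> on \<open>X\<close> assigns to \<open>x \<in> X\<close> an alternating \<open>l\<close>-linear functional on the tangent
  space of \<open>X\<close>; its arguments are given as a list of length \<open>l\<close>. Every form is represented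
  uniquely, by extending it with \<open>0\<close> to points outside \<open>X\<close> and to lists of the wrong length or
  with non-tangential entries. Degrees are integers, so that there is only the zero form in
  negative degree.
\<close>

type_synonym 'a dform = "'a \<Rightarrow> 'a list \<Rightarrow> real"

text \<open>The direction space of the affine hull; used for simplices and for the whole space.\<close>

definition tangent :: "'a::real_vector set \<Rightarrow> 'a set"
  where "tangent X = span {x - y |x y. x \<in> X \<and> y \<in> X}"

definition alt_forms :: "int \<Rightarrow> 'a::real_vector set \<Rightarrow> ('a list \<Rightarrow> real) set"
  where "alt_forms l V = {f.
    (\<forall>vs. f vs \<noteq> 0 \<longrightarrow> int (length vs) = l \<and> set vs \<subseteq> V) \<and>
    (\<forall>us ws u v a b. set us \<subseteq> V \<and> set ws \<subseteq> V \<and> u \<in> V \<and> v \<in> V \<longrightarrow>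
       f (us @ (a *\<^sub>R u + b *\<^sub>R v) # ws) = a * f (us @ u # ws) + b * f (us @ v # ws)) \<and>
    (\<forall>vs. \<not> distinct vs \<longrightarrow> f vs = 0)}"

definition dforms :: "int \<Rightarrow> 'a::real_vector set \<Rightarrow> 'a dform set"
  where "dforms l X = {\<omega>. (\<forall>x\<in>X. \<omega> x \<in> alt_forms l (tangent X)) \<and> (\<forall>x. x \<notin> X \<longrightarrow> \<omega> x = (\<lambda>vs. 0))}"

definition form_trace :: "'a::real_vector set \<Rightarrow> 'a dform \<Rightarrow> 'a dform"
  where "form_trace X \<omega> = (\<lambda>x vs. if x \<in> X \<and> set vs \<subseteq> tangent X then \<omega> x vs else 0)"

text \<open>The exterior product on the graded algebra of forms: for homogeneous factors of degrees
  \<open>a\<close> and \<open>b\<close> only the summand with that \<open>a\<close> and with \<open>length vs = a + b\<close> is nonzero.\<close>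

definition wedge :: "'a dform \<Rightarrow> 'a dform \<Rightarrow> 'a dform"
  where "wedge \<alpha> \<beta> = (\<lambda>x vs. \<Sum>a\<le>length vs.
    (\<Sum>\<sigma> | \<sigma> permutes {..<length vs}.
       of_int (sign \<sigma>) * \<alpha> x (map (\<lambda>j. vs ! \<sigma> j) [0..<a])
                       * \<beta> x (map (\<lambda>j. vs ! \<sigma> j) [a..<length vs]))
    / (fact a * fact (length vs - a)))"

text \<open>The exterior derivative. Only used on full-dimensional simplices, where the derivative is
  uniquely determined except possibly on the boundary, a null set.\<close>

definition ext_deriv :: "'a::real_normed_vector set \<Rightarrow> 'a dform \<Rightarrow> 'a dform"
  where "ext_deriv X \<omega> = (\<lambda>x vs. if x \<in> X
    then \<Sum>j<length vs. (-1) ^ j *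
      frechet_derivative (\<lambda>y. \<omega> y (take j vs @ drop (Suc j) vs)) (at x within X) (vs ! j)
    else 0)"

text \<open>\<open>D us\<close> is the iterated derivative of \<open>f\<close> in the directions \<open>us\<close>.\<close>

definition smooth_fun :: "('a::real_normed_vector \<Rightarrow> real) \<Rightarrow> bool"
  where "smooth_fun f \<longleftrightarrow> (\<exists>D :: 'a list \<Rightarrow> 'a \<Rightarrow> real. D [] = f \<and>
    (\<forall>us x. (D us has_derivative (\<lambda>h. D (h # us) x)) (at x)))"

text \<open>Smoothness up to the boundary means that the components are restrictions of smooth
  functions on the whole space.\<close>

definition smooth_forms :: "int \<Rightarrow> 'a::real_normed_vector set \<Rightarrow> 'a dform set"
  where "smooth_forms l X = {\<omega> \<in> dforms l X.
    \<forall>vs. set vs \<subseteq> tangent X \<longrightarrow> (\<exists>g. smooth_fun g \<and> (\<forall>x\<in>X. \<omega> x vs = g x))}"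

definition form_support :: "'a::topological_space dform \<Rightarrow> 'a set"
  where "form_support \<omega> = closure {x. \<omega> x \<noteq> (\<lambda>vs. 0)}"

definition smooth_forms_c :: "int \<Rightarrow> 'a::euclidean_space set \<Rightarrow> 'a dform set"
  where "smooth_forms_c l X =
    {\<omega> \<in> smooth_forms l X. compact (form_support \<omega>) \<and> form_support \<omega> \<subseteq> rel_interior X}"

text \<open>The Euclidean norm on alternating \<open>l\<close>-linear functionals on the whole space, in which the
  increasing exterior products of the dual standard basis are orthonormal: each increasing
  multi-index is counted \<open>fact l\<close> times.\<close>

definition alt_norm :: "int \<Rightarrow> ('a::euclidean_space list \<Rightarrow> real) \<Rightarrow> real"
  where "alt_norm l f =
    sqrt ((\<Sum>vs | int (length vs) = l \<and> set vs \<subseteq> Basis. (f vs)\<^sup>2) / fact (nat l))"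

definition Lp_norm :: "ereal \<Rightarrow> int \<Rightarrow> 'a::euclidean_space set \<Rightarrow> 'a dform \<Rightarrow> ereal"
  where "Lp_norm p l X \<omega> =
    (if p = \<infinity> then esssup (lebesgue_on X) (\<lambda>x. ereal (alt_norm l (\<omega> x)))
     else if integrable (lebesgue_on X) (\<lambda>x. alt_norm l (\<omega> x) powr real_of_ereal p)
     then ereal ((LINT x|lebesgue_on X. alt_norm l (\<omega> x) powr real_of_ereal p)
                   powr (1 / real_of_ereal p))
     else \<infinity>)"

section \<open>Integration over oriented simplices\<close>

text \<open>A nonempty simplex is oriented by an enumeration \<open>ws\<close> of its vertices. A form is integrated
  over it by pulling it back along the affine chart \<open>simplex_chart ws\<close> from the standard simplex
  in \<open>\<real>\<^sup>m\<close>. A vertex carries the positive orientation, so that integration over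
  it is evaluation.\<close>

definition simplex_edges :: "'a::real_vector list \<Rightarrow> 'a list"
  where "simplex_edges ws = map (\<lambda>w. w - hd ws) (tl ws)"

definition simplex_chart :: "'a::real_vector list \<Rightarrow> (nat \<Rightarrow> real) \<Rightarrow> 'a"
  where "simplex_chart ws t = hd ws + (\<Sum>j<length ws - 1. t j *\<^sub>R (simplex_edges ws ! j))"

definition lborel_power :: "nat \<Rightarrow> (nat \<Rightarrow> real) measure"
  where "lborel_power m = (\<Pi>\<^sub>M j\<in>{..<m}. lborel)"

definition std_simplex :: "nat \<Rightarrow> (nat \<Rightarrow> real) set"
  where "std_simplex m = {t \<in> space (lborel_power m). (\<forall>j<m. 0 \<le> t j) \<and> (\<Sum>j<m. t j) \<le> 1}"

definition form_integral :: "'a::real_vector list \<Rightarrow> 'a dform \<Rightarrow> real"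
  where "form_integral ws \<omega> =
    (let m = length ws - 1 in
     set_lebesgue_integral (lborel_power m) (std_simplex m)
       (\<lambda>t. \<omega> (simplex_chart ws t) (simplex_edges ws)))"

definition gram_det :: "'a::real_inner list \<Rightarrow> real"
  where "gram_det us = (\<Sum>\<sigma> | \<sigma> permutes {..<length us}.
    of_int (sign \<sigma>) * (\<Prod>j<length us. us ! j \<bullet> us ! \<sigma> j))"

definition vertices :: "'a::real_vector set \<Rightarrow> 'a set"
  where "vertices S = {v. v extreme_point_of S}"

text \<open>The dimension-\<open>d\<close> volume is the integral of the Riemannian density over the affine chart.
  That density is constant, and the result does not depend on the enumeration.\<close>

definition simplex_volume :: "'a::euclidean_space set \<Rightarrow> real"
  where "simplex_volume S =
    (let ws = (SOME ws. distinct ws \<and> set ws = vertices S); m = length ws - 1 in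
     measure (lborel_power m) (std_simplex m) * sqrt (gram_det (simplex_edges ws)))"

section \<open>Polynomial differential forms\<close>

text \<open>Polynomials of degree at most \<open>r\<close>; there is only the zero polynomial if \<open>r\<close> is negative.\<close>

definition poly_fun :: "int \<Rightarrow> ('a::euclidean_space \<Rightarrow> real) \<Rightarrow> bool"
  where "poly_fun r q \<longleftrightarrow> (\<exists>c :: ('a \<Rightarrow> nat) \<Rightarrow> real. \<forall>x. q x =
    (\<Sum>\<alpha> | (\<forall>b. b \<notin> Basis \<longrightarrow> \<alpha> b = 0) \<and> int (\<Sum>b\<in>Basis. \<alpha> b) \<le> r.
       c \<alpha> * (\<Prod>b\<in>Basis. (x \<bullet> b) ^ \<alpha> b)))"

definition poly_forms :: "int \<Rightarrow> int \<Rightarrow> 'a::euclidean_space dform set"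
  where "poly_forms r l = {\<omega> \<in> dforms l UNIV. \<forall>vs. poly_fun r (\<lambda>x. \<omega> x vs)}"

definition koszul :: "'a dform \<Rightarrow> 'a dform"
  where "koszul \<omega> = (\<lambda>x vs. \<omega> x (x # vs))"

definition trimmed_poly_forms :: "int \<Rightarrow> int \<Rightarrow> 'a::euclidean_space dform set"
  where "trimmed_poly_forms r l =
    {\<alpha> + koszul \<beta> |\<alpha> \<beta>. \<alpha> \<in> poly_forms (r - 1) l \<and> \<beta> \<in> poly_forms (r - 1) (l + 1)}"

definition poly_forms_on :: "int \<Rightarrow> int \<Rightarrow> 'a::euclidean_space set \<Rightarrow> 'a dform set"
  where "poly_forms_on r l S = form_trace S ` poly_forms r l"

definition trimmed_poly_forms_on :: "int \<Rightarrow> int \<Rightarrow> 'a::euclidean_space set \<Rightarrow> 'a dform set"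
  where "trimmed_poly_forms_on r l S = form_trace S ` trimmed_poly_forms r l"

datatype fe_family = Full | Trimmed

definition admissible_family :: "nat \<Rightarrow> fe_family \<Rightarrow> nat \<Rightarrow> bool"
  where "admissible_family n fam k \<longleftrightarrow> (k = 0 \<longrightarrow> fam = Full) \<and> (k = n \<longrightarrow> fam = Trimmed)"

definition sdim :: "'a::euclidean_space set \<Rightarrow> nat"
  where "sdim S = nat (aff_dim S)"

fun fe_forms :: "fe_family \<Rightarrow> nat \<Rightarrow> nat \<Rightarrow> 'a::euclidean_space set \<Rightarrow> 'a dform set"
  where
    "fe_forms Full r k S = poly_forms_on (int r) (int k) S"
  | "fe_forms Trimmed r k S = trimmed_poly_forms_on (int r) (int k) S"

definition fe_forms0 :: "fe_family \<Rightarrow> nat \<Rightarrow> nat \<Rightarrow> 'a::euclidean_space set \<Rightarrow> 'a dform set"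
  where "fe_forms0 fam r k S =
    {\<omega> \<in> fe_forms fam r k S. \<forall>G. G face_of S \<and> G \<noteq> S \<longrightarrow> form_trace G \<omega> = 0}"

definition fe_index :: "fe_family \<Rightarrow> nat \<Rightarrow> nat \<Rightarrow> 'a::euclidean_space set \<Rightarrow> nat set"
  where "fe_index fam r k S = {1..dim (fe_forms0 fam r k S)}"

section \<open>Degrees of freedom\<close>

text \<open>The forms \<open>\<eta>\<close> that define the functionals \<open>\<omega> \<mapsto> \<integral>\<^sub>S \<eta> \<and> tr\<^sub>S \<omega>\<close>.\<close>

fun dof_forms :: "fe_family \<Rightarrow> nat \<Rightarrow> nat \<Rightarrow> 'a::euclidean_space set \<Rightarrow> 'a dform set"
  where
    "dof_forms Full r k S =
       trimmed_poly_forms_on (int r + int k - int (sdim S)) (int (sdim S) - int k) S"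
  | "dof_forms Trimmed r k S =
       poly_forms_on (int r + int k - int (sdim S) - 1) (int (sdim S) - int k) S"

text \<open>Reference simplices \<open>R m\<close>, and for each family and each form degree \<open>k\<close> a basis
  \<open>\<eta> fam k m 1, \<eta> fam k m 2, \<dots>\<close> on \<open>R m\<close>.\<close>

definition reference_dofs ::
    "nat \<Rightarrow> (nat \<Rightarrow> 'a::euclidean_space set) \<Rightarrow> (fe_family \<Rightarrow> nat \<Rightarrow> nat \<Rightarrow> nat \<Rightarrow> 'a dform) \<Rightarrow> bool"
  where "reference_dofs r R \<eta> \<longleftrightarrow>
    (\<forall>m\<le>DIM('a). int m simplex R m) \<and>
    (\<forall>fam k m. admissible_family DIM('a) fam k \<and> m \<le> DIM('a) \<longrightarrow>
       inj_on (\<eta> fam k m) (fe_index fam r k (R m)) \<and>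
       independent (\<eta> fam k m ` fe_index fam r k (R m)) \<and>
       span (\<eta> fam k m ` fe_index fam r k (R m)) = dof_forms fam r k (R m))"

definition affine_bij :: "('a::real_vector \<Rightarrow> 'a) \<Rightarrow> 'a set \<Rightarrow> 'a set \<Rightarrow> bool"
  where "affine_bij A X Y \<longleftrightarrow> (\<exists>L c. linear L \<and> A = (\<lambda>x. c + L x)) \<and> bij_betw A X Y"

text \<open>The pullback of a form on \<open>X\<close> along the inverse of the affine bijection \<open>A\<close> from \<open>X\<close> to \<open>Y\<close>;
  the linear part of \<open>A\<close> is \<open>\<lambda>v. A v - A 0\<close>.\<close>

definition pullback_inv :: "('a::real_vector \<Rightarrow> 'a) \<Rightarrow> 'a set \<Rightarrow> 'a set \<Rightarrow> 'a dform \<Rightarrow> 'a dform"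
  where "pullback_inv A X Y \<eta> = (\<lambda>y vs. if y \<in> Y \<and> set vs \<subseteq> tangent Y
    then \<eta> (inv_into X A y) (map (inv_into (tangent X) (\<lambda>v. A v - A 0)) vs) else 0)"

definition dof ::
    "(nat \<Rightarrow> 'a::euclidean_space set) \<Rightarrow> (nat \<Rightarrow> nat \<Rightarrow> 'a dform) \<Rightarrow>
     ('a set \<Rightarrow> 'a list) \<Rightarrow> ('a set \<Rightarrow> 'a \<Rightarrow> 'a) \<Rightarrow> 'a set \<Rightarrow> nat \<Rightarrow> 'a dform \<Rightarrow> real"
  where "dof R \<eta> orient A S i \<omega> =
    form_integral (orient S)
      (wedge (pullback_inv (A S) (R (sdim S)) S (\<eta> (sdim S) i)) (form_trace S \<omega>))"

section \<open>Triangulations\<close>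

text \<open>The library's simplicial complexes contain the empty simplex, of dimension \<open>-1\<close>.\<close>

definition top_simplices :: "'a::euclidean_space set set \<Rightarrow> 'a set set"
  where "top_simplices \<T> = {T \<in> \<T>. aff_dim T = int DIM('a)}"

definition triangulates :: "'a::euclidean_space set set \<Rightarrow> 'a set \<Rightarrow> bool"
  where "triangulates \<T> \<Omega> \<longleftrightarrow>
    simplicial_complex \<T> \<and> (\<forall>S\<in>\<T>. \<exists>T\<in>top_simplices \<T>. S \<subseteq> T) \<and>
    open \<Omega> \<and> connected \<Omega> \<and> \<Omega> \<noteq> {} \<and> closure \<Omega> = \<Union>\<T> \<and> \<Omega> = interior (\<Union>\<T>)"

text \<open>\<open>N = 0\<close> is allowed, which covers \<open>T = T0\<close>.\<close>

definition face_connected :: "'a::euclidean_space set set \<Rightarrow> bool"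
  where "face_connected \<T> \<longleftrightarrow>
    (\<forall>T0\<in>top_simplices \<T>. \<forall>T\<in>top_simplices \<T>. T0 \<inter> T \<noteq> {} \<longrightarrow>
       (\<exists>N (c :: nat \<Rightarrow> 'a set). c 0 = T0 \<and> c N = T \<and>
          (\<forall>j\<in>{1..N}. c j \<in> top_simplices \<T> \<and>
             (c j \<inter> c (j - 1)) facet_of (c j) \<and> (c j \<inter> c (j - 1)) facet_of (c (j - 1)) \<and>
             T0 \<inter> T \<subseteq> c j \<inter> c (j - 1))))"

definition orientation :: "'a::euclidean_space set set \<Rightarrow> ('a set \<Rightarrow> 'a list) \<Rightarrow> bool"
  where "orientation \<T> orient \<longleftrightarrow>
    (\<forall>S\<in>\<T>. S \<noteq> {} \<longrightarrow> distinct (orient S) \<and> set (orient S) = vertices S)"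

definition mesh_size :: "'a::euclidean_space set set \<Rightarrow> 'a set \<Rightarrow> real"
  where "mesh_size \<T> S =
    (if aff_dim S = 0 then Min {diameter E |E. E \<in> \<T> \<and> aff_dim E = 1 \<and> S \<subseteq> E}
     else diameter S)"

definition shape_measure :: "'a::euclidean_space set set \<Rightarrow> real"
  where "shape_measure \<T> =
    Sup {diameter T ^ sdim T / simplex_volume T |T. T \<in> \<T> \<and> 1 \<le> aff_dim T}"

text \<open>Positive distance, which holds if one of the sets is empty (unlike with \<^const>\<open>setdist\<close>).\<close>

definition separated :: "'a::metric_space set \<Rightarrow> 'a set \<Rightarrow> bool"
  where "separated X Y \<longleftrightarrow> (\<exists>\<delta>>0. \<forall>x\<in>X. \<forall>y\<in>Y. \<delta> \<le> dist x y)"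

text \<open>\<open>n / p\<close> for \<open>1 \<le> p \<le> \<infinity>\<close>\<close>

definition dim_over :: "nat \<Rightarrow> ereal \<Rightarrow> real"
  where "dim_over n p = (if p = \<infinity> then 0 else real n / real_of_ereal p)"

end

theory Submission
  imports Defs "Jordan_Normal_Form.Determinant"
begin

text \<open>
  In the barycentric coordinates \<open>\<lambda>\<^sub>j\<close> of the facet \<open>F\<close> the pairing with \<open>\<xi>\<close> decouples: choose smooth
  kernels \<open>\<kappa>\<^sub>0, \<dots>, \<kappa>\<^sub>r\<close> supported in a small interval \<open>[lo, hi]\<close> with \<open>lo > 0\<close>, dual to the monomials of
  degree at most \<open>r\<close>. Products of them in the coordinates are dual to the monomials
  \<open>\<Prod>\<^sub>j \<lambda>\<^sub>j^\<beta>\<^sub>j\<close>, so weighting these products by the values of the functional on the monomial forms gives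
  \<open>\<xi>\<close>, with compact support in the interior of \<open>F\<close>. Multiplying by a cutoff in the coordinate of the vertex
  opposite to \<open>F\<close> gives \<open>\<Xi>\<close> on \<open>T\<close>. If \<open>S\<close> is not a vertex, shape regularity alone makes \<open>h_S\<close>, \<open>h_F\<close> and \<open>h_T\<close>
  comparable. If \<open>S\<close> is a vertex, \<open>h_S\<close> is the length of a shortest edge at \<open>S\<close>, which need not belong to \<open>T\<close>;
  then all coordinates are first contracted by the factor \<open>h_S / h_F\<close> towards \<open>S\<close>, and the transversal one by
  \<open>h_S / h_T\<close>, which makes the scaling exact without comparing neighbouring simplices.
\<close>

text \<open>The mesh size enters at two places only. The weights of \<xi> are values of the
  functional on monomial forms in the patch coordinates, and both factors of that pairing are
  evaluated on edge vectors of S: the pulled-back reference form takes reference values there, and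
  the patch coordinates stay in [0, 1] on S. Hence the weights are bounded by a constant; keeping
  them so is what dictates that the contraction for a vertex is centred at S. What remains are the
  gradients of the coordinates, at most a constant over h, and the support, in a ball of radius of
  order h. With a = n - k - 1 covectors this gives h to the power n/p - a, and one more 1/h for the
  derivative. Components are indexed by permutations of the d = n - 1 coordinate indices: the first
  a values name covectors of \<xi>, the last k values the complementary covectors of \<omega>. Signs
  then cancel in the pairing, and the repetition count a! appears on both sides. \<xi> must be the
  same for all T over F, although coordinates on the whole space depend on T; on F they are
  determined by the vertices of F.\<close>

no_notation scalar_prod (infix "\<bullet>" 70)
hide_const (open) Determinant.det Module.smult

section \<open>Smooth functions\<close>

text \<open>\<open>smooth_fun\<close> asks for one consistent system of iterated directional
  derivatives. Choosing a derivative once for every member of F and folding this choice over the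
  list of directions gives such a system, because F is closed under directional derivatives.\<close>

lemma smooth_fun_coinduct:
  assumes f: "f \<in> F"
    and F: "\<And>g. g \<in> F \<Longrightarrow> \<exists>g'. (\<forall>x. (g has_derivative g' x) (at x)) \<and> (\<forall>h. (\<lambda>x. g' x h) \<in> F)"
  shows "smooth_fun f"
proof -
  have "\<forall>g\<in>F. \<exists>g'. (\<forall>x. (g has_derivative g' x) (at x)) \<and> (\<forall>h. (\<lambda>x. g' x h) \<in> F)" using F by blast
  from bchoice[OF this] obtain D where D: "\<And>g x. g \<in> F \<Longrightarrow> (g has_derivative D g x) (at x)"
    "\<And>g h. g \<in> F \<Longrightarrow> (\<lambda>x. D g x h) \<in> F" by blast
  define E where "E us = foldr (\<lambda>h g x. D g x h) us f" for us
  have "E us \<in> F" for us by (induction us) (simp_all add: E_def f D)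
  moreover have "E (h # us) x = D (E us) x h" for h us x by (simp add: E_def)
  ultimately show ?thesis unfolding smooth_fun_def
    by (intro exI[of _ E]) (simp add: D E_def)
qed

lemma smooth_fun_derivative:
  assumes "smooth_fun f"
  obtains f' where "\<And>x. (f has_derivative f' x) (at x)" "\<And>h. smooth_fun (\<lambda>x. f' x h)"
proof -
  obtain D where D: "D [] = f" "\<And>us x. (D us has_derivative (\<lambda>h. D (h # us) x)) (at x)"
    using assms unfolding smooth_fun_def by blast
  show ?thesis
  proof
    show "(f has_derivative (\<lambda>h. D [h] x)) (at x)" for x using D(2)[of "[]"] D(1) by simp
    \<comment> \<open>The head of the list is the direction of the latest derivative, so the
      direction differentiated first has to be appended at the end.\<close>
    show "smooth_fun (\<lambda>x. D [h] x)" for h unfolding smooth_fun_def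
      by (rule exI[of _ "\<lambda>us. D (us @ [h])"]) (use D(2) in auto)
  qed
qed

lemma smooth_fun_const: "smooth_fun (\<lambda>x. c)"
  by (rule smooth_fun_coinduct[of _ "range (\<lambda>c x. c)"]) (auto intro!: exI[of _ "\<lambda>x h. 0"])

lemma smooth_fun_bounded_linear: "bounded_linear l \<Longrightarrow> smooth_fun l"
proof (rule smooth_fun_coinduct[of _ "insert l (range (\<lambda>c x. c))"])
  assume l: "bounded_linear l"
  fix g assume "g \<in> insert l (range (\<lambda>c x. c))"
  then consider "g = l" | c where "g = (\<lambda>x. c)" by blast
  then show "\<exists>g'. (\<forall>x. (g has_derivative g' x) (at x)) \<and>
      (\<forall>h. (\<lambda>x. g' x h) \<in> insert l (range (\<lambda>c x. c)))"
  proof cases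
    case 1
    then show ?thesis
      using bounded_linear_imp_has_derivative[OF l] by (intro exI[of _ "\<lambda>x h. l h"]) auto
  next
    case 2
    then show ?thesis by (intro exI[of _ "\<lambda>x h. 0"]) auto
  qed
qed simp

text \<open>The derivative of a product is a sum of products, so products alone are not closed under
  differentiation. The algebra generated by all smooth functions is, and coinduction shows that it
  contains nothing but smooth functions.\<close>

inductive_set smooth_alg :: "('a::real_normed_vector \<Rightarrow> real) set" where
  base: "smooth_fun f \<Longrightarrow> f \<in> smooth_alg"
| add: "f \<in> smooth_alg \<Longrightarrow> g \<in> smooth_alg \<Longrightarrow> (\<lambda>x. f x + g x) \<in> smooth_alg"
| mult: "f \<in> smooth_alg \<Longrightarrow> g \<in> smooth_alg \<Longrightarrow> (\<lambda>x. f x * g x) \<in> smooth_alg"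

lemma smooth_alg_smooth: 
  assumes "f \<in> smooth_alg" shows "smooth_fun f"
proof (rule smooth_fun_coinduct[OF assms])
  fix g :: "'a \<Rightarrow> real" assume "g \<in> smooth_alg"
  then show "\<exists>g'. (\<forall>x. (g has_derivative g' x) (at x)) \<and> (\<forall>h. (\<lambda>x. g' x h) \<in> smooth_alg)"
  proof induction
    case (base f)
    then show ?case using smooth_fun_derivative smooth_alg.base by metis
  next
    case (add f g)
    then obtain f' g' where "\<And>x. (f has_derivative f' x) (at x)" "\<And>h. (\<lambda>x. f' x h) \<in> smooth_alg"
      "\<And>x. (g has_derivative g' x) (at x)" "\<And>h. (\<lambda>x. g' x h) \<in> smooth_alg" by blast
    then show ?case
      by (intro exI[of _ "\<lambda>x h. f' x h + g' x h"]) (auto intro: has_derivative_add smooth_alg.add)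
  next
    case (mult f g)
    then obtain f' g' where "\<And>x. (f has_derivative f' x) (at x)" "\<And>h. (\<lambda>x. f' x h) \<in> smooth_alg"
      "\<And>x. (g has_derivative g' x) (at x)" "\<And>h. (\<lambda>x. g' x h) \<in> smooth_alg" by blast
    with mult.hyps show ?case
      by (intro exI[of _ "\<lambda>x h. f x * g' x h + f' x h * g x"] conjI allI
          has_derivative_mult smooth_alg.add smooth_alg.mult)
  qed
qed

lemma smooth_fun_add: "smooth_fun f \<Longrightarrow> smooth_fun g \<Longrightarrow> smooth_fun (\<lambda>x. f x + g x)"
  by (rule smooth_alg_smooth, rule smooth_alg.add; rule smooth_alg.base)

lemma smooth_fun_mult: "smooth_fun f \<Longrightarrow> smooth_fun g \<Longrightarrow> smooth_fun (\<lambda>x. f x * g x)"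
  by (rule smooth_alg_smooth, rule smooth_alg.mult; rule smooth_alg.base)

lemma smooth_fun_sum: "(\<And>i. i \<in> I \<Longrightarrow> smooth_fun (f i)) \<Longrightarrow> smooth_fun (\<lambda>x. \<Sum>i\<in>I. f i x)"
  by (induction I rule: infinite_finite_induct) (auto intro: smooth_fun_const smooth_fun_add)

lemma smooth_fun_prod: "(\<And>i. i \<in> I \<Longrightarrow> smooth_fun (f i)) \<Longrightarrow> smooth_fun (\<lambda>x. \<Prod>i\<in>I. f i x)"
  by (induction I rule: infinite_finite_induct) (auto intro: smooth_fun_const smooth_fun_mult)

lemma smooth_fun_poly: "smooth_fun (\<lambda>x::real. poly p x)"
proof (induction p)
  case 0
  then show ?case by (simp add: smooth_fun_const)
next
  case (pCons a p)
  have "smooth_fun (\<lambda>x. a + x * poly p x)"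
    by (rule smooth_fun_add[OF smooth_fun_const smooth_fun_mult[OF
          smooth_fun_bounded_linear[OF bounded_linear_ident] pCons.IH]])
  then show ?case by simp
qed

text \<open>For an affine inner function the chain rule only contributes the constant factor
  \<open>l h\<close>. The family of all a * g (c + l x) with g smooth is therefore closed under
  directional derivatives.\<close>

lemma smooth_fun_compose_affine:
  assumes g: "smooth_fun (g :: real \<Rightarrow> real)" and l: "bounded_linear l"
  shows "smooth_fun (\<lambda>x. g (c + l x))"
proof (rule smooth_fun_coinduct[of _ "{\<lambda>x. a * g (c + l x) | a g. smooth_fun g}"])
  show "(\<lambda>x. g (c + l x)) \<in> {\<lambda>x. a * g (c + l x) | a g. smooth_fun g}"
    using g by (intro CollectI exI[of _ 1] exI[of _ g]) auto
next
  fix q assume "q \<in> {\<lambda>x. a * g (c + l x) | a g. smooth_fun g}"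
  then obtain a g where q: "q = (\<lambda>x. a * g (c + l x))" and "smooth_fun g" by blast
  then obtain g' where g': "\<And>x. (g has_derivative g' x) (at x)" "\<And>h. smooth_fun (\<lambda>x. g' x h)"
    using smooth_fun_derivative by blast
  have lin: "g' x h = h * g' x 1" for x h
    using linear_scale[OF has_derivative_linear[OF g'(1)], of x h 1] by simp
  have "(q has_derivative (\<lambda>h. (a * l h) * g' (c + l x) 1)) (at x)" for x
  proof -
    have "((\<lambda>x. c + l x) has_derivative l) (at x)"
      using has_derivative_add[OF has_derivative_const bounded_linear_imp_has_derivative[OF l]] by simp
    from has_derivative_compose[OF this g'(1)]
    have "((\<lambda>x. a * g (c + l x)) has_derivative (\<lambda>h. a * g' (c + l x) (l h))) (at x)"
      by (rule has_derivative_mult_right)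
    moreover have "(\<lambda>h. a * g' (c + l x) (l h)) = (\<lambda>h. (a * l h) * g' (c + l x) 1)"
      by (rule ext, subst lin) simp
    ultimately show ?thesis by (simp only: q)
  qed
  moreover have "(\<lambda>x. (a * l h) * g' (c + l x) 1) \<in> {\<lambda>x. a * g (c + l x) | a g. smooth_fun g}" for h
    using g'(2)[of 1] by (intro CollectI exI[of _ "a * l h"] exI[of _ "\<lambda>x. g' x 1"]) simp
  ultimately show "\<exists>g'. (\<forall>x. (q has_derivative g' x) (at x)) \<and>
      (\<forall>h. (\<lambda>x. g' x h) \<in> {\<lambda>x. a * g (c + l x) | a g. smooth_fun g})"
    by (intro exI[of _ "\<lambda>x h. (a * l h) * g' (c + l x) 1"]) blast
qed

lemma smooth_fun_continuous_on:
  assumes "smooth_fun f" shows "continuous_on X f"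
proof -
  obtain f' where "\<And>x. (f has_derivative f' x) (at x)" "\<And>h. smooth_fun (\<lambda>x. f' x h)"
    using smooth_fun_derivative[OF assms] by blast
  then show ?thesis
    by (intro continuous_at_imp_continuous_on ballI has_derivative_continuous)
qed

section \<open>Bump functions and dual kernels on the line\<close>

text \<open>The classical flat function exp (-1/x), with a polynomial in 1/x in front so that the
  family is closed under differentiation: p turns into X^2 (p - p').\<close>

definition flat :: "real poly \<Rightarrow> real \<Rightarrow> real"
  where "flat p x = (if 0 < x then poly p (1 / x) * exp (- 1 / x) else 0)"

lemma poly_mult_exp_tendsto: "((\<lambda>y. poly p y * exp (- y)) \<longlongrightarrow> (0::real)) at_top"
proof -
  have "((\<lambda>y. \<Sum>i\<le>degree p. coeff p i * (y ^ i / exp y)) \<longlongrightarrow> (\<Sum>i\<le>degree p. coeff p i * 0)) at_top"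
    by (intro tendsto_intros tendsto_power_div_exp_0)
  then show ?thesis
    by (simp add: poly_altdef exp_minus field_simps sum_distrib_right sum_divide_distrib)
qed

lemma flat_has_derivative:
  "(flat p has_real_derivative flat ([:0, 0, 1:] * (p - pderiv p)) x) (at x)"
proof -
  consider "x < 0" | "0 < x" | "x = 0" by linarith
  then show ?thesis
  proof cases
    case 1
    have "((\<lambda>x. 0) has_real_derivative 0) (at x)" by simp
    then have "(flat p has_real_derivative 0) (at x)"
      by (rule has_field_derivative_transform_within_open[of _ _ _ "{..<0}"])
        (use 1 in \<open>auto simp: flat_def\<close>)
    then show ?thesis using 1 by (simp add: flat_def)
  next
    case 2
    have "((\<lambda>x. poly p (1 / x) * exp (- 1 / x)) has_real_derivative
      flat ([:0, 0, 1:] * (p - pderiv p)) x) (at x)"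
      using 2 by (auto intro!: derivative_eq_intros poly_DERIV[THEN DERIV_chain2]
          simp: flat_def power2_eq_square field_simps)
    then show ?thesis
      by (rule has_field_derivative_transform_within_open[of _ _ _ "{0<..}"])
        (use 2 in \<open>auto simp: flat_def\<close>)
  next
    case 3
    have "((\<lambda>h. (flat p (0 + h) - flat p 0) / h) \<longlongrightarrow> 0) (at 0)"
      proof (rule filterlim_split_at)
      have "\<forall>\<^sub>F h in at_left 0. (flat p (0 + h) - flat p 0) / h = 0"
        by (auto simp: eventually_at_filter flat_def)
      then show "((\<lambda>h. (flat p (0 + h) - flat p 0) / h) \<longlongrightarrow> 0) (at_left 0)"
        by (rule tendsto_eventually)
      \<comment> \<open>With h = 1/y the right difference quotient at 0 is y p(y) exp (-y), which
        tends to 0.\<close>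
      have ev: "\<forall>\<^sub>F y in at_top. poly ([:0, 1:] * p) y * exp (- y) =
          (flat p (0 + inverse y) - flat p 0) / inverse y"
        using eventually_gt_at_top[of "0::real"]
        by eventually_elim (simp add: flat_def divide_simps)
      have "((\<lambda>y. (flat p (0 + inverse y) - flat p 0) / inverse y) \<longlongrightarrow> 0) at_top"
        by (rule Lim_transform_eventually[OF poly_mult_exp_tendsto ev])
      then show "((\<lambda>h. (flat p (0 + h) - flat p 0) / h) \<longlongrightarrow> 0) (at_right 0)"
        unfolding filterlim_at_right_to_top .
    qed
    then show ?thesis using 3 by (simp add: DERIV_def flat_def)
  qed
qed

lemma smooth_fun_flat: "smooth_fun (flat p)"
proof (rule smooth_fun_coinduct[of _ "{\<lambda>x. c * flat p x | c p. True}"])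
  show "flat p \<in> {\<lambda>x. c * flat p x | c p. True}"
    by (intro CollectI exI[of _ 1] exI[of _ p]) auto
next
  fix g assume "g \<in> {\<lambda>x. c * flat p x | c p. True}"
  then obtain c p where g: "g = (\<lambda>x. c * flat p x)" by blast
  let ?q = "[:0, 0, 1:] * (p - pderiv p)"
  have "(g has_derivative (\<lambda>h. (c * h) * flat ?q x)) (at x)" for x
    using has_derivative_mult_right[OF flat_has_derivative[of p x, unfolded has_field_derivative_def], of c]
    by (simp add: g ac_simps)
  then show "\<exists>g'. (\<forall>x. (g has_derivative g' x) (at x)) \<and>
      (\<forall>h. (\<lambda>x. g' x h) \<in> {\<lambda>x. c * flat p x | c p. True})"
    by (intro exI[of _ "\<lambda>x h. (c * h) * flat ?q x"]) blast
qed

section \<open>Compactly supported bumps and their polynomial moments\<close>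

definition bump :: "real \<Rightarrow> real \<Rightarrow> real \<Rightarrow> real"
  where "bump a b x = flat 1 (x - a) * flat 1 (b - x)"

lemma smooth_fun_bump: "smooth_fun (bump a b)"
proof -
  have "smooth_fun (\<lambda>x. flat 1 (- a + x) * flat 1 (b + - x))"
    by (intro smooth_fun_mult smooth_fun_compose_affine smooth_fun_flat bounded_linear_minus bounded_linear_ident)
  then show ?thesis by (simp add: bump_def[abs_def])
qed

lemma continuous_on_bump: "continuous_on X (\<lambda>x. bump a b x)"
  using smooth_fun_continuous_on[OF smooth_fun_bump] by simp

lemma bump_pos: "a < x \<Longrightarrow> x < b \<Longrightarrow> 0 < bump a b x"
  by (simp add: bump_def flat_def)

lemma bump_nonneg: "0 \<le> bump a b x"
  by (simp add: bump_def flat_def)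

lemma bump_eq_0: "x \<notin> {a<..<b} \<Longrightarrow> bump a b x = 0"
  by (auto simp: bump_def flat_def)

lemma integrable_continuous_compact_support:
  fixes f :: "real \<Rightarrow> real"
  assumes "continuous_on UNIV f" and "\<And>x. x \<notin> {a..b} \<Longrightarrow> f x = 0"
  shows "integrable lborel f" "LINT x|lborel. f x = integral {a..b} f"
proof -
  have c: "continuous_on {a..b} f" using assms(1) continuous_on_subset by blast
  have eq: "(\<lambda>x. indicator {a..b} x *\<^sub>R f x) = f" using assms(2) by (auto simp: indicator_def fun_eq_iff)
  have s: "set_integrable lborel {a..b} f" using borel_integrable_atLeastAtMost'[OF c] .
  then show "integrable lborel f" unfolding set_integrable_def eq .
  show "LINT x|lborel. f x = integral {a..b} f"
    using set_borel_integral_eq_integral(2)[OF s] unfolding set_lebesgue_integral_def eq .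
qed

text \<open>Gram-Schmidt for the inner product \<open>I p q\<close> of polynomials weighted by the
  bump. In the induction step u, which is X^m minus its projection to lower degrees, is orthogonal
  to all lower degrees, while I u X^m = I u u is nonzero. So a multiple of u corrects the moment of
  order m and leaves the earlier ones alone. The data y are generalised because the induction
  hypothesis serves two different right-hand sides.\<close>

lemma bump_poly_moment_problem:
  assumes ab: "a < b"
  shows "\<exists>p. (\<forall>i\<ge>m. coeff p i = 0) \<and> (\<forall>j<m. (LINT x|lborel. bump a b x * poly p x * x ^ j) = y j)"
proof (induction m arbitrary: y)
  case 0
  then show ?case by (intro exI[of _ 0]) simp
next
  case (Suc m)
  define I where "I p q = (LINT x|lborel. bump a b x * poly p x * poly q x)" for p q
  have int: "integrable lborel (\<lambda>x. bump a b x * poly p x * poly q x)" for p q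
    by (rule integrable_continuous_compact_support[of _ a b])
      (auto intro!: continuous_intros continuous_on_bump simp: bump_eq_0)
  have I_add: "I (p + p') q = I p q + I p' q" for p p' q
    using Bochner_Integration.integral_add[OF int[of p q] int[of p' q]] by (simp add: I_def algebra_simps)
  have I_smult: "I (smult c p) q = c * I p q" for c p q
    by (simp add: I_def ac_simps flip: integral_mult_right_zero)
  have I_comm: "I p q = I q p" for p q by (simp add: I_def ac_simps)
  have I_monom: "(LINT x|lborel. bump a b x * poly p x * x ^ j) = I p (monom 1 j)" for p j
    by (simp add: I_def poly_monom)
  \<comment> \<open>Applied to the moments of X^m, the induction hypothesis yields the orthogonal
    projection of X^m to the polynomials of degree below m.\<close>
  obtain q where q: "\<And>i. m \<le> i \<Longrightarrow> coeff q i = 0"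
    "\<And>j. j < m \<Longrightarrow> I q (monom 1 j) = I (monom 1 m) (monom 1 j)"
    using Suc.IH[of "\<lambda>j. I (monom 1 m) (monom 1 j)"] unfolding I_monom by blast
  define u where "u = monom 1 m + smult (- 1) q"
  have u0: "u \<noteq> 0"
  proof
    assume "u = 0"
    then have "coeff u m = 0" by simp
    then show False using q(1)[of m] by (simp add: u_def)
  qed
  have orth: "I u (monom 1 j) = 0" if "j < m" for j
    using q(2)[OF that] by (simp only: u_def I_add I_smult)
  have orth': "I p u = 0" if "\<And>i. m \<le> i \<Longrightarrow> coeff p i = 0" for p
  proof -
    have "p = (\<Sum>i<m. smult (coeff p i) (monom 1 i))"
    proof (rule poly_eqI)
      fix n
      have "coeff (\<Sum>i<m. smult (coeff p i) (monom 1 i)) n = (\<Sum>i<m. coeff (smult (coeff p i) (monom 1 i)) n)"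
        by (rule coeff_sum)
      also have "\<dots> = (\<Sum>i<m. if i = n then coeff p i else 0)" by (rule sum.cong) auto
      also have "\<dots> = coeff p n" using that[of n] by (simp add: sum.delta)
      finally show "coeff p n = coeff (\<Sum>i<m. smult (coeff p i) (monom 1 i)) n" by simp
    qed
    moreover have "I (\<Sum>i\<in>K. smult (coeff p i) (monom 1 i)) u = (\<Sum>i\<in>K. coeff p i * I (monom 1 i) u)"
      if "finite K" for K
      using that by (induction K) (auto simp: I_add I_smult, simp add: I_def)
    ultimately have "I p u = (\<Sum>i<m. coeff p i * I (monom 1 i) u)" by (metis finite_lessThan)
    then show ?thesis using orth by (simp add: I_comm)
  qed
  define c where "c = I u (monom 1 m)"
  have "c = I u u"
  proof -
    have "I u u = I (monom 1 m) u + (- 1) * I q u"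
      using I_add[of "monom 1 m" "smult (-1) q" u] unfolding u_def[symmetric] I_smult .
    moreover have "I q u = 0" by (rule orth') (rule q(1))
    ultimately show ?thesis unfolding c_def I_comm[of u "monom 1 m"] by simp
  qed
  \<comment> \<open>A nonnegative continuous function with integral 0 vanishes; as the bump is
    positive on the open interval, u would have infinitely many roots.\<close>
  moreover have "I u u \<noteq> 0"
  proof
    assume "I u u = 0"
    let ?f = "\<lambda>x. bump a b x * poly u x * poly u x"
    have c: "continuous_on UNIV ?f"
      by (intro continuous_intros continuous_on_bump)
    have "integral {a..b} ?f = 0"
    proof -
      have "?f x = 0" if "x \<notin> {a..b}" for x using that bump_eq_0[of x a b] by auto
      from integrable_continuous_compact_support(2)[OF c this] show ?thesis
        using \<open>I u u = 0\<close> by (simp add: I_def)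
    qed
    moreover have "0 \<le> ?f x" for x by (simp add: bump_nonneg mult.assoc)
    ultimately have z: "?f x = 0" if "x \<in> {a..b}" for x
      using integral_eq_0_iff[of a b ?f] continuous_on_subset[OF c, of "{a..b}"] ab that by auto
    have "poly u x = 0" if "x \<in> {a<..<b}" for x
      using z[of x] bump_pos[of a x b] that by auto
    then have "{a<..<b} \<subseteq> {x. poly u x = 0}" by auto
    then show False using poly_roots_finite[OF u0] infinite_Ioo[OF ab] finite_subset by blast
  qed
  ultimately have c0: "c \<noteq> 0" by simp
  obtain p where p: "\<And>i. m \<le> i \<Longrightarrow> coeff p i = 0" "\<And>j. j < m \<Longrightarrow> I p (monom 1 j) = y j"
    using Suc.IH[of y] unfolding I_monom by blast
  let ?p = "p + smult ((y m - I p (monom 1 m)) / c) u"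
  have "\<forall>i\<ge>Suc m. coeff ?p i = 0" using p(1) q(1) by (auto simp: u_def)
  moreover have "\<forall>j<Suc m. I ?p (monom 1 j) = y j"
    using p(2) orth c0 by (auto simp: less_Suc_eq I_add I_smult c_def)
  ultimately show ?case unfolding I_monom by blast
qed

lemma dual_kernel_exists:
  fixes r :: nat
  assumes ab: "a < b"
  obtains \<kappa> :: "nat \<Rightarrow> real \<Rightarrow> real" where "\<And>i. smooth_fun (\<kappa> i)"
    "\<And>i x. x \<notin> {a..b} \<Longrightarrow> \<kappa> i x = 0"
    "\<And>i j. i \<le> r \<Longrightarrow> j \<le> r \<Longrightarrow> (LINT x|lborel. \<kappa> i x * x ^ j) = (if i = j then 1 else 0)"
proof -
  have "\<exists>p. \<forall>j<Suc r. (LINT x|lborel. bump a b x * poly p x * x ^ j) = (if i = j then 1 else 0)" for i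
    using bump_poly_moment_problem[OF ab, of "Suc r" "\<lambda>j. if i = j then 1 else 0"] by metis
  then obtain p where p: "\<And>i j. j < Suc r \<Longrightarrow>
      (LINT x|lborel. bump a b x * poly (p i) x * x ^ j) = (if i = j then 1 else 0)" by metis
  show ?thesis
  proof (rule that)
    show "smooth_fun (\<lambda>x. bump a b x * poly (p i) x)" for i
      by (intro smooth_fun_mult smooth_fun_bump smooth_fun_poly)
    show "bump a b x * poly (p i) x = 0" if "x \<notin> {a..b}" for i x
      using that bump_eq_0[of x a b] by auto
    show "(LINT x|lborel. bump a b x * poly (p i) x * x ^ j) = (if i = j then 1 else 0)"
      if "i \<le> r" "j \<le> r" for i j
      using p[of j i] that by simp
  qed
qed

lemma smooth_bounded_derivative:
  fixes f :: "real \<Rightarrow> real"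
  assumes f: "smooth_fun f" and s: "\<And>x. x \<notin> {a..b} \<Longrightarrow> f x = 0"
  obtains f' M where "\<And>x. (f has_real_derivative f' x) (at x)" "continuous_on UNIV f'"
    "\<And>x. x \<notin> {a..b} \<Longrightarrow> f' x = 0" "\<And>x. \<bar>f x\<bar> \<le> M" "\<And>x. \<bar>f' x\<bar> \<le> M"
proof -
  obtain D where D: "\<And>x. (f has_derivative D x) (at x)" "\<And>h. smooth_fun (\<lambda>x. D x h)"
    using smooth_fun_derivative[OF f] by blast
  have lin: "D x h = D x 1 * h" for x h
    using linear_scale[OF has_derivative_linear[OF D(1)], of x h 1] by simp
  have d: "(f has_real_derivative D x 1) (at x)" for x
    using D(1)[of x] lin[of x] unfolding has_field_derivative_def by (metis ext)
  have z: "D x 1 = 0" if "x \<notin> {a..b}" for x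
  proof -
    have "((\<lambda>x. 0) has_real_derivative 0) (at x)" by simp
    then have "(f has_real_derivative 0) (at x)"
      by (rule has_field_derivative_transform_within_open[of _ _ _ "- {a..b}"]) (use that s in auto)
    then show ?thesis using d DERIV_unique by blast
  qed
  have bd: "\<exists>M. \<forall>x. \<bar>g x\<bar> \<le> M" if "smooth_fun g" "\<And>x. x \<notin> {a..b} \<Longrightarrow> g x = 0" for g :: "real \<Rightarrow> real"
  proof -
    have "compact (g ` {a..b})"
      by (intro compact_continuous_image smooth_fun_continuous_on that(1) compact_Icc)
    then have "bounded (g ` {a..b})" by (rule compact_imp_bounded)
    then obtain M where "\<forall>x\<in>{a..b}. \<bar>g x\<bar> \<le> M" by (auto simp: bounded_iff)
    then have "\<bar>g x\<bar> \<le> max M 0" for x using that(2)[of x] by (cases "x \<in> {a..b}") (auto intro: max.coboundedI1)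
    then show ?thesis by blast
  qed
  obtain M1 where M1: "\<And>x. \<bar>f x\<bar> \<le> M1" using bd[OF f s] by blast
  obtain M2 where M2: "\<And>x. \<bar>D x 1\<bar> \<le> M2" using bd[OF D(2) z] by blast
  show ?thesis
    by (rule that[of "\<lambda>x. D x 1" "max M1 M2"])
      (use d z M1 M2 smooth_fun_continuous_on[OF D(2)] in \<open>auto simp: le_max_iff_disj\<close>)
qed

section \<open>Alternating forms\<close>

lemma alt_forms_supp: "f \<in> alt_forms l V \<Longrightarrow> f vs \<noteq> 0 \<Longrightarrow> int (length vs) = l \<and> set vs \<subseteq> V"
  unfolding alt_forms_def by blast

lemma alt_forms_linear:
  "f \<in> alt_forms l V \<Longrightarrow> set us \<subseteq> V \<Longrightarrow> set ws \<subseteq> V \<Longrightarrow> u \<in> V \<Longrightarrow> v \<in> V \<Longrightarrow>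
   f (us @ (a *\<^sub>R u + b *\<^sub>R v) # ws) = a * f (us @ u # ws) + b * f (us @ v # ws)"
  unfolding alt_forms_def by blast

lemma alt_forms_not_distinct: "f \<in> alt_forms l V \<Longrightarrow> \<not> distinct vs \<Longrightarrow> f vs = 0"
  unfolding alt_forms_def by blast

lemma alt_formsI:
  assumes "\<And>vs. f vs \<noteq> 0 \<Longrightarrow> int (length vs) = l \<and> set vs \<subseteq> V"
    and "\<And>us ws u v a b. set us \<subseteq> V \<Longrightarrow> set ws \<subseteq> V \<Longrightarrow> u \<in> V \<Longrightarrow> v \<in> V \<Longrightarrow>
       f (us @ (a *\<^sub>R u + b *\<^sub>R v) # ws) = a * f (us @ u # ws) + b * f (us @ v # ws)"
    and "\<And>vs. \<not> distinct vs \<Longrightarrow> f vs = 0"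
  shows "f \<in> alt_forms l V"
  unfolding alt_forms_def using assms by blast

lemma alt_forms_sum:
  assumes f: "f \<in> alt_forms l V" and V: "subspace V" and I: "finite I" "e ` I \<subseteq> V"
    and us: "set us \<subseteq> V" "set ws \<subseteq> V"
  shows "f (us @ (\<Sum>i\<in>I. c i *\<^sub>R e i) # ws) = (\<Sum>i\<in>I. c i * f (us @ e i # ws))"
  using I
proof (induction I rule: finite_induct)
  case empty
  have "f (us @ (0 *\<^sub>R 0 + 0 *\<^sub>R 0) # ws) = 0 * f (us @ 0 # ws) + 0 * f (us @ 0 # ws)"
    by (rule alt_forms_linear[OF f us]) (use V subspace_0 in auto)
  then show ?case by simp
next
  case (insert i I)
  have "f (us @ (c i *\<^sub>R e i + 1 *\<^sub>R (\<Sum>i\<in>I. c i *\<^sub>R e i)) # ws) =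
    c i * f (us @ e i # ws) + 1 * f (us @ (\<Sum>i\<in>I. c i *\<^sub>R e i) # ws)"
    by (rule alt_forms_linear[OF f us])
      (use insert.prems V in \<open>auto intro!: subspace_sum subspace_scale\<close>)
  then show ?case using insert by simp
qed

text \<open>Multilinear expansion one argument at a time; the prefix \<open>pre\<close> carries the
  slots that have already been replaced by members of the family \<open>e\<close>.\<close>

lemma alt_forms_expand:
  fixes l :: "'i \<Rightarrow> 'a::real_vector \<Rightarrow> real"
  assumes f: "f \<in> alt_forms p V" and V: "subspace V" and I: "finite I" "e ` I \<subseteq> V"
    and l: "\<And>u. u \<in> V \<Longrightarrow> u = (\<Sum>i\<in>I. l i u *\<^sub>R e i)"
  shows "set pre \<subseteq> V \<Longrightarrow> set us \<subseteq> V \<Longrightarrow>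
    f (pre @ us) = (\<Sum>J | set J \<subseteq> I \<and> length J = length us.
       prod_list (map2 l J us) * f (pre @ map e J))"
proof (induction us arbitrary: pre)
  case Nil
  have "{J. set J \<subseteq> I \<and> length J = length ([] :: 'a list)} = {[]}" by auto
  then show ?case by simp
next
  case (Cons u us)
  have u: "u \<in> V" and us: "set us \<subseteq> V" using Cons.prems by auto
  let ?L = "{J. set J \<subseteq> I \<and> length J = length us}"
  have fin: "finite ?L" using I(1) by (rule finite_lists_length_eq)
  have "f (pre @ u # us) = f (pre @ (\<Sum>i\<in>I. l i u *\<^sub>R e i) # us)"
    using l[OF u] by simp
  also have "\<dots> = (\<Sum>i\<in>I. l i u * f (pre @ e i # us))"
    by (rule alt_forms_sum[OF f V I Cons.prems(1) us])
  also have "\<dots> = (\<Sum>i\<in>I. l i u * (\<Sum>J\<in>?L. prod_list (map2 l J us) * f (pre @ map e (i # J))))"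
  proof (rule sum.cong[OF refl])
    fix i assume i: "i \<in> I"
    have "set (pre @ [e i]) \<subseteq> V" using i I(2) Cons.prems(1) by auto
    from Cons.IH[OF this us]
    show "l i u * f (pre @ e i # us) =
        l i u * (\<Sum>J\<in>?L. prod_list (map2 l J us) * f (pre @ map e (i # J)))" by simp
  qed
  also have "\<dots> = (\<Sum>(J, i)\<in>?L \<times> I. prod_list (map2 l (i # J) (u # us)) * f (pre @ map e (i # J)))"
    by (subst sum.cartesian_product[symmetric], subst sum.swap)
      (simp add: sum_distrib_left mult.assoc)
  also have "\<dots> = (\<Sum>J | set J \<subseteq> I \<and> length J = Suc (length us).
       prod_list (map2 l J (u # us)) * f (pre @ map e J))"
    unfolding lists_length_Suc_eq
    by (subst sum.reindex) (auto simp: inj_on_def intro!: sum.cong)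
  finally show ?case by simp
qed

text \<open>Polarisation: expand the form with u + v in both slots, where it vanishes.\<close>

lemma alt_forms_swap:
  assumes f: "f \<in> alt_forms l V" and V: "subspace V"
    and s: "set xs \<subseteq> V" "set ys \<subseteq> V" "set zs \<subseteq> V" "u \<in> V" "v \<in> V"
  shows "f (xs @ u # ys @ v # zs) = - f (xs @ v # ys @ u # zs)"
proof -
  have uv: "u + v \<in> V" using V s subspace_add by blast
  have 1: "f (xs @ (u + v) # ys @ w # zs) = f (xs @ u # ys @ w # zs) + f (xs @ v # ys @ w # zs)"
    if "w \<in> V" for w
    using alt_forms_linear[OF f, of xs "ys @ w # zs" u v 1 1] s that by simp
  have 2: "f (xs @ w # ys @ (u + v) # zs) = f (xs @ w # ys @ u # zs) + f (xs @ w # ys @ v # zs)"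
    if "w \<in> V" for w
    using alt_forms_linear[OF f, of "xs @ w # ys" zs u v 1 1] s that by simp
  have 3: "f (xs @ w # ys @ w # zs) = 0" for w
    by (rule alt_forms_not_distinct[OF f]) auto
  show ?thesis using 1[OF uv] 2[OF s(4)] 2[OF s(5)] 3 by simp
qed

text \<open>Induction over transpositions. The index set is an interval because in
  \<open>wedge_coef_form\<close> only the tail slots a, ..., d - 1 are permuted.\<close>

lemma alt_forms_permute:
  assumes f: "f \<in> alt_forms l V" and V: "subspace V" and e: "\<And>i. i \<in> {m..<n} \<Longrightarrow> e i \<in> V"
    and p: "p permutes {m..<n}"
  shows "f (map (e \<circ> p) [m..<n]) = of_int (sign p) * f (map e [m..<n])"
  using finite_atLeastLessThan p
proof (induction p rule: permutes_rev_induct)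
  case id
  then show ?case by simp
next
  case (swap a b p)
  have *: "f (map (e \<circ> (p \<circ> Transposition.transpose i j)) [m..<n]) = - f (map (e \<circ> p) [m..<n])"
    if ij: "m \<le> i" "i < j" "j < n" for i j
  proof -
    let ?g = "e \<circ> p"
    have g: "?g k \<in> V" if "k \<in> {m..<n}" for k
      using that e permutes_in_image[OF swap(4)] by auto
    have sp: "[m..<n] = [m..<i] @ i # [Suc i..<j] @ j # [Suc j..<n]"
    proof -
      have "[m..<n] = [m..<i] @ [i..<n]" using upt_add_eq_append[of m i "n - i"] ij by simp
      moreover have "[i..<n] = i # [Suc i..<n]" using ij by (simp add: upt_conv_Cons)
      moreover have "[Suc i..<n] = [Suc i..<j] @ [j..<n]"
        using upt_add_eq_append[of "Suc i" j "n - j"] ij by simp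
      moreover have "[j..<n] = j # [Suc j..<n]" using ij by (simp add: upt_conv_Cons)
      ultimately show ?thesis by simp
    qed
    have "map (?g \<circ> Transposition.transpose i j) [m..<n] =
        map ?g [m..<i] @ ?g j # map ?g [Suc i..<j] @ ?g i # map ?g [Suc j..<n]"
      unfolding sp using ij by (auto simp: transpose_def)
    moreover have "map ?g [m..<n] =
        map ?g [m..<i] @ ?g i # map ?g [Suc i..<j] @ ?g j # map ?g [Suc j..<n]"
      unfolding sp by simp
    moreover have "f (map ?g [m..<i] @ ?g j # map ?g [Suc i..<j] @ ?g i # map ?g [Suc j..<n]) =
      - f (map ?g [m..<i] @ ?g i # map ?g [Suc i..<j] @ ?g j # map ?g [Suc j..<n])"
      by (rule alt_forms_swap[OF f V]) (use g ij in auto)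
    ultimately show ?thesis by (simp add: comp_assoc)
  qed
  have "f (map (e \<circ> (p \<circ> Transposition.transpose a b)) [m..<n]) = - f (map (e \<circ> p) [m..<n])"
    using *[of a b] *[of b a] swap(1-3) by (cases "a < b") (auto simp: transpose_commute)
  moreover have "sign (p \<circ> Transposition.transpose a b) = - sign p"
    using swap by (subst sign_compose)
      (auto simp: sign_swap_id permutation_swap_id intro: permutation_permutes[THEN iffD2])
  ultimately show ?case using swap(5) by (simp only: of_int_minus mult_minus_left)
qed

lemma sum_bounded_eq: "(\<And>x. x \<in> A \<Longrightarrow> g x = (c::real)) \<Longrightarrow> sum g A = of_nat (card A) * c"
  by (metis sum.cong sum_constant)

section \<open>Sums over permutations with prescribed values\<close>

text \<open>Two permutations that agree on A differ by a permutation of the complement, so those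
  agreeing with p on A form a coset.\<close>

lemma permutes_agree_eq:
  assumes "A \<subseteq> U" "p permutes U"
  shows "{q. q permutes U \<and> (\<forall>i\<in>A. q i = p i)} = (\<circ>) p ` {r. r permutes (U - A)}"
proof (intro equalityI subsetI)
  fix q assume "q \<in> {q. q permutes U \<and> (\<forall>i\<in>A. q i = p i)}"
  then have q: "q permutes U" "\<And>i. i \<in> A \<Longrightarrow> q i = p i" by auto
  let ?r = "inv_into UNIV p \<circ> q"
  have r: "?r permutes U" using permutes_compose[OF q(1) permutes_inv[OF assms(2)]] .
  have "?r permutes (U - A)"
    by (rule permutes_superset[OF r]) (use q(2) assms(2) in \<open>auto simp: permutes_inverses\<close>)
  moreover have "q = p \<circ> ?r" using assms(2)
    by (auto simp: fun_eq_iff permutes_inverses)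
  ultimately show "q \<in> (\<circ>) p ` {r. r permutes (U - A)}" by blast
next
  fix q assume "q \<in> (\<circ>) p ` {r. r permutes (U - A)}"
  then obtain r where r: "q = p \<circ> r" "r permutes (U - A)" by auto
  have "r permutes U" using permutes_subset[OF r(2)] by blast
  then show "q \<in> {q. q permutes U \<and> (\<forall>i\<in>A. q i = p i)}"
    using r assms permutes_compose permutes_not_in[OF r(2)] by fastforce
qed

lemma sum_permutes_agree:
  assumes "finite U" "A \<subseteq> U" "p permutes U"
  shows "(\<Sum>q | q permutes U \<and> (\<forall>i\<in>A. q i = p i). h q) = (\<Sum>r | r permutes (U - A). h (p \<circ> r))"
proof -
  have "inj_on ((\<circ>) p) {r. r permutes (U - A)}"
    using permutes_inj[OF assms(3)] by (auto simp: inj_on_def fun_eq_iff)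
  then show ?thesis unfolding permutes_agree_eq[OF assms(2,3)]
    by (subst sum.reindex) auto
qed

lemma ex_permutes_map_eq:
  assumes J: "distinct J" "set J \<subseteq> {..<d}" "length J = d - a" and a: "a \<le> d"
  shows "\<exists>p. p permutes {..<d} \<and> map p [a..<d] = J"
proof -
  have "card ({..<d} - set J) = card {..<a}"
    using J a by (simp add: card_Diff_subset distinct_card)
  then obtain g where g: "bij_betw g {..<a} ({..<d} - set J)"
    by (metis finite_Diff finite_lessThan finite_same_card_bij)
  have bJ: "bij_betw (\<lambda>i. J ! (i - a)) {a..<d} (set J)"
  proof -
    have "bij_betw (\<lambda>i. i - a) {a..<d} {..<d - a}"
      by (rule bij_betw_byWitness[where f' = "\<lambda>i. i + a"]) auto
    moreover have "bij_betw ((!) J) {..<d - a} (set J)"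
      using bij_betw_nth[OF J(1) _ refl] J(3) by simp
    ultimately show ?thesis using bij_betw_trans by (fastforce simp: comp_def)
  qed
  define p where "p i = (if i < a then g i else if i < d then J ! (i - a) else i)" for i
  have "bij_betw p ({..<a} \<union> {a..<d}) (({..<d} - set J) \<union> set J)"
  proof (rule bij_betw_combine)
    show "bij_betw p {..<a} ({..<d} - set J)"
      using g by (rule bij_betw_cong[THEN iffD1, rotated]) (auto simp: p_def)
    show "bij_betw p {a..<d} (set J)"
      using bJ by (rule bij_betw_cong[THEN iffD1, rotated]) (auto simp: p_def)
  qed auto
  moreover have "{..<a} \<union> {a..<d} = {..<d}" "({..<d} - set J) \<union> set J = {..<d}" using a J by auto
  ultimately have "bij_betw p {..<d} {..<d}" by simp
  then have "p permutes {..<d}" by (rule bij_imp_permutes) (use a in \<open>auto simp: p_def\<close>)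
  moreover have "map p [a..<d] = J"
    by (rule nth_equalityI) (use J in \<open>auto simp: p_def\<close>)
  ultimately show ?thesis by blast
qed

text \<open>Each injective list is the tail of exactly \<open>fact a\<close> permutations, one for
  every arrangement of the remaining values on the head. This is what allows multi-indices to be
  replaced by permutations of all d indices.\<close>

lemma sum_permutes_tail:
  fixes h :: "nat list \<Rightarrow> real"
  assumes a: "a \<le> d"
  shows "(\<Sum>p | p permutes {..<d}. h (map p [a..<d])) =
    fact a * (\<Sum>J | distinct J \<and> set J \<subseteq> {..<d} \<and> length J = d - a. h J)"
proof -
  let ?P = "{p. p permutes {..<d}}"
  let ?L = "{J. distinct J \<and> set J \<subseteq> {..<d} \<and> length J = d - a}"
  have fP: "finite ?P" by (rule finite_permutations) simp
  have fL: "finite ?L"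
    by (rule finite_subset[OF _ finite_lists_length_eq[of "{..<d}" "d - a"]]) auto
  have sub: "(\<lambda>p. map p [a..<d]) ` ?P \<subseteq> ?L"
  proof
    fix J assume "J \<in> (\<lambda>p. map p [a..<d]) ` ?P"
    then obtain p where p: "p permutes {..<d}" and J: "J = map p [a..<d]" by blast
    have "distinct J" unfolding J distinct_map
      using permutes_inj_on[OF p, of "{a..<d}"] by simp
    moreover have "set J \<subseteq> {..<d}"
      unfolding J set_map using permutes_image[OF p] by (metis image_mono lessThan_atLeast0 set_upt ivl_subset le0 order_refl)
    ultimately show "J \<in> ?L" by (simp add: J)
  qed
  have "(\<Sum>p\<in>?P. h (map p [a..<d])) =
      (\<Sum>J\<in>?L. \<Sum>p\<in>{p\<in>?P. map p [a..<d] = J}. h (map p [a..<d]))"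
    by (rule sum.group[OF fP fL sub, symmetric])
  also have "\<dots> = (\<Sum>J\<in>?L. fact a * h J)"
  proof (rule sum.cong[OF refl])
    fix J assume "J \<in> ?L"
    then have J: "distinct J" "set J \<subseteq> {..<d}" "length J = d - a" by auto
    from ex_permutes_map_eq[OF J a] obtain p where p: "p permutes {..<d}" "map p [a..<d] = J" by blast
    have "{q \<in> ?P. map q [a..<d] = J} = {q. q permutes {..<d} \<and> (\<forall>i\<in>{a..<d}. q i = p i)}"
      unfolding p(2)[symmetric] by (simp only: map_eq_conv set_upt mem_Collect_eq)
    also have "\<dots> = (\<circ>) p ` {r. r permutes ({..<d} - {a..<d})}"
      by (rule permutes_agree_eq[OF _ p(1)]) auto
    finally have *: "{q \<in> ?P. map q [a..<d] = J} = (\<circ>) p ` {r. r permutes ({..<d} - {a..<d})}" .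
    have eq: "{q \<in> ?P. map q [a..<d] = J} = (\<circ>) p ` {r. r permutes {..<a}}"
    proof -
      have "{..<d} - {a..<d} = {..<a}" using a by auto
      with * show ?thesis by simp
    qed
    have "card {q \<in> ?P. map q [a..<d] = J} = fact a" unfolding eq
    proof (subst card_image)
      show "inj_on ((\<circ>) p) {r. r permutes {..<a}}"
        using permutes_inj[OF p(1)] by (auto simp: inj_on_def fun_eq_iff)
    qed (simp add: card_permutations)
    moreover have "(\<Sum>p\<in>{p\<in>?P. map p [a..<d] = J}. h (map p [a..<d])) =
        of_nat (card {q \<in> ?P. map q [a..<d] = J}) * h J"
      by (rule sum_bounded_eq) blast
    ultimately show "(\<Sum>p\<in>{p\<in>?P. map p [a..<d] = J}. h (map p [a..<d])) = fact a * h J"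
      by (simp only: of_nat_fact)
  qed
  finally show ?thesis by (simp only: sum_distrib_left)
qed

text \<open>In the multilinear expansion index lists with a repetition contribute nothing, and the
  others are tails of permutations. The factor a! is the multiplicity with which each tail
  occurs.\<close>

lemma alt_forms_expand_permutes:
  fixes l :: "nat \<Rightarrow> 'a::real_vector \<Rightarrow> real"
  assumes f: "f \<in> alt_forms p V" and V: "subspace V" and e: "\<And>i. i < d \<Longrightarrow> e i \<in> V"
    and l: "\<And>u. u \<in> V \<Longrightarrow> u = (\<Sum>i<d. l i u *\<^sub>R e i)"
    and us: "set us \<subseteq> V" "length us = d - a" and a: "a \<le> d"
  shows "fact a * f us = (\<Sum>\<tau> | \<tau> permutes {..<d}.
    prod_list (map2 l (map \<tau> [a..<d]) us) * f (map (e \<circ> \<tau>) [a..<d]))"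
proof -
  let ?h = "\<lambda>J. prod_list (map2 l J us) * f (map e J)"
  have "f us = (\<Sum>J | set J \<subseteq> {..<d} \<and> length J = length us. ?h J)"
    using alt_forms_expand[OF f V, of "{..<d}" e l "[]" us] e l us by auto
  also have "\<dots> = (\<Sum>J | distinct J \<and> set J \<subseteq> {..<d} \<and> length J = d - a. ?h J)"
  proof (rule sum.mono_neutral_right)
    show "finite {J. set J \<subseteq> {..<d} \<and> length J = length us}"
      by (rule finite_lists_length_eq) simp
    show "\<forall>J\<in>{J. set J \<subseteq> {..<d} \<and> length J = length us} -
        {J. distinct J \<and> set J \<subseteq> {..<d} \<and> length J = d - a}. ?h J = 0"
    proof
      fix J assume "J \<in> {J. set J \<subseteq> {..<d} \<and> length J = length us} -
        {J. distinct J \<and> set J \<subseteq> {..<d} \<and> length J = d - a}"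
      then have "\<not> distinct (map e J)" using us by (auto simp: distinct_map)
      then show "?h J = 0" using alt_forms_not_distinct[OF f] by simp
    qed
  qed (use us in auto)
  finally show ?thesis using sum_permutes_tail[OF a, of ?h] by simp
qed

text \<open>Pigeonhole: an index list of length k over m < k indices has a repetition, so every term
  of the multilinear expansion vanishes.\<close>

lemma alt_forms_eq_zero:
  fixes l :: "nat \<Rightarrow> 'a::real_vector \<Rightarrow> real"
  assumes f: "f \<in> alt_forms (int k) V" and V: "subspace V" and e: "\<And>i. i < m \<Longrightarrow> e i \<in> V"
    and l: "\<And>u. u \<in> V \<Longrightarrow> u = (\<Sum>i<m. l i u *\<^sub>R e i)" and k: "m < k"
  shows "f = (\<lambda>vs. 0)"
proof (rule ext, rule ccontr)
  fix us assume nz: "f us \<noteq> 0"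
  then have us: "length us = k" "set us \<subseteq> V" using alt_forms_supp[OF f nz] by auto
  have "f us = (\<Sum>J | set J \<subseteq> {..<m} \<and> length J = length us.
      prod_list (map2 l J us) * f (map e J))"
    using alt_forms_expand[OF f V, of "{..<m}" e l "[]" us] e l us by auto
  also have "\<dots> = 0"
  proof (intro sum.neutral ballI)
    fix J assume J: "J \<in> {J. set J \<subseteq> {..<m} \<and> length J = length us}"
    have "\<not> distinct J"
    proof
      assume "distinct J"
      then have "length J = card (set J)" by (simp add: distinct_card)
      also have "\<dots> \<le> card {..<m}" using J by (intro card_mono) auto
      finally show False using J us k by simp
    qed
    then show "prod_list (map2 l J us) * f (map e J) = 0"
      using alt_forms_not_distinct[OF f, of "map e J"] by (simp add: distinct_map)
  qed
  finally show False using nz by simp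
qed

text \<open>A permutation contributes the tensor product of the covectors named by its first a
  values. A coefficient that depends on \<tau> only through the remaining values turns the signed
  sum into an alternating form. Indexing by all of \<tau> rather than by its head keeps the
  complementary indices, and the sign relating the two parts, at hand for the pairing with a form of
  complementary degree.\<close>

definition coef_form ::
    "nat \<Rightarrow> nat \<Rightarrow> ((nat \<Rightarrow> nat) \<Rightarrow> real) \<Rightarrow> (nat \<Rightarrow> 'a \<Rightarrow> real) \<Rightarrow> 'a list \<Rightarrow> real"
  where "coef_form d a g l vs = (if length vs = a
    then \<Sum>\<tau> | \<tau> permutes {..<d}. of_int (sign \<tau>) * g \<tau> * prod_list (map2 l (map \<tau> [0..<a]) vs)
    else 0)"

lemma prod_list_map2_linear:
  fixes l :: "'i \<Rightarrow> 'a::real_vector \<Rightarrow> real"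
  assumes "\<And>i. i \<in> set J \<Longrightarrow> linear (l i)" and "length J = length us + Suc (length ws)"
  shows "prod_list (map2 l J (us @ (a *\<^sub>R u + b *\<^sub>R v) # ws)) =
    a * prod_list (map2 l J (us @ u # ws)) + b * prod_list (map2 l J (us @ v # ws))"
  using assms
proof (induction us arbitrary: J)
  case Nil
  then obtain i K where "J = i # K" by (cases J) auto
  with Nil show ?case by (simp add: linear_add linear_scale distrib_right)
next
  case (Cons x us)
  then obtain i K where "J = i # K" by (cases J) auto
  with Cons show ?case by (simp add: algebra_simps)
qed

lemma prod_list_map2_nth:
  "length us = a \<Longrightarrow> prod_list (map2 l (map \<tau> [0..<a]) us) = (\<Prod>i<a. l (\<tau> i) (us ! i))"
proof -
  assume "length us = a"
  then have "map2 l (map \<tau> [0..<a]) us = map (\<lambda>i. l (\<tau> i) (us ! i)) [0..<a]"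
    by (intro nth_equalityI) auto
  then show ?thesis by (simp add: prod.distinct_set_conv_list[symmetric] lessThan_atLeast0)
qed

text \<open>Composing \<tau> with the transposition of two equal slots preserves the product and the
  coefficient and flips the sign, so the sum equals its negative.\<close>

lemma coef_form_not_distinct:
  assumes a: "a \<le> d" and nd: "\<not> distinct vs"
    and g: "\<And>\<tau> i j. \<tau> permutes {..<d} \<Longrightarrow> i < a \<Longrightarrow> j < a \<Longrightarrow>
        g (\<tau> \<circ> Transposition.transpose i j) = g \<tau>"
  shows "coef_form d a g l vs = 0"
proof (cases "length vs = a")
  case True
  obtain i j where ij: "i < a" "j < a" "i \<noteq> j" "vs ! i = vs ! j"
    using nd True by (auto simp: distinct_conv_nth)
  let ?t = "Transposition.transpose i j"
  let ?f = "\<lambda>\<tau>. of_int (sign \<tau>) * g \<tau> * prod_list (map2 l (map \<tau> [0..<a]) vs)"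
  have t: "?t permutes {..<d}" "?t permutes {..<a}" using ij a by (auto intro: permutes_swap_id)
  have "(\<Sum>\<tau> | \<tau> permutes {..<d}. ?f \<tau>) = (\<Sum>\<tau> | \<tau> permutes {..<d}. ?f (\<tau> \<circ> ?t))"
    by (rule sum_permutations_compose_right[OF t(1)])
  also have "\<dots> = (\<Sum>\<tau> | \<tau> permutes {..<d}. - ?f \<tau>)"
  proof (rule sum.cong[OF refl])
    fix \<tau> assume "\<tau> \<in> {\<tau>. \<tau> permutes {..<d}}"
    then have tau: "\<tau> permutes {..<d}" by simp
    have "sign (\<tau> \<circ> ?t) = - sign \<tau>"
      using ij permutation_permutes[of \<tau>] tau
      by (subst sign_compose) (auto simp: sign_swap_id permutation_swap_id)
    moreover have "(\<Prod>i<a. l ((\<tau> \<circ> ?t) i) (vs ! i)) = (\<Prod>i<a. l (\<tau> i) (vs ! i))"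
    proof -
      have "vs ! m = vs ! ?t m" for m using ij by (auto simp: Transposition.transpose_def)
      then have "(\<Prod>i<a. l ((\<tau> \<circ> ?t) i) (vs ! i)) = (\<Prod>i<a. ((\<lambda>i. l (\<tau> i) (vs ! i)) \<circ> ?t) i)"
        by (intro prod.cong) auto
      also have "\<dots> = (\<Prod>i<a. l (\<tau> i) (vs ! i))"
        using prod.permute[OF t(2), of "\<lambda>i. l (\<tau> i) (vs ! i)"] by simp
      finally show ?thesis .
    qed
    ultimately show "?f (\<tau> \<circ> ?t) = - ?f \<tau>"
      unfolding prod_list_map2_nth[OF True] g[OF tau ij(1,2)] by (simp only: of_int_minus mult_minus_left)
  qed
  finally show ?thesis using True by (simp add: coef_form_def sum_negf)
qed (simp add: coef_form_def)

lemma coef_form_linear: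
  fixes l :: "nat \<Rightarrow> 'a::real_vector \<Rightarrow> real"
  assumes a: "a \<le> d" and l: "\<And>i. i < d \<Longrightarrow> linear (l i)"
  shows "coef_form d a g l (us @ (\<alpha> *\<^sub>R u + \<beta> *\<^sub>R v) # ws) =
    \<alpha> * coef_form d a g l (us @ u # ws) + \<beta> * coef_form d a g l (us @ v # ws)"
proof (cases "length us + Suc (length ws) = a")
  case True
  have *: "prod_list (map2 l (map \<tau> [0..<a]) (us @ (\<alpha> *\<^sub>R u + \<beta> *\<^sub>R v) # ws)) =
      \<alpha> * prod_list (map2 l (map \<tau> [0..<a]) (us @ u # ws)) +
      \<beta> * prod_list (map2 l (map \<tau> [0..<a]) (us @ v # ws))" if "\<tau> permutes {..<d}" for \<tau>
  proof (rule prod_list_map2_linear)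
    fix i assume "i \<in> set (map \<tau> [0..<a])"
    then obtain j where "j < a" "i = \<tau> j" by auto
    then show "linear (l i)" using l permutes_in_image[OF that, of j] a by auto
  qed (use True in simp)
  show ?thesis using True
    by (simp add: coef_form_def * algebra_simps sum.distrib sum_distrib_left cong: conj_cong)
qed (simp add: coef_form_def)

lemma coef_form_alt:
  fixes l :: "nat \<Rightarrow> 'a::real_vector \<Rightarrow> real"
  assumes a: "a \<le> d" and l: "\<And>i. i < d \<Longrightarrow> linear (l i)" and V: "subspace V"
    and g: "\<And>\<tau> i j. \<tau> permutes {..<d} \<Longrightarrow> i < a \<Longrightarrow> j < a \<Longrightarrow>
        g (\<tau> \<circ> Transposition.transpose i j) = g \<tau>"
  shows "(\<lambda>vs. if set vs \<subseteq> V then coef_form d a g l vs else 0) \<in> alt_forms (int a) V"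
proof (rule alt_formsI)
  fix vs assume "(if set vs \<subseteq> V then coef_form d a g l vs else 0) \<noteq> 0"
  then show "int (length vs) = int a \<and> set vs \<subseteq> V" by (auto simp: coef_form_def split: if_splits)
next
  fix us ws u v \<alpha> \<beta>
  assume "set us \<subseteq> V" "set ws \<subseteq> V" "u \<in> V" "v \<in> V"
  then show "(if set (us @ (\<alpha> *\<^sub>R u + \<beta> *\<^sub>R v) # ws) \<subseteq> V
       then coef_form d a g l (us @ (\<alpha> *\<^sub>R u + \<beta> *\<^sub>R v) # ws) else 0) =
      \<alpha> * (if set (us @ u # ws) \<subseteq> V then coef_form d a g l (us @ u # ws) else 0) +
      \<beta> * (if set (us @ v # ws) \<subseteq> V then coef_form d a g l (us @ v # ws) else 0)"
    using coef_form_linear[OF a l] V by (simp add: subspace_add subspace_scale)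
next
  fix vs :: "'a list" assume "\<not> distinct vs"
  then show "(if set vs \<subseteq> V then coef_form d a g l vs else 0) = 0"
    using coef_form_not_distinct[OF a] g by auto
qed

text \<open>Inserting the definition of \<alpha> gives a double sum over \<sigma> from
  \<open>wedge\<close> and \<tau> from \<open>coef_form\<close>. Duality of l and e forces \<sigma>
  = \<tau> on the first a slots, so \<sigma> is \<tau> followed by a rearrangement r of the tail.
  The signs of \<sigma> and \<tau> multiply to that of r, and r produces the same sign in f. What
  survives is one term without sign for every \<tau>, counted k! times.\<close>

lemma wedge_coef_form:
  fixes e :: "nat \<Rightarrow> 'a::real_vector"
  assumes d: "d = a + k" and f: "f \<in> alt_forms (int k) V" and V: "subspace V"
    and e: "\<And>i. i < d \<Longrightarrow> e i \<in> V"
    and l: "\<And>i j. i < d \<Longrightarrow> j < d \<Longrightarrow> l i (e j) = (if i = j then c else 0)"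
    and A: "\<And>vs. set vs \<subseteq> V \<Longrightarrow> \<alpha> x vs = coef_form d a g l vs" and B: "\<beta> x = f"
  shows "wedge \<alpha> \<beta> x (map e [0..<d]) =
    c ^ a / fact a * (\<Sum>\<tau> | \<tau> permutes {..<d}. g \<tau> * f (map (e \<circ> \<tau>) [a..<d]))"
proof -
  let ?P = "{\<sigma>. \<sigma> permutes {..<d}}"
  have fin: "finite ?P" by (rule finite_permutations) simp
  have m: "map (\<lambda>j. map e [0..<d] ! \<sigma> j) [p..<q] = map (e \<circ> \<sigma>) [p..<q]"
    if s: "\<sigma> permutes {..<d}" and q: "q \<le> d" for \<sigma> p q
  proof (rule map_cong[OF refl])
    fix j assume "j \<in> set [p..<q]"
    then have "j \<in> {..<d}" using q by auto
    then have "\<sigma> j \<in> {..<d}" using permutes_in_image[OF s] by blast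
    then show "map e [0..<d] ! \<sigma> j = (e \<circ> \<sigma>) j" by simp
  qed
  have mV: "set (map (e \<circ> \<sigma>) [p..<q]) \<subseteq> V" if s: "\<sigma> permutes {..<d}" and q: "q \<le> d" for \<sigma> p q
  proof
    fix v assume "v \<in> set (map (e \<circ> \<sigma>) [p..<q])"
    then obtain j where j: "v = e (\<sigma> j)" "j \<in> {p..<q}" by auto
    then have "j \<in> {..<d}" using q by auto
    then have "\<sigma> j \<in> {..<d}" using permutes_in_image[OF s] by blast
    then show "v \<in> V" using e j by simp
  qed
  define I where "I \<sigma> b = of_int (sign \<sigma>) * coef_form d a g l (map (e \<circ> \<sigma>) [0..<b])
      * f (map (e \<circ> \<sigma>) [b..<d])" for \<sigma> b
  have "wedge \<alpha> \<beta> x (map e [0..<d]) = (\<Sum>b\<le>d. (\<Sum>\<sigma>\<in>?P. I \<sigma> b) / (fact b * fact (d - b)))"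
  proof -
    have "of_int (sign \<sigma>) * \<alpha> x (map (\<lambda>j. map e [0..<d] ! \<sigma> j) [0..<b])
        * \<beta> x (map (\<lambda>j. map e [0..<d] ! \<sigma> j) [b..<d]) = I \<sigma> b"
      if "\<sigma> permutes {..<d}" "b \<le> d" for \<sigma> b
      unfolding m[OF that] m[OF that(1) order_refl] I_def B A[OF mV[OF that]] ..
    then show ?thesis unfolding wedge_def by simp
  qed
  \<comment> \<open>\<open>wedge\<close> sums over all splittings of the argument list, and
    \<open>coef_form\<close> vanishes on lists of length other than a.\<close>
  also have "\<dots> = (\<Sum>b\<in>{a}. (\<Sum>\<sigma>\<in>?P. I \<sigma> b) / (fact b * fact (d - b)))"
    by (rule sum.mono_neutral_right) (auto simp: d I_def coef_form_def)
  also have "\<dots> = (\<Sum>\<sigma>\<in>?P. I \<sigma> a) / (fact a * fact k)" using d by simp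
  also have "(\<Sum>\<sigma>\<in>?P. I \<sigma> a) = (\<Sum>\<sigma>\<in>?P. \<Sum>\<tau>\<in>?P. if (\<forall>i\<in>{..<a}. \<sigma> i = \<tau> i)
      then of_int (sign \<sigma>) * of_int (sign \<tau>) * g \<tau> * c ^ a * f (map (e \<circ> \<sigma>) [a..<d]) else 0)"
  proof (rule sum.cong[OF refl])
    fix \<sigma> assume "\<sigma> \<in> ?P"
    then have s: "\<sigma> permutes {..<d}" by simp
    have "prod_list (map2 l (map \<tau> [0..<a]) (map (e \<circ> \<sigma>) [0..<a])) =
        (if \<forall>i\<in>{..<a}. \<sigma> i = \<tau> i then c ^ a else 0)" if t: "\<tau> permutes {..<d}" for \<tau>
    proof -
      have "prod_list (map2 l (map \<tau> [0..<a]) (map (e \<circ> \<sigma>) [0..<a])) =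
          (\<Prod>i<a. l (\<tau> i) (e (\<sigma> i)))"
        by (subst prod_list_map2_nth) auto
      also have "\<dots> = (\<Prod>i<a. if \<sigma> i = \<tau> i then c else 0)"
      proof (rule prod.cong[OF refl])
        fix i assume "i \<in> {..<a}"
        then have "i \<in> {..<d}" using d by auto
        then have "\<sigma> i \<in> {..<d}" "\<tau> i \<in> {..<d}"
          using permutes_in_image[OF s] permutes_in_image[OF t] by blast+
        then show "l (\<tau> i) (e (\<sigma> i)) = (if \<sigma> i = \<tau> i then c else 0)" using l by auto
      qed
      also have "\<dots> = (if \<forall>i\<in>{..<a}. \<sigma> i = \<tau> i then c ^ a else 0)"
      proof (cases "\<forall>i\<in>{..<a}. \<sigma> i = \<tau> i")
        case False
        then obtain i where "i \<in> {..<a}" "\<sigma> i \<noteq> \<tau> i" by blast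
        then have "(\<Prod>i<a. if \<sigma> i = \<tau> i then c else 0) = 0" by (intro prod_zero) auto
        then show ?thesis using False by simp
      qed simp
      finally show ?thesis .
    qed
    then show "I \<sigma> a = (\<Sum>\<tau>\<in>?P. if (\<forall>i\<in>{..<a}. \<sigma> i = \<tau> i)
      then of_int (sign \<sigma>) * of_int (sign \<tau>) * g \<tau> * c ^ a * f (map (e \<circ> \<sigma>) [a..<d]) else 0)"
      by (auto simp: I_def coef_form_def sum_distrib_left sum_distrib_right intro!: sum.cong)
  qed
  also have "\<dots> = (\<Sum>\<tau>\<in>?P. \<Sum>\<sigma>\<in>?P. if (\<forall>i\<in>{..<a}. \<sigma> i = \<tau> i)
      then of_int (sign \<sigma>) * of_int (sign \<tau>) * g \<tau> * c ^ a * f (map (e \<circ> \<sigma>) [a..<d]) else 0)"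
    by (rule sum.swap)
  also have "\<dots> = (\<Sum>\<tau>\<in>?P. fact k * c ^ a * (g \<tau> * f (map (e \<circ> \<tau>) [a..<d])))"
  proof (rule sum.cong[OF refl])
    fix \<tau> assume "\<tau> \<in> ?P"
    then have t: "\<tau> permutes {..<d}" by simp
    let ?h = "\<lambda>\<sigma>. of_int (sign \<sigma>) * of_int (sign \<tau>) * g \<tau> * c ^ a * f (map (e \<circ> \<sigma>) [a..<d])"
    have "(\<Sum>\<sigma>\<in>?P. if (\<forall>i\<in>{..<a}. \<sigma> i = \<tau> i) then ?h \<sigma> else 0) =
        (\<Sum>\<sigma> | \<sigma> permutes {..<d} \<and> (\<forall>i\<in>{..<a}. \<sigma> i = \<tau> i). ?h \<sigma>)"
      by (subst sum.inter_filter[OF fin, symmetric]) (simp only: mem_Collect_eq)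
    also have "\<dots> = (\<Sum>r | r permutes ({..<d} - {..<a}). ?h (\<tau> \<circ> r))"
      by (rule sum_permutes_agree) (use t d in auto)
    also have "{..<d} - {..<a} = {a..<d}" by auto
    also have "(\<Sum>r | r permutes {a..<d}. ?h (\<tau> \<circ> r)) =
        of_nat (card {r. r permutes {a..<d}}) * (g \<tau> * c ^ a * f (map (e \<circ> \<tau>) [a..<d]))"
    proof (rule sum_bounded_eq)
      fix r assume "r \<in> {r. r permutes {a..<d}}"
      then have r: "r permutes {a..<d}" by simp
      have "sign (\<tau> \<circ> r) = sign \<tau> * sign r"
        using permutation_permutes t r by (intro sign_compose) blast+
      moreover have "f (map (e \<circ> (\<tau> \<circ> r)) [a..<d]) = of_int (sign r) * f (map (e \<circ> \<tau>) [a..<d])"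
      proof -
        have "(e \<circ> \<tau>) i \<in> V" if "i \<in> {a..<d}" for i
          using mV[OF t order_refl, of a] that by auto
        from alt_forms_permute[where e = "e \<circ> \<tau>", OF f V this r] show ?thesis by (simp only: comp_assoc)
      qed
      moreover have "(of_int (sign \<tau>) * of_int (sign \<tau>) :: real) = 1"
        "(of_int (sign r) * of_int (sign r) :: real) = 1"
        by (simp_all flip: of_int_mult)
      ultimately show "?h (\<tau> \<circ> r) = g \<tau> * c ^ a * f (map (e \<circ> \<tau>) [a..<d])"
      proof -
        assume *: "sign (\<tau> \<circ> r) = sign \<tau> * sign r"
          "f (map (e \<circ> (\<tau> \<circ> r)) [a..<d]) = of_int (sign r) * f (map (e \<circ> \<tau>) [a..<d])"
        have "s * q * s * g \<tau> * c ^ a * (q * y) = (s * s) * (q * q) * (g \<tau> * c ^ a * y)" for s q y :: real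
          by (simp only: ac_simps)
        then show ?thesis
          unfolding * by (simp add: ac_simps flip: of_int_mult)
      qed
    qed
    also have "card {r. r permutes {a..<d}} = fact k"
      by (rule card_permutations) (use d in auto)
    finally show "(\<Sum>\<sigma>\<in>?P. if (\<forall>i\<in>{..<a}. \<sigma> i = \<tau> i) then ?h \<sigma> else 0) =
        fact k * c ^ a * (g \<tau> * f (map (e \<circ> \<tau>) [a..<d]))"
      by (simp only: of_nat_fact mult.assoc mult.left_commute)
  qed
  also have "\<dots> / (fact a * fact k) =
      c ^ a / fact a * (\<Sum>\<tau>\<in>?P. g \<tau> * f (map (e \<circ> \<tau>) [a..<d]))"
    by (simp add: sum_distrib_left[symmetric])
  finally show ?thesis .
qed

section \<open>Polynomial functions\<close>

definition multi_indices :: "int \<Rightarrow> ('a::euclidean_space \<Rightarrow> nat) set"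
  where "multi_indices r = {\<alpha>. (\<forall>b. b \<notin> Basis \<longrightarrow> \<alpha> b = 0) \<and> int (\<Sum>b\<in>Basis. \<alpha> b) \<le> r}"

lemma poly_fun_iff: "poly_fun r q \<longleftrightarrow>
    (\<exists>c. \<forall>x. q x = (\<Sum>\<alpha>\<in>multi_indices r. c \<alpha> * (\<Prod>b\<in>Basis. (x \<bullet> b) ^ \<alpha> b)))"
  by (simp add: poly_fun_def multi_indices_def)

lemma finite_multi_indices: "finite (multi_indices r :: ('a::euclidean_space \<Rightarrow> nat) set)"
proof (rule finite_subset)
  show "finite {f :: 'a \<Rightarrow> nat. \<forall>x. (x \<in> Basis \<longrightarrow> f x \<in> {..nat r}) \<and> (x \<notin> Basis \<longrightarrow> f x = 0)}"
    by (rule finite_set_of_finite_funs) auto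
  show "multi_indices r \<subseteq> {f :: 'a \<Rightarrow> nat. \<forall>x. (x \<in> Basis \<longrightarrow> f x \<in> {..nat r}) \<and> (x \<notin> Basis \<longrightarrow> f x = 0)}"
  proof
    fix \<alpha> :: "'a \<Rightarrow> nat" assume a: "\<alpha> \<in> multi_indices r"
    have "\<alpha> x \<le> nat r" if "x \<in> Basis" for x
    proof -
      have "\<alpha> x \<le> (\<Sum>b\<in>Basis. \<alpha> b)" using that by (intro member_le_sum) auto
      moreover have "int (\<Sum>b\<in>Basis. \<alpha> b) \<le> r" using a by (simp add: multi_indices_def)
      ultimately show ?thesis by linarith
    qed
    then show "\<alpha> \<in> {f. \<forall>x. (x \<in> Basis \<longrightarrow> f x \<in> {..nat r}) \<and> (x \<notin> Basis \<longrightarrow> f x = 0)}"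
      using a by (simp add: multi_indices_def)
  qed
qed

lemma poly_fun_neg: "r < 0 \<Longrightarrow> poly_fun r q \<longleftrightarrow> q = (\<lambda>x. 0)"
  for q :: "'a::euclidean_space \<Rightarrow> real"
proof -
  assume "r < 0"
  then have "multi_indices r = ({} :: ('a \<Rightarrow> nat) set)"
    unfolding multi_indices_def using of_nat_0_le_iff by (force simp del: of_nat_sum)
  then show ?thesis by (simp add: poly_fun_iff fun_eq_iff)
qed

lemma poly_fun_mono:
  assumes "poly_fun r q" "r \<le> r'" shows "poly_fun r' q"
proof -
  obtain c where c: "\<And>x. q x = (\<Sum>\<alpha>\<in>multi_indices r. c \<alpha> * (\<Prod>b\<in>Basis. (x \<bullet> b) ^ \<alpha> b))"
    using assms(1) unfolding poly_fun_iff by blast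
  have "multi_indices r \<subseteq> (multi_indices r' :: ('a \<Rightarrow> nat) set)" using assms(2) by (auto simp: multi_indices_def)
  then have "q x = (\<Sum>\<alpha>\<in>multi_indices r'. (if \<alpha> \<in> multi_indices r then c \<alpha> else 0) * (\<Prod>b\<in>Basis. (x \<bullet> b) ^ \<alpha> b))" for x
    unfolding c by (intro sum.mono_neutral_cong_left finite_multi_indices) auto
  then show ?thesis unfolding poly_fun_iff by (intro exI[of _ "\<lambda>\<alpha>. if \<alpha> \<in> multi_indices r then c \<alpha> else 0"]) blast
qed

lemma poly_fun_const:
  assumes "0 \<le> r" shows "poly_fun r (\<lambda>x::'a::euclidean_space. k)"
proof -
  have z: "(\<lambda>_. 0) \<in> (multi_indices r :: ('a \<Rightarrow> nat) set)" using assms by (simp add: multi_indices_def)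
  have "k = (\<Sum>\<alpha>\<in>multi_indices r. (if \<alpha> = (\<lambda>_. 0) then k else 0) * (\<Prod>b\<in>Basis. (x \<bullet> b) ^ \<alpha> b))" for x :: 'a
  proof -
    have "(\<Sum>\<alpha>\<in>multi_indices r. (if \<alpha> = (\<lambda>_. 0) then k else 0) * (\<Prod>b\<in>Basis. (x \<bullet> b) ^ \<alpha> b)) =
        (\<Sum>\<alpha>\<in>{\<lambda>_. 0}. (if \<alpha> = (\<lambda>_. 0) then k else 0) * (\<Prod>b\<in>Basis. (x \<bullet> b) ^ \<alpha> b))"
      using z by (intro sum.mono_neutral_right finite_multi_indices) auto
    then show ?thesis by simp
  qed
  then show ?thesis unfolding poly_fun_iff by (intro exI[of _ "\<lambda>\<alpha>. if \<alpha> = (\<lambda>_. 0) then k else 0"]) blast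
qed

lemma poly_fun_add: "poly_fun r f \<Longrightarrow> poly_fun r g \<Longrightarrow> poly_fun r (\<lambda>x. f x + g x)"
proof -
  assume "poly_fun r f" "poly_fun r g"
  then obtain c d where
    "\<And>x. f x = (\<Sum>\<alpha>\<in>multi_indices r. c \<alpha> * (\<Prod>b\<in>Basis. (x \<bullet> b) ^ \<alpha> b))"
    "\<And>x. g x = (\<Sum>\<alpha>\<in>multi_indices r. d \<alpha> * (\<Prod>b\<in>Basis. (x \<bullet> b) ^ \<alpha> b))"
    unfolding poly_fun_iff by blast
  then show ?thesis unfolding poly_fun_iff
    by (intro exI[of _ "\<lambda>\<alpha>. c \<alpha> + d \<alpha>"]) (simp add: distrib_right sum.distrib)
qed

lemma poly_fun_cmult: "poly_fun r f \<Longrightarrow> poly_fun r (\<lambda>x. k * f x)"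
proof -
  assume "poly_fun r f"
  then obtain c where "\<And>x. f x = (\<Sum>\<alpha>\<in>multi_indices r. c \<alpha> * (\<Prod>b\<in>Basis. (x \<bullet> b) ^ \<alpha> b))"
    unfolding poly_fun_iff by blast
  then show ?thesis unfolding poly_fun_iff
    by (intro exI[of _ "\<lambda>\<alpha>. k * c \<alpha>"]) (simp add: sum_distrib_left mult.assoc)
qed

lemma poly_fun_zero: "poly_fun r (\<lambda>x. 0)"
  unfolding poly_fun_iff by (intro exI[of _ "\<lambda>_. 0"]) simp

lemma poly_fun_sum: "(\<And>i. i \<in> I \<Longrightarrow> poly_fun r (f i)) \<Longrightarrow> poly_fun r (\<lambda>x. \<Sum>i\<in>I. f i x)"
  by (induction I rule: infinite_finite_induct) (auto intro: poly_fun_zero poly_fun_add)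

lemma poly_fun_mult_inner:
  fixes f :: "'a::euclidean_space \<Rightarrow> real"
  assumes b: "b \<in> Basis" and f: "poly_fun r f"
  shows "poly_fun (r + 1) (\<lambda>x. (x \<bullet> b) * f x)"
proof -
  obtain c where c: "\<And>x. f x = (\<Sum>\<alpha>\<in>multi_indices r. c \<alpha> * (\<Prod>b\<in>Basis. (x \<bullet> b) ^ \<alpha> b))"
    using f unfolding poly_fun_iff by blast
  let ?u = "\<lambda>\<alpha> :: 'a \<Rightarrow> nat. \<alpha>(b := Suc (\<alpha> b))"
  \<comment> \<open>Coefficients shifted by one in the exponent of b, with 0 where that exponent is
    0, which is outside the image of the shift \<open>?u\<close>.\<close>
  let ?c = "\<lambda>\<alpha> :: 'a \<Rightarrow> nat. if \<alpha> b = 0 then 0 else c (\<alpha>(b := \<alpha> b - 1))"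
  have inj: "inj_on ?u (multi_indices r)"
    by (auto simp: inj_on_def fun_eq_iff split: if_splits)
  have sumu: "(\<Sum>b'\<in>Basis. ?u \<alpha> b') = Suc (\<Sum>b'\<in>Basis. \<alpha> b')" for \<alpha>
  proof -
    have "sum (?u \<alpha>) (Basis - {b}) = sum \<alpha> (Basis - {b})" by (rule sum.cong) auto
    then show ?thesis using sum.remove[OF finite_Basis b, of "?u \<alpha>"] sum.remove[OF finite_Basis b, of \<alpha>]
      by simp
  qed
  have sub: "?u ` multi_indices r \<subseteq> multi_indices (r + 1)"
  proof (rule image_subsetI)
    fix \<alpha> :: "'a \<Rightarrow> nat" assume "\<alpha> \<in> multi_indices r"
    then show "?u \<alpha> \<in> multi_indices (r + 1)"
      using b unfolding multi_indices_def mem_Collect_eq sumu by auto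
  qed
  have "(x \<bullet> b) * f x = (\<Sum>\<alpha>\<in>multi_indices (r + 1). ?c \<alpha> * (\<Prod>b\<in>Basis. (x \<bullet> b) ^ \<alpha> b))" for x
  proof -
    have "(\<Sum>\<alpha>\<in>multi_indices (r + 1). ?c \<alpha> * (\<Prod>b\<in>Basis. (x \<bullet> b) ^ \<alpha> b)) =
        (\<Sum>\<alpha>\<in>?u ` multi_indices r. ?c \<alpha> * (\<Prod>b\<in>Basis. (x \<bullet> b) ^ \<alpha> b))"
    proof (rule sum.mono_neutral_right[OF finite_multi_indices sub], rule ballI)
      fix \<alpha> :: "'a \<Rightarrow> nat" assume al: "\<alpha> \<in> multi_indices (r + 1) - ?u ` multi_indices r"
      have "\<alpha> b = 0"
      proof (rule ccontr)
        assume nz: "\<alpha> b \<noteq> 0"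
        let ?a = "\<alpha>(b := \<alpha> b - 1)"
        have u: "\<alpha> = ?u ?a" using nz by auto
        have "int (\<Sum>b'\<in>Basis. \<alpha> b') \<le> r + 1" using al by (auto simp: multi_indices_def)
        moreover have "(\<Sum>b'\<in>Basis. \<alpha> b') = Suc (\<Sum>b'\<in>Basis. ?a b')"
          using sumu[of ?a] unfolding u[symmetric] .
        ultimately have "int (\<Sum>b'\<in>Basis. ?a b') \<le> r" by linarith
        then have "?a \<in> multi_indices r" using al b by (auto simp: multi_indices_def)
        then show False using u al by blast
      qed
      then show "?c \<alpha> * (\<Prod>b\<in>Basis. (x \<bullet> b) ^ \<alpha> b) = 0" by simp
    qed
    also have "\<dots> = (\<Sum>\<alpha>\<in>multi_indices r. ?c (?u \<alpha>) * (\<Prod>b'\<in>Basis. (x \<bullet> b') ^ ?u \<alpha> b'))"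
      by (subst sum.reindex[OF inj]) simp
    also have "\<dots> = (\<Sum>\<alpha>\<in>multi_indices r. (x \<bullet> b) * (c \<alpha> * (\<Prod>b'\<in>Basis. (x \<bullet> b') ^ \<alpha> b')))"
    proof (rule sum.cong[OF refl])
      fix \<alpha> :: "'a \<Rightarrow> nat" assume "\<alpha> \<in> multi_indices r"
      have "(\<Prod>b'\<in>Basis. (x \<bullet> b') ^ ?u \<alpha> b') = (x \<bullet> b) * (\<Prod>b'\<in>Basis. (x \<bullet> b') ^ \<alpha> b')"
      proof -
        have "(\<Prod>b'\<in>Basis - {b}. (x \<bullet> b') ^ ?u \<alpha> b') = (\<Prod>b'\<in>Basis - {b}. (x \<bullet> b') ^ \<alpha> b')"
          by (rule prod.cong) auto
        then show ?thesis
          using prod.remove[OF finite_Basis b, of "\<lambda>b'. (x \<bullet> b') ^ ?u \<alpha> b'"]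
            prod.remove[OF finite_Basis b, of "\<lambda>b'. (x \<bullet> b') ^ \<alpha> b'"] by simp
      qed
      then show "?c (?u \<alpha>) * (\<Prod>b'\<in>Basis. (x \<bullet> b') ^ ?u \<alpha> b') =
          (x \<bullet> b) * (c \<alpha> * (\<Prod>b'\<in>Basis. (x \<bullet> b') ^ \<alpha> b'))" by simp
    qed
    finally show ?thesis by (simp add: c sum_distrib_left)
  qed
  then show ?thesis unfolding poly_fun_iff by (intro exI[of _ ?c]) blast
qed

text \<open>Polynomials arise from constants by sums and by multiplication with coordinates, each of
  which raises the degree by one. With a predicate Q graded by degree, one induction covers both
  affine substitution and the passage to monomials in chart coordinates.\<close>

lemma poly_fun_compose_induct:
  fixes A :: "'t \<Rightarrow> 'a::euclidean_space" and Q :: "nat \<Rightarrow> ('t \<Rightarrow> real) \<Rightarrow> bool"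
  assumes q: "poly_fun (int r) q"
    and const: "\<And>c m. Q m (\<lambda>t. c)"
    and add: "\<And>m f g. Q m f \<Longrightarrow> Q m g \<Longrightarrow> Q m (\<lambda>t. f t + g t)"
    and mult: "\<And>m f b. b \<in> Basis \<Longrightarrow> Q m f \<Longrightarrow> Q (Suc m) (\<lambda>t. (A t \<bullet> b) * f t)"
    and mono: "\<And>m f. Q m f \<Longrightarrow> Q (Suc m) f"
  shows "Q r (\<lambda>t. q (A t))"
proof -
  obtain c where c: "\<And>x. q x = (\<Sum>\<alpha>\<in>multi_indices r. c \<alpha> * (\<Prod>b\<in>Basis. (x \<bullet> b) ^ \<alpha> b))"
    using q unfolding poly_fun_iff by blast
  have mono': "Q m' f" if "Q m f" "m \<le> m'" for m m' f
    using that(2,1) by (induction rule: dec_induct) (auto intro: mono)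
  have pow: "Q (m + k) (\<lambda>t. (A t \<bullet> b) ^ k * f t)" if "b \<in> Basis" "Q m f" for b m f k
    using mult[OF that(1)] that(2) by (induction k) (auto simp: mult.assoc)
  have mon: "Q (\<Sum>b\<in>B. \<alpha> b) (\<lambda>t. k * (\<Prod>b\<in>B. (A t \<bullet> b) ^ \<alpha> b))" if "finite B" "B \<subseteq> Basis" for B \<alpha> k
    using that
  proof (induction B)
    case empty
    then show ?case using const by simp
  next
    case (insert b B)
    then show ?case using pow[of b "\<Sum>b\<in>B. \<alpha> b" "\<lambda>t. k * (\<Prod>b\<in>B. (A t \<bullet> b) ^ \<alpha> b)" "\<alpha> b"]
      by (simp add: ac_simps)
  qed
  have "Q r (\<lambda>t. \<Sum>\<alpha>\<in>I. c \<alpha> * (\<Prod>b\<in>Basis. (A t \<bullet> b) ^ \<alpha> b))" if "finite I" "I \<subseteq> multi_indices r" for I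
    using that
  proof (induction I)
    case empty
    then show ?case using const by simp
  next
    case (insert \<alpha> I)
    have "(\<Sum>b\<in>Basis. \<alpha> b) \<le> r" using insert.prems
      by (auto simp: multi_indices_def simp del: of_nat_sum)
    then have "Q r (\<lambda>t. c \<alpha> * (\<Prod>b\<in>Basis. (A t \<bullet> b) ^ \<alpha> b))"
      using mono'[OF mon[of Basis \<alpha> "c \<alpha>"]] by simp
    then show ?case using insert add by simp
  qed
  then show ?thesis unfolding c using finite_multi_indices by blast
qed

lemma poly_fun_compose_affine:
  fixes L :: "'a::euclidean_space \<Rightarrow> 'b::euclidean_space"
  assumes q: "poly_fun r q" and L: "linear L"
  shows "poly_fun r (\<lambda>x. q (c + L x))"
proof (cases "r < 0")
  case True
  then show ?thesis using q by (simp add: poly_fun_neg)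
next
  case False
  then have r: "int (nat r) = r" by simp
  have "poly_fun (int (nat r)) (\<lambda>x. q (c + L x))"
  proof (rule poly_fun_compose_induct[where Q = "\<lambda>m f. poly_fun (int m) f"
        and A = "\<lambda>x. c + L x" and q = q])
    fix m f and b :: 'b assume b: "b \<in> Basis" and f: "poly_fun (int m) (f :: 'a \<Rightarrow> real)"
    have "poly_fun (int m + 1) (\<lambda>x. (c \<bullet> b) * f x + (\<Sum>b'\<in>Basis. (L b' \<bullet> b) * ((x \<bullet> b') * f x)))"
      by (intro poly_fun_add poly_fun_sum poly_fun_cmult poly_fun_mult_inner f poly_fun_mono[OF f]) simp_all
    moreover have "(c \<bullet> b) * f x + (\<Sum>b'\<in>Basis. (L b' \<bullet> b) * ((x \<bullet> b') * f x)) = ((c + L x) \<bullet> b) * f x" for x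
    proof -
      have "L x = (\<Sum>b'\<in>Basis. (x \<bullet> b') *\<^sub>R L b')"
        by (subst euclidean_representation[of x, symmetric]) (simp only: linear_sum[OF L] linear_scale[OF L])
      then have "L x \<bullet> b = (\<Sum>b'\<in>Basis. (x \<bullet> b') * (L b' \<bullet> b))" by (simp add: inner_sum_left)
      then show ?thesis by (simp add: inner_add_left distrib_right distrib_left sum_distrib_left sum_distrib_right ac_simps)
    qed
    ultimately show "poly_fun (int (Suc m)) (\<lambda>x. ((c + L x) \<bullet> b) * f x)" by (simp add: add.commute)
  qed (use q r in \<open>auto intro: poly_fun_const poly_fun_add poly_fun_mono\<close>)
  then show ?thesis using r by simp
qed

lemma poly_fun_continuous_on: "poly_fun r q \<Longrightarrow> continuous_on X q"
proof -
  assume "poly_fun r q"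
  then obtain c where "\<And>x. q x = (\<Sum>\<alpha>\<in>multi_indices r. c \<alpha> * (\<Prod>b\<in>Basis. (x \<bullet> b) ^ \<alpha> b))"
    unfolding poly_fun_iff by blast
  then have "q = (\<lambda>x. \<Sum>\<alpha>\<in>multi_indices r. c \<alpha> * (\<Prod>b\<in>Basis. (x \<bullet> b) ^ \<alpha> b))" by blast
  then show ?thesis by (auto intro!: continuous_intros)
qed

text \<open>Each exponent, not the total degree, is bounded by m: the index set is then a product
  and matches the products of one-dimensional kernels.\<close>

definition monomial_sum :: "nat \<Rightarrow> nat \<Rightarrow> ((nat \<Rightarrow> real) \<Rightarrow> real) \<Rightarrow> bool"
  where "monomial_sum d m f \<longleftrightarrow>
    (\<exists>c. \<forall>t. f t = (\<Sum>\<beta>\<in>{..<d} \<rightarrow>\<^sub>E {..m}. c \<beta> * (\<Prod>j<d. t j ^ \<beta> j)))"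

lemma finite_exponents: "finite ({..<d::nat} \<rightarrow>\<^sub>E {..m::nat})"
  by (rule finite_PiE) auto

lemma monomial_sum_add: "monomial_sum d m f \<Longrightarrow> monomial_sum d m g \<Longrightarrow> monomial_sum d m (\<lambda>t. f t + g t)"
proof -
  assume "monomial_sum d m f" "monomial_sum d m g"
  then obtain c c' where
    "\<And>t. f t = (\<Sum>\<beta>\<in>{..<d} \<rightarrow>\<^sub>E {..m}. c \<beta> * (\<Prod>j<d. t j ^ \<beta> j))"
    "\<And>t. g t = (\<Sum>\<beta>\<in>{..<d} \<rightarrow>\<^sub>E {..m}. c' \<beta> * (\<Prod>j<d. t j ^ \<beta> j))"
    unfolding monomial_sum_def by blast
  then show ?thesis unfolding monomial_sum_def
    by (intro exI[of _ "\<lambda>\<alpha>. c \<alpha> + c' \<alpha>"]) (simp add: distrib_right sum.distrib)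
qed

lemma monomial_sum_cmult: "monomial_sum d m f \<Longrightarrow> monomial_sum d m (\<lambda>t. k * f t)"
proof -
  assume "monomial_sum d m f"
  then obtain c where "\<And>t. f t = (\<Sum>\<beta>\<in>{..<d} \<rightarrow>\<^sub>E {..m}. c \<beta> * (\<Prod>j<d. t j ^ \<beta> j))"
    unfolding monomial_sum_def by blast
  then show ?thesis unfolding monomial_sum_def
    by (intro exI[of _ "\<lambda>\<alpha>. k * c \<alpha>"]) (simp add: sum_distrib_left mult.assoc)
qed

lemma monomial_sum_zero: "monomial_sum d m (\<lambda>t. 0)"
  unfolding monomial_sum_def by (intro exI[of _ "\<lambda>_. 0"]) simp

lemma monomial_sum_sum: "(\<And>i. i \<in> I \<Longrightarrow> monomial_sum d m (f i)) \<Longrightarrow> monomial_sum d m (\<lambda>t. \<Sum>i\<in>I. f i t)"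
  by (induction I rule: infinite_finite_induct) (auto intro: monomial_sum_zero monomial_sum_add)

lemma monomial_sum_monomial:
  assumes "\<beta> \<in> {..<d} \<rightarrow>\<^sub>E {..m}" shows "monomial_sum d m (\<lambda>t. \<Prod>j<d. t j ^ \<beta> j)"
proof -
  have "(\<Prod>j<d. t j ^ \<beta> j) =
      (\<Sum>\<gamma>\<in>{..<d} \<rightarrow>\<^sub>E {..m}. (if \<gamma> = \<beta> then 1 else 0) * (\<Prod>j<d. t j ^ \<gamma> j))" for t :: "nat \<Rightarrow> real"
  proof -
    have "(\<Sum>\<gamma>\<in>{..<d} \<rightarrow>\<^sub>E {..m}. (if \<gamma> = \<beta> then 1 else 0) * (\<Prod>j<d. t j ^ \<gamma> j)) =
      (\<Sum>\<gamma>\<in>{\<beta>}. (if \<gamma> = \<beta> then 1 else 0) * (\<Prod>j<d. t j ^ \<gamma> j))"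
      using assms by (intro sum.mono_neutral_right finite_exponents) auto
    then show ?thesis by simp
  qed
  then show ?thesis unfolding monomial_sum_def by (intro exI[of _ "\<lambda>\<gamma>. if \<gamma> = \<beta> then 1 else 0"]) blast
qed

lemma monomial_sum_linear_comb:
  assumes "monomial_sum d m f"
    and "\<And>\<beta>. \<beta> \<in> {..<d} \<rightarrow>\<^sub>E {..m} \<Longrightarrow> monomial_sum d m' (\<lambda>t. h t * (\<Prod>j<d. t j ^ \<beta> j))"
  shows "monomial_sum d m' (\<lambda>t. h t * f t)"
proof -
  obtain c where c: "\<And>t. f t = (\<Sum>\<beta>\<in>{..<d} \<rightarrow>\<^sub>E {..m}. c \<beta> * (\<Prod>j<d. t j ^ \<beta> j))"
    using assms(1) unfolding monomial_sum_def by blast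
  have "monomial_sum d m' (\<lambda>t. \<Sum>\<beta>\<in>{..<d} \<rightarrow>\<^sub>E {..m}. c \<beta> * (h t * (\<Prod>j<d. t j ^ \<beta> j)))"
    by (intro monomial_sum_sum monomial_sum_cmult assms(2))
  then show ?thesis by (simp add: c sum_distrib_left mult.left_commute)
qed

lemma monomial_sum_Suc: "monomial_sum d m f \<Longrightarrow> monomial_sum d (Suc m) f"
  using monomial_sum_linear_comb[of d m f "Suc m" "\<lambda>_. 1"]
  by (simp add: monomial_sum_monomial PiE_def Pi_def le_SucI)

lemma monomial_sum_mult_coordinate:
  assumes i: "i < d" and f: "monomial_sum d m f"
  shows "monomial_sum d (Suc m) (\<lambda>t. t i * f t)"
proof (rule monomial_sum_linear_comb[OF f])
  fix \<beta> :: "nat \<Rightarrow> nat" assume b: "\<beta> \<in> {..<d} \<rightarrow>\<^sub>E {..m}"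
  have *: "\<beta>(i := Suc (\<beta> i)) \<in> {..<d} \<rightarrow>\<^sub>E {..Suc m}"
    using b i by (auto simp: PiE_def Pi_def extensional_def le_SucI)
  show "monomial_sum d (Suc m) (\<lambda>t. t i * (\<Prod>j<d. t j ^ \<beta> j))"
  proof -
    have "(\<Prod>j\<in>{..<d} - {i}. t j ^ (\<beta>(i := Suc (\<beta> i))) j) = (\<Prod>j\<in>{..<d} - {i}. t j ^ \<beta> j)" for t :: "nat \<Rightarrow> real"
      by (rule prod.cong) auto
    then have "(\<Prod>j<d. t j ^ (\<beta>(i := Suc (\<beta> i))) j) = t i * (\<Prod>j<d. t j ^ \<beta> j)" for t :: "nat \<Rightarrow> real"
      using i prod.remove[of "{..<d}" i "\<lambda>j. t j ^ (\<beta>(i := Suc (\<beta> i))) j"]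
        prod.remove[of "{..<d}" i "\<lambda>j. t j ^ \<beta> j"] by simp
    with monomial_sum_monomial[OF *] show ?thesis by simp
  qed
qed

lemma monomial_sum_const: "monomial_sum d m (\<lambda>t. c)"
proof -
  have "(\<lambda>j\<in>{..<d}. 0) \<in> {..<d} \<rightarrow>\<^sub>E {..m}" by auto
  from monomial_sum_cmult[OF monomial_sum_monomial[OF this], of c] show ?thesis by simp
qed

lemma poly_fun_chart:
  assumes "poly_fun (int r) q"
  shows "monomial_sum d r (\<lambda>t. q (p + (\<Sum>j<d. t j *\<^sub>R e j)))"
proof (rule poly_fun_compose_induct[where Q = "monomial_sum d", OF assms])
  fix m f b assume f: "monomial_sum d m f"
  have "monomial_sum d (Suc m) (\<lambda>t. (p \<bullet> b) * f t + (\<Sum>j<d. (e j \<bullet> b) * (t j * f t)))"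
    by (intro monomial_sum_add monomial_sum_sum monomial_sum_cmult monomial_sum_mult_coordinate
        monomial_sum_Suc f) simp
  then show "monomial_sum d (Suc m) (\<lambda>t. ((p + (\<Sum>j<d. t j *\<^sub>R e j)) \<bullet> b) * f t)"
    by (simp add: inner_add_left inner_sum_left distrib_left sum_distrib_left ac_simps)
qed (auto intro: monomial_sum_const monomial_sum_add monomial_sum_Suc)

section \<open>Tangent spaces and affine maps\<close>

lemma subspace_tangent: "subspace (tangent X)"
  by (simp add: tangent_def)

lemma tangent_mono: "X \<subseteq> Y \<Longrightarrow> tangent X \<subseteq> tangent Y"
  unfolding tangent_def by (intro span_mono) blast

lemma diff_in_tangent: "x \<in> X \<Longrightarrow> y \<in> X \<Longrightarrow> x - y \<in> tangent X"
  unfolding tangent_def by (intro span_base) blast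

lemma tangent_UNIV: "tangent UNIV = UNIV"
  using diff_in_tangent[of _ UNIV 0] by auto

lemma tangent_affine_image:
  assumes L: "linear L" shows "tangent ((\<lambda>x. c + L x) ` X) = L ` tangent X"
proof -
  have "{x - y |x y. x \<in> (\<lambda>x. c + L x) ` X \<and> y \<in> (\<lambda>x. c + L x) ` X} = L ` {x - y |x y. x \<in> X \<and> y \<in> X}"
    (is "?l = ?r")
  proof (intro equalityI subsetI)
    fix z assume "z \<in> ?l"
    then obtain x y where "x \<in> X" "y \<in> X" "z = (c + L x) - (c + L y)" by blast
    then have "z = L (x - y)" by (simp add: linear_diff[OF L])
    then show "z \<in> ?r" using \<open>x \<in> X\<close> \<open>y \<in> X\<close> by blast
  next
    fix z assume "z \<in> ?r"
    then obtain x y where "x \<in> X" "y \<in> X" "z = L (x - y)" by blast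
    then have "z = (c + L x) - (c + L y)" by (simp add: linear_diff[OF L])
    then show "z \<in> ?l" using \<open>x \<in> X\<close> \<open>y \<in> X\<close> by blast
  qed
  then show ?thesis unfolding tangent_def by (simp only: linear_span_image[OF L])
qed

lemma tangent_eq_span:
  assumes "x0 \<in> X" shows "tangent X = span ((\<lambda>x. x - x0) ` X)"
proof (rule antisym)
  show "tangent X \<subseteq> span ((\<lambda>x. x - x0) ` X)"
    unfolding tangent_def
  proof (rule span_minimal)
    show "{x - y |x y. x \<in> X \<and> y \<in> X} \<subseteq> span ((\<lambda>x. x - x0) ` X)"
    proof
      fix z assume "z \<in> {x - y |x y. x \<in> X \<and> y \<in> X}"
      then obtain x y where xy: "x \<in> X" "y \<in> X" "z = x - y" by blast
      have "(x - x0) - (y - x0) \<in> span ((\<lambda>x. x - x0) ` X)"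
        using xy by (intro span_diff span_base) auto
      then show "z \<in> span ((\<lambda>x. x - x0) ` X)" using xy by simp
    qed
  qed simp
  show "span ((\<lambda>x. x - x0) ` X) \<subseteq> tangent X"
    by (rule span_minimal) (use assms diff_in_tangent subspace_tangent in auto)
qed

lemma affine_hull_tangent:
  assumes "x0 \<in> X" shows "affine hull X = (+) x0 ` tangent X"
proof -
  have "(+) (- x0) ` X = (\<lambda>x. x - x0) ` X" by auto
  then show ?thesis
    using affine_hull_span_gen[OF hull_inc[OF assms]] tangent_eq_span[OF assms] by simp
qed

text \<open>From a relative interior point p one can move a little in any tangent direction without
  leaving X. Moving along a vector in the kernel of L does not change the image, so injectivity on X
  excludes nonzero kernel vectors.\<close>

lemma inj_on_tangent:
  fixes L :: "'a::euclidean_space \<Rightarrow> 'b::real_vector"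
  assumes X: "convex X" "X \<noteq> {}" and L: "linear L" and inj: "inj_on (\<lambda>x. c + L x) X"
  shows "inj_on L (tangent X)"
proof (rule linear_inj_on_iff_eq_0[OF L subspace_tangent, THEN iffD2], intro ballI impI)
  fix v assume v: "v \<in> tangent X" "L v = 0"
  obtain p where p: "p \<in> rel_interior X" using rel_interior_eq_empty X by blast
  then obtain e where e: "p \<in> X" "e > 0" "cball p e \<inter> affine hull X \<subseteq> X"
    unfolding mem_rel_interior_cball by blast
  show "v = 0"
  proof (rule ccontr)
    assume "v \<noteq> 0"
    let ?t = "e / norm v"
    have "p + ?t *\<^sub>R v \<in> affine hull X"
      unfolding affine_hull_tangent[OF e(1)] using v subspace_scale[OF subspace_tangent] by blast
    moreover have "p + ?t *\<^sub>R v \<in> cball p e" using \<open>v \<noteq> 0\<close> e(2) by (simp add: dist_norm)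
    ultimately have m: "p + ?t *\<^sub>R v \<in> X" using e(3) by blast
    have "c + L (p + ?t *\<^sub>R v) = c + L p" using v(2) by (simp add: linear_add[OF L] linear_scale[OF L])
    then have "p + ?t *\<^sub>R v = p" using inj_onD[OF inj _ m e(1)] by blast
    then show False using \<open>v \<noteq> 0\<close> e(2) by simp
  qed
qed

text \<open>Even when X is lower-dimensional, the inverse is the restriction of an affine map of the
  whole space: L' extends a left inverse of L on the tangent space, and c' is fixed by one point of
  X. Pullbacks along the inverse thus inherit continuity from the ambient form.\<close>

lemma affine_bij_inverse:
  fixes A :: "'a::euclidean_space \<Rightarrow> 'a"
  assumes X: "convex X" "X \<noteq> {}" and A: "affine_bij A X Y"
  obtains c L c' L' where "linear L" "A = (\<lambda>x. c + L x)" "bij_betw A X Y"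
    "linear L'" "\<And>x. x \<in> X \<Longrightarrow> c' + L' (A x) = x" "\<And>v. v \<in> tangent X \<Longrightarrow> L' (L v) = v"
    "tangent Y = L ` tangent X" "inj_on L (tangent X)"
proof -
  obtain L c where L: "linear L" "A = (\<lambda>x. c + L x)" and bij: "bij_betw A X Y"
    using A unfolding affine_bij_def by blast
  have "inj_on (\<lambda>x. c + L x) X" using bij L(2) by (simp add: bij_betw_def)
  then have inj: "inj_on L (tangent X)" by (rule inj_on_tangent[OF X L(1)])
  obtain L' where L': "linear L'" "\<And>v. v \<in> tangent X \<Longrightarrow> L' (L v) = v"
    using linear_exists_left_inverse_on[OF L(1) subspace_tangent inj] by blast
  obtain x0 where x0: "x0 \<in> X" using X by blast
  have "(x0 - L' (A x0)) + L' (A x) = x" if "x \<in> X" for x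
  proof -
    have "L' (A x) - L' (A x0) = L' (L (x - x0))"
      unfolding L(2) by (simp add: linear_diff[OF L(1)] linear_diff[OF L'(1)] linear_add[OF L'(1)])
    also have "\<dots> = x - x0" using L'(2) diff_in_tangent[OF that x0] by blast
    finally show ?thesis by (simp add: algebra_simps)
  qed
  moreover have "tangent Y = L ` tangent X"
    using tangent_affine_image[OF L(1), of c X] bij L(2) by (simp add: bij_betw_def)
  ultimately show ?thesis using that[OF L bij L'(1) _ L'(2)] inj by blast
qed

text \<open>Injectivity is available on X only. A point of an open segment in the image is the image
  of the point dividing the original segment in the same ratio, which lies in X by convexity, so the
  face condition can be checked in X.\<close>

lemma face_of_affine_image:
  assumes X: "convex X" and L: "linear L" and inj: "inj_on (\<lambda>x. c + L x) X" and G: "G face_of X"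
  shows "((\<lambda>x. c + L x) ` G) face_of ((\<lambda>x. c + L x) ` X)"
  unfolding face_of_def
proof (intro conjI ballI impI)
  let ?A = "\<lambda>x. c + L x"
  show "?A ` G \<subseteq> ?A ` X" using face_of_imp_subset[OF G] by blast
  have "?A ` G = (\<lambda>x. c + x) ` (L ` G)" by auto
  then show "convex (?A ` G)"
    using convex_translation convex_linear_image[OF L face_of_imp_convex[OF G]] by metis
  have *: "a \<in> G \<and> b \<in> G" if h: "a \<in> X" "b \<in> X" "x \<in> G" "?A x \<in> open_segment (?A a) (?A b)" for a b x
  proof -
    obtain u where u: "0 < u" "u < 1" "?A x = (1 - u) *\<^sub>R ?A a + u *\<^sub>R ?A b" "?A a \<noteq> ?A b"
      using h(4) unfolding in_segment by blast
    have "?A x = ?A ((1 - u) *\<^sub>R a + u *\<^sub>R b)"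
      unfolding u(3) linear_add[OF L] linear_scale[OF L] by (simp add: algebra_simps)
    moreover have "(1 - u) *\<^sub>R a + u *\<^sub>R b \<in> X"
      using convexD_alt[OF X h(1,2)] u by simp
    ultimately have "x = (1 - u) *\<^sub>R a + u *\<^sub>R b"
      using inj_onD[OF inj] h(3) face_of_imp_subset[OF G] by blast
    then have "x \<in> open_segment a b" using u unfolding in_segment by blast
    then show ?thesis using G h(1-3) unfolding face_of_def by blast
  qed
  fix y z w assume "y \<in> ?A ` X" "z \<in> ?A ` X" "w \<in> ?A ` G" "w \<in> open_segment y z"
  then show "y \<in> ?A ` G" "z \<in> ?A ` G" using * by blast+
qed

section \<open>Pullback of polynomial forms\<close>

lemma alt_forms_pullback:
  assumes f: "f \<in> alt_forms l UNIV" and L: "linear L"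
  shows "(\<lambda>vs. f (map L vs)) \<in> alt_forms l UNIV"
proof (rule alt_formsI)
  show "int (length vs) = l \<and> set vs \<subseteq> UNIV" if "f (map L vs) \<noteq> 0" for vs
    using alt_forms_supp[OF f that] by simp
  show "f (map L (us @ (a *\<^sub>R u + b *\<^sub>R v) # ws)) = a * f (map L (us @ u # ws)) + b * f (map L (us @ v # ws))"
    for us ws u v a b
    using alt_forms_linear[OF f, of "map L us" "map L ws" "L u" "L v" a b]
    by (simp add: linear_add[OF L] linear_scale[OF L])
  show "f (map L vs) = 0" if "\<not> distinct vs" for vs
    using alt_forms_not_distinct[OF f] that by (simp add: distinct_map)
qed

lemma alt_forms_contract:
  assumes f: "f \<in> alt_forms (l + 1) UNIV"
  shows "(\<lambda>vs. f (x # vs)) \<in> alt_forms l UNIV"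
proof (rule alt_formsI)
  show "int (length vs) = l \<and> set vs \<subseteq> UNIV" if "f (x # vs) \<noteq> 0" for vs
    using alt_forms_supp[OF f that] by simp
  show "f (x # us @ (a *\<^sub>R u + b *\<^sub>R v) # ws) = a * f (x # us @ u # ws) + b * f (x # us @ v # ws)"
    for us ws u v a b
    using alt_forms_linear[OF f, of "x # us" ws u v a b] by simp
  show "f (x # vs) = 0" if "\<not> distinct vs" for vs
    using alt_forms_not_distinct[OF f] that by simp
qed

lemma alt_forms_add:
  assumes f: "f \<in> alt_forms l V" and g: "g \<in> alt_forms l V"
  shows "(\<lambda>vs. f vs + g vs) \<in> alt_forms l V"
proof (rule alt_formsI)
  show "int (length vs) = l \<and> set vs \<subseteq> V" if "f vs + g vs \<noteq> 0" for vs
    using alt_forms_supp[OF f, of vs] alt_forms_supp[OF g, of vs] that by fastforce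
next
  fix us ws u v a b
  assume s: "set us \<subseteq> V" "set ws \<subseteq> V" "u \<in> V" "v \<in> V"
  show "f (us @ (a *\<^sub>R u + b *\<^sub>R v) # ws) + g (us @ (a *\<^sub>R u + b *\<^sub>R v) # ws) =
      a * (f (us @ u # ws) + g (us @ u # ws)) + b * (f (us @ v # ws) + g (us @ v # ws))"
    unfolding alt_forms_linear[OF f s] alt_forms_linear[OF g s] by (simp add: algebra_simps)
qed (simp add: alt_forms_not_distinct[OF f] alt_forms_not_distinct[OF g])

lemma poly_formsI:
  assumes "\<And>x. \<omega> x \<in> alt_forms l UNIV" "\<And>vs. poly_fun r (\<lambda>x. \<omega> x vs)"
  shows "\<omega> \<in> poly_forms r l"
  using assms by (simp add: poly_forms_def dforms_def tangent_UNIV)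

lemma poly_formsD:
  assumes "\<omega> \<in> poly_forms r l"
  shows "\<omega> x \<in> alt_forms l UNIV" "poly_fun r (\<lambda>x. \<omega> x vs)"
  using assms by (auto simp: poly_forms_def dforms_def tangent_UNIV)

lemma poly_forms_pullback:
  assumes w: "\<omega> \<in> poly_forms r l" and L: "linear L"
  shows "(\<lambda>x vs. \<omega> (c + L x) (map L vs)) \<in> poly_forms r l"
  by (rule poly_formsI)
    (use alt_forms_pullback[OF poly_formsD(1)[OF w] L] poly_fun_compose_affine[OF poly_formsD(2)[OF w] L] in auto)

text \<open>The Koszul operator contracts with the position vector, which is not preserved by
  translations. Contracting with c + L x splits into contraction with L x, which is the Koszul
  operator of the pulled-back \<beta>, and contraction with the constant c, which leaves the degree
  r - 1 unchanged and is absorbed into \<alpha>.\<close>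

lemma trimmed_poly_forms_pullback:
  assumes w: "\<omega> \<in> trimmed_poly_forms r l" and L: "linear L"
  shows "(\<lambda>x vs. \<omega> (c + L x) (map L vs)) \<in> trimmed_poly_forms r l"
proof -
  obtain \<alpha> \<beta> where ab: "\<omega> = \<alpha> + koszul \<beta>" "\<alpha> \<in> poly_forms (r - 1) l" "\<beta> \<in> poly_forms (r - 1) (l + 1)"
    using w unfolding trimmed_poly_forms_def by blast
  define \<alpha>' where "\<alpha>' x vs = \<alpha> (c + L x) (map L vs) + \<beta> (c + L x) (c # map L vs)" for x vs
  define \<beta>' where "\<beta>' x vs = \<beta> (c + L x) (map L vs)" for x vs
  have "\<alpha>' \<in> poly_forms (r - 1) l"
  proof (rule poly_formsI)
    show "\<alpha>' x \<in> alt_forms l UNIV" for x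
    proof -
      have "(\<lambda>vs. \<alpha> (c + L x) (map L vs)) \<in> alt_forms l UNIV"
        by (rule alt_forms_pullback[OF poly_formsD(1)[OF ab(2)] L])
      moreover have "(\<lambda>vs. \<beta> (c + L x) (c # map L vs)) \<in> alt_forms l UNIV"
        by (rule alt_forms_pullback[OF alt_forms_contract[OF poly_formsD(1)[OF ab(3)]] L])
      ultimately show ?thesis unfolding \<alpha>'_def by (rule alt_forms_add)
    qed
    show "poly_fun (r - 1) (\<lambda>x. \<alpha>' x vs)" for vs
      unfolding \<alpha>'_def
      by (intro poly_fun_add poly_fun_compose_affine[OF poly_formsD(2)[OF ab(2)] L]
          poly_fun_compose_affine[OF poly_formsD(2)[OF ab(3)] L])
  qed
  moreover have "\<beta>' \<in> poly_forms (r - 1) (l + 1)"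
    unfolding \<beta>'_def by (rule poly_forms_pullback[OF ab(3) L])
  moreover have "(\<lambda>x vs. \<omega> (c + L x) (map L vs)) = \<alpha>' + koszul \<beta>'"
  proof (intro ext)
    fix x vs
    have "\<beta> (c + L x) ([] @ (1 *\<^sub>R c + 1 *\<^sub>R L x) # map L vs) =
        1 * \<beta> (c + L x) ([] @ c # map L vs) + 1 * \<beta> (c + L x) ([] @ L x # map L vs)"
      by (rule alt_forms_linear[OF poly_formsD(1)[OF ab(3)]]) auto
    then show "\<omega> (c + L x) (map L vs) = (\<alpha>' + koszul \<beta>') x vs"
      by (simp add: ab(1) \<alpha>'_def \<beta>'_def koszul_def)
  qed
  ultimately show ?thesis unfolding trimmed_poly_forms_def by blast
qed

definition pull :: "('a::real_vector \<Rightarrow> 'a) \<Rightarrow> ('a \<Rightarrow> 'a) \<Rightarrow> 'a set \<Rightarrow> 'a dform \<Rightarrow> 'a dform"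
  where "pull A L X \<omega> = (\<lambda>x vs. if x \<in> X \<and> set vs \<subseteq> tangent X then \<omega> (A x) (map L vs) else 0)"

lemma pull_form_trace:
  assumes "A ` X \<subseteq> Y" "L ` tangent X \<subseteq> tangent Y"
  shows "pull A L X (form_trace Y \<omega>) = form_trace X (\<lambda>x vs. \<omega> (A x) (map L vs))"
  using assms by (auto simp: pull_def form_trace_def fun_eq_iff)

lemma pull_fe_forms0:
  fixes A :: "'a::euclidean_space \<Rightarrow> 'a"
  assumes X: "convex X" and L: "linear L" and A: "A = (\<lambda>x. c + L x)" and bij: "bij_betw A X Y"
    and w: "\<omega> \<in> fe_forms0 fam r k Y"
  shows "pull A L X \<omega> \<in> fe_forms0 fam r k X"
proof -
  have im: "A ` X = Y" and inj: "inj_on A X" using bij by (auto simp: bij_betw_def)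
  have tan: "L ` tangent Z = tangent (A ` Z)" for Z
    using tangent_affine_image[OF L, of c Z] A by simp
  have "pull A L X \<omega> \<in> fe_forms fam r k X"
  proof (cases fam)
    case Full
    then obtain \<omega>' where "\<omega>' \<in> poly_forms (int r) (int k)" "\<omega> = form_trace Y \<omega>'"
      using w by (auto simp: fe_forms0_def poly_forms_on_def)
    moreover have "(\<lambda>x vs. \<omega>' (A x) (map L vs)) \<in> poly_forms (int r) (int k)"
      unfolding A by (rule poly_forms_pullback[OF calculation(1) L])
    ultimately show ?thesis using Full pull_form_trace[of A X Y L \<omega>'] im tan[of X]
      by (auto simp: poly_forms_on_def)
  next
    case Trimmed
    then obtain \<omega>' where "\<omega>' \<in> trimmed_poly_forms (int r) (int k)" "\<omega> = form_trace Y \<omega>'"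
      using w by (auto simp: fe_forms0_def trimmed_poly_forms_on_def)
    moreover have "(\<lambda>x vs. \<omega>' (A x) (map L vs)) \<in> trimmed_poly_forms (int r) (int k)"
      unfolding A by (rule trimmed_poly_forms_pullback[OF calculation(1) L])
    ultimately show ?thesis using Trimmed pull_form_trace[of A X Y L \<omega>'] im tan[of X]
      by (auto simp: trimmed_poly_forms_on_def)
  qed
  moreover have "form_trace G (pull A L X \<omega>) = 0" if G: "G face_of X" "G \<noteq> X" for G
  proof -
    have sub: "G \<subseteq> X" by (rule face_of_imp_subset[OF G(1)])
    have "(A ` G) face_of Y"
      using face_of_affine_image[OF X L _ G(1), of c] inj im by (simp add: A)
    moreover have "A ` G \<noteq> Y"
      using inj_on_image_eq_iff[OF inj sub order_refl] im G(2) by simp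
    ultimately have z: "form_trace (A ` G) \<omega> = 0" using w by (simp add: fe_forms0_def)
    have "\<omega> (A x) (map L vs) = 0" if "x \<in> G" "set vs \<subseteq> tangent G" for x vs
    proof -
      have "set (map L vs) \<subseteq> tangent (A ` G)" using that tan[of G] by auto
      then show ?thesis using fun_cong[OF fun_cong[OF z, of "A x"], of "map L vs"] that
        by (simp add: form_trace_def)
    qed
    then show ?thesis using sub tangent_mono[OF sub]
      by (auto simp: form_trace_def pull_def fun_eq_iff)
  qed
  ultimately show ?thesis by (simp add: fe_forms0_def)
qed

text \<open>\<open>dim\<close> refers to spans, so a basis B inside V is transported. The left
  inverse g extends by linearity from B to its span, which makes f injective there.\<close>

lemma dim_eq_linear_bij:
  fixes f :: "'a::real_vector \<Rightarrow> 'b::real_vector"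
  assumes f: "linear f" and g: "linear g" and gf: "\<And>v. v \<in> V \<Longrightarrow> g (f v) = v" and fV: "f ` V = W"
  shows "dim V = dim W"
proof -
  obtain B where B: "B \<subseteq> V" "independent B" "V \<subseteq> span B" "card B = dim V"
    using basis_exists by blast
  have "g (f v) = v" if "v \<in> span B" for v
  proof -
    have "(g \<circ> f) v = id v"
      by (rule linear_eq_on_span[of _ _ B, OF linear_compose[OF f g] linear_id _ that])
        (use B(1) gf in auto)
    then show ?thesis by simp
  qed
  then have inj: "inj_on f (span B)" by (rule inj_on_inverseI)
  have "span (f ` B) = span W"
  proof (rule antisym)
    show "span (f ` B) \<subseteq> span W" using B(1) fV by (intro span_mono) blast
    have "W \<subseteq> f ` span B" using B(3) fV by blast
    then show "span W \<subseteq> span (f ` B)"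
      unfolding linear_span_image[OF f, symmetric] by (intro span_minimal linear_subspace_image[OF f]) auto
  qed
  then have "dim W = card (f ` B)"
    by (rule dim_eq_card) (rule linear_independent_injective_image[OF f B(2) inj])
  also have "\<dots> = card B"
    by (rule card_image) (rule inj_on_subset[OF inj span_superset])
  finally show ?thesis using B(4) by simp
qed

lemma linear_pull: "linear (pull A L X)"
  by (rule linearI) (auto simp: pull_def fun_eq_iff scaleR_fun_def)

lemma pull_inverse:
  assumes A': "\<And>y. y \<in> Y \<Longrightarrow> A' y \<in> X" "\<And>v. v \<in> tangent Y \<Longrightarrow> L' v \<in> tangent X"
    "\<And>y. y \<in> Y \<Longrightarrow> A (A' y) = y" "\<And>v. v \<in> tangent Y \<Longrightarrow> L (L' v) = v"
    and w: "\<omega> \<in> fe_forms0 fam r k Y"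
  shows "pull A' L' Y (pull A L X \<omega>) = \<omega>"
proof (intro ext)
  fix y vs
  obtain \<omega>' where w': "\<omega> = form_trace Y \<omega>'"
    using w by (cases fam) (auto simp: fe_forms0_def poly_forms_on_def trimmed_poly_forms_on_def)
  show "pull A' L' Y (pull A L X \<omega>) y vs = \<omega> y vs"
  proof (cases "y \<in> Y \<and> set vs \<subseteq> tangent Y")
    case True
    then have "map L (map L' vs) = vs" using A'(4) by (auto intro!: map_idI)
    moreover have "set (map L' vs) \<subseteq> tangent X" using True A'(2) by auto
    ultimately show ?thesis using True A'(1,3) by (simp add: pull_def)
  qed (auto simp: pull_def w' form_trace_def)
qed

text \<open>The reference bases are indexed by the reference simplex, the degrees of freedom by S.
  Pullbacks along the affine bijection and its inverse are mutually inverse on the trace-free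
  spaces, so both index sets agree.\<close>

lemma fe_index_affine:
  fixes A :: "'a::euclidean_space \<Rightarrow> 'a"
  assumes X: "convex X" "X \<noteq> {}" and A: "affine_bij A X Y"
  shows "fe_index fam r k Y = fe_index fam r k X"
proof -
  obtain c L c' L' where L: "linear L" "A = (\<lambda>x. c + L x)" "bij_betw A X Y"
    "linear L'" "\<And>x. x \<in> X \<Longrightarrow> c' + L' (A x) = x" "\<And>v. v \<in> tangent X \<Longrightarrow> L' (L v) = v"
    "tangent Y = L ` tangent X" "inj_on L (tangent X)"
    by (rule affine_bij_inverse[OF X A], rule that; assumption)
  define A' where "A' = (\<lambda>x. c' + L' x)"
  have im: "A ` X = Y" using L(3) by (simp add: bij_betw_def)
  have A': "A' (A x) = x" if "x \<in> X" for x using L(5)[OF that] by (simp add: A'_def)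
  have A'Y: "A' y \<in> X" "A (A' y) = y" if "y \<in> Y" for y using that A' im by auto
  have L'Y: "L' v \<in> tangent X" "L (L' v) = v" if "v \<in> tangent Y" for v using that L(6,7) by auto
  have bij': "bij_betw A' Y X"
    by (rule bij_betw_byWitness[where f' = A]) (use A' A'Y im in auto)
  have Y: "convex Y"
  proof -
    have "Y = (\<lambda>x. c + x) ` (L ` X)" using im L(2) by auto
    then show ?thesis using convex_translation convex_linear_image[OF L(1) X(1)] by metis
  qed
  have "dim (fe_forms0 fam r k Y) = dim (fe_forms0 fam r k X)"
  proof (rule dim_eq_linear_bij[OF linear_pull linear_pull])
    show "pull A' L' Y (pull A L X \<omega>) = \<omega>" if "\<omega> \<in> fe_forms0 fam r k Y" for \<omega>
      by (rule pull_inverse[OF A'Y(1) L'Y(1) A'Y(2) L'Y(2) that])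
    have inv: "pull A L X (pull A' L' Y \<omega>) = \<omega>" if "\<omega> \<in> fe_forms0 fam r k X" for \<omega>
      by (rule pull_inverse[where A = A' and L = L' and X = Y and A' = A and L' = L and Y = X])
        (use im L(6,7) A' that in auto)
    show "pull A L X ` fe_forms0 fam r k Y = fe_forms0 fam r k X"
    proof (intro equalityI subsetI)
      fix \<omega> assume "\<omega> \<in> pull A L X ` fe_forms0 fam r k Y"
      then show "\<omega> \<in> fe_forms0 fam r k X" using pull_fe_forms0[OF X(1) L(1-3)] by blast
    next
      fix \<omega> assume w: "\<omega> \<in> fe_forms0 fam r k X"
      have "pull A' L' Y \<omega> \<in> fe_forms0 fam r k Y"
        by (rule pull_fe_forms0[OF Y L(4) A'_def bij' w])
      then show "\<omega> \<in> pull A L X ` fe_forms0 fam r k Y" using inv[OF w] by (metis image_eqI)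
    qed
  qed
  then show ?thesis by (simp add: fe_index_def)
qed

section \<open>Integrals over simplices\<close>

interpretation lborel_power: product_sigma_finite "\<lambda>_::nat. lborel :: real measure"
  by standard

lemma space_lborel_power: "space (lborel_power m) = {..<m} \<rightarrow>\<^sub>E UNIV"
  by (simp add: lborel_power_def space_PiM)

lemma measurable_lborel_power_coordinate:
  "j < m \<Longrightarrow> (\<lambda>t. t j) \<in> borel_measurable (lborel_power m)"
  unfolding lborel_power_def using measurable_component_singleton[of j "{..<m}" "\<lambda>_. lborel"] by simp

lemma sets_std_simplex: "std_simplex m \<in> sets (lborel_power m)"
proof -
  have "std_simplex m = {t \<in> space (lborel_power m). (\<forall>j\<in>{..<m}. 0 \<le> t j) \<and> (\<Sum>j<m. t j) \<le> 1}"
    by (auto simp: std_simplex_def)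
  moreover have "{t \<in> space (lborel_power m). \<forall>j\<in>{..<m}. 0 \<le> t j} \<in> sets (lborel_power m)"
    by (rule sets.sets_Collect_finite_All)
      (auto intro!: borel_measurable_le borel_measurable_const measurable_lborel_power_coordinate)
  moreover have "{t \<in> space (lborel_power m). (\<Sum>j<m. t j) \<le> 1} \<in> sets (lborel_power m)"
    by (intro borel_measurable_le borel_measurable_sum borel_measurable_const)
      (auto intro: measurable_lborel_power_coordinate)
  ultimately show ?thesis by (auto intro!: sets.sets_Collect_conj)
qed

lemma emeasure_std_simplex_le: "emeasure (lborel_power m) (std_simplex m) \<le> 1"
proof -
  have "std_simplex m \<subseteq> {..<m} \<rightarrow>\<^sub>E {0..1}"
  proof
    fix t assume t: "t \<in> std_simplex m"
    have "t j \<le> 1" if "j < m" for j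
    proof -
      have "t j \<le> (\<Sum>j<m. t j)" using t that by (intro member_le_sum) (auto simp: std_simplex_def)
      then show ?thesis using t by (simp add: std_simplex_def)
    qed
    then show "t \<in> {..<m} \<rightarrow>\<^sub>E {0..1}" using t
      by (auto simp: std_simplex_def space_lborel_power PiE_def Pi_def)
  qed
  moreover have "{..<m} \<rightarrow>\<^sub>E {0..1} \<in> sets (lborel_power m)"
    unfolding lborel_power_def by (rule sets_PiM_I_finite) auto
  ultimately have "emeasure (lborel_power m) (std_simplex m) \<le> emeasure (lborel_power m) ({..<m} \<rightarrow>\<^sub>E {0..1})"
    by (intro emeasure_mono)
  also have "\<dots> = (\<Prod>j<m. emeasure lborel {0..1::real})"
    unfolding lborel_power_def by (rule lborel_power.emeasure_PiM) auto
  finally show ?thesis by simp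
qed

lemma simplex_chart_in:
  assumes ws: "ws \<noteq> []" "set ws \<subseteq> S" and S: "convex S" and t: "t \<in> std_simplex (length ws - 1)"
  shows "simplex_chart ws t \<in> S"
proof -
  let ?m = "length ws - 1"
  define u where "u i = (if i = 0 then 1 - (\<Sum>j<?m. t j) else t (i - 1))" for i
  have len: "length ws = Suc ?m" using ws(1) by (cases ws) auto
  have "(\<Sum>i<Suc ?m. u i *\<^sub>R ws ! i) \<in> S"
  proof (rule convex_sum[OF _ S])
    show "(\<Sum>i<Suc ?m. u i) = 1"
      by (subst sum.lessThan_Suc_shift) (simp add: u_def)
    show "0 \<le> u i" if "i \<in> {..<Suc ?m}" for i using t that by (auto simp: u_def std_simplex_def)
    show "ws ! i \<in> S" if "i \<in> {..<Suc ?m}" for i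
      using ws(2) len that by (metis lessThan_iff nth_mem subsetD)
  qed simp
  also have "(\<Sum>i<Suc ?m. u i *\<^sub>R ws ! i) = simplex_chart ws t"
  proof -
    have "simplex_edges ws ! j = ws ! Suc j - ws ! 0" if "j < ?m" for j
      using that ws(1) by (simp add: simplex_edges_def nth_tl hd_conv_nth)
    then have "simplex_chart ws t = ws ! 0 + (\<Sum>j<?m. t j *\<^sub>R (ws ! Suc j - ws ! 0))"
      using ws(1) by (simp add: simplex_chart_def hd_conv_nth)
    also have "\<dots> = (\<Sum>i<Suc ?m. u i *\<^sub>R ws ! i)"
      by (subst sum.lessThan_Suc_shift)
        (simp add: u_def scaleR_diff_right scaleR_diff_left sum_subtractf flip: scaleR_sum_left)
    finally show ?thesis by simp
  qed
  finally show ?thesis .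
qed

lemma set_simplex_edges:
  assumes "ws \<noteq> []" shows "set (simplex_edges ws) \<subseteq> {u - v |u v. u \<in> set ws \<and> v \<in> set ws}"
  using assms by (cases ws) (auto simp: simplex_edges_def)

lemma simplex_edges_tangent:
  assumes ws: "ws \<noteq> []" "set ws \<subseteq> S" shows "set (simplex_edges ws) \<subseteq> tangent S"
proof
  fix v assume "v \<in> set (simplex_edges ws)"
  then obtain u w where "u \<in> set ws" "w \<in> set ws" "v = u - w"
    using set_simplex_edges[OF ws(1)] by blast
  then show "v \<in> tangent S" using diff_in_tangent[of u S w] ws(2) by blast
qed

lemma measurable_simplex_chart:
  fixes ws :: "'a::euclidean_space list"
  shows "simplex_chart ws \<in> borel_measurable (lborel_power (length ws - 1))"
  unfolding simplex_chart_def
  by (intro borel_measurable_add borel_measurable_const borel_measurable_sum borel_measurable_scaleR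
      measurable_lborel_power_coordinate) auto

text \<open>The regularity shared by the pulled-back reference forms and the monomial forms. A
  continuous representative on the whole space makes the composition with
  \<open>simplex_chart\<close> measurable at once; compactness of S then bounds it.\<close>

definition cont_components :: "'a::euclidean_space set \<Rightarrow> 'a dform \<Rightarrow> bool"
  where "cont_components S \<alpha> \<longleftrightarrow> (\<forall>vs. set vs \<subseteq> tangent S \<longrightarrow>
    (\<exists>g. continuous_on UNIV g \<and> (\<forall>y\<in>S. \<alpha> y vs = g y)))"

definition wedge_term :: "'a dform \<Rightarrow> 'a dform \<Rightarrow> 'a \<Rightarrow> 'a list \<Rightarrow> nat \<Rightarrow> (nat \<Rightarrow> nat) \<Rightarrow> real"
  where "wedge_term \<alpha> \<beta> x vs a \<sigma> = of_int (sign \<sigma>) * \<alpha> x (map (\<lambda>j. vs ! \<sigma> j) [0..<a])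
     * \<beta> x (map (\<lambda>j. vs ! \<sigma> j) [a..<length vs])"

lemma wedge_eq: "wedge \<alpha> \<beta> x vs = (\<Sum>a\<le>length vs.
    (\<Sum>\<sigma> | \<sigma> permutes {..<length vs}. wedge_term \<alpha> \<beta> x vs a \<sigma>) / (fact a * fact (length vs - a)))"
  by (simp add: wedge_def wedge_term_def)

lemma set_map_permutes:
  assumes s: "\<sigma> permutes {..<length vs}" and q: "q \<le> length vs"
  shows "set (map (\<lambda>j. vs ! \<sigma> j) [p..<q]) \<subseteq> set vs"
proof
  fix v assume "v \<in> set (map (\<lambda>j. vs ! \<sigma> j) [p..<q])"
  then obtain j where j: "v = vs ! \<sigma> j" "j \<in> {p..<q}" by auto
  then have "j \<in> {..<length vs}" using q by auto
  then have "\<sigma> j \<in> {..<length vs}" using permutes_in_image[OF s] by blast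
  then show "v \<in> set vs" using j(1) by simp
qed

lemma cont_components_wedge:
  assumes a: "cont_components S \<alpha>" and b: "cont_components S \<beta>" and vs: "set vs \<subseteq> tangent S"
  shows "\<exists>g. continuous_on UNIV g \<and> (\<forall>y\<in>S. wedge \<alpha> (form_trace S \<beta>) y vs = g y)"
proof -
  let ?P = "{\<sigma>. \<sigma> permutes {..<length vs}}"
  have "\<exists>g. continuous_on UNIV g \<and> (\<forall>y\<in>S. wedge_term \<alpha> (form_trace S \<beta>) y vs p \<sigma> = g y)"
    if "\<sigma> permutes {..<length vs}" "p \<le> length vs" for p \<sigma>
  proof -
    let ?v1 = "map (\<lambda>j. vs ! \<sigma> j) [0..<p]" and ?v2 = "map (\<lambda>j. vs ! \<sigma> j) [p..<length vs]"
    have s: "set ?v1 \<subseteq> tangent S" "set ?v2 \<subseteq> tangent S"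
      using set_map_permutes[OF that] set_map_permutes[OF that(1) order_refl] vs by blast+
    obtain g1 g2 where g: "continuous_on UNIV g1" "\<forall>y\<in>S. \<alpha> y ?v1 = g1 y"
      "continuous_on UNIV g2" "\<forall>y\<in>S. \<beta> y ?v2 = g2 y"
      using a b s unfolding cont_components_def by meson
    have "continuous_on UNIV (\<lambda>y. of_int (sign \<sigma>) * g1 y * g2 y)"
      by (intro continuous_intros g)
    moreover have "\<forall>y\<in>S. wedge_term \<alpha> (form_trace S \<beta>) y vs p \<sigma> = of_int (sign \<sigma>) * g1 y * g2 y"
      using g(2,4) s(2) by (simp only: wedge_term_def form_trace_def) simp
    ultimately show ?thesis by blast
  qed
  note ex = this
  define g where "g p \<sigma> = (SOME g. continuous_on UNIV g \<and>
      (\<forall>y\<in>S. wedge_term \<alpha> (form_trace S \<beta>) y vs p \<sigma> = g y))" for p \<sigma>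
  have g: "continuous_on UNIV (g p \<sigma>) \<and> (\<forall>y\<in>S. wedge_term \<alpha> (form_trace S \<beta>) y vs p \<sigma> = g p \<sigma> y)"
    if "\<sigma> permutes {..<length vs}" "p \<le> length vs" for p \<sigma>
    unfolding g_def by (rule someI_ex[OF ex[OF that]])
  have "continuous_on UNIV (\<lambda>y. \<Sum>p\<le>length vs. (\<Sum>\<sigma>\<in>?P. g p \<sigma> y) / (fact p * fact (length vs - p)))"
    by (intro continuous_intros) (use g in auto)
  moreover have "\<forall>y\<in>S. wedge \<alpha> (form_trace S \<beta>) y vs =
      (\<Sum>p\<le>length vs. (\<Sum>\<sigma>\<in>?P. g p \<sigma> y) / (fact p * fact (length vs - p)))"
    unfolding wedge_eq using g by (intro ballI sum.cong refl arg_cong2[where f = "(/)"]) auto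
  ultimately show ?thesis by blast
qed

section \<open>Integrability, linearity and size of the pairing over a simplex\<close>

lemma integrable_form_integrand:
  fixes ws :: "'a::euclidean_space list" and \<alpha> :: "'a dform"
  assumes ws: "ws \<noteq> []" "set ws \<subseteq> S" and S: "convex S" "compact S"
    and g: "continuous_on UNIV g" "\<forall>y\<in>S. \<alpha> y (simplex_edges ws) = g y"
  shows "set_integrable (lborel_power (length ws - 1)) (std_simplex (length ws - 1))
    (\<lambda>t. \<alpha> (simplex_chart ws t) (simplex_edges ws))"
proof -
  let ?m = "length ws - 1"
  have "compact (g ` S)" using S(2) g(1) by (metis compact_continuous_image continuous_on_subset subset_UNIV)
  then obtain B where B: "\<And>y. y \<in> S \<Longrightarrow> \<bar>g y\<bar> \<le> B"
    using compact_imp_bounded by (fastforce simp: bounded_iff)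
  have "set_integrable (lborel_power ?m) (std_simplex ?m) (\<lambda>t. g (simplex_chart ws t))"
    unfolding set_integrable_def
  proof (rule integrableI_bounded_set[where A = "std_simplex ?m" and B = B])
    show "emeasure (lborel_power ?m) (std_simplex ?m) < \<infinity>"
      using emeasure_std_simplex_le[of ?m] by (rule le_less_trans) simp
    have "(\<lambda>t. g (simplex_chart ws t)) \<in> borel_measurable (lborel_power ?m)"
      by (rule measurable_compose[OF measurable_simplex_chart]) (rule borel_measurable_continuous_onI[OF g(1)])
    then show "(\<lambda>t. indicat_real (std_simplex ?m) t *\<^sub>R g (simplex_chart ws t)) \<in> borel_measurable (lborel_power ?m)"
      using sets_std_simplex by (intro borel_measurable_scaleR borel_measurable_indicator)
    show "AE x\<in>std_simplex ?m in lborel_power ?m.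
        norm (indicat_real (std_simplex ?m) x *\<^sub>R g (simplex_chart ws x)) \<le> B"
      using B simplex_chart_in[OF ws S(1)] by (auto intro!: AE_I2)
  qed (auto simp: sets_std_simplex)
  moreover have "(\<lambda>t. indicat_real (std_simplex ?m) t *\<^sub>R g (simplex_chart ws t)) =
      (\<lambda>t. indicat_real (std_simplex ?m) t *\<^sub>R \<alpha> (simplex_chart ws t) (simplex_edges ws))"
    using g(2) simplex_chart_in[OF ws S(1)] by (auto simp: indicator_def fun_eq_iff)
  ultimately show ?thesis by (simp add: set_integrable_def)
qed

lemma form_integral_cong:
  assumes ws: "ws \<noteq> []" "set ws \<subseteq> S" "convex S"
    and eq: "\<And>y. y \<in> S \<Longrightarrow> \<alpha> y (simplex_edges ws) = \<beta> y (simplex_edges ws)"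
  shows "form_integral ws \<alpha> = form_integral ws \<beta>"
  unfolding form_integral_def Let_def set_lebesgue_integral_def
  using eq simplex_chart_in[OF ws] by (intro Bochner_Integration.integral_cong) (auto simp: indicator_def)

text \<open>Reduces the functional on S to its values on the members of an expansion. The f i need
  not be alternating, which is used for monomial forms: the formula defining \<open>wedge\<close> is
  linear in the second factor anyway.\<close>

lemma form_integral_wedge_sum:
  fixes ws :: "'a::euclidean_space list"
  assumes ws: "ws \<noteq> []" "set ws \<subseteq> S" and S: "convex S" "compact S" and I: "finite I"
    and a: "cont_components S \<alpha>" and f: "\<And>i. i \<in> I \<Longrightarrow> cont_components S (f i)"
    and w: "\<And>y vs. y \<in> S \<Longrightarrow> set vs \<subseteq> tangent S \<Longrightarrow> \<omega> y vs = (\<Sum>i\<in>I. c i * f i y vs)"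
  shows "form_integral ws (wedge \<alpha> (form_trace S \<omega>)) =
    (\<Sum>i\<in>I. c i * form_integral ws (wedge \<alpha> (form_trace S (f i))))"
proof -
  let ?e = "simplex_edges ws" and ?m = "length ws - 1"
  have e: "set ?e \<subseteq> tangent S" by (rule simplex_edges_tangent[OF ws])
  have int: "set_integrable (lborel_power ?m) (std_simplex ?m)
      (\<lambda>t. wedge \<alpha> (form_trace S (f i)) (simplex_chart ws t) ?e)" if "i \<in> I" for i
    using cont_components_wedge[OF a f[OF that] e] integrable_form_integrand[OF ws S] by blast
  have lin: "wedge \<alpha> (form_trace S \<omega>) y ?e = (\<Sum>i\<in>I. c i * wedge \<alpha> (form_trace S (f i)) y ?e)"
    if y: "y \<in> S" for y
  proof -
    have t: "wedge_term \<alpha> (form_trace S \<omega>) y ?e p \<sigma> =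
        (\<Sum>i\<in>I. c i * wedge_term \<alpha> (form_trace S (f i)) y ?e p \<sigma>)"
      if s: "\<sigma> permutes {..<length ?e}" for p \<sigma>
    proof -
      have v: "set (map (\<lambda>j. ?e ! \<sigma> j) [p..<length ?e]) \<subseteq> tangent S"
        using set_map_permutes[OF s order_refl] e by blast
      show ?thesis using y v w[OF y v]
        by (simp only: wedge_term_def form_trace_def) (simp add: sum_distrib_left ac_simps)
    qed
    have "wedge \<alpha> (form_trace S \<omega>) y ?e = (\<Sum>p\<le>length ?e. \<Sum>i\<in>I. c i *
        ((\<Sum>\<sigma> | \<sigma> permutes {..<length ?e}. wedge_term \<alpha> (form_trace S (f i)) y ?e p \<sigma>) /
          (fact p * fact (length ?e - p))))"
      unfolding wedge_eq
    proof (rule sum.cong[OF refl])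
      fix p
      have "(\<Sum>\<sigma> | \<sigma> permutes {..<length ?e}. wedge_term \<alpha> (form_trace S \<omega>) y ?e p \<sigma>) =
          (\<Sum>\<sigma> | \<sigma> permutes {..<length ?e}. \<Sum>i\<in>I. c i * wedge_term \<alpha> (form_trace S (f i)) y ?e p \<sigma>)"
        using t by (intro sum.cong) auto
      also have "\<dots> = (\<Sum>i\<in>I. c i * (\<Sum>\<sigma> | \<sigma> permutes {..<length ?e}. wedge_term \<alpha> (form_trace S (f i)) y ?e p \<sigma>))"
        by (subst sum.swap) (simp add: sum_distrib_left)
      finally show "(\<Sum>\<sigma> | \<sigma> permutes {..<length ?e}. wedge_term \<alpha> (form_trace S \<omega>) y ?e p \<sigma>) /
          (fact p * fact (length ?e - p)) = (\<Sum>i\<in>I. c i *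
        ((\<Sum>\<sigma> | \<sigma> permutes {..<length ?e}. wedge_term \<alpha> (form_trace S (f i)) y ?e p \<sigma>) /
          (fact p * fact (length ?e - p))))"
        by (simp only: sum_divide_distrib[where A = I] times_divide_eq_right)
    qed
    also have "\<dots> = (\<Sum>i\<in>I. c i * wedge \<alpha> (form_trace S (f i)) y ?e)"
      unfolding wedge_eq by (subst sum.swap) (simp add: sum_distrib_left)
    finally show ?thesis .
  qed
  have "form_integral ws (wedge \<alpha> (form_trace S \<omega>)) =
      form_integral ws (\<lambda>y vs. \<Sum>i\<in>I. c i * wedge \<alpha> (form_trace S (f i)) y vs)"
    by (rule form_integral_cong[OF ws S(1)]) (rule lin)
  also have "\<dots> = (\<Sum>i\<in>I. c i * form_integral ws (wedge \<alpha> (form_trace S (f i))))"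
    unfolding form_integral_def Let_def set_lebesgue_integral_def
  proof -
    have "(LINT t|lborel_power ?m. indicat_real (std_simplex ?m) t *\<^sub>R
        (\<Sum>i\<in>I. c i * wedge \<alpha> (form_trace S (f i)) (simplex_chart ws t) ?e)) =
      (LINT t|lborel_power ?m. (\<Sum>i\<in>I. c i * (indicat_real (std_simplex ?m) t *\<^sub>R
         wedge \<alpha> (form_trace S (f i)) (simplex_chart ws t) ?e)))"
      by (simp add: sum_distrib_left ac_simps)
    also have "\<dots> = (\<Sum>i\<in>I. (LINT t|lborel_power ?m. c i * (indicat_real (std_simplex ?m) t *\<^sub>R
         wedge \<alpha> (form_trace S (f i)) (simplex_chart ws t) ?e)))"
      by (rule Bochner_Integration.integral_sum)
        (intro integrable_mult_right int[unfolded set_integrable_def])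
    finally show "(LINT t|lborel_power ?m. indicat_real (std_simplex ?m) t *\<^sub>R
        (\<Sum>i\<in>I. c i * wedge \<alpha> (form_trace S (f i)) (simplex_chart ws t) ?e)) =
      (\<Sum>i\<in>I. c i * (LINT t|lborel_power ?m. indicat_real (std_simplex ?m) t *\<^sub>R
         wedge \<alpha> (form_trace S (f i)) (simplex_chart ws t) ?e))" by simp
  qed
  finally show ?thesis .
qed

text \<open>The chart carries the integral to the standard simplex, whose measure is at most 1, and
  only values on edge vectors enter. The size of the simplex therefore does not appear in the bound.
  Dividing by the factorials in \<open>wedge\<close> is estimated by dividing by 1.\<close>

lemma form_integral_wedge_bound:
  fixes ws :: "'a::euclidean_space list"
  assumes ws: "ws \<noteq> []" "set ws \<subseteq> S" and S: "convex S" "compact S"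
    and c: "cont_components S \<alpha>" "cont_components S \<beta>"
    and A: "\<And>y vs. y \<in> S \<Longrightarrow> set vs \<subseteq> set (simplex_edges ws) \<Longrightarrow> \<bar>\<alpha> y vs\<bar> \<le> A"
    and B: "\<And>y vs. y \<in> S \<Longrightarrow> set vs \<subseteq> set (simplex_edges ws) \<Longrightarrow> \<bar>\<beta> y vs\<bar> \<le> B"
    and nn: "0 \<le> A" "0 \<le> B"
  shows "\<bar>form_integral ws (wedge \<alpha> (form_trace S \<beta>))\<bar> \<le> real (length ws) * fact (length ws) * (A * B)"
proof -
  let ?e = "simplex_edges ws" and ?m = "length ws - 1" and ?M = "real (length ws) * fact (length ws) * (A * B)"
  have e: "set ?e \<subseteq> tangent S" by (rule simplex_edges_tangent[OF ws])
  have len: "length ?e = ?m" by (simp add: simplex_edges_def)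
  have bd: "\<bar>wedge \<alpha> (form_trace S \<beta>) y ?e\<bar> \<le> ?M" if y: "y \<in> S" for y
  proof -
    have t: "\<bar>wedge_term \<alpha> (form_trace S \<beta>) y ?e p \<sigma>\<bar> \<le> A * B"
      if s: "\<sigma> permutes {..<length ?e}" and p: "p \<le> length ?e" for p \<sigma>
    proof -
      have v: "set (map (\<lambda>j. ?e ! \<sigma> j) [p..<length ?e]) \<subseteq> set ?e" "set (map (\<lambda>j. ?e ! \<sigma> j) [0..<p]) \<subseteq> set ?e"
        by (rule set_map_permutes[OF s]; use p in simp)+
      have "\<bar>of_int (sign \<sigma>) * x * z\<bar> = \<bar>x\<bar> * \<bar>z\<bar>" for x z :: real
        by (simp add: abs_mult flip: of_int_abs)
      then show ?thesis
        using mult_mono[OF A[OF y v(2)] B[OF y v(1)] nn(1)] y v(1) e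
        by (simp only: wedge_term_def form_trace_def) (simp del: set_map)
    qed
    have "\<bar>wedge \<alpha> (form_trace S \<beta>) y ?e\<bar> \<le> (\<Sum>p\<le>length ?e. fact (length ?e) * (A * B))"
      unfolding wedge_eq
    proof (rule order_trans[OF sum_abs sum_mono])
      fix p assume p: "p \<in> {..length ?e}"
      let ?s = "\<Sum>\<sigma> | \<sigma> permutes {..<length ?e}. wedge_term \<alpha> (form_trace S \<beta>) y ?e p \<sigma>"
      have "\<bar>?s\<bar> \<le> (\<Sum>\<sigma> | \<sigma> permutes {..<length ?e}. A * B)"
        by (rule order_trans[OF sum_abs sum_mono]) (use t p in auto)
      also have "\<dots> = fact (length ?e) * (A * B)" by (simp add: card_permutations)
      finally have s: "\<bar>?s\<bar> \<le> fact (length ?e) * (A * B)" .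
      have "(1::real) \<le> fact p * fact (length ?e - p)"
        using mult_mono[OF fact_ge_1[of p] fact_ge_1[of "length ?e - p"]] by simp
      then have "\<bar>?s\<bar> / (fact p * fact (length ?e - p)) \<le> \<bar>?s\<bar> / 1"
        by (intro divide_left_mono) auto
      then show "\<bar>?s / (fact p * fact (length ?e - p))\<bar> \<le> fact (length ?e) * (A * B)"
        using s by (simp add: abs_divide abs_mult)
    qed
    also have "\<dots> = real (length ws) * fact ?m * (A * B)" using ws(1) len by (cases ws) auto
    also have "\<dots> \<le> ?M"
      using nn by (intro mult_right_mono mult_left_mono fact_mono) auto
    finally show ?thesis .
  qed
  have int: "set_integrable (lborel_power ?m) (std_simplex ?m)
      (\<lambda>t. wedge \<alpha> (form_trace S \<beta>) (simplex_chart ws t) ?e)"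
    using cont_components_wedge[OF c e] integrable_form_integrand[OF ws S] by blast
  have "\<bar>form_integral ws (wedge \<alpha> (form_trace S \<beta>))\<bar> \<le>
      (LINT t|lborel_power ?m. norm (indicat_real (std_simplex ?m) t *\<^sub>R wedge \<alpha> (form_trace S \<beta>) (simplex_chart ws t) ?e))"
    unfolding form_integral_def Let_def set_lebesgue_integral_def real_norm_def[symmetric]
    by (rule integral_norm_bound)
  also have "\<dots> \<le> (LINT t|lborel_power ?m. indicat_real (std_simplex ?m) t * ?M)"
  proof (rule integral_mono)
    show "integrable (lborel_power ?m) (\<lambda>t. norm (indicat_real (std_simplex ?m) t *\<^sub>R wedge \<alpha> (form_trace S \<beta>) (simplex_chart ws t) ?e))"
      by (rule integrable_norm) (use int in \<open>simp add: set_integrable_def\<close>)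
    show "integrable (lborel_power ?m) (\<lambda>t. indicat_real (std_simplex ?m) t * ?M)"
      using emeasure_std_simplex_le[of ?m] sets_std_simplex[of ?m]
      by (intro integrable_mult_left integrable_real_indicator) (auto intro: le_less_trans)
    show "norm (indicat_real (std_simplex ?m) t *\<^sub>R wedge \<alpha> (form_trace S \<beta>) (simplex_chart ws t) ?e) \<le>
        indicat_real (std_simplex ?m) t * ?M" for t
      using bd simplex_chart_in[OF ws S(1)] by (auto simp: indicator_def)
  qed
  also have "\<dots> = measure (lborel_power ?m) (std_simplex ?m) * ?M"
    using sets_std_simplex[of ?m] sets.sets_into_space[OF sets_std_simplex[of ?m]] by (simp add: Int_absorb2)
  also have "\<dots> \<le> 1 * ?M"
  proof (rule mult_right_mono)
    show "measure (lborel_power ?m) (std_simplex ?m) \<le> 1"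
      using emeasure_std_simplex_le[of ?m] unfolding measure_def
      by (metis enn2real_leI ennreal_1 zero_le_one)
  qed (use nn in simp)
  finally show ?thesis by simp
qed

section \<open>The dual form on a facet\<close>

text \<open>The patch is a copy of F shrunk by the factor s: its points have coordinates off j + s *
  t j with t in the standard simplex, and the conditions on \<open>off\<close> keep it inside F.
  With s = 1 and off = 0 it is F itself. The functionals \<open>l i\<close> are barycentric
  coordinates on F but live on the whole space, so that the same formulas extend to simplices over
  F.\<close>

locale facet_patch =
  fixes ws :: "'a::euclidean_space list" and d :: nat and l :: "nat \<Rightarrow> 'a \<Rightarrow> real"
    and s :: real and off :: "nat \<Rightarrow> real"
  assumes length_ws: "length ws = Suc d"
    and l_linear: "\<And>i. i < d \<Longrightarrow> linear (l i)"
    and l_edges: "\<And>i j. i < d \<Longrightarrow> j < d \<Longrightarrow> l i (simplex_edges ws ! j) = (if i = j then 1 else 0)"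
    and s_pos: "0 < s"
    and off_nonneg: "\<And>j. j < d \<Longrightarrow> 0 \<le> off j"
    and off_sum: "(\<Sum>j<d. off j) \<le> 1 - s"
begin

abbreviation "F \<equiv> convex hull (set ws)"

definition lam :: "nat \<Rightarrow> 'a \<Rightarrow> real"
  where "lam j x = (l j (x - hd ws) - off j) / s"

lemma ws_nonempty: "ws \<noteq> []"
  using length_ws by auto

lemma length_edges: "length (simplex_edges ws) = d"
  by (simp add: simplex_edges_def length_ws)

lemma set_ws_F: "set ws \<subseteq> F"
  by (rule hull_subset)

lemma tangent_F: "tangent F = span (set (simplex_edges ws))"
proof (rule antisym)
  let ?W = "span (set (simplex_edges ws))"
  have hd: "hd ws \<in> F" using set_ws_F ws_nonempty by (metis hd_in_set subsetD)
  have "F \<subseteq> (+) (hd ws) ` ?W"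
  proof (rule hull_minimal)
    show "set ws \<subseteq> (+) (hd ws) ` ?W"
    proof
      fix w assume w: "w \<in> set ws"
      have "w - hd ws \<in> ?W"
      proof (cases "w = hd ws")
        case True
        then show ?thesis by (simp add: span_zero)
      next
        case False
        then have "w \<in> set (tl ws)" using w ws_nonempty by (cases ws) auto
        then show ?thesis by (intro span_base) (auto simp: simplex_edges_def)
      qed
      then show "w \<in> (+) (hd ws) ` ?W" by (metis add.commute diff_add_cancel image_eqI)
    qed
    show "convex ((+) (hd ws) ` ?W)" by (intro convex_translation subspace_imp_convex subspace_span)
  qed
  note sub = this
  have "x - hd ws \<in> ?W" if x: "x \<in> F" for x
  proof -
    obtain w where "w \<in> ?W" "x = hd ws + w" using subsetD[OF sub x] by (rule imageE)
    then show ?thesis by simp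
  qed
  then show "tangent F \<subseteq> ?W"
    unfolding tangent_eq_span[OF hd] by (intro span_minimal[OF _ subspace_span] image_subsetI)
  show "?W \<subseteq> tangent F"
    by (intro span_minimal subspace_tangent simplex_edges_tangent ws_nonempty set_ws_F)
qed

lemma tangent_expand:
  assumes "u \<in> tangent F" shows "u = (\<Sum>i<d. l i u *\<^sub>R (simplex_edges ws ! i))"
proof -
  let ?p = "\<lambda>u. \<Sum>i<d. l i u *\<^sub>R (simplex_edges ws ! i)"
  have "linear ?p"
  proof (rule linearI)
    show "?p (x + y) = ?p x + ?p y" for x y
      using l_linear by (simp add: linear_add scaleR_add_left sum.distrib)
    show "?p (c *\<^sub>R x) = c *\<^sub>R ?p x" for c x
      using l_linear by (simp add: linear_scale scaleR_sum_right)
  qed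
  moreover have "id e = ?p e" if e: "e \<in> set (simplex_edges ws)" for e
  proof -
    obtain j where j: "j < d" "e = simplex_edges ws ! j"
      using e unfolding in_set_conv_nth length_edges by blast
    have "?p e = (\<Sum>i<d. if i = j then simplex_edges ws ! j else 0)"
    proof (rule sum.cong[OF refl])
      fix i assume "i \<in> {..<d}"
      then show "l i e *\<^sub>R simplex_edges ws ! i = (if i = j then simplex_edges ws ! j else 0)"
        unfolding j(2) using l_edges[OF _ j(1), of i] by simp
    qed
    also have "\<dots> = e" using j by simp
    finally show ?thesis by simp
  qed
  ultimately have "id u = ?p u"
    using assms tangent_F by (intro linear_eq_on_span[of id ?p "set (simplex_edges ws)" u] linear_id) auto
  then show ?thesis by simp
qed

lemma F_expand:
  assumes "x \<in> F" shows "x = hd ws + (\<Sum>i<d. off i *\<^sub>R (simplex_edges ws ! i))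
    + (\<Sum>i<d. lam i x *\<^sub>R (s *\<^sub>R (simplex_edges ws ! i)))"
proof -
  have "hd ws \<in> F" using set_ws_F ws_nonempty by (metis hd_in_set subsetD)
  then have "x - hd ws = (\<Sum>i<d. l i (x - hd ws) *\<^sub>R (simplex_edges ws ! i))"
    using tangent_expand diff_in_tangent assms by blast
  also have "\<dots> = (\<Sum>i<d. (off i + s * lam i x) *\<^sub>R (simplex_edges ws ! i))"
    using s_pos by (simp add: lam_def)
  finally have "x - hd ws = (\<Sum>i<d. (off i + s * lam i x) *\<^sub>R (simplex_edges ws ! i))" .
  then have "x = hd ws + (\<Sum>i<d. (off i + s * lam i x) *\<^sub>R (simplex_edges ws ! i))"
    by (metis add.commute diff_add_cancel)
  then show ?thesis
    by (simp add: scaleR_add_left sum.distrib mult.commute add.assoc)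
qed

lemma lam_chart:
  assumes "j < d" shows "lam j (simplex_chart ws t) = (t j - off j) / s"
proof -
  have "l j (\<Sum>i<d. t i *\<^sub>R (simplex_edges ws ! i)) = (\<Sum>i<d. t i * (if i = j then 1 else 0))"
    using l_edges[OF assms]
    by (subst linear_sum[OF l_linear[OF assms]])
      (auto simp: linear_scale[OF l_linear[OF assms]] intro!: sum.cong)
  also have "\<dots> = (\<Sum>i<d. if i = j then t i else 0)" by (rule sum.cong) auto
  also have "\<dots> = t j" using assms by simp
  finally show ?thesis by (simp add: lam_def simplex_chart_def length_ws)
qed

lemma chart_eq: "simplex_chart ws t = hd ws + (\<Sum>i<d. off i *\<^sub>R (simplex_edges ws ! i))
    + (\<Sum>i<d. ((t i - off i) / s) *\<^sub>R (s *\<^sub>R (simplex_edges ws ! i)))"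
  using s_pos by (simp add: simplex_chart_def length_ws scaleR_diff_left sum_subtractf)

text \<open>A monomial in the patch coordinates times a tensor product of covectors, deliberately
  not antisymmetrised. The functional is applied to such multilinear forms one by one; only their
  sum over \<tau> needs to reproduce an alternating form.\<close>

definition monomial_form :: "nat \<Rightarrow> nat \<Rightarrow> (nat \<Rightarrow> nat) \<Rightarrow> (nat \<Rightarrow> nat) \<Rightarrow> 'a dform"
  where "monomial_form a k \<tau> \<beta> y us = (if length us = k
    then (\<Prod>j<d. lam j y ^ \<beta> j) * prod_list (map2 (\<lambda>i v. l i v / s) (map \<tau> [a..<d]) us) else 0)"

definition bump_coef :: "(nat \<Rightarrow> real \<Rightarrow> real) \<Rightarrow> nat \<Rightarrow> ((nat \<Rightarrow> nat) \<Rightarrow> (nat \<Rightarrow> nat) \<Rightarrow> real)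
    \<Rightarrow> 'a \<Rightarrow> (nat \<Rightarrow> nat) \<Rightarrow> real"
  where "bump_coef \<kappa> r c x \<tau> = (\<Sum>\<beta>\<in>{..<d} \<rightarrow>\<^sub>E {..r}. c \<tau> \<beta> * (\<Prod>j<d. \<kappa> (\<beta> j) (lam j x)))"

definition facet_form :: "nat \<Rightarrow> (nat \<Rightarrow> real \<Rightarrow> real) \<Rightarrow> nat
    \<Rightarrow> ((nat \<Rightarrow> nat) \<Rightarrow> (nat \<Rightarrow> nat) \<Rightarrow> real) \<Rightarrow> 'a dform"
  where "facet_form a \<kappa> r c x vs = (if x \<in> F \<and> set vs \<subseteq> tangent F
    then coef_form d a (bump_coef \<kappa> r c x) (\<lambda>i v. l i v / s) vs else 0)"

lemma kernel_integral:
  assumes sm: "\<And>i. smooth_fun (\<kappa> i)" and supp: "\<And>i x. x \<notin> {lo..hi} \<Longrightarrow> \<kappa> i x = 0"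
    and mom: "\<And>i j. i \<le> r \<Longrightarrow> j \<le> r \<Longrightarrow> (LINT x|lborel. \<kappa> i x * x ^ j) = (if i = j then 1 else 0)"
    and ij: "i \<le> r" "j \<le> r"
  shows "integrable lborel (\<lambda>x. \<kappa> i ((x - p) / s) * ((x - p) / s) ^ j)" (is ?A)
    "(LINT x|lborel. \<kappa> i ((x - p) / s) * ((x - p) / s) ^ j) = (if i = j then s else 0)" (is ?B)
proof -
  let ?f = "\<lambda>x. \<kappa> i ((x - p) / s) * ((x - p) / s) ^ j"
  have "continuous_on UNIV (\<kappa> i)" by (rule smooth_fun_continuous_on[OF sm])
  then have "continuous_on UNIV (\<lambda>x. \<kappa> i ((x - p) / s))"
    by (rule continuous_on_compose2) (use s_pos in \<open>auto intro!: continuous_intros\<close>)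
  then have "continuous_on UNIV ?f" using s_pos by (intro continuous_intros) auto
  moreover have "?f x = 0" if "x \<notin> {p + s * lo..p + s * hi}" for x
  proof -
    have "(x - p) / s \<notin> {lo..hi}" using that s_pos by (auto simp: field_simps)
    then show ?thesis using supp by simp
  qed
  ultimately show ?A by (rule integrable_continuous_compact_support(1))
  have "(LINT x|lborel. ?f x) = \<bar>s\<bar> *\<^sub>R (LINT x|lborel. ?f (p + s * x))"
    by (rule lborel_integral_real_affine) (use s_pos in simp)
  also have "\<dots> = s * (if i = j then 1 else 0)"
    using s_pos mom[OF ij] by simp
  finally show ?B by simp
qed

lemma cont_components_monomial_form:
  assumes a: "a \<le> d" shows "cont_components S (monomial_form a k \<tau> \<beta>)"
  unfolding cont_components_def
proof (intro allI impI)
  fix us :: "'a list"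
  let ?g = "\<lambda>y. if length us = k then (\<Prod>j<d. lam j y ^ \<beta> j) *
      prod_list (map2 (\<lambda>i v. l i v / s) (map \<tau> [a..<d]) us) else 0"
  have "continuous_on UNIV (lam j)" if "j < d" for j
    unfolding lam_def using l_linear[OF that] s_pos
    by (intro continuous_intros linear_continuous_on_compose[of _ _ "l j"]) auto
  then have "continuous_on UNIV ?g" by (cases "length us = k") (auto intro!: continuous_intros)
  moreover have "\<forall>y\<in>S. monomial_form a k \<tau> \<beta> y us = ?g y" by (simp add: monomial_form_def)
  ultimately show "\<exists>g. continuous_on UNIV g \<and> (\<forall>y\<in>S. monomial_form a k \<tau> \<beta> y us = g y)" by blast
qed

text \<open>Let \<open>co\<close> be the coefficients of the components of \<omega> on complementary
  edges, as polynomials in the patch coordinates. Both sides equal s^k / a! times the sum of all c *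
  co. On the left \<open>wedge_coef_form\<close> isolates these components with the factor (1/s)^a /
  a!, and duality of the kernels matches the exponents with a factor s for each of the d = a + k
  coordinates. On the right \<omega> is expanded into monomial forms, where rescaling the k
  covectors gives s^k and counting permutations gives 1 / a!.\<close>

lemma facet_form_pairing:
  fixes c :: "(nat \<Rightarrow> nat) \<Rightarrow> (nat \<Rightarrow> nat) \<Rightarrow> real"
  assumes sm: "\<And>i. smooth_fun (\<kappa> i)" and supp: "\<And>i x. x \<notin> {lo..hi} \<Longrightarrow> \<kappa> i x = 0"
    and mom: "\<And>i j. i \<le> r \<Longrightarrow> j \<le> r \<Longrightarrow> (LINT x|lborel. \<kappa> i x * x ^ j) = (if i = j then 1 else 0)"
    and lo: "0 \<le> lo" and hi: "real d * hi \<le> 1"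
    and d: "d = a + k" and w: "\<omega> \<in> poly_forms (int r) (int k)"
    and S: "convex S" "compact S" "S \<subseteq> F" and wsS: "wsS \<noteq> []" "set wsS \<subseteq> S"
    and \<alpha>: "cont_components S \<alpha>"
    and c: "\<And>\<tau> \<beta>. c \<tau> \<beta> = form_integral wsS (wedge \<alpha> (form_trace S (monomial_form a k \<tau> \<beta>)))"
  shows "form_integral ws (wedge (facet_form a \<kappa> r c) (form_trace F \<omega>)) =
    form_integral wsS (wedge \<alpha> (form_trace S \<omega>))"
proof -
  let ?E = "\<lambda>j. simplex_edges ws ! j" and ?P = "{\<tau>. \<tau> permutes {..<d}}" and ?X = "{..<d} \<rightarrow>\<^sub>E {..r}"
  let ?l = "\<lambda>i v. l i v / s"
  have fP: "finite ?P" by (rule finite_permutations) simp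
  have fX: "finite ?X" by (rule finite_exponents)
  have edges: "simplex_edges ws = map ?E [0..<d]"
    using length_edges by (metis map_nth)
  have E_tan: "?E j \<in> tangent F" if "j < d" for j
    using simplex_edges_tangent[OF ws_nonempty set_ws_F] that length_edges by (metis nth_mem subsetD)
  have E_tau: "set (map (?E \<circ> \<tau>) [a..<d]) \<subseteq> tangent F" if t: "\<tau> permutes {..<d}" for \<tau>
  proof
    fix v assume "v \<in> set (map (?E \<circ> \<tau>) [a..<d])"
    then obtain j where j: "v = ?E (\<tau> j)" "j \<in> {a..<d}" by auto
    then have "j \<in> {..<d}" by auto
    then have "\<tau> j \<in> {..<d}" using permutes_in_image[OF t] by blast
    then show "v \<in> tangent F" using E_tan j(1) by simp
  qed
  \<comment> \<open>\<open>?p\<close> is the vertex of the patch that corresponds to hd ws, and s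
    times the edges of F are the edges of the patch; so \<open>co\<close> refers to the patch
    coordinates.\<close>
  let ?p = "hd ws + (\<Sum>i<d. off i *\<^sub>R ?E i)"
  have "\<exists>co. \<forall>t. \<omega> (?p + (\<Sum>i<d. t i *\<^sub>R (s *\<^sub>R ?E i))) (map (?E \<circ> \<tau>) [a..<d]) =
      (\<Sum>\<beta>\<in>?X. co \<beta> * (\<Prod>j<d. t j ^ \<beta> j))" for \<tau>
    using poly_fun_chart[OF poly_formsD(2)[OF w], where d = d and p = ?p and e = "\<lambda>i. s *\<^sub>R ?E i"]
    unfolding monomial_sum_def by blast
  then obtain co where co: "\<And>\<tau> t. \<omega> (?p + (\<Sum>i<d. t i *\<^sub>R (s *\<^sub>R ?E i))) (map (?E \<circ> \<tau>) [a..<d]) =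
      (\<Sum>\<beta>\<in>?X. co \<tau> \<beta> * (\<Prod>j<d. t j ^ \<beta> j))" by metis
  define T where "T = (\<Sum>\<tau>\<in>?P. \<Sum>\<beta>\<in>?X. c \<tau> \<beta> * co \<tau> \<beta>)"
  have alt: "(\<lambda>vs. form_trace F \<omega> x vs) \<in> alt_forms (int k) (tangent F)" if "x \<in> F" for x
  proof (rule alt_formsI)
    note f = poly_formsD(1)[OF w, of x]
    show "int (length vs) = int k \<and> set vs \<subseteq> tangent F" if "form_trace F \<omega> x vs \<noteq> 0" for vs
      using alt_forms_supp[OF f, of vs] that by (auto simp: form_trace_def split: if_splits)
    show "form_trace F \<omega> x (us @ (p *\<^sub>R u + q *\<^sub>R v) # vs) =
        p * form_trace F \<omega> x (us @ u # vs) + q * form_trace F \<omega> x (us @ v # vs)"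
      if "set us \<subseteq> tangent F" "set vs \<subseteq> tangent F" "u \<in> tangent F" "v \<in> tangent F" for us vs u v p q
    proof -
      have "p *\<^sub>R u + q *\<^sub>R v \<in> tangent F"
        using that subspace_tangent subspace_add subspace_scale by blast
      then show ?thesis using that \<open>x \<in> F\<close> alt_forms_linear[OF f, of us vs u v p q]
        by (simp add: form_trace_def)
    qed
    show "form_trace F \<omega> x vs = 0" if "\<not> distinct vs" for vs
      using alt_forms_not_distinct[OF f that] by (simp add: form_trace_def)
  qed
  have wedge: "wedge (facet_form a \<kappa> r c) (form_trace F \<omega>) x (simplex_edges ws) =
      (1 / s) ^ a / fact a * (\<Sum>\<tau>\<in>?P. bump_coef \<kappa> r c x \<tau> * \<omega> x (map (?E \<circ> \<tau>) [a..<d]))"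
    if x: "x \<in> F" for x
  proof -
    have "wedge (facet_form a \<kappa> r c) (form_trace F \<omega>) x (map ?E [0..<d]) =
      (1 / s) ^ a / fact a * (\<Sum>\<tau>\<in>?P. bump_coef \<kappa> r c x \<tau> * form_trace F \<omega> x (map (?E \<circ> \<tau>) [a..<d]))"
    proof (rule wedge_coef_form[OF d alt[OF x] subspace_tangent E_tan])
      show "l i (?E j) / s = (if i = j then 1 / s else 0)" if "i < d" "j < d" for i j
        using l_edges[OF that] by simp
    qed (use x in \<open>auto simp: facet_form_def\<close>)
    moreover have "(\<Sum>\<tau>\<in>?P. bump_coef \<kappa> r c x \<tau> * form_trace F \<omega> x (map (?E \<circ> \<tau>) [a..<d])) =
        (\<Sum>\<tau>\<in>?P. bump_coef \<kappa> r c x \<tau> * \<omega> x (map (?E \<circ> \<tau>) [a..<d]))"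
      by (intro sum.cong refl arg_cong2[where f = "(*)"]) (use E_tau x in \<open>simp add: form_trace_def\<close>)
    ultimately show ?thesis unfolding edges[symmetric] by (simp only:)
  qed
  let ?K = "\<lambda>\<beta> \<gamma> t. \<Prod>j<d. \<kappa> (\<beta> j) ((t j - off j) / s) * ((t j - off j) / s) ^ \<gamma> j"
  \<comment> \<open>The kernels live in [lo, hi] with 0 \<le> lo and d * hi \<le> 1. The product
    thus vanishes outside the standard simplex, and the integral may be taken over the whole space,
    where it factors.\<close>
  have K0: "?K \<beta> \<gamma> t = 0" if t: "t \<in> space (lborel_power d)" "t \<notin> std_simplex d" for \<beta> \<gamma> :: "nat \<Rightarrow> nat" and t
  proof (rule ccontr)
    assume "?K \<beta> \<gamma> t \<noteq> 0"
    then have "\<kappa> (\<beta> j) ((t j - off j) / s) \<noteq> 0" if "j < d" for j using that by auto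
    then have in_int: "(t j - off j) / s \<in> {lo..hi}" if "j < d" for j using supp that by blast
    have t2: "off j + s * lo \<le> t j \<and> t j \<le> off j + s * hi" if "j < d" for j
      using in_int[OF that] s_pos by (auto simp: field_simps)
    have "0 \<le> t j" if "j < d" for j
      using t2[OF that] off_nonneg[OF that] s_pos lo by (smt (verit) mult_nonneg_nonneg)
    moreover have "(\<Sum>j<d. t j) \<le> (\<Sum>j<d. off j + s * hi)" using t2 by (intro sum_mono) auto
    moreover have "(\<Sum>j<d. off j + s * hi) = (\<Sum>j<d. off j) + s * (real d * hi)"
      by (simp add: sum.distrib)
    moreover have "s * (real d * hi) \<le> s * 1" using hi s_pos by (intro mult_left_mono) auto
    ultimately have "t \<in> std_simplex d" using t(1) off_sum by (auto simp: std_simplex_def)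
    then show False using t(2) by simp
  qed
  have Kint: "integrable (lborel_power d) (?K \<beta> \<gamma>)"
    "(LINT t|lborel_power d. ?K \<beta> \<gamma> t) = (if \<beta> = \<gamma> then s ^ d else 0)"
    if bg: "\<beta> \<in> ?X" "\<gamma> \<in> ?X" for \<beta> \<gamma>
  proof -
    have le: "\<beta> j \<le> r" "\<gamma> j \<le> r" if "j \<in> {..<d}" for j using bg that by (auto simp: PiE_def Pi_def)
    note ki = kernel_integral[where \<kappa> = \<kappa>, OF sm supp mom]
    show "integrable (lborel_power d) (?K \<beta> \<gamma>)"
      unfolding lborel_power_def
      by (rule lborel_power.product_integrable_prod) (use ki(1) le in auto)
    have "(LINT t|lborel_power d. ?K \<beta> \<gamma> t) =
        (\<Prod>j<d. LINT x|lborel. \<kappa> (\<beta> j) ((x - off j) / s) * ((x - off j) / s) ^ \<gamma> j)"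
      unfolding lborel_power_def
      by (rule lborel_power.product_integral_prod) (use ki(1) le in auto)
    also have "\<dots> = (\<Prod>j<d. if \<beta> j = \<gamma> j then s else 0)"
      by (rule prod.cong[OF refl]) (use ki(2) le in auto)
    also have "\<dots> = (if \<beta> = \<gamma> then s ^ d else 0)"
    proof (cases "\<beta> = \<gamma>")
      case False
      then obtain j where "\<beta> j \<noteq> \<gamma> j" by blast
      moreover have "j < d" using bg calculation by (metis PiE_arb lessThan_iff)
      ultimately have "(\<Prod>j<d. if \<beta> j = \<gamma> j then s else 0) = 0" by (intro prod_zero) auto
      then show ?thesis using False by simp
    qed simp
    finally show "(LINT t|lborel_power d. ?K \<beta> \<gamma> t) = (if \<beta> = \<gamma> then s ^ d else 0)" .
  qed
  let ?C = "(1 / s) ^ a / fact a"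
  have integrand: "indicat_real (std_simplex d) t *\<^sub>R
      wedge (facet_form a \<kappa> r c) (form_trace F \<omega>) (simplex_chart ws t) (simplex_edges ws) =
      (\<Sum>\<tau>\<in>?P. \<Sum>\<beta>\<in>?X. \<Sum>\<gamma>\<in>?X. ?C * (c \<tau> \<beta> * co \<tau> \<gamma>) * ?K \<beta> \<gamma> t)" (is "?lhs = ?rhs")
    if t: "t \<in> space (lborel_power d)" for t
  proof (cases "t \<in> std_simplex d")
    case False
    have "?rhs = 0"
      by (intro sum.neutral ballI) (simp only: K0[OF t False] mult_zero_right)
    moreover have "indicat_real (std_simplex d) t = 0" using False by simp
    ultimately show ?thesis by (simp only: scaleR_zero_left)
  next
    case True
    let ?x = "simplex_chart ws t" and ?t = "\<lambda>j. (t j - off j) / s"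
    have x: "?x \<in> F"
      by (rule simplex_chart_in) (use ws_nonempty set_ws_F length_ws True in auto)
    have "bump_coef \<kappa> r c ?x \<tau> * \<omega> ?x (map (?E \<circ> \<tau>) [a..<d]) =
        (\<Sum>\<beta>\<in>?X. \<Sum>\<gamma>\<in>?X. (c \<tau> \<beta> * co \<tau> \<gamma>) * ?K \<beta> \<gamma> t)" for \<tau>
    proof -
      have "\<omega> ?x (map (?E \<circ> \<tau>) [a..<d]) = (\<Sum>\<gamma>\<in>?X. co \<tau> \<gamma> * (\<Prod>j<d. ?t j ^ \<gamma> j))"
        unfolding chart_eq using co[of ?t \<tau>] .
      moreover have "bump_coef \<kappa> r c ?x \<tau> = (\<Sum>\<beta>\<in>?X. c \<tau> \<beta> * (\<Prod>j<d. \<kappa> (\<beta> j) (?t j)))"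
        unfolding bump_coef_def using lam_chart by (intro sum.cong refl arg_cong2[where f = "(*)"] prod.cong) auto
      ultimately show ?thesis
        by (simp add: sum_product prod.distrib ac_simps)
    qed
    then show ?thesis using True wedge[OF x] by (simp add: sum_distrib_left mult.assoc)
  qed
  have "form_integral ws (wedge (facet_form a \<kappa> r c) (form_trace F \<omega>)) =
      (LINT t|lborel_power d. (\<Sum>\<tau>\<in>?P. \<Sum>\<beta>\<in>?X. \<Sum>\<gamma>\<in>?X. ?C * (c \<tau> \<beta> * co \<tau> \<gamma>) * ?K \<beta> \<gamma> t))"
    unfolding form_integral_def Let_def set_lebesgue_integral_def
    by (rule Bochner_Integration.integral_cong) (use length_ws integrand in auto)
  also have "\<dots> = (\<Sum>\<tau>\<in>?P. \<Sum>\<beta>\<in>?X. \<Sum>\<gamma>\<in>?X. ?C * (c \<tau> \<beta> * co \<tau> \<gamma>) * (LINT t|lborel_power d. ?K \<beta> \<gamma> t))"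
  proof -
    have i: "integrable (lborel_power d) (\<lambda>t. ?C * (c \<tau> \<beta> * co \<tau> \<gamma>) * ?K \<beta> \<gamma> t)"
      if "\<beta> \<in> ?X" "\<gamma> \<in> ?X" for \<tau> \<beta> \<gamma>
      by (rule integrable_mult_right[OF Kint(1)[OF that]])
    have "(LINT t|lborel_power d. (\<Sum>\<tau>\<in>?P. \<Sum>\<beta>\<in>?X. \<Sum>\<gamma>\<in>?X. ?C * (c \<tau> \<beta> * co \<tau> \<gamma>) * ?K \<beta> \<gamma> t)) =
        (\<Sum>\<tau>\<in>?P. (LINT t|lborel_power d. (\<Sum>\<beta>\<in>?X. \<Sum>\<gamma>\<in>?X. ?C * (c \<tau> \<beta> * co \<tau> \<gamma>) * ?K \<beta> \<gamma> t)))"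
      by (rule Bochner_Integration.integral_sum) (intro Bochner_Integration.integrable_sum i)
    also have "\<dots> = (\<Sum>\<tau>\<in>?P. \<Sum>\<beta>\<in>?X. (LINT t|lborel_power d. (\<Sum>\<gamma>\<in>?X. ?C * (c \<tau> \<beta> * co \<tau> \<gamma>) * ?K \<beta> \<gamma> t)))"
      by (intro sum.cong[OF refl], rule Bochner_Integration.integral_sum) (intro Bochner_Integration.integrable_sum i)
    also have "\<dots> = (\<Sum>\<tau>\<in>?P. \<Sum>\<beta>\<in>?X. \<Sum>\<gamma>\<in>?X. (LINT t|lborel_power d. ?C * (c \<tau> \<beta> * co \<tau> \<gamma>) * ?K \<beta> \<gamma> t))"
      by (intro sum.cong[OF refl], rule Bochner_Integration.integral_sum) (rule i)
    finally show ?thesis by (simp only: integral_mult_right_zero)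
  qed
  \<comment> \<open>Duality of the kernels leaves only the diagonal; s^d is the Jacobian of the
    contraction.\<close>
  also have "\<dots> = (\<Sum>\<tau>\<in>?P. \<Sum>\<beta>\<in>?X. \<Sum>\<gamma>\<in>?X. if \<beta> = \<gamma> then ?C * (c \<tau> \<beta> * co \<tau> \<gamma>) * s ^ d else 0)"
    using Kint(2) by (intro sum.cong refl) simp
  also have "\<dots> = (\<Sum>\<tau>\<in>?P. \<Sum>\<beta>\<in>?X. ?C * (c \<tau> \<beta> * co \<tau> \<beta>) * s ^ d)"
    using fX by (intro sum.cong refl) simp
  also have "\<dots> = ?C * s ^ d * T"
    by (simp add: T_def sum_distrib_left ac_simps)
  also have "?C * s ^ d = s ^ k / fact a"
    using s_pos d by (simp add: power_add field_simps)
  finally have lhs: "form_integral ws (wedge (facet_form a \<kappa> r c) (form_trace F \<omega>)) = s ^ k / fact a * T" .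
  \<comment> \<open>Points and tangent vectors of S are points and tangent vectors of F, so the
    coordinates of F expand \<omega> on S too, whatever the dimension of S.\<close>
  have expand: "\<omega> y us = (\<Sum>(\<tau>, \<beta>)\<in>?P \<times> ?X. (s ^ k / fact a * co \<tau> \<beta>) * monomial_form a k \<tau> \<beta> y us)"
    if y: "y \<in> S" and us: "set us \<subseteq> tangent S" for y us
  proof (cases "length us = k")
    case False
    have "\<omega> y us = 0" using alt_forms_supp[OF poly_formsD(1)[OF w], of y us] False by auto
    then show ?thesis using False by (simp add: monomial_form_def)
  next
    case True
    have yF: "y \<in> F" and usF: "set us \<subseteq> tangent F" using y us S(3) tangent_mono[OF S(3)] by auto
    have "fact a * form_trace F \<omega> y us = (\<Sum>\<tau>\<in>?P.
        prod_list (map2 l (map \<tau> [a..<d]) us) * form_trace F \<omega> y (map (?E \<circ> \<tau>) [a..<d]))"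
      by (rule alt_forms_expand_permutes[OF alt[OF yF] subspace_tangent E_tan tangent_expand usF])
        (use True d in auto)
    also have "\<dots> = (\<Sum>\<tau>\<in>?P. \<Sum>\<beta>\<in>?X. (s ^ k * co \<tau> \<beta>) * monomial_form a k \<tau> \<beta> y us)"
    proof (rule sum.cong[OF refl])
      fix \<tau> assume tau: "\<tau> \<in> ?P"
      have "form_trace F \<omega> y (map (?E \<circ> \<tau>) [a..<d]) = (\<Sum>\<beta>\<in>?X. co \<tau> \<beta> * (\<Prod>j<d. lam j y ^ \<beta> j))"
        using E_tau[of \<tau>] tau yF co[of "\<lambda>i. lam i y" \<tau>] F_expand[OF yF] by (simp add: form_trace_def)
      moreover have "prod_list (map2 l J vs) = s ^ length vs * prod_list (map2 ?l J vs)"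
        if "length J = length vs" for J and vs :: "'a list"
        using that s_pos by (induction J vs rule: list_induct2) (auto simp: field_simps)
      then have "prod_list (map2 l (map \<tau> [a..<d]) us) = s ^ k * prod_list (map2 ?l (map \<tau> [a..<d]) us)"
        using True d by simp
      ultimately show "prod_list (map2 l (map \<tau> [a..<d]) us) * form_trace F \<omega> y (map (?E \<circ> \<tau>) [a..<d]) =
          (\<Sum>\<beta>\<in>?X. (s ^ k * co \<tau> \<beta>) * monomial_form a k \<tau> \<beta> y us)"
        using True by (simp add: monomial_form_def sum_distrib_left ac_simps)
    qed
    finally have "fact a * \<omega> y us = (\<Sum>\<tau>\<in>?P. \<Sum>\<beta>\<in>?X. (s ^ k * co \<tau> \<beta>) * monomial_form a k \<tau> \<beta> y us)"
      using yF usF by (simp add: form_trace_def)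
    then have "\<omega> y us = (\<Sum>\<tau>\<in>?P. \<Sum>\<beta>\<in>?X. (s ^ k * co \<tau> \<beta>) * monomial_form a k \<tau> \<beta> y us) / fact a"
      by (simp add: field_simps)
    then show ?thesis
      by (simp add: sum.cartesian_product[symmetric] sum_divide_distrib)
  qed
  have "form_integral wsS (wedge \<alpha> (form_trace S \<omega>)) = (\<Sum>i\<in>?P \<times> ?X. (s ^ k / fact a * co (fst i) (snd i)) *
      form_integral wsS (wedge \<alpha> (form_trace S (monomial_form a k (fst i) (snd i)))))"
    by (rule form_integral_wedge_sum[OF wsS S(1,2) _ \<alpha>])
      (use fP fX d expand cont_components_monomial_form in \<open>auto simp: case_prod_beta\<close>)
  also have "\<dots> = (\<Sum>(\<tau>, \<beta>)\<in>?P \<times> ?X. s ^ k / fact a * (c \<tau> \<beta> * co \<tau> \<beta>))"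
    by (rule sum.cong[OF refl]) (simp only: c[symmetric] case_prod_beta ac_simps)
  also have "\<dots> = s ^ k / fact a * T"
    unfolding T_def by (simp add: sum.cartesian_product[symmetric] sum_distrib_left)
  finally show ?thesis using lhs by simp
qed

end

section \<open>Norm bounds\<close>

lemma alt_norm_nonneg: "0 \<le> alt_norm l f"
  unfolding alt_norm_def by (intro real_sqrt_ge_zero divide_nonneg_nonneg sum_nonneg) auto

text \<open>At most n^n basis lists contribute, with n = \<open>DIM('a)\<close>, and the square root
  of this count is estimated by the count itself. The factor is the same for all degrees l.\<close>

lemma alt_norm_le:
  fixes f :: "'a::euclidean_space list \<Rightarrow> real"
  assumes B: "\<And>vs. int (length vs) = l \<Longrightarrow> set vs \<subseteq> Basis \<Longrightarrow> \<bar>f vs\<bar> \<le> B" and nn: "0 \<le> B"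
    and l: "l \<le> int DIM('a)"
  shows "alt_norm l f \<le> real (DIM('a) ^ DIM('a)) * B"
proof -
  let ?L = "{vs :: 'a list. int (length vs) = l \<and> set vs \<subseteq> Basis}" and ?K = "DIM('a) ^ DIM('a)"
  have "card ?L \<le> card {vs :: 'a list. set vs \<subseteq> Basis \<and> length vs = nat l}"
    by (rule card_mono) (auto simp: finite_lists_length_eq)
  also have "\<dots> = DIM('a) ^ nat l" by (simp add: card_lists_length_eq)
  also have "\<dots> \<le> ?K" using l by (intro power_increasing) auto
  finally have card: "card ?L \<le> ?K" .
  have "(\<Sum>vs\<in>?L. (f vs)\<^sup>2) \<le> (\<Sum>vs\<in>?L. B\<^sup>2)"
  proof (rule sum_mono)
    fix vs assume "vs \<in> ?L"
    then have "\<bar>f vs\<bar> \<le> \<bar>B\<bar>" using B nn by auto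
    then show "(f vs)\<^sup>2 \<le> B\<^sup>2" by (simp only: abs_le_square_iff)
  qed
  also have "\<dots> \<le> real ?K * B\<^sup>2" using card by (simp add: mult_right_mono del: of_nat_power)
  finally have s: "(\<Sum>vs\<in>?L. (f vs)\<^sup>2) \<le> real ?K * B\<^sup>2" .
  have "(\<Sum>vs\<in>?L. (f vs)\<^sup>2) / fact (nat l) \<le> (\<Sum>vs\<in>?L. (f vs)\<^sup>2) / 1"
    by (intro divide_left_mono sum_nonneg) (auto simp: fact_ge_1)
  also have "\<dots> \<le> real ?K * B\<^sup>2" using s by simp
  also have "\<dots> \<le> (real ?K * B)\<^sup>2"
  proof -
    have "1 \<le> real ?K" by (simp add: one_le_power Suc_le_eq)
    then have "real ?K * 1 * B\<^sup>2 \<le> real ?K * real ?K * B\<^sup>2"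
      by (intro mult_right_mono mult_left_mono) auto
    then show ?thesis by (simp only: power2_eq_square ac_simps mult_1_left)
  qed
  finally have "alt_norm l f \<le> sqrt ((real ?K * B)\<^sup>2)" unfolding alt_norm_def by (rule real_sqrt_le_mono)
  then show ?thesis using nn by simp
qed

lemma alt_norm_measurable:
  assumes "\<And>vs. (\<lambda>x. \<Theta> x vs) \<in> borel_measurable M"
  shows "(\<lambda>x. alt_norm l (\<Theta> x)) \<in> borel_measurable M"
  unfolding alt_norm_def using assms by measurable

text \<open>Lebesgue measure is complete, so arbitrary values on a null set preserve measurability.
  This covers \<open>ext_deriv\<close>, whose values on the boundary of T are not
  controlled.\<close>

lemma borel_measurable_lebesgue_on_spike:
  fixes f g :: "'a::euclidean_space \<Rightarrow> real"
  assumes T: "T \<in> sets lebesgue" and N: "negligible N" and g: "g \<in> borel_measurable (lebesgue_on T)"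
    and eq: "\<And>x. x \<in> T - N \<Longrightarrow> f x = g x"
  shows "f \<in> borel_measurable (lebesgue_on T)"
proof (rule measurableI)
  fix A :: "real set" assume A: "A \<in> sets borel"
  have "g -` A \<inter> space (lebesgue_on T) \<in> sets (lebesgue_on T)" using g A by (rule measurable_sets)
  then have "g -` A \<inter> T \<in> sets lebesgue" using T by (simp add: sets_restrict_space_iff space_restrict_space)
  moreover have "N \<in> sets lebesgue" "f -` A \<inter> T \<inter> N \<in> sets lebesgue"
    using N negligible_subset[OF N, of "f -` A \<inter> T \<inter> N"] by (auto intro: negligible_imp_sets)
  ultimately have "(g -` A \<inter> T - N) \<union> (f -` A \<inter> T \<inter> N) \<in> sets lebesgue" by blast
  moreover have "f -` A \<inter> space (lebesgue_on T) = (g -` A \<inter> T - N) \<union> (f -` A \<inter> T \<inter> N)"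
    using eq by (auto simp: space_restrict_space)
  ultimately show "f -` A \<inter> space (lebesgue_on T) \<in> sets (lebesgue_on T)"
    using T by (auto simp: sets_restrict_space_iff)
qed simp

text \<open>Replaces the power 1/p of a volume by a bound uniform in p.\<close>

lemma powr_inverse_le:
  fixes V :: real assumes "0 \<le> V" "1 \<le> q" shows "V powr (1 / q) \<le> 1 + V"
proof (cases "V \<le> 1")
  case True
  then have "V powr (1 / q) \<le> 1" using assms by (intro powr_le1) auto
  then show ?thesis using assms by simp
next
  case False
  then have "V powr (1 / q) \<le> V powr 1" using assms by (intro powr_mono) auto
  then show ?thesis using False by simp
qed

text \<open>A form of size M * h^(-e) concentrated on a ball of radius \<rho> * h. The volume of
  that ball raised to the power 1/p produces the exponent n/p; for p = \<infinity> the pointwise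
  bound is all there is, in accordance with \<open>dim_over\<close>.\<close>

lemma Lp_norm_bound:
  fixes \<Theta> :: "'a::euclidean_space dform"
  assumes X: "X \<in> lmeasurable"
    and meas: "(\<lambda>x. alt_norm l (\<Theta> x)) \<in> borel_measurable (lebesgue_on X)"
    and bd: "AE x in lebesgue_on X. alt_norm l (\<Theta> x) \<le> M * h powr (- e) * indicator (cball z (\<rho> * h)) x"
    and nn: "0 \<le> M" "0 \<le> \<rho>" "0 < h" and p: "1 \<le> p"
  shows "Lp_norm p l X \<Theta> \<le>
    ereal (M * (1 + unit_ball_vol (real DIM('a)) * \<rho> ^ DIM('a)) * h powr (dim_over DIM('a) p - e))"
proof -
  let ?V = "unit_ball_vol (real DIM('a)) * \<rho> ^ DIM('a)" and ?B = "M * h powr (- e)"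
  let ?L = "lebesgue_on X"
  have V: "0 \<le> ?V" using nn by simp
  have B: "0 \<le> ?B" using nn by simp
  have bd': "AE x in ?L. alt_norm l (\<Theta> x) \<le> ?B"
    using bd by (rule AE_mp) (rule AE_I2, use B in \<open>auto simp: indicator_def split: if_splits\<close>)
  show ?thesis
  proof (cases "p = \<infinity>")
    case True
    have "esssup ?L (\<lambda>x. ereal (alt_norm l (\<Theta> x))) \<le> ereal ?B"
      using bd' meas by (intro esssup_I) auto
    also have "\<dots> \<le> ereal (M * (1 + ?V) * h powr (- e))"
    proof -
      have "M * 1 * h powr (- e) \<le> M * (1 + ?V) * h powr (- e)"
        using nn V by (intro mult_right_mono mult_left_mono) auto
      then show ?thesis by simp
    qed
    finally show ?thesis using True by (simp add: Lp_norm_def dim_over_def)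
  next
    case False
    define q where "q = real_of_ereal p"
    have pq: "p = ereal q" using p False by (cases p) (auto simp: q_def)
    have q: "1 \<le> q" using p pq by (simp add: one_ereal_def)
    let ?c = "cball z (\<rho> * h)"
    have Xs: "X \<in> sets lebesgue" using X by (rule fmeasurableD)
    let ?A = "?c \<inter> X"
    have A: "?A \<in> sets ?L" using Xs by (auto simp: sets_restrict_space_iff)
    have "?A \<in> lmeasurable" using X by (intro fmeasurable_Int_fmeasurable) auto
    have mA: "measure ?L ?A \<le> ?V * h ^ DIM('a)"
    proof -
      have "measure ?L ?A = measure lebesgue ?A"
        using Xs by (intro measure_restrict_space) auto
      also have "\<dots> \<le> measure lebesgue ?c"
        by (rule measure_mono_fmeasurable) (use Xs in auto)
      also have "\<dots> = ?V * h ^ DIM('a)"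
        using nn by (simp add: content_cball power_mult_distrib)
      finally show ?thesis .
    qed
    have int_ind: "integrable ?L (\<lambda>x. ?B powr q * indicator ?A x)"
    proof (intro integrable_mult_right integrable_real_indicator A)
      have "emeasure ?L ?A = emeasure lebesgue ?A" using Xs by (intro emeasure_restrict_space) auto
      also have "\<dots> < \<infinity>" using fmeasurableD2[OF \<open>?A \<in> lmeasurable\<close>] by (simp only: less_top infinity_ennreal_def not_False_eq_True)
      finally show "emeasure ?L ?A < \<infinity>" .
    qed
    have le: "AE x in ?L. alt_norm l (\<Theta> x) powr q \<le> ?B powr q * indicator ?A x"
      using bd
    proof (rule AE_mp, intro AE_I2 impI)
      fix x assume x: "x \<in> space ?L" and a: "alt_norm l (\<Theta> x) \<le> M * h powr (- e) * indicator ?c x"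
      show "alt_norm l (\<Theta> x) powr q \<le> ?B powr q * indicator ?A x"
      proof (cases "x \<in> ?c")
        case True
        then show ?thesis using a x powr_mono2[OF _ alt_norm_nonneg, of q l "\<Theta> x" ?B] q
          by (simp add: space_restrict_space indicator_def)
      next
        case False
        then have "alt_norm l (\<Theta> x) = 0" using a alt_norm_nonneg[of l "\<Theta> x"] by simp
        then show ?thesis by simp
      qed
    qed
    have int: "integrable ?L (\<lambda>x. alt_norm l (\<Theta> x) powr q)"
    proof (rule Bochner_Integration.integrable_bound[OF int_ind])
      show "(\<lambda>x. alt_norm l (\<Theta> x) powr q) \<in> borel_measurable ?L"
        using meas by measurable
      show "AE x in ?L. norm (alt_norm l (\<Theta> x) powr q) \<le> norm (?B powr q * indicator ?A x)"
        using le by (rule AE_mp) (rule AE_I2, simp)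
    qed
    have "(LINT x|?L. alt_norm l (\<Theta> x) powr q) \<le> (LINT x|?L. ?B powr q * indicator ?A x)"
      by (rule integral_mono_AE[OF int int_ind le])
    also have "\<dots> = ?B powr q * measure ?L ?A"
      using A sets.sets_into_space[OF A] by (simp add: Int_absorb2)
    also have "\<dots> \<le> ?B powr q * (?V * h ^ DIM('a))"
      using mA by (intro mult_left_mono) auto
    finally have "(LINT x|?L. alt_norm l (\<Theta> x) powr q) powr (1 / q) \<le>
        (?B powr q * (?V * h ^ DIM('a))) powr (1 / q)"
      using q by (intro powr_mono2 integral_nonneg_AE) auto
    also have "\<dots> = (?B powr q) powr (1 / q) * (?V powr (1 / q) * (h ^ DIM('a)) powr (1 / q))"
      using B V nn by (simp add: powr_mult)
    also have "(?B powr q) powr (1 / q) = ?B" using q B by (simp add: powr_powr)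
    also have "(h ^ DIM('a)) powr (1 / q) = h powr (real DIM('a) / q)"
      using nn by (simp add: powr_realpow[symmetric] powr_powr)
    also have "?B * (?V powr (1 / q) * h powr (real DIM('a) / q)) \<le>
        ?B * ((1 + ?V) * h powr (real DIM('a) / q))"
      using powr_inverse_le[OF V q] B by (intro mult_left_mono mult_right_mono) auto
    also have "\<dots> = M * (1 + ?V) * h powr (dim_over DIM('a) p - e)"
      using nn pq by (simp add: dim_over_def powr_diff powr_minus field_simps)
    finally show ?thesis using int pq by (simp add: Lp_norm_def)
  qed
qed

text \<open>The product rule gives n terms, each with one differentiated factor of size M * L * norm
  v and n - 1 factors of size M. If coordinate i is outside [-1, 1], every term vanishes: it
  contains either \<open>k i\<close> or \<open>k' i\<close> there.\<close>

lemma prod_has_derivative_bound: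
  fixes k k' :: "nat \<Rightarrow> real \<Rightarrow> real" and A :: "nat \<Rightarrow> 'a::euclidean_space \<Rightarrow> real"
  assumes k: "\<And>i x. i < n \<Longrightarrow> (k i has_real_derivative k' i x) (at x)"
    and A: "\<And>i. i < n \<Longrightarrow> linear (A i)"
    and M: "\<And>i x. i < n \<Longrightarrow> \<bar>k i x\<bar> \<le> M" "\<And>i x. i < n \<Longrightarrow> \<bar>k' i x\<bar> \<le> M" "1 \<le> M"
    and z: "\<And>i x. i < n \<Longrightarrow> x \<notin> {-1..1} \<Longrightarrow> k i x = 0" "\<And>i x. i < n \<Longrightarrow> x \<notin> {-1..1} \<Longrightarrow> k' i x = 0"
    and L: "\<And>i v. i < n \<Longrightarrow> \<bar>A i v\<bar> \<le> L * norm v"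
  obtains D where "\<And>x. ((\<lambda>x. \<Prod>i<n. k i (p i + A i x)) has_derivative D x) (at x)"
    "\<And>x v. \<bar>D x v\<bar> \<le> real n * M ^ n * (L * norm v)"
    "\<And>x v i. i < n \<Longrightarrow> p i + A i x \<notin> {-1..1} \<Longrightarrow> D x v = 0"
proof
  let ?a = "\<lambda>i x. p i + A i x"
  let ?D = "\<lambda>x v. \<Sum>i<n. (A i v * k' i (?a i x)) * (\<Prod>j\<in>{..<n} - {i}. k j (?a j x))"
  show "((\<lambda>x. \<Prod>i<n. k i (?a i x)) has_derivative ?D x) (at x)" for x
  proof (rule has_derivative_prod)
    fix i assume "i \<in> {..<n}"
    then have i: "i < n" by simp
    have "(?a i has_derivative A i) (at x)"
      using has_derivative_add[OF has_derivative_const linear_imp_has_derivative[OF A[OF i]]] by simp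
    from has_derivative_compose[OF this k[OF i, unfolded has_field_derivative_def]]
    show "((\<lambda>x. k i (?a i x)) has_derivative (\<lambda>v. A i v * k' i (?a i x))) (at x)"
      by (simp add: mult.commute)
  qed
  show "\<bar>?D x v\<bar> \<le> real n * M ^ n * (L * norm v)" for x v
  proof -
    have "\<bar>?D x v\<bar> \<le> (\<Sum>i<n. (L * norm v) * M ^ n)"
    proof (rule order_trans[OF sum_abs sum_mono])
      fix i assume i: "i \<in> {..<n}"
      then have i': "i < n" by simp
      have "\<bar>\<Prod>j\<in>{..<n} - {i}. k j (?a j x)\<bar> \<le> (\<Prod>j\<in>{..<n} - {i}. M)"
        unfolding abs_prod by (intro prod_mono) (use M in auto)
      also have "\<dots> = M ^ (n - 1)" using i by simp
      finally have pr: "\<bar>\<Prod>j\<in>{..<n} - {i}. k j (?a j x)\<bar> \<le> M ^ (n - 1)" .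
      have "\<bar>A i v * k' i (?a i x)\<bar> \<le> (L * norm v) * M"
        unfolding abs_mult using L[OF i', of v] M(2)[OF i'] by (intro mult_mono) auto
      then have "\<bar>(A i v * k' i (?a i x)) * (\<Prod>j\<in>{..<n} - {i}. k j (?a j x))\<bar> \<le> ((L * norm v) * M) * M ^ (n - 1)"
        unfolding abs_mult[of "A i v * k' i (?a i x)"] using pr M(3) by (intro mult_mono) auto
      also have "\<dots> = (L * norm v) * M ^ n"
        using i' power_Suc[of M "n - 1"] by simp
      finally show "\<bar>(A i v * k' i (?a i x)) * (\<Prod>j\<in>{..<n} - {i}. k j (?a j x))\<bar> \<le> (L * norm v) * M ^ n" .
    qed
    then show ?thesis by (simp add: ac_simps)
  qed
  show "?D x v = 0" if i: "i < n" "?a i x \<notin> {-1..1}" for x v i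
  proof (rule sum.neutral, rule ballI)
    fix j assume j: "j \<in> {..<n}"
    show "(A j v * k' j (?a j x)) * (\<Prod>m\<in>{..<n} - {j}. k m (?a m x)) = 0"
    proof (cases "j = i")
      case True
      then show ?thesis using z(2)[OF i] by simp
    next
      case False
      then have "(\<Prod>m\<in>{..<n} - {j}. k m (?a m x)) = 0"
        using i z(1)[OF i] by (intro prod_zero) auto
      then show ?thesis by simp
    qed
  qed
qed

section \<open>The Gram determinant and barycentric gradients\<close>

definition gram_mat :: "'a::real_inner list \<Rightarrow> real mat"
  where "gram_mat us = Matrix.mat (length us) (length us) (\<lambda>(i, j). us ! i \<bullet> us ! j)"

lemma gram_mat_carrier: "gram_mat us \<in> carrier_mat (length us) (length us)"
  by (simp add: gram_mat_def)

lemma gram_det_eq: "gram_det us = Determinant.det (gram_mat us)"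
proof -
  let ?n = "length us"
  have "(\<Prod>j<?n. us ! j \<bullet> us ! p j) = (\<Prod>i = 0..<?n. gram_mat us $$ (i, p i))" if p: "p permutes {..<?n}" for p
    unfolding lessThan_atLeast0
  proof (rule prod.cong[OF refl])
    fix i assume "i \<in> {0..<?n}"
    moreover from this have "p i \<in> {..<?n}" using permutes_in_image[OF p, of i] by simp
    ultimately show "us ! i \<bullet> us ! p i = gram_mat us $$ (i, p i)" by (simp add: gram_mat_def)
  qed
  then show ?thesis
    unfolding gram_det_def det_def'[OF gram_mat_carrier] lessThan_atLeast0[symmetric]
    by (intro sum.cong refl arg_cong2[where f = "(*)"]) simp_all
qed

lemma gram_mat_mult_vec:
  "gram_mat us *\<^sub>v Matrix.vec (length us) m =
    Matrix.vec (length us) (\<lambda>i. us ! i \<bullet> (\<Sum>j<length us. m j *\<^sub>R us ! j))"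
  by (rule eq_vecI)
    (auto simp: gram_mat_def scalar_prod_def inner_sum_right lessThan_atLeast0 ac_simps intro!: sum.cong)

text \<open>In an orthonormal basis the Gram matrix is U times its transpose, so its determinant is
  a square. A kernel vector would give a combination of the us that is orthogonal to all of them,
  hence zero.\<close>

lemma gram_det_pos:
  fixes us :: "'a::euclidean_space list"
  assumes len: "length us = DIM('a)" and ind: "\<And>m. (\<Sum>j<DIM('a). m j *\<^sub>R us ! j) = 0 \<Longrightarrow> \<forall>j<DIM('a). m j = (0::real)"
  shows "0 < gram_det us"
proof -
  let ?n = "DIM('a)"
  obtain bs :: "'a list" where bs: "distinct bs" "set bs = Basis"
    using finite_distinct_list finite_Basis by blast
  have lbs: "length bs = ?n" using bs distinct_card by fastforce
  define U where "U = Matrix.mat ?n ?n (\<lambda>(i, j). us ! i \<bullet> bs ! j)"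
  have U: "U \<in> carrier_mat ?n ?n" by (simp add: U_def)
  have "gram_mat us = U * transpose_mat U"
  proof (rule eq_matI)
    fix i j assume ij: "i < dim_row (U * transpose_mat U)" "j < dim_col (U * transpose_mat U)"
    then have ij': "i < ?n" "j < ?n" using U by auto
    have "us ! i \<bullet> us ! j = (\<Sum>b\<in>Basis. (us ! i \<bullet> b) * (us ! j \<bullet> b))" by (rule euclidean_inner)
    also have "\<dots> = (\<Sum>l<?n. (us ! i \<bullet> bs ! l) * (us ! j \<bullet> bs ! l))"
      using sum.reindex_bij_betw[OF bij_betw_nth[OF bs(1) refl refl], of "\<lambda>b. (us ! i \<bullet> b) * (us ! j \<bullet> b)"]
      by (simp add: bs lbs)
    finally show "gram_mat us $$ (i, j) = (U * transpose_mat U) $$ (i, j)"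
      using ij' by (simp add: gram_mat_def len U_def scalar_prod_def lessThan_atLeast0)
  qed (use U len in \<open>auto simp: gram_mat_def\<close>)
  then have "Determinant.det (gram_mat us) = Determinant.det U * Determinant.det U"
    using det_mult[OF U, of "transpose_mat U"] det_transpose[OF U] U by simp
  then have nn: "0 \<le> gram_det us" by (simp add: gram_det_eq)
  have "gram_det us \<noteq> 0"
  proof
    assume "gram_det us = 0"
    then have "Determinant.det (gram_mat us) = 0" by (simp add: gram_det_eq)
    then obtain v where v: "v \<in> carrier_vec ?n" "v \<noteq> 0\<^sub>v ?n" "gram_mat us *\<^sub>v v = 0\<^sub>v ?n"
      using det_0_iff_vec_prod_zero[OF gram_mat_carrier[of us]] len by auto
    let ?m = "\<lambda>i. vec_index v i"
    let ?x = "\<Sum>j<?n. ?m j *\<^sub>R us ! j"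
    have veq: "v = Matrix.vec (length us) ?m" using v(1) len by auto
    have "us ! i \<bullet> ?x = 0" if i: "i < ?n" for i
    proof -
      have "vec_index (gram_mat us *\<^sub>v v) i = us ! i \<bullet> ?x"
        using gram_mat_mult_vec[of us ?m] veq i len by simp
      then show ?thesis using v(3) i by simp
    qed
    then have "?x \<bullet> ?x = 0" by (subst inner_sum_left) simp
    then have "\<forall>j<?n. ?m j = 0" using ind by simp
    then have "v = 0\<^sub>v ?n" using v(1) by auto
    then show False using v(2) by simp
  qed
  then show ?thesis using nn by simp
qed

text \<open>Cramer's rule for the Gram system with right-hand side us ! i \<bullet> v. In the
  Leibniz expansion of the numerator each permutation meets the replaced column exactly once, which
  yields one factor h * norm v and n - 1 factors h * h.\<close>

lemma gram_coordinate_bound: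
  fixes us :: "'a::euclidean_space list"
  assumes n: "length us = n" "0 < n" and h: "\<And>i. i < n \<Longrightarrow> norm (us ! i) \<le> h"
    and v: "v = (\<Sum>j<n. m j *\<^sub>R us ! j)" and k: "k < n"
  shows "\<bar>m k\<bar> * \<bar>gram_det us\<bar> \<le> fact n * (h ^ (2 * n - 1) * norm v)"
proof -
  have h0: "0 \<le> h" using h[OF n(2)] norm_ge_zero order_trans by blast
  let ?A = "gram_mat us" and ?x = "Matrix.vec n m"
  let ?b = "?A *\<^sub>v ?x"
  have A: "?A \<in> carrier_mat n n" using gram_mat_carrier[of us] n by simp
  have b: "vec_index ?b i = us ! i \<bullet> v" if "i < n" for i
    using gram_mat_mult_vec[of us m] that n v by simp
  have "Determinant.det (replace_col ?A ?b k) = m k * gram_det us"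
    using cramer_lemma_mat[OF A _ k, of ?x] k by (simp add: gram_det_eq)
  moreover have "\<bar>Determinant.det (replace_col ?A ?b k)\<bar> \<le> (\<Sum>p | p permutes {0..<n}. h ^ (2 * n - 1) * norm v)"
  proof -
    have R: "replace_col ?A ?b k \<in> carrier_mat n n" using A by (auto simp: replace_col_def)
    have "\<bar>of_int (sign p) * (\<Prod>i = 0..<n. replace_col ?A ?b k $$ (i, p i))\<bar> \<le> h ^ (2 * n - 1) * norm v"
      if p: "p permutes {0..<n}" for p
    proof -
      have pi: "p i < n" if "i < n" for i using permutes_in_image[OF p, of i] that by auto
      have e: "\<bar>replace_col ?A ?b k $$ (i, p i)\<bar> \<le> (if p i = k then h * norm v else h * h)" if i: "i < n" for i
      proof -
        have "replace_col ?A ?b k $$ (i, p i) = (if p i = k then us ! i \<bullet> v else us ! i \<bullet> us ! p i)"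
          using A b i pi[OF i] n by (simp add: replace_col_def gram_mat_def)
        moreover have "\<bar>us ! i \<bullet> v\<bar> \<le> h * norm v"
          by (rule order_trans[OF Cauchy_Schwarz_ineq2 mult_right_mono[OF h[OF i]]]) simp
        moreover have "\<bar>us ! i \<bullet> us ! p i\<bar> \<le> h * h"
          by (rule order_trans[OF Cauchy_Schwarz_ineq2 mult_mono[OF h[OF i] h[OF pi[OF i]] h0]]) simp
        ultimately show ?thesis by simp
      qed
      obtain i0 where i0: "i0 \<in> {0..<n}" "p i0 = k"
        using permutes_image[OF p] k by (metis atLeastLessThan_iff imageE le0)
      have "\<bar>of_int (sign p) * (\<Prod>i = 0..<n. replace_col ?A ?b k $$ (i, p i))\<bar> =
          (\<Prod>i = 0..<n. \<bar>replace_col ?A ?b k $$ (i, p i)\<bar>)"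
        by (simp add: abs_mult abs_prod flip: of_int_abs)
      also have "\<dots> \<le> (\<Prod>i = 0..<n. if p i = k then h * norm v else h * h)"
        by (rule prod_mono) (use e in auto)
      also have "\<dots> = h * norm v * (\<Prod>i\<in>{0..<n} - {i0}. if p i = k then h * norm v else h * h)"
        using i0 by (subst prod.remove[of _ i0]) auto
      also have "(\<Prod>i\<in>{0..<n} - {i0}. if p i = k then h * norm v else h * h) = (\<Prod>i\<in>{0..<n} - {i0}. h * h)"
      proof (rule prod.cong[OF refl])
        fix i assume i: "i \<in> {0..<n} - {i0}"
        then have "p i \<noteq> p i0" using permutes_inj[OF p] by (auto dest: injD)
        then show "(if p i = k then h * norm v else h * h) = h * h" using i0(2) by simp
      qed
      also have "\<dots> = (h * h) ^ (n - 1)" using i0(1) by simp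
      also have "h * norm v * (h * h) ^ (n - 1) = h ^ (2 * n - 1) * norm v"
      proof -
        have "(h * h) ^ (n - 1) = h ^ (2 * (n - 1))" by (simp add: power_mult power2_eq_square)
        moreover have "2 * n - 1 = Suc (2 * (n - 1))" using n(2) by simp
        ultimately show ?thesis by simp
      qed
      finally show ?thesis .
    qed
    then show ?thesis
      unfolding det_def'[OF R] by (intro order_trans[OF sum_abs sum_mono]) auto
  qed
  moreover have "card {p. p permutes {0..<n}} = fact n" by (rule card_permutations) auto
  ultimately show ?thesis by (simp add: abs_mult)
qed

lemma measure_std_simplex:
  assumes "0 < n"
  shows "0 < measure (lborel_power n) (std_simplex n)" "measure (lborel_power n) (std_simplex n) \<le> 1"
proof -
  let ?Q = "{..<n} \<rightarrow>\<^sub>E {0..1 / real n}"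
  have "?Q \<subseteq> std_simplex n"
  proof
    fix t assume t: "t \<in> ?Q"
    then have "(\<Sum>j<n. t j) \<le> (\<Sum>j<n. 1 / real n)" by (intro sum_mono) (auto simp: PiE_def Pi_def)
    then show "t \<in> std_simplex n" using t assms
      by (auto simp: std_simplex_def space_lborel_power PiE_def Pi_def)
  qed
  then have "emeasure (lborel_power n) ?Q \<le> emeasure (lborel_power n) (std_simplex n)"
    by (rule emeasure_mono) (rule sets_std_simplex)
  moreover have "emeasure (lborel_power n) ?Q = (\<Prod>j<n. emeasure lborel {0..1 / real n})"
    unfolding lborel_power_def by (rule lborel_power.emeasure_PiM) auto
  moreover have "(\<Prod>j<n. emeasure lborel {0..1 / real n}) = ennreal ((1 / real n) ^ n)"
    by (simp add: ennreal_power)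
  ultimately have "ennreal ((1 / real n) ^ n) \<le> emeasure (lborel_power n) (std_simplex n)" by simp
  moreover have "0 < ennreal ((1 / real n) ^ n)" using assms by simp
  ultimately have "0 < emeasure (lborel_power n) (std_simplex n)" by (rule less_le_trans[rotated])
  moreover have "emeasure (lborel_power n) (std_simplex n) < \<infinity>"
    using emeasure_std_simplex_le[of n] by (rule le_less_trans) simp
  ultimately show "0 < measure (lborel_power n) (std_simplex n)"
    unfolding measure_def by (simp add: enn2real_positive_iff)
  show "measure (lborel_power n) (std_simplex n) \<le> 1"
    unfolding measure_def using emeasure_std_simplex_le[of n] by (intro enn2real_leI) simp_all
qed

lemma simplex_edges_independent:
  fixes ws :: "'a::euclidean_space list"
  assumes ws: "distinct ws" "ws \<noteq> []" and ind: "\<not> affine_dependent (set ws)"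
  shows "distinct (simplex_edges ws)" "independent (set (simplex_edges ws))"
proof -
  obtain w us where w: "ws = w # us" using ws(2) by (cases ws) auto
  have e: "simplex_edges ws = map (\<lambda>x. x - w) us" by (simp add: simplex_edges_def w)
  show "distinct (simplex_edges ws)" unfolding e using ws(1) w by (simp add: distinct_map inj_on_def)
  have "\<not> affine_dependent (insert w (set us))" using ind w by simp
  then have "independent ((\<lambda>x. - w + x) ` set us)"
    using affine_dependent_iff_dependent[of w "set us"] ws(1) w by simp
  then show "independent (set (simplex_edges ws))" unfolding e by simp
qed

lemma span_list_expand:
  assumes "v \<in> span (set es)" "distinct es"
  obtains m where "v = (\<Sum>j<length es. m j *\<^sub>R es ! j)"
proof -
  obtain u where "v = (\<Sum>e\<in>set es. u e *\<^sub>R e)"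
    using assms(1) span_finite[of "set es"] by auto
  also have "\<dots> = (\<Sum>j<length es. u (es ! j) *\<^sub>R es ! j)"
    using sum.reindex_bij_betw[OF bij_betw_nth[OF assms(2) refl refl], of "\<lambda>e. u e *\<^sub>R e"] by simp
  finally show ?thesis by (rule that)
qed

lemma independent_list_zero:
  assumes "independent (set es)" "distinct es" "(\<Sum>j<length es. m j *\<^sub>R es ! j) = 0" "j < length es"
  shows "m j = (0::real)"
proof -
  define u where "u e = m (the_inv_into {..<length es} ((!) es) e)" for e
  have inj: "inj_on ((!) es) {..<length es}" using assms(2) by (simp add: inj_on_def nth_eq_iff_index_eq)
  have u: "u (es ! i) = m i" if "i < length es" for i
    using the_inv_into_f_f[OF inj, of i] that by (simp add: u_def)
  have "(\<Sum>e\<in>set es. u e *\<^sub>R e) = (\<Sum>i<length es. u (es ! i) *\<^sub>R es ! i)"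
    using sum.reindex_bij_betw[OF bij_betw_nth[OF assms(2) refl refl], of "\<lambda>e. u e *\<^sub>R e"] by simp
  also have "\<dots> = 0" using assms(3) u by simp
  finally have "u (es ! j) = 0"
    using assms(1,4) independentD[of "set es" "set es" u "es ! j"] by simp
  then show ?thesis using u assms(4) by simp
qed

text \<open>The volume is at most sqrt g for the Gram determinant g of the edges, so the shape bound
  gives h^(2n) \<le> \<mu>^2 * g for the diameter h. Inserted into Cramer's bound for the edge
  coordinates of v, the determinant cancels and each coordinate is at most n! * \<mu>^2 * norm v /
  h. A linear f of size at most 1 on the edges adds up n of them.\<close>

lemma simplex_gradient_bound:
  fixes C :: "'a::euclidean_space set" and f :: "'a \<Rightarrow> real"
  assumes ind: "\<not> affine_dependent C" and card: "card C = DIM('a) + 1"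
    and mu: "diameter (convex hull C) ^ DIM('a) / simplex_volume (convex hull C) \<le> \<mu>"
    and f: "linear f" and f1: "\<And>u v. u \<in> C \<Longrightarrow> v \<in> C \<Longrightarrow> \<bar>f (u - v)\<bar> \<le> 1"
  shows "0 < diameter (convex hull C)"
    "\<bar>f v\<bar> \<le> real DIM('a) * (fact DIM('a) * \<mu>\<^sup>2) * norm v / diameter (convex hull C)"
proof -
  let ?T = "convex hull C" and ?n = "DIM('a)"
  let ?h = "diameter ?T"
  have fin: "finite C" using ind aff_independent_finite by blast
  have vT: "vertices ?T = C"
    unfolding vertices_def using extreme_point_of_convex_hull_affine_independent[OF ind] by auto
  \<comment> \<open>The very enumeration chosen in \<open>simplex_volume\<close>, so that the volume
    unfolds to the Gram determinant of these edges.\<close>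
  define ws where "ws = (SOME ws. distinct ws \<and> set ws = vertices ?T)"
  have "\<exists>ws. distinct ws \<and> set ws = vertices ?T" using finite_distinct_list[OF fin] vT by auto
  then have "distinct ws \<and> set ws = vertices ?T" unfolding ws_def by (rule someI_ex)
  then have ws: "distinct ws" "set ws = C" using vT by auto
  have len: "length ws = ?n + 1" using ws card distinct_card by metis
  then have wsn: "ws \<noteq> []" by auto
  let ?es = "simplex_edges ws"
  have les: "length ?es = ?n" using len by (simp add: simplex_edges_def)
  note es = simplex_edges_independent[OF ws(1) wsn ind[folded ws(2)]]
  have span: "v \<in> span (set ?es)" for v
  proof -
    have "card (set ?es) = ?n" using es(1) les distinct_card by metis
    then have "UNIV \<subseteq> span (set ?es)"
      using card_ge_dim_independent[of "set ?es" UNIV] es(2) by (simp add: dim_UNIV)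
    then show ?thesis by blast
  qed
  have bdd: "bounded ?T" using fin by (simp add: finite_imp_bounded bounded_convex_hull)
  have nrm: "norm (u - w) \<le> ?h" if "u \<in> C" "w \<in> C" for u w
    using diameter_bounded_bound[OF bdd, of u w] that hull_subset[of C convex] by (auto simp: dist_norm)
  have edge: "\<exists>u w. u \<in> C \<and> w \<in> C \<and> e = u - w" if "e \<in> set ?es" for e
    using set_simplex_edges[OF wsn] that ws(2) by blast
  have hes: "norm (?es ! i) \<le> ?h" if "i < ?n" for i
    using edge[of "?es ! i"] nth_mem[of i ?es] that les nrm by auto
  show h: "0 < ?h"
  proof -
    have "?es ! 0 \<in> set ?es" using les by simp
    moreover have "0 \<notin> set ?es" using es(2) dependent_zero by blast
    ultimately have "?es ! 0 \<noteq> 0" by metis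
    then show ?thesis using hes[of 0] by (meson DIM_positive less_le_trans zero_less_norm_iff)
  qed
  let ?ms = "measure (lborel_power ?n) (std_simplex ?n)" and ?g = "gram_det ?es"
  have g: "0 < ?g"
  proof (rule gram_det_pos[OF les])
    fix m :: "nat \<Rightarrow> real" assume "(\<Sum>j<?n. m j *\<^sub>R ?es ! j) = 0"
    then show "\<forall>j<?n. m j = 0" using independent_list_zero[OF es(2,1), of m] les by simp
  qed
  have vol: "simplex_volume ?T = ?ms * sqrt ?g"
    unfolding simplex_volume_def ws_def[symmetric] Let_def using len by simp
  note ms = measure_std_simplex[OF DIM_positive, where ?'a1 = 'a]
  have "?h ^ ?n \<le> \<mu> * (?ms * sqrt ?g)"
    using mu ms(1) g unfolding vol by (simp add: pos_divide_le_eq)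
  also have "\<dots> \<le> \<mu> * (1 * sqrt ?g)"
  proof -
    have "0 < ?h ^ ?n / (?ms * sqrt ?g)" using h ms(1) g by simp
    then have "0 \<le> \<mu>" using mu unfolding vol by linarith
    then show ?thesis using ms(2) g by (intro mult_left_mono mult_right_mono) auto
  qed
  finally have "(?h ^ ?n)\<^sup>2 \<le> (\<mu> * sqrt ?g)\<^sup>2" using h by (intro power_mono) auto
  then have hg: "?h ^ (2 * ?n) \<le> \<mu>\<^sup>2 * ?g" using g by (simp add: power_mult_distrib power_mult[symmetric] mult.commute)
  obtain m where m: "v = (\<Sum>j<length ?es. m j *\<^sub>R ?es ! j)" by (rule span_list_expand[OF span es(1)])
  have mk: "\<bar>m k\<bar> \<le> fact ?n * \<mu>\<^sup>2 * norm v / ?h" if k: "k < ?n" for k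
  proof -
    have "\<bar>m k\<bar> * ?g \<le> fact ?n * (?h ^ (2 * ?n - 1) * norm v)"
      using gram_coordinate_bound[OF les DIM_positive hes m[unfolded les] k] g by simp
    then have "?h * (\<bar>m k\<bar> * ?g) \<le> ?h * (fact ?n * (?h ^ (2 * ?n - 1) * norm v))"
      using h by (intro mult_left_mono) auto
    also have "\<dots> = fact ?n * norm v * ?h ^ (2 * ?n)"
    proof -
      have "?h ^ (2 * ?n) = ?h * ?h ^ (2 * ?n - 1)" using power_Suc[of ?h "2 * ?n - 1"] by simp
      then show ?thesis by (simp only: ac_simps)
    qed
    also have "\<dots> \<le> fact ?n * norm v * (\<mu>\<^sup>2 * ?g)" using hg by (intro mult_left_mono) auto
    finally have "(?h * \<bar>m k\<bar>) * ?g \<le> (fact ?n * \<mu>\<^sup>2 * norm v) * ?g" by (simp only: ac_simps)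
    then have "?h * \<bar>m k\<bar> \<le> fact ?n * \<mu>\<^sup>2 * norm v" using g by (rule mult_right_le_imp_le)
    then show ?thesis using h by (simp add: field_simps)
  qed
  have "\<bar>f v\<bar> = \<bar>\<Sum>j<?n. m j * f (?es ! j)\<bar>"
    unfolding m les by (simp add: linear_sum[OF f] linear_scale[OF f])
  also have "\<dots> \<le> (\<Sum>j<?n. \<bar>m j\<bar> * 1)"
  proof (rule order_trans[OF sum_abs sum_mono])
    fix j assume "j \<in> {..<?n}"
    then have "\<bar>f (?es ! j)\<bar> \<le> 1" using edge[of "?es ! j"] nth_mem[of j ?es] les f1 by auto
    then show "\<bar>m j * f (?es ! j)\<bar> \<le> \<bar>m j\<bar> * 1" unfolding abs_mult by (intro mult_left_mono) auto
  qed
  also have "\<dots> \<le> (\<Sum>j<?n. fact ?n * \<mu>\<^sup>2 * norm v / ?h)" using mk by (intro sum_mono) auto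
  finally show "\<bar>f v\<bar> \<le> real ?n * (fact ?n * \<mu>\<^sup>2) * norm v / ?h" by (simp add: ac_simps)
qed

section \<open>Extension to the adjacent simplices\<close>

lemma prod_list_map2_bound:
  fixes l :: "nat \<Rightarrow> 'a::real_normed_vector \<Rightarrow> real"
  assumes "length vs = a" "a \<le> d" "\<tau> permutes {..<d}"
    and l: "\<And>i v. i < d \<Longrightarrow> v \<in> set vs \<Longrightarrow> \<bar>l i v\<bar> \<le> K" and K: "0 \<le> K"
  shows "\<bar>prod_list (map2 l (map \<tau> [0..<a]) vs)\<bar> \<le> K ^ a"
proof -
  have "(\<Prod>i<a. \<bar>l (\<tau> i) (vs ! i)\<bar>) \<le> (\<Prod>i<a. K)"
  proof (rule prod_mono, rule conjI)
    fix i assume i: "i \<in> {..<a}"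
    then have "i \<in> {..<d}" using assms(2) by auto
    then have "\<tau> i \<in> {..<d}" using permutes_in_image[OF assms(3)] by blast
    then show "\<bar>l (\<tau> i) (vs ! i)\<bar> \<le> K" using l i assms(1) by auto
  qed simp
  then show ?thesis unfolding prod_list_map2_nth[OF assms(1)] abs_prod by simp
qed

context facet_patch
begin

text \<open>\<open>lT (x - hd ws)\<close> is meant to be the barycentric coordinate of the vertex
  opposite F. Its scale \<open>sT\<close> is separate from \<open>s\<close> because for a vertex S
  it is measured by T, whereas \<open>s\<close> has to be common to all simplices over F.\<close>

definition patch_form :: "nat \<Rightarrow> (nat \<Rightarrow> real \<Rightarrow> real) \<Rightarrow> nat
    \<Rightarrow> ((nat \<Rightarrow> nat) \<Rightarrow> (nat \<Rightarrow> nat) \<Rightarrow> real) \<Rightarrow> (real \<Rightarrow> real) \<Rightarrow> ('a \<Rightarrow> real) \<Rightarrow> real \<Rightarrow> 'a set \<Rightarrow> 'a dform"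
  where "patch_form a \<kappa> r c \<psi> lT sT T x vs = (if x \<in> T
    then coef_form d a (\<lambda>\<tau>. bump_coef \<kappa> r c x \<tau> * \<psi> (lT (x - hd ws) / sT)) (\<lambda>i v. l i v / s) vs else 0)"

lemma bump_coef_support:
  assumes supp: "\<And>i x. x \<notin> {lo..hi} \<Longrightarrow> \<kappa> i x = (0::real)" and nz: "bump_coef \<kappa> r c x \<tau> \<noteq> 0" and j: "j < d"
  shows "lam j x \<in> {lo..hi}"
proof (rule ccontr)
  assume "lam j x \<notin> {lo..hi}"
  then have "(\<Prod>j<d. \<kappa> (\<beta> j) (lam j x)) = 0" for \<beta> using supp j by (intro prod_zero) auto
  then have "bump_coef \<kappa> r c x \<tau> = 0" unfolding bump_coef_def by (simp only: mult_zero_right sum.neutral_const)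
  then show False using nz by simp
qed

lemma coef_form_nonzero:
  assumes "coef_form d a g m vs \<noteq> 0" obtains \<tau> where "g \<tau> \<noteq> 0"
proof -
  have "\<not> (\<forall>\<tau>. g \<tau> = 0)"
  proof
    assume "\<forall>\<tau>. g \<tau> = 0"
    then have "coef_form d a g m vs = 0" by (simp add: coef_form_def)
    then show False using assms by simp
  qed
  then show ?thesis using that by blast
qed

lemma continuous_on_lam: "j < d \<Longrightarrow> continuous_on X (lam j)"
proof -
  assume j: "j < d"
  have "continuous_on X (\<lambda>x. l j x)" using l_linear[OF j] by (rule linear_continuous_on[OF linear_conv_bounded_linear[THEN iffD1]])
  moreover have "lam j = (\<lambda>x. (l j x - l j (hd ws) - off j) / s)"
    by (simp add: lam_def linear_diff[OF l_linear[OF j]] fun_eq_iff)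
  ultimately show ?thesis using s_pos by (auto intro!: continuous_intros)
qed

lemma lam_eq_affine: "j < d \<Longrightarrow> lam j x = - (l j (hd ws) + off j) / s + l j x / s"
  using linear_diff[OF l_linear] by (simp add: lam_def add_divide_distrib diff_divide_distrib)

lemma linear_scaled: "i < d \<Longrightarrow> linear (\<lambda>v. l i v / s)"
  using linear_compose_scale_right[OF l_linear, of i "1 / s"] by simp

lemma smooth_fun_kernel_prod:
  assumes sm: "\<And>i. smooth_fun (\<kappa> i)"
  shows "smooth_fun (\<lambda>x. bump_coef \<kappa> r c x \<tau>)"
proof -
  have "smooth_fun (\<lambda>x. \<kappa> i (- (l j (hd ws) + off j) / s + l j x / s))" if "j < d" for i j
  proof -
    have "bounded_linear (\<lambda>x. l j x / s)"
      using linear_scaled[OF that] by (simp add: linear_conv_bounded_linear)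
    then show ?thesis by (rule smooth_fun_compose_affine[OF sm])
  qed
  then have "smooth_fun (\<lambda>x. \<kappa> i (lam j x))" if "j < d" for i j
    using lam_eq_affine[OF that] that by simp
  then show ?thesis unfolding bump_coef_def
    by (intro smooth_fun_sum smooth_fun_mult smooth_fun_const smooth_fun_prod) simp
qed

lemma smooth_fun_coef_form:
  assumes "\<And>\<tau>. smooth_fun (\<lambda>x. g x \<tau>)"
  shows "smooth_fun (\<lambda>x. coef_form d a (g x) m vs)"
proof (cases "length vs = a")
  case True
  have "smooth_fun (\<lambda>x. \<Sum>\<tau> | \<tau> permutes {..<d}. (of_int (sign \<tau>) * g x \<tau>) * prod_list (map2 m (map \<tau> [0..<a]) vs))"
    by (intro smooth_fun_sum smooth_fun_mult smooth_fun_const assms)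
  then show ?thesis using True by (simp add: coef_form_def)
qed (simp add: coef_form_def smooth_fun_const)

lemma bump_coef_tail:
  assumes "\<And>\<beta>. c (\<tau> \<circ> Transposition.transpose i j) \<beta> = c \<tau> \<beta>"
  shows "bump_coef \<kappa> r c x (\<tau> \<circ> Transposition.transpose i j) = bump_coef \<kappa> r c x \<tau>"
  using assms by (simp add: bump_coef_def)

text \<open>The support lies in the compact set K where all patch coordinates are in [lo, hi]. On K
  the barycentric coordinates are positive: that of \<open>ws ! Suc i\<close> is at least s * lo,
  that of hd ws at least s - s/2. The latter is why d * hi \<le> 1/2 is asked for, while d * hi
  \<le> 1 suffices in \<open>facet_form_pairing\<close>.\<close>

lemma facet_form_smooth_c:
  assumes sm: "\<And>i. smooth_fun (\<kappa> i)" and supp: "\<And>i x. x \<notin> {lo..hi} \<Longrightarrow> \<kappa> i x = 0"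
    and lo: "0 < lo" and hi: "real d * hi \<le> 1 / 2" and a: "a \<le> d"
    and c: "\<And>\<tau> i j \<beta>. \<tau> permutes {..<d} \<Longrightarrow> i < a \<Longrightarrow> j < a \<Longrightarrow>
        c (\<tau> \<circ> Transposition.transpose i j) \<beta> = c \<tau> \<beta>"
    and ws: "distinct ws" "\<not> affine_dependent (set ws)"
  shows "facet_form a \<kappa> r c \<in> smooth_forms_c (int a) F"
proof -
  note lin = linear_scaled
  have "facet_form a \<kappa> r c \<in> dforms (int a) F"
  proof -
    have "facet_form a \<kappa> r c x \<in> alt_forms (int a) (tangent F)" if "x \<in> F" for x
    proof -
      have "(\<lambda>vs. if set vs \<subseteq> tangent F then coef_form d a (bump_coef \<kappa> r c x) (\<lambda>i v. l i v / s) vs else 0)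
          \<in> alt_forms (int a) (tangent F)"
        by (rule coef_form_alt[OF a lin subspace_tangent]) (use bump_coef_tail c in auto)
      then show ?thesis using that by (simp add: facet_form_def[abs_def])
    qed
    then show ?thesis by (auto simp: dforms_def facet_form_def)
  qed
  moreover have "\<exists>g. smooth_fun g \<and> (\<forall>x\<in>F. facet_form a \<kappa> r c x vs = g x)" if "set vs \<subseteq> tangent F" for vs
    using smooth_fun_coef_form[OF smooth_fun_kernel_prod[OF sm]] that
    by (intro exI[of _ "\<lambda>x. coef_form d a (bump_coef \<kappa> r c x) (\<lambda>i v. l i v / s) vs"]) (auto simp: facet_form_def)
  ultimately have 1: "facet_form a \<kappa> r c \<in> smooth_forms (int a) F" by (simp add: smooth_forms_def)
  define K where "K = {x \<in> F. \<forall>j<d. lam j x \<in> {lo..hi}}"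
  have cF: "compact F" by (simp add: finite_imp_compact compact_convex_hull)
  have "K = F \<inter> (\<Inter>j\<in>{..<d}. {x. lam j x \<in> {lo..hi}})" by (auto simp: K_def)
  moreover have "closed {x. lam j x \<in> {lo..hi}}" if "j < d" for j
    using continuous_closed_vimage[OF closed_atLeastAtMost[of lo hi], of "lam j"]
      continuous_on_lam[OF that, of UNIV] by (simp add: vimage_def continuous_on_eq_continuous_at)
  ultimately have K: "compact K" using cF by (auto intro!: compact_Int_closed closed_INT)
  have sub: "{x. facet_form a \<kappa> r c x \<noteq> (\<lambda>vs. 0)} \<subseteq> K"
  proof
    fix x assume "x \<in> {x. facet_form a \<kappa> r c x \<noteq> (\<lambda>vs. 0)}"
    then obtain vs where vs: "facet_form a \<kappa> r c x vs \<noteq> 0" by fastforce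
    then have x: "x \<in> F" "coef_form d a (bump_coef \<kappa> r c x) (\<lambda>i v. l i v / s) vs \<noteq> 0"
      by (auto simp: facet_form_def split: if_splits)
    then obtain \<tau> where "bump_coef \<kappa> r c x \<tau> \<noteq> 0" using coef_form_nonzero by blast
    then have "\<forall>j<d. lam j x \<in> {lo..hi}" using bump_coef_support[where \<kappa> = \<kappa>, OF supp] by blast
    then show "x \<in> K" using x(1) by (simp add: K_def)
  qed
  then have cl: "form_support (facet_form a \<kappa> r c) \<subseteq> K"
    unfolding form_support_def using K by (simp add: closure_minimal compact_imp_closed)
  have 2: "compact (form_support (facet_form a \<kappa> r c))"
    using compact_Int_closed[OF K closed_closure] cl unfolding form_support_def by (metis inf.absorb2)
  have "K \<subseteq> rel_interior F"
  proof
    fix x assume x: "x \<in> K"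
    \<comment> \<open>Index 0 is the barycentric coordinate of hd ws; the others are shifted by one
      to match the positions in ws.\<close>
    define t where "t j = (if j = 0 then 1 - (\<Sum>i<d. l i (x - hd ws)) else l (j - 1) (x - hd ws))" for j
    have li: "l i (x - hd ws) = off i + s * lam i x" for i using s_pos by (simp add: lam_def)
    have lpos: "0 < l i (x - hd ws)" if "i < d" for i
      unfolding li using x that off_nonneg[OF that] s_pos lo by (auto simp: K_def intro!: add_nonneg_pos)
    have "(\<Sum>i<d. l i (x - hd ws)) = (\<Sum>i<d. off i) + s * (\<Sum>i<d. lam i x)"
      unfolding li by (simp add: sum.distrib sum_distrib_left)
    also have "\<dots> \<le> (1 - s) + s * (1 / 2)"
    proof -
      have "(\<Sum>i<d. lam i x) \<le> (\<Sum>i<d. hi)" using x by (intro sum_mono) (auto simp: K_def)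
      then have "(\<Sum>i<d. lam i x) \<le> 1 / 2" using hi by simp
      then show ?thesis using off_sum s_pos by (intro add_mono mult_left_mono) auto
    qed
    also have "\<dots> < 1" using s_pos by simp
    finally have t0: "0 < t 0" by (simp add: t_def)
    have tpos: "0 < t j" if "j < Suc d" for j using t0 lpos that by (cases j) (auto simp: t_def)
    have tsum: "(\<Sum>j<Suc d. t j) = 1" by (subst sum.lessThan_Suc_shift) (simp add: t_def)
    have edge: "simplex_edges ws ! i = ws ! Suc i - ws ! 0" if "i < d" for i
      using that length_ws ws_nonempty by (simp add: simplex_edges_def nth_tl hd_conv_nth)
    have xF: "x \<in> F" using x by (simp add: K_def)
    have "hd ws \<in> F" using set_ws_F ws_nonempty hd_in_set by blast
    then have "x - hd ws = (\<Sum>i<d. l i (x - hd ws) *\<^sub>R (simplex_edges ws ! i))"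
      using tangent_expand diff_in_tangent[OF xF] by blast
    then have "x = ws ! 0 + (\<Sum>i<d. l i (x - hd ws) *\<^sub>R (simplex_edges ws ! i))"
      using ws_nonempty by (simp add: hd_conv_nth algebra_simps)
    also have "\<dots> = ws ! 0 + (\<Sum>i<d. l i (x - hd ws) *\<^sub>R (ws ! Suc i - ws ! 0))"
      using edge by simp
    also have "\<dots> = (\<Sum>j<Suc d. t j *\<^sub>R ws ! j)"
      by (subst sum.lessThan_Suc_shift)
        (simp add: t_def scaleR_diff_right scaleR_diff_left sum_subtractf flip: scaleR_sum_left)
    finally have xt: "x = (\<Sum>j<Suc d. t j *\<^sub>R ws ! j)" .
    define u where "u w = t (the_inv_into {..<Suc d} ((!) ws) w)" for w
    have bij: "bij_betw ((!) ws) {..<Suc d} (set ws)" using bij_betw_nth[OF ws(1) _ refl] length_ws by simp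
    have u: "u (ws ! j) = t j" if "j < Suc d" for j
      using the_inv_into_f_f[OF bij_betw_imp_inj_on[OF bij], of j] that by (simp add: u_def)
    have "\<forall>w\<in>set ws. 0 < u w"
    proof
      fix w assume "w \<in> set ws"
      then obtain j where "j < Suc d" "w = ws ! j" by (auto simp: in_set_conv_nth length_ws)
      then show "0 < u w" using u tpos by simp
    qed
    moreover have "sum u (set ws) = 1"
      using sum.reindex_bij_betw[OF bij, of u] u tsum by simp
    moreover have "(\<Sum>w\<in>set ws. u w *\<^sub>R w) = x"
      using sum.reindex_bij_betw[OF bij, of "\<lambda>w. u w *\<^sub>R w"] u xt by simp
    ultimately show "x \<in> rel_interior F"
      unfolding rel_interior_convex_hull_explicit[OF ws(2)] by blast
  qed
  then show ?thesis using 1 2 cl by (auto simp: smooth_forms_c_def)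
qed

lemma patch_form_trace:
  assumes FT: "F \<subseteq> T" and lT: "\<And>v. v \<in> tangent F \<Longrightarrow> lT v = 0" and chi: "\<psi> 0 = 1"
  shows "form_trace F (patch_form a \<kappa> r c \<psi> lT sT T) = facet_form a \<kappa> r c"
proof (intro ext)
  fix x vs
  have "hd ws \<in> F" using set_ws_F ws_nonempty hd_in_set by blast
  then have "lT (x - hd ws) = 0" if "x \<in> F" using lT diff_in_tangent[OF that] by blast
  then show "form_trace F (patch_form a \<kappa> r c \<psi> lT sT T) x vs = facet_form a \<kappa> r c x vs"
    using FT chi by (auto simp: form_trace_def patch_form_def facet_form_def)
qed

lemma patch_form_support:
  assumes supp: "\<And>i x. x \<notin> {lo..hi} \<Longrightarrow> \<kappa> i x = 0" and chi: "\<And>x. x \<notin> {-\<delta>..\<delta>} \<Longrightarrow> \<psi> x = 0"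
    and nz: "patch_form a \<kappa> r c \<psi> lT sT T x \<noteq> (\<lambda>vs. 0)"
  shows "x \<in> T" "\<And>j. j < d \<Longrightarrow> lam j x \<in> {lo..hi}" "lT (x - hd ws) / sT \<in> {-\<delta>..\<delta>}"
proof -
  obtain vs where "patch_form a \<kappa> r c \<psi> lT sT T x vs \<noteq> 0" using nz by fastforce
  then have x: "x \<in> T" "coef_form d a (\<lambda>\<tau>. bump_coef \<kappa> r c x \<tau> * \<psi> (lT (x - hd ws) / sT)) (\<lambda>i v. l i v / s) vs \<noteq> 0"
    by (auto simp: patch_form_def split: if_splits)
  then obtain \<tau> where t: "bump_coef \<kappa> r c x \<tau> * \<psi> (lT (x - hd ws) / sT) \<noteq> 0" using coef_form_nonzero by blast
  show "x \<in> T" by (rule x(1))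
  show "lam j x \<in> {lo..hi}" if "j < d" for j using bump_coef_support[where \<kappa> = \<kappa>, OF supp _ that] t by fastforce
  show "lT (x - hd ws) / sT \<in> {-\<delta>..\<delta>}" using chi t by fastforce
qed

lemma patch_form_smooth:
  assumes sm: "\<And>i. smooth_fun (\<kappa> i)" "smooth_fun \<psi>" and a: "a \<le> d"
    and c: "\<And>\<tau> i j \<beta>. \<tau> permutes {..<d} \<Longrightarrow> i < a \<Longrightarrow> j < a \<Longrightarrow>
        c (\<tau> \<circ> Transposition.transpose i j) \<beta> = c \<tau> \<beta>"
    and lT: "linear lT" and T: "tangent T = UNIV"
  shows "smooth_fun (\<lambda>x. coef_form d a (\<lambda>\<tau>. bump_coef \<kappa> r c x \<tau> * \<psi> (lT (x - hd ws) / sT)) (\<lambda>i v. l i v / s) vs)"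
    "patch_form a \<kappa> r c \<psi> lT sT T \<in> smooth_forms (int a) T"
proof -
  have "smooth_fun (\<lambda>x. \<psi> (- lT (hd ws) / sT + lT x / sT))"
  proof (rule smooth_fun_compose_affine[OF sm(2)])
    show "bounded_linear (\<lambda>x. lT x / sT)"
      using linear_compose_scale_right[OF lT, of "1 / sT"] by (simp add: linear_conv_bounded_linear)
  qed
  then have chi: "smooth_fun (\<lambda>x. \<psi> (lT (x - hd ws) / sT))"
    by (simp add: linear_diff[OF lT] diff_divide_distrib)
  show sm': "smooth_fun (\<lambda>x. coef_form d a (\<lambda>\<tau>. bump_coef \<kappa> r c x \<tau> * \<psi> (lT (x - hd ws) / sT)) (\<lambda>i v. l i v / s) vs)" for vs
    by (intro smooth_fun_coef_form smooth_fun_mult smooth_fun_kernel_prod sm(1) chi)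
  note lin = linear_scaled
  have "patch_form a \<kappa> r c \<psi> lT sT T x \<in> alt_forms (int a) (tangent T)" if "x \<in> T" for x
  proof -
    have "(\<lambda>vs. if set vs \<subseteq> UNIV then coef_form d a (\<lambda>\<tau>. bump_coef \<kappa> r c x \<tau> * \<psi> (lT (x - hd ws) / sT)) (\<lambda>i v. l i v / s) vs else 0)
        \<in> alt_forms (int a) UNIV"
      by (rule coef_form_alt[OF a lin subspace_UNIV]) (use bump_coef_tail c in auto)
    then show ?thesis using that T by (simp add: patch_form_def[abs_def])
  qed
  then have "patch_form a \<kappa> r c \<psi> lT sT T \<in> dforms (int a) T" by (auto simp: dforms_def patch_form_def)
  moreover have "\<exists>g. smooth_fun g \<and> (\<forall>x\<in>T. patch_form a \<kappa> r c \<psi> lT sT T x vs = g x)" for vs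
    using sm' by (intro exI[of _ "\<lambda>x. coef_form d a (\<lambda>\<tau>. bump_coef \<kappa> r c x \<tau> * \<psi> (lT (x - hd ws) / sT)) (\<lambda>i v. l i v / s) vs"])
      (auto simp: patch_form_def)
  ultimately show "patch_form a \<kappa> r c \<psi> lT sT T \<in> smooth_forms (int a) T" by (simp add: smooth_forms_def)
qed

end

section \<open>Norm estimates for the extended form\<close>

context facet_patch
begin

text \<open>Index d stands for the transversal coordinate, so that all n = d + 1 factors of the
  extension can be treated alike.\<close>

definition coord :: "('a \<Rightarrow> real) \<Rightarrow> real \<Rightarrow> nat \<Rightarrow> 'a \<Rightarrow> real"
  where "coord lT sT i x = (if i < d then lam i x else lT (x - hd ws) / sT)"

text \<open>Each component on basis vectors is a sum of constants times products of n one-variable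
  functions of affine coordinates with gradient at most L / h. The a covectors contribute (L / h)^a,
  the derivative one more L / h, and the assumption K confines everything to a ball of radius \<rho>
  * h, so that \<open>Lp_norm_bound\<close> applies with exponents a and a + 1. In E the factor n^n
  comes from \<open>alt_norm_le\<close>, d! and (r + 1)^d count permutations and exponents, and B
  bounds the weights.\<close>

lemma patch_form_estimates:
  fixes c :: "(nat \<Rightarrow> nat) \<Rightarrow> (nat \<Rightarrow> nat) \<Rightarrow> real" and lT :: "'a \<Rightarrow> real"
  assumes sm: "\<And>i. smooth_fun (\<kappa> i)" "smooth_fun \<psi>" and a: "a \<le> d" and n: "DIM('a) = Suc d"
    and c: "\<And>\<tau> i j \<beta>. \<tau> permutes {..<d} \<Longrightarrow> i < a \<Longrightarrow> j < a \<Longrightarrow>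
        c (\<tau> \<circ> Transposition.transpose i j) \<beta> = c \<tau> \<beta>"
    and lT: "linear lT" and T: "tangent T = UNIV" "compact T" "convex T"
    and B: "\<And>\<tau> \<beta>. \<tau> permutes {..<d} \<Longrightarrow> \<bar>c \<tau> \<beta>\<bar> \<le> B" "0 \<le> B"
    and der: "\<And>i x. (\<kappa> i has_real_derivative \<kappa>' i x) (at x)" "\<And>x. (\<psi> has_real_derivative \<psi>' x) (at x)"
    and M: "\<And>i x. i \<le> r \<Longrightarrow> \<bar>\<kappa> i x\<bar> \<le> M" "\<And>i x. i \<le> r \<Longrightarrow> \<bar>\<kappa>' i x\<bar> \<le> M" "\<And>x. \<bar>\<psi> x\<bar> \<le> M" "\<And>x. \<bar>\<psi>' x\<bar> \<le> M" "1 \<le> M"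
    and z: "\<And>i x. x \<notin> {-1..1} \<Longrightarrow> \<kappa> i x = 0" "\<And>i x. x \<notin> {-1..1} \<Longrightarrow> \<kappa>' i x = 0"
      "\<And>x. x \<notin> {-1..1} \<Longrightarrow> \<psi> x = 0" "\<And>x. x \<notin> {-1..1} \<Longrightarrow> \<psi>' x = 0"
    and h: "0 < h" and L: "1 \<le> L"
    and l_bd: "\<And>i v. i < d \<Longrightarrow> \<bar>l i v / s\<bar> \<le> L / h * norm v" and lT_bd: "\<And>v. \<bar>lT v / sT\<bar> \<le> L / h * norm v"
    and K: "\<And>x. (\<And>i. i < Suc d \<Longrightarrow> coord lT sT i x \<in> {-1..1}) \<Longrightarrow> x \<in> cball q (\<rho> * h)" and rho: "0 \<le> \<rho>"
    and p: "1 \<le> p"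
  defines "E \<equiv> real (DIM('a) ^ DIM('a)) * (real DIM('a) * (fact d * real (Suc r ^ d) * B * (real DIM('a) * M ^ DIM('a) * L ^ DIM('a))))
      * (1 + unit_ball_vol (real DIM('a)) * \<rho> ^ DIM('a))"
  shows "Lp_norm p (int a) T (patch_form a \<kappa> r c \<psi> lT sT T) \<le> ereal (E * h powr (dim_over DIM('a) p - real a))" (is ?one)
    "Lp_norm p (int a + 1) T (ext_deriv T (patch_form a \<kappa> r c \<psi> lT sT T))
      \<le> ereal (E * h powr (dim_over DIM('a) p - real a - 1))" (is ?two)
proof -
  let ?n = "Suc d" and ?P = "{\<tau>. \<tau> permutes {..<d}}" and ?X = "{..<d} \<rightarrow>\<^sub>E {..r}"
  let ?\<Xi> = "patch_form a \<kappa> r c \<psi> lT sT T" and ?l = "\<lambda>i v. l i v / s"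
  let ?k = "\<lambda>\<beta> i. if i < d then \<kappa> (\<beta> i) else \<psi>" and ?k' = "\<lambda>\<beta> i. if i < d then \<kappa>' (\<beta> i) else \<psi>'"
  let ?A = "\<lambda>i v. if i < d then l i v / s else lT v / sT"
  let ?p = "\<lambda>i. if i < d then - (l i (hd ws) + off i) / s else - lT (hd ws) / sT"
  let ?f = "\<lambda>\<beta> x. \<Prod>i<?n. ?k \<beta> i (?p i + ?A i x)"
  let ?N = "fact d * real (Suc r ^ d)"
  let ?Mn = "real ?n * M ^ ?n"
  have L0: "0 \<le> L / h" using L h by simp
  have coord: "coord lT sT i x = ?p i + ?A i x" for i x
    using lam_eq_affine by (simp add: coord_def linear_diff[OF lT] diff_divide_distrib)
  have lbd: "\<bar>?A i v\<bar> \<le> L / h * norm v" if "i < ?n" for i v using l_bd lT_bd by auto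
  have linA: "linear (?A i)" if "i < ?n" for i
    using linear_scaled[of i] linear_compose_scale_right[OF lT, of "1 / sT"] by (cases "i < d") simp_all
  have fX: "finite ?X" by (rule finite_exponents)
  have fP: "finite ?P" by (rule finite_permutations) simp
  have cardX: "card ?X = Suc r ^ d" by (simp add: card_PiE)
  have cardP: "card ?P = fact d" by (rule card_permutations) auto
  have beta: "\<beta> i \<le> r" if "\<beta> \<in> ?X" "i < d" for \<beta> i using that by (auto simp: PiE_def Pi_def)
  define C where "C vs \<tau> \<beta> = of_int (sign \<tau>) * c \<tau> \<beta> * prod_list (map2 ?l (map \<tau> [0..<a]) vs)" for vs \<tau> \<beta>
  define G where "G vs x = coef_form d a (\<lambda>\<tau>. bump_coef \<kappa> r c x \<tau> * \<psi> (lT (x - hd ws) / sT)) ?l vs" for vs x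
  have G_eq: "G vs x = (\<Sum>\<tau>\<in>?P. \<Sum>\<beta>\<in>?X. C vs \<tau> \<beta> * ?f \<beta> x)" if "length vs = a" for vs x
  proof -
    have "?f \<beta> x = (\<Prod>j<d. \<kappa> (\<beta> j) (lam j x)) * \<psi> (lT (x - hd ws) / sT)" for \<beta>
      using lam_eq_affine by (simp add: linear_diff[OF lT] diff_divide_distrib)
    then show ?thesis using that
      by (simp add: G_def coef_form_def bump_coef_def C_def sum_distrib_left sum_distrib_right ac_simps)
  qed
  have C_bd: "\<bar>C vs \<tau> \<beta>\<bar> \<le> B * (L / h) ^ a" if vs: "length vs = a" "set vs \<subseteq> Basis" and t: "\<tau> \<in> ?P" for vs \<tau> \<beta>
  proof -
    have "\<bar>prod_list (map2 ?l (map \<tau> [0..<a]) vs)\<bar> \<le> (L / h) ^ a"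
    proof (rule prod_list_map2_bound[OF vs(1) a _ _ L0])
      show "\<bar>l i v / s\<bar> \<le> L / h" if "i < d" "v \<in> set vs" for i v
        using l_bd[OF that(1), of v] norm_Basis[of v] that(2) vs(2) by auto
    qed (use t in simp)
    then have "\<bar>c \<tau> \<beta>\<bar> * \<bar>prod_list (map2 ?l (map \<tau> [0..<a]) vs)\<bar> \<le> B * (L / h) ^ a"
      using B t by (intro mult_mono) auto
    then show ?thesis by (simp add: C_def abs_mult flip: of_int_abs)
  qed
  have k_der: "(?k \<beta> i has_real_derivative ?k' \<beta> i x) (at x)" for \<beta> i x using der by simp
  have k_bd: "\<bar>?k \<beta> i x\<bar> \<le> M" "\<bar>?k' \<beta> i x\<bar> \<le> M" if "\<beta> \<in> ?X" for \<beta> i x using M beta[OF that] by auto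
  have k_z: "?k \<beta> i x = 0" "?k' \<beta> i x = 0" if "x \<notin> {-1..1}" for \<beta> i x using z that by auto
  have f_bd: "\<bar>?f \<beta> x\<bar> \<le> M ^ ?n" if "\<beta> \<in> ?X" for \<beta> x
  proof -
    have "(\<Prod>i<?n. \<bar>?k \<beta> i (?p i + ?A i x)\<bar>) \<le> (\<Prod>i<?n. M)"
      by (rule prod_mono) (use k_bd[OF that] in auto)
    then show ?thesis by (simp only: abs_prod prod_constant card_lessThan)
  qed
  have outside: "\<exists>i<?n. ?p i + ?A i x \<notin> {-1..1}" if "x \<notin> cball q (\<rho> * h)" for x
    using K[of x] that unfolding coord by blast
  have f_0: "?f \<beta> x = 0" if x: "x \<notin> cball q (\<rho> * h)" for \<beta> x
  proof -
    obtain i where i: "i < ?n" "?p i + ?A i x \<notin> {-1..1}" using outside[OF x] by blast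
    have "?k \<beta> i (?p i + ?A i x) = 0" by (rule k_z(1)[OF i(2)])
    then show ?thesis using i(1) by (intro prod_zero bexI[of _ i]) simp_all
  qed
  have "\<exists>D. (\<forall>x. (?f \<beta> has_derivative D x) (at x)) \<and> (\<forall>x v. \<bar>D x v\<bar> \<le> ?Mn * (L / h * norm v)) \<and>
      (\<forall>x v. x \<notin> cball q (\<rho> * h) \<longrightarrow> D x v = 0)" if b: "\<beta> \<in> ?X" for \<beta>
  proof (rule prod_has_derivative_bound[where k = "?k \<beta>" and k' = "?k' \<beta>" and A = ?A and p = ?p and n = ?n and M = M and L = "L / h"])
    show "(?k \<beta> i has_real_derivative ?k' \<beta> i x) (at x)" for i x by (rule k_der)
    show "\<bar>?k \<beta> i x\<bar> \<le> M" "\<bar>?k' \<beta> i x\<bar> \<le> M" for i x by (rule k_bd[OF b])+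
    show "?k \<beta> i x = 0" "?k' \<beta> i x = 0" if "x \<notin> {-1..1}" for i x by (rule k_z[OF that])+
    fix D assume D: "\<And>x. (?f \<beta> has_derivative D x) (at x)" "\<And>x v. \<bar>D x v\<bar> \<le> ?Mn * (L / h * norm v)"
      "\<And>x v i. i < ?n \<Longrightarrow> ?p i + ?A i x \<notin> {-1..1} \<Longrightarrow> D x v = 0"
    have "D x v = 0" if "x \<notin> cball q (\<rho> * h)" for x v
      using outside[OF that] D(3) by blast
    then show ?thesis using D(1,2) by blast
  qed (use linA lbd M(5) in auto)
  then have "\<forall>\<beta>\<in>?X. \<exists>D. (\<forall>x. (?f \<beta> has_derivative D x) (at x)) \<and> (\<forall>x v. \<bar>D x v\<bar> \<le> ?Mn * (L / h * norm v)) \<and>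
      (\<forall>x v. x \<notin> cball q (\<rho> * h) \<longrightarrow> D x v = 0)" by blast
  from bchoice[OF this] obtain D where D0: "\<forall>\<beta>\<in>?X. (\<forall>x. (?f \<beta> has_derivative D \<beta> x) (at x)) \<and>
      (\<forall>x v. \<bar>D \<beta> x v\<bar> \<le> ?Mn * (L / h * norm v)) \<and> (\<forall>x v. x \<notin> cball q (\<rho> * h) \<longrightarrow> D \<beta> x v = 0)" ..
  have D: "(?f \<beta> has_derivative D \<beta> x) (at x)" "\<bar>D \<beta> x v\<bar> \<le> ?Mn * (L / h * norm v)"
    "x \<notin> cball q (\<rho> * h) \<Longrightarrow> D \<beta> x v = 0" if "\<beta> \<in> ?X" for \<beta> x v
    using D0 that by blast+
  define DG where "DG vs x v = (\<Sum>\<tau>\<in>?P. \<Sum>\<beta>\<in>?X. C vs \<tau> \<beta> * D \<beta> x v)" for vs x v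
  have DG: "(G vs has_derivative DG vs x) (at x)" if "length vs = a" for vs x
    unfolding G_eq[OF that, abs_def] DG_def[abs_def] using D(1)
    by (intro has_derivative_sum has_derivative_mult_right)
  have double_sum: "\<bar>\<Sum>\<tau>\<in>?P. \<Sum>\<beta>\<in>?X. C vs \<tau> \<beta> * F \<beta>\<bar> \<le> ?N * (B * (L / h) ^ a * Y)"
    if vs: "length vs = a" "set vs \<subseteq> Basis" and F: "\<And>\<beta>. \<beta> \<in> ?X \<Longrightarrow> \<bar>F \<beta>\<bar> \<le> Y" for vs F Y
  proof -
    have "\<bar>\<Sum>\<tau>\<in>?P. \<Sum>\<beta>\<in>?X. C vs \<tau> \<beta> * F \<beta>\<bar> \<le> (\<Sum>\<tau>\<in>?P. \<Sum>\<beta>\<in>?X. B * (L / h) ^ a * Y)"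
    proof (rule order_trans[OF sum_abs sum_mono], rule order_trans[OF sum_abs sum_mono])
      fix \<tau> \<beta> assume "\<tau> \<in> ?P" "\<beta> \<in> ?X"
      then show "\<bar>C vs \<tau> \<beta> * F \<beta>\<bar> \<le> B * (L / h) ^ a * Y"
        unfolding abs_mult using C_bd[OF vs] F B(2) L0 by (intro mult_mono) auto
    qed
    also have "\<dots> = ?N * (B * (L / h) ^ a * Y)" using cardX cardP by simp
    finally show ?thesis .
  qed
  \<comment> \<open>Since 1 \<le> L, powers of L are raised to the common exponent n; only h keeps
    its exact power.\<close>
  have Lpow: "(L / h) ^ j \<le> L ^ ?n * h powr (- real j)" if "j \<le> ?n" for j
  proof -
    have "(L / h) ^ j = L ^ j * h powr (- real j)"
      using h by (simp add: power_divide powr_minus powr_realpow field_simps)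
    also have "\<dots> \<le> L ^ ?n * h powr (- real j)"
      using L that by (intro mult_right_mono power_increasing) auto
    finally show ?thesis .
  qed
  \<comment> \<open>One factor n is spent on the product rule, the other on the a + 1 summands of
    the exterior derivative. For the form itself both are slack, which gives a single constant for
    the two estimates.\<close>
  let ?E0 = "real ?n * (?N * B * (real ?n * M ^ ?n * L ^ ?n))"
  have E0: "0 \<le> ?E0" using B(2) M(5) L by simp
  have Mn1: "0 \<le> M ^ ?n" using M(5) by simp
  have G_bd: "\<bar>G vs x\<bar> \<le> ?E0 * h powr (- real a) * indicator (cball q (\<rho> * h)) x"
    if vs: "length vs = a" "set vs \<subseteq> Basis" for vs x
  proof (cases "x \<in> cball q (\<rho> * h)")
    case False
    then have "G vs x = 0" unfolding G_eq[OF vs(1)] using f_0[OF False]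
      by (intro sum.neutral ballI) (simp only: mult_zero_right)
    then show ?thesis using False by simp
  next
    case True
    have "\<bar>G vs x\<bar> \<le> ?N * (B * (L / h) ^ a * M ^ ?n)"
      unfolding G_eq[OF vs(1)] by (rule double_sum[OF vs f_bd])
    also have "\<dots> \<le> ?N * (B * (L ^ ?n * h powr (- real a)) * M ^ ?n)"
      using Lpow[of a] a B(2) Mn1 by (intro mult_left_mono mult_right_mono) auto
    also have "\<dots> = 1 * (1 * (?N * (B * (L ^ ?n * h powr (- real a)) * M ^ ?n)))" by simp
    also have "\<dots> \<le> real ?n * (real ?n * (?N * (B * (L ^ ?n * h powr (- real a)) * M ^ ?n)))"
      using B(2) Mn1 L by (intro mult_mono) auto
    finally show ?thesis using True by (simp add: ac_simps)
  qed
  have smG: "smooth_fun (G vs)" for vs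
    unfolding G_def[abs_def] by (rule patch_form_smooth(1)[where \<kappa> = \<kappa> and \<psi> = \<psi> and c = c and lT = lT and T = T and a = a, OF sm a c lT T(1)])
  have Xi_T: "?\<Xi> x vs = G vs x" if "x \<in> T" for x vs using that by (simp add: patch_form_def G_def)
  have G_len: "G vs x = 0" if "length vs \<noteq> a" for vs x using that by (simp add: G_def coef_form_def)
  have Tl: "T \<in> lmeasurable" using T(2) by (rule lmeasurable_compact)
  then have Ts: "T \<in> sets lebesgue" by (rule fmeasurableD)
  have nnK: "real (DIM('a) ^ DIM('a)) * ?E0 \<ge> 0" using E0 by simp
  have Xi_meas: "(\<lambda>x. ?\<Xi> x vs) \<in> borel_measurable (lebesgue_on T)" for vs
  proof (rule borel_measurable_lebesgue_on_spike[OF Ts negligible_empty])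
    show "G vs \<in> borel_measurable (lebesgue_on T)"
      by (rule continuous_imp_measurable_on_sets_lebesgue[OF smooth_fun_continuous_on[OF smG] Ts])
  qed (use Xi_T in auto)
  show ?one
  proof -
    have "Lp_norm p (int a) T ?\<Xi> \<le> ereal ((real (DIM('a) ^ DIM('a)) * ?E0) * (1 + unit_ball_vol (real DIM('a)) * \<rho> ^ DIM('a))
        * h powr (dim_over DIM('a) p - real a))"
    proof (rule Lp_norm_bound[OF Tl alt_norm_measurable[OF Xi_meas] _ nnK rho h p])
      show "AE x in lebesgue_on T. alt_norm (int a) (?\<Xi> x) \<le>
          real (DIM('a) ^ DIM('a)) * ?E0 * h powr (- real a) * indicator (cball q (\<rho> * h)) x"
      proof (rule AE_I2)
        fix x assume "x \<in> space (lebesgue_on T)"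
        then have x: "x \<in> T" by (simp add: space_restrict_space)
        have "alt_norm (int a) (?\<Xi> x) \<le> real (DIM('a) ^ DIM('a)) * (?E0 * h powr (- real a) * indicator (cball q (\<rho> * h)) x)"
        proof (rule alt_norm_le)
          show "\<bar>?\<Xi> x vs\<bar> \<le> ?E0 * h powr (- real a) * indicator (cball q (\<rho> * h)) x"
            if "int (length vs) = int a" "set vs \<subseteq> Basis" for vs
            using G_bd[of vs x] that Xi_T[OF x] by simp
          show "0 \<le> ?E0 * h powr (- real a) * indicator (cball q (\<rho> * h)) x"
            by (intro mult_nonneg_nonneg[OF mult_nonneg_nonneg[OF E0]]) auto
          show "int a \<le> int DIM('a)" using a n by simp
        qed
        then show "alt_norm (int a) (?\<Xi> x) \<le>
          real (DIM('a) ^ DIM('a)) * ?E0 * h powr (- real a) * indicator (cball q (\<rho> * h)) x"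
          by (simp only: mult.assoc)
      qed
    qed
    then show ?thesis unfolding E_def n .
  qed
  \<comment> \<open>The exterior derivative computed from the extension G to the whole space. It
    agrees with \<open>ext_deriv\<close> in the interior of T, and the boundary is a null
    set.\<close>
  define H where "H vs x = (\<Sum>j<length vs. (-1) ^ j * DG (take j vs @ drop (Suc j) vs) x (vs ! j))" for vs x
  have cut_len: "length (take j vs @ drop (Suc j) vs) = length vs - 1" if "j < length vs" for j and vs :: "'a list"
    using that by simp
  have cut_set: "set (take j vs @ drop (Suc j) vs) \<subseteq> set vs" for j and vs :: "'a list"
    using set_take_subset set_drop_subset by fastforce
  have frech: "frechet_derivative (\<lambda>y. ?\<Xi> y ws') (at x within T) = D'"
    if x: "x \<in> interior T" and D': "(G ws' has_derivative D') (at x)" for x ws' D'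
  proof -
    have "((\<lambda>y. ?\<Xi> y ws') has_derivative D') (at x)"
      by (rule has_derivative_transform_within_open[OF D' open_interior x])
        (use Xi_T[OF subsetD[OF interior_subset]] in simp)
    then have "frechet_derivative (\<lambda>y. ?\<Xi> y ws') (at x) = D'" by (rule frechet_derivative_at[symmetric])
    then show ?thesis using at_within_interior[OF x] by simp
  qed
  have ext_eq: "ext_deriv T ?\<Xi> x vs = H vs x" if x: "x \<in> interior T" and vs: "length vs = Suc a" for x vs
  proof -
    have "frechet_derivative (\<lambda>y. ?\<Xi> y (take j vs @ drop (Suc j) vs)) (at x within T) =
        DG (take j vs @ drop (Suc j) vs) x" if "j < length vs" for j
      by (rule frech[OF x DG]) (use cut_len[OF that] vs in simp)
    then show ?thesis using x interior_subset[of T] by (auto simp: ext_deriv_def H_def intro!: sum.cong)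
  qed
  \<comment> \<open>Measurability of the norm is derived from that of all components, so lists of
    the wrong length have to be settled as well.\<close>
  have ext_0: "ext_deriv T ?\<Xi> x vs = 0" if x: "x \<in> interior T" and vs: "length vs \<noteq> Suc a" for x vs
  proof -
    have "frechet_derivative (\<lambda>y. ?\<Xi> y (take j vs @ drop (Suc j) vs)) (at x within T) = (\<lambda>v. 0)"
      if "j < length vs" for j
    proof (rule frech[OF x])
      have "G (take j vs @ drop (Suc j) vs) = (\<lambda>x. 0)"
        using G_len cut_len[OF that] vs that by (intro ext) simp
      then show "(G (take j vs @ drop (Suc j) vs) has_derivative (\<lambda>v. 0)) (at x)" by simp
    qed
    then show ?thesis by (auto simp: ext_deriv_def intro!: sum.neutral)
  qed
  have neg: "negligible (T - interior T)"
    using negligible_convex_frontier[OF T(3)] compact_imp_closed[OF T(2)]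
    by (simp add: frontier_def closure_closed)
  have H_meas: "H vs \<in> borel_measurable (lebesgue_on T)" if vs: "length vs = Suc a" for vs
  proof -
    have "continuous_on T (\<lambda>x. DG ws' x v)" if ws': "length ws' = a" for ws' v
    proof -
      obtain g' where g': "\<And>x. (G ws' has_derivative g' x) (at x)" "\<And>h. smooth_fun (\<lambda>x. g' x h)"
        using smooth_fun_derivative[OF smG[of ws']] by blast
      have "g' x = DG ws' x" for x by (rule has_derivative_unique[OF g'(1) DG[OF ws']])
      then show ?thesis using smooth_fun_continuous_on[OF g'(2)[of v]] by simp
    qed
    then have "continuous_on T (H vs)" unfolding H_def[abs_def]
      by (intro continuous_intros) (use cut_len vs in simp)
    then show ?thesis by (rule continuous_imp_measurable_on_sets_lebesgue[OF _ Ts])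
  qed
  have ext_meas: "(\<lambda>x. ext_deriv T ?\<Xi> x vs) \<in> borel_measurable (lebesgue_on T)" for vs
  proof (cases "length vs = Suc a")
    case True
    show ?thesis
      by (rule borel_measurable_lebesgue_on_spike[OF Ts neg H_meas[OF True]]) (use ext_eq True in auto)
  next
    case False
    show ?thesis
      by (rule borel_measurable_lebesgue_on_spike[OF Ts neg borel_measurable_const[of 0]]) (use ext_0 False in auto)
  qed
  have H_bd: "\<bar>H vs x\<bar> \<le> ?E0 * h powr (- (real a + 1)) * indicator (cball q (\<rho> * h)) x"
    if vs: "length vs = Suc a" "set vs \<subseteq> Basis" for vs x
  proof (cases "x \<in> cball q (\<rho> * h)")
    case False
    have "DG ws' x v = 0" for ws' v
      unfolding DG_def using D(3)[OF _ False] by (intro sum.neutral ballI) simp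
    then show ?thesis using False by (simp add: H_def)
  next
    case True
    have "\<bar>H vs x\<bar> \<le> (\<Sum>j<length vs. ?N * (B * (L / h) ^ a * (?Mn * (L / h * 1))))"
      unfolding H_def
    proof (rule order_trans[OF sum_abs sum_mono])
      fix j assume j: "j \<in> {..<length vs}"
      let ?w = "take j vs @ drop (Suc j) vs"
      have w: "length ?w = a" "set ?w \<subseteq> Basis" using cut_len[of j vs] cut_set[of j vs] j vs by auto
      have nv: "norm (vs ! j) = 1" using j vs(2) by (intro norm_Basis) auto
      have "\<bar>D \<beta> x (vs ! j)\<bar> \<le> ?Mn * (L / h * 1)" if "\<beta> \<in> ?X" for \<beta>
        using D(2)[OF that, of x "vs ! j"] nv by simp
      then have "\<bar>DG ?w x (vs ! j)\<bar> \<le> ?N * (B * (L / h) ^ a * (?Mn * (L / h * 1)))"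
        unfolding DG_def by (rule double_sum[OF w])
      then show "\<bar>(-1) ^ j * DG ?w x (vs ! j)\<bar> \<le> ?N * (B * (L / h) ^ a * (?Mn * (L / h * 1)))"
        by (simp add: abs_mult power_abs)
    qed
    also have "\<dots> = real (Suc a) * (?N * B * ?Mn * (L / h) ^ Suc a)" using vs(1) by (simp add: ac_simps)
    also have "\<dots> \<le> real ?n * (?N * B * ?Mn * (L ^ ?n * h powr (- real (Suc a))))"
    proof (rule mult_mono)
      have nn: "0 \<le> ?N * B * ?Mn" using B(2) Mn1 by (intro mult_nonneg_nonneg) auto
      then show "?N * B * ?Mn * (L / h) ^ Suc a \<le> ?N * B * ?Mn * (L ^ ?n * h powr (- real (Suc a)))"
        using Lpow[of "Suc a"] a by (intro mult_left_mono) auto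
      show "0 \<le> ?N * B * ?Mn * (L / h) ^ Suc a"
        using nn L0 by (intro mult_nonneg_nonneg[OF nn] zero_le_power)
    qed (use a in auto)
    finally show ?thesis using True by (simp add: ac_simps)
  qed
  show ?two
  proof -
    have "Lp_norm p (int a + 1) T (ext_deriv T ?\<Xi>) \<le> ereal ((real (DIM('a) ^ DIM('a)) * ?E0) * (1 + unit_ball_vol (real DIM('a)) * \<rho> ^ DIM('a))
        * h powr (dim_over DIM('a) p - (real a + 1)))"
    proof (rule Lp_norm_bound[OF Tl alt_norm_measurable[OF ext_meas] _ nnK rho h p])
      have "AE x in lebesgue. x \<notin> T - interior T"
        using neg by (intro AE_not_in) (simp add: negligible_iff_null_sets)
      moreover have "T \<inter> space lebesgue \<in> sets lebesgue" using Ts by simp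
      ultimately have "AE x in lebesgue_on T. x \<in> interior T"
        by (subst AE_restrict_space_iff) auto
      then show "AE x in lebesgue_on T. alt_norm (int a + 1) (ext_deriv T ?\<Xi> x) \<le>
          real (DIM('a) ^ DIM('a)) * ?E0 * h powr (- (real a + 1)) * indicator (cball q (\<rho> * h)) x"
      proof (rule AE_mp, intro AE_I2 impI)
        fix x assume x: "x \<in> interior T"
        have "alt_norm (int a + 1) (ext_deriv T ?\<Xi> x) \<le>
            real (DIM('a) ^ DIM('a)) * (?E0 * h powr (- (real a + 1)) * indicator (cball q (\<rho> * h)) x)"
        proof (rule alt_norm_le)
          show "\<bar>ext_deriv T ?\<Xi> x vs\<bar> \<le> ?E0 * h powr (- (real a + 1)) * indicator (cball q (\<rho> * h)) x"
            if "int (length vs) = int a + 1" "set vs \<subseteq> Basis" for vs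
            using H_bd[of vs x] ext_eq[OF x, of vs] that by simp
          show "0 \<le> ?E0 * h powr (- (real a + 1)) * indicator (cball q (\<rho> * h)) x"
            by (intro mult_nonneg_nonneg[OF mult_nonneg_nonneg[OF E0]]) auto
          show "int a + 1 \<le> int DIM('a)" using a n by simp
        qed
        then show "alt_norm (int a + 1) (ext_deriv T ?\<Xi> x) \<le>
          real (DIM('a) ^ DIM('a)) * ?E0 * h powr (- (real a + 1)) * indicator (cball q (\<rho> * h)) x"
          by (simp only: mult.assoc)
      qed
    qed
    then show ?thesis unfolding E_def n by (simp only: diff_diff_eq)
  qed
qed

end

text \<open>A gap \<delta> in the values of a linear functional with norm at most K forces distance
  \<delta> / K. The closure is included because \<open>form_support\<close> is a closure.\<close>

lemma separated_by_linear:
  fixes f :: "'a::euclidean_space \<Rightarrow> real"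
  assumes f: "linear f" and \<delta>: "0 < \<delta>" and X: "\<And>x. x \<in> X \<Longrightarrow> c + \<delta> \<le> f x" and Y: "\<And>y. y \<in> Y \<Longrightarrow> f y = c"
  shows "separated (closure X) Y"
proof -
  obtain K where K: "0 < K" "\<And>x. \<bar>f x\<bar> \<le> K * norm x"
    using linear_bounded_pos[OF f] by (auto simp: mult.commute)
  have "closure X \<subseteq> {x. c + \<delta> \<le> f x}"
  proof (rule closure_minimal)
    show "closed {x. c + \<delta> \<le> f x}"
      using f by (intro closed_Collect_le continuous_on_const linear_continuous_on)
        (simp add: linear_conv_bounded_linear)
  qed (use X in auto)
  then have "\<delta> / K \<le> dist x y" if "x \<in> closure X" "y \<in> Y" for x y
  proof -
    have "c + \<delta> \<le> f x" using that(1) \<open>closure X \<subseteq> _\<close> by blast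
    then have "\<delta> \<le> f (x - y)" using Y[OF that(2)] by (simp add: linear_diff[OF f])
    also have "\<dots> \<le> K * norm (x - y)" using K(2)[of "x - y"] by simp
    finally show ?thesis using K(1) by (simp add: dist_norm field_simps)
  qed
  then show ?thesis unfolding separated_def using \<delta> K(1) by (intro exI[of _ "\<delta> / K"]) auto
qed

section \<open>The simplex over a facet, its coordinates and the separation from other
  facets\<close>

lemma dual_functionals:
  fixes es :: "'a::euclidean_space list"
  assumes "distinct es" "independent (set es)"
  obtains f :: "nat \<Rightarrow> 'a \<Rightarrow> real" where "\<And>i. i < length es \<Longrightarrow> linear (f i)"
    "\<And>i j. i < length es \<Longrightarrow> j < length es \<Longrightarrow> f i (es ! j) = (if i = j then 1 else 0)"
proof -
  have "\<forall>i. \<exists>g. linear g \<and> (\<forall>x\<in>set es. g x = (if x = es ! i then 1 else (0::real)))"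
    using linear_independent_extend[OF assms(2), of "\<lambda>x. if x = es ! _ then 1 else (0::real)"] by simp
  from choice[OF this] obtain f where f: "\<And>i. linear (f i)"
    "\<And>i x. x \<in> set es \<Longrightarrow> f i x = (if x = es ! i then 1 else (0::real))" by blast
  show ?thesis
  proof (rule that)
    show "linear (f i)" for i by (rule f(1))
    show "f i (es ! j) = (if i = j then 1 else 0)" if "i < length es" "j < length es" for i j
      using f(2)[of "es ! j" i] that nth_eq_iff_index_eq[OF assms(1)] by auto
  qed
qed

lemma simplex_edges_snoc: "ws \<noteq> [] \<Longrightarrow> simplex_edges (ws @ [v]) = simplex_edges ws @ [v - hd ws]"
  by (simp add: simplex_edges_def)

text \<open>\<open>l\<close> and \<open>lT\<close> are now the barycentric coordinates of the full
  simplex relative to hd ws: \<open>l i\<close> belongs to \<open>ws ! Suc i\<close>, and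
  \<open>lT\<close> to v. The condition \<open>sT \<le> s\<close> controls the coordinate of hd ws
  on the support.\<close>

locale simplex_patch = facet_patch ws d l s off
  for ws :: "'a::euclidean_space list" and d l s off +
  fixes v :: 'a and lT :: "'a \<Rightarrow> real" and sT :: real
  assumes dim: "DIM('a) = Suc d" and distinct_ws: "distinct ws" and v: "v \<notin> set ws"
    and ind: "\<not> affine_dependent (insert v (set ws))"
    and l_v: "\<And>i. i < d \<Longrightarrow> l i (v - hd ws) = 0"
    and lT_linear: "linear lT" and lT_edges: "\<And>j. j < d \<Longrightarrow> lT (simplex_edges ws ! j) = 0"
    and lT_v: "lT (v - hd ws) = 1" and sT_pos: "0 < sT" and sT_le: "sT \<le> s"
begin

abbreviation "T \<equiv> convex hull (insert v (set ws))"

lemma edge_nth: "i < d \<Longrightarrow> simplex_edges ws ! i = ws ! Suc i - hd ws"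
  using length_ws ws_nonempty by (simp add: simplex_edges_def nth_tl)

lemma vertex_cases:
  assumes "u \<in> insert v (set ws)"
  obtains "u = v" | "u = hd ws" | i where "i < d" "u = ws ! Suc i" "u - hd ws = simplex_edges ws ! i"
proof -
  consider "u = v" | j where "j < Suc d" "u = ws ! j" using assms length_ws by (auto simp: in_set_conv_nth)
  then show ?thesis
  proof cases
    case 2
    then show ?thesis using that edge_nth ws_nonempty by (cases j) (auto simp: hd_conv_nth)
  qed (rule that(1))
qed

lemma l_vertex: "u \<in> insert v (set ws) \<Longrightarrow> i < d \<Longrightarrow> l i (u - hd ws) = (if u = ws ! Suc i then 1 else 0)"
proof -
  assume u: "u \<in> insert v (set ws)" and i: "i < d"
  have "ws ! Suc i \<noteq> v" using v i length_ws nth_mem by force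
  note n1 = this
  have n2: "ws ! Suc i \<noteq> hd ws"
    using distinct_ws i length_ws ws_nonempty by (simp add: hd_conv_nth nth_eq_iff_index_eq)
  have n3: "ws ! Suc i = ws ! Suc j \<longleftrightarrow> i = j" if "j < d" for j
    using distinct_ws i length_ws that by (simp add: nth_eq_iff_index_eq)
  from u show ?thesis
  proof (cases rule: vertex_cases)
    case 1
    then show ?thesis using l_v[OF i] n1 by simp
  next
    case 2
    then show ?thesis using linear_0[OF l_linear[OF i]] n2 by simp
  next
    case (3 j)
    then show ?thesis using l_edges[OF i 3(1)] n3[OF 3(1)] by auto
  qed
qed

lemma lT_vertex: "u \<in> insert v (set ws) \<Longrightarrow> lT (u - hd ws) = (if u = v then 1 else 0)"
proof -
  assume u: "u \<in> insert v (set ws)"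
  from u show ?thesis
  proof (cases rule: vertex_cases)
    case 2
    then have "u \<noteq> v" using v ws_nonempty hd_in_set by blast
    then show ?thesis using 2 linear_0[OF lT_linear] by simp
  next
    case (3 j)
    then have "u \<noteq> v" using v length_ws nth_mem[of "Suc j" ws] by auto
    then show ?thesis using 3 lT_edges by simp
  qed (simp add: lT_v)
qed

lemma l_diff_le: "u \<in> insert v (set ws) \<Longrightarrow> w \<in> insert v (set ws) \<Longrightarrow> i < d \<Longrightarrow> \<bar>l i (u - w)\<bar> \<le> 1"
  using l_vertex[of u i] l_vertex[of w i] linear_diff[OF l_linear, of i "u - hd ws" "w - hd ws"] by auto

lemma lT_diff_le: "u \<in> insert v (set ws) \<Longrightarrow> w \<in> insert v (set ws) \<Longrightarrow> \<bar>lT (u - w)\<bar> \<le> 1"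
  using lT_vertex[of u] lT_vertex[of w] linear_diff[OF lT_linear, of "u - hd ws" "w - hd ws"] by auto

lemma T_edges:
  shows "distinct (simplex_edges (ws @ [v]))" "span (set (simplex_edges (ws @ [v]))) = UNIV"
proof -
  have e: "distinct (simplex_edges (ws @ [v]))" "independent (set (simplex_edges (ws @ [v])))"
    using simplex_edges_independent[of "ws @ [v]"] distinct_ws v ind by auto
  show "distinct (simplex_edges (ws @ [v]))" by (rule e(1))
  have "card (set (simplex_edges (ws @ [v]))) = DIM('a)"
    using distinct_card[OF e(1)] dim length_ws by (simp add: simplex_edges_def)
  then show "span (set (simplex_edges (ws @ [v]))) = UNIV"
    using card_ge_dim_independent[of "set (simplex_edges (ws @ [v]))" UNIV] e(2) by auto
qed

lemma tangent_T: "tangent T = UNIV"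
proof -
  have "set (simplex_edges (ws @ [v])) \<subseteq> tangent T"
    by (rule simplex_edges_tangent) (use hull_subset[of "insert v (set ws)" convex] in auto)
  then have "span (set (simplex_edges (ws @ [v]))) \<subseteq> tangent T"
    by (intro span_minimal subspace_tangent)
  then show ?thesis using T_edges(2) by auto
qed

lemma space_expand: "x = (\<Sum>i<d. l i x *\<^sub>R (simplex_edges ws ! i)) + lT x *\<^sub>R (v - hd ws)"
proof -
  let ?p = "\<lambda>x. (\<Sum>i<d. l i x *\<^sub>R (simplex_edges ws ! i)) + lT x *\<^sub>R (v - hd ws)"
  have lin: "linear ?p"
  proof (rule linearI)
    show "?p (x + y) = ?p x + ?p y" for x y
      by (simp add: linear_add[OF l_linear] linear_add[OF lT_linear] scaleR_add_left sum.distrib)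
    show "?p (c *\<^sub>R x) = c *\<^sub>R ?p x" for c x
      by (simp add: linear_scale[OF l_linear] linear_scale[OF lT_linear] scaleR_sum_right scaleR_add_right)
  qed
  have "id e = ?p e" if e: "e \<in> set (simplex_edges (ws @ [v]))" for e
  proof -
    consider "e = v - hd ws" | j where "j < d" "e = simplex_edges ws ! j"
    proof -
      have "e = v - hd ws \<or> e \<in> set (simplex_edges ws)"
        using e unfolding simplex_edges_snoc[OF ws_nonempty] by simp
      moreover have "\<exists>j<d. simplex_edges ws ! j = e" if "e \<in> set (simplex_edges ws)"
        using that length_edges by (simp add: in_set_conv_nth)
      ultimately show ?thesis using that by blast
    qed
    then show ?thesis
    proof cases
      case 1
      then show ?thesis using l_v lT_v by simp
    next
      case 2
      have "(\<Sum>i<d. l i e *\<^sub>R (simplex_edges ws ! i)) = (\<Sum>i<d. if i = j then simplex_edges ws ! j else 0)"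
      proof (rule sum.cong[OF refl])
        fix i assume "i \<in> {..<d}"
        then show "l i e *\<^sub>R simplex_edges ws ! i = (if i = j then simplex_edges ws ! j else 0)"
          unfolding 2(2) using l_edges[OF _ 2(1), of i] by simp
      qed
      also have "\<dots> = e" using 2 by simp
      finally show ?thesis using lT_edges[OF 2(1)] 2(2) by simp
    qed
  qed
  note eq = this
  have "id x = ?p x"
    by (rule linear_eq_on_span[OF linear_id lin eq]) (assumption, simp only: T_edges(2) UNIV_I)
  then show ?thesis unfolding id_apply .
qed

text \<open>The centre is the point where all patch coordinates vanish, the image of hd ws under the
  contraction. Moving one of the n coordinates within [-1, 1] displaces the point by at most
  L.\<close>

lemma coord_cball:
  assumes x: "\<And>i. i < Suc d \<Longrightarrow> coord lT sT i x \<in> {-1..1}"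
    and E: "\<And>i. i < d \<Longrightarrow> s * norm (simplex_edges ws ! i) \<le> L" and ET: "sT * norm (v - hd ws) \<le> L"
  shows "x \<in> cball (hd ws + (\<Sum>i<d. off i *\<^sub>R (simplex_edges ws ! i))) (real (Suc d) * L)"
proof -
  let ?q = "hd ws + (\<Sum>i<d. off i *\<^sub>R (simplex_edges ws ! i))"
  have "x - hd ws = (\<Sum>i<d. l i (x - hd ws) *\<^sub>R (simplex_edges ws ! i)) + lT (x - hd ws) *\<^sub>R (v - hd ws)"
    by (rule space_expand)
  also have "\<dots> = (\<Sum>i<d. (off i + s * lam i x) *\<^sub>R (simplex_edges ws ! i)) + (sT * (lT (x - hd ws) / sT)) *\<^sub>R (v - hd ws)"
    using s_pos sT_pos by (simp add: lam_def)
  finally have "x - hd ws = (\<Sum>i<d. (off i + s * lam i x) *\<^sub>R (simplex_edges ws ! i)) + (sT * (lT (x - hd ws) / sT)) *\<^sub>R (v - hd ws)" .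
  moreover have "(\<Sum>i<d. (off i + s * lam i x) *\<^sub>R (simplex_edges ws ! i)) =
      (\<Sum>i<d. off i *\<^sub>R (simplex_edges ws ! i)) + (\<Sum>i<d. lam i x *\<^sub>R (s *\<^sub>R (simplex_edges ws ! i)))"
    by (simp add: scaleR_add_left sum.distrib mult.commute)
  moreover have "(sT * (lT (x - hd ws) / sT)) *\<^sub>R (v - hd ws) = (lT (x - hd ws) / sT) *\<^sub>R (sT *\<^sub>R (v - hd ws))"
    by (simp only: scaleR_scaleR mult.commute)
  ultimately have "x - hd ws = (\<Sum>i<d. off i *\<^sub>R (simplex_edges ws ! i)) +
      ((\<Sum>i<d. lam i x *\<^sub>R (s *\<^sub>R (simplex_edges ws ! i))) + (lT (x - hd ws) / sT) *\<^sub>R (sT *\<^sub>R (v - hd ws)))"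
    by (simp only: add.assoc)
  moreover have "x - (hd ws + A) = W" if "x - hd ws = A + W" for A W
    using that by (simp add: diff_diff_add[symmetric])
  ultimately have "x - ?q = (\<Sum>i<d. lam i x *\<^sub>R (s *\<^sub>R (simplex_edges ws ! i))) + (lT (x - hd ws) / sT) *\<^sub>R (sT *\<^sub>R (v - hd ws))"
    by blast
  then have eq: "norm (x - ?q) = norm ((\<Sum>i<d. lam i x *\<^sub>R (s *\<^sub>R (simplex_edges ws ! i))) + (lT (x - hd ws) / sT) *\<^sub>R (sT *\<^sub>R (v - hd ws)))"
    by (rule arg_cong)
  have "norm ((\<Sum>i<d. lam i x *\<^sub>R (s *\<^sub>R (simplex_edges ws ! i))) + (lT (x - hd ws) / sT) *\<^sub>R (sT *\<^sub>R (v - hd ws))) \<le> (\<Sum>i<d. L) + L"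
  proof (rule norm_triangle_le, rule add_mono)
    show "norm (\<Sum>i<d. lam i x *\<^sub>R (s *\<^sub>R (simplex_edges ws ! i))) \<le> (\<Sum>i<d. L)"
    proof (rule sum_norm_le)
      fix i assume i: "i \<in> {..<d}"
      have "\<bar>lam i x\<bar> \<le> 1" using x[of i] i by (auto simp: coord_def)
      then have "\<bar>lam i x\<bar> * (s * norm (simplex_edges ws ! i)) \<le> 1 * L"
        using E[of i] i s_pos by (intro mult_mono) auto
      then show "norm (lam i x *\<^sub>R (s *\<^sub>R (simplex_edges ws ! i))) \<le> L" using s_pos by (simp add: abs_mult mult.assoc)
    qed
    have "\<bar>lT (x - hd ws) / sT\<bar> \<le> 1" using x[of d] by (auto simp: coord_def)
    then have "\<bar>lT (x - hd ws) / sT\<bar> * (sT * norm (v - hd ws)) \<le> 1 * L"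
      using ET sT_pos by (intro mult_mono) auto
    then show "norm ((lT (x - hd ws) / sT) *\<^sub>R (sT *\<^sub>R (v - hd ws))) \<le> L" using sT_pos by simp
  qed
  then have "norm (x - ?q) \<le> real (Suc d) * L" unfolding eq by (simp add: distrib_right)
  moreover have "dist ?q x = norm (x - ?q)" by (simp only: dist_norm norm_minus_commute)
  ultimately show ?thesis by (simp only: mem_cball)
qed

text \<open>A facet of T lies opposite a vertex u, and the barycentric coordinate of u vanishes on
  it. For u = v it is F. For u = \<open>ws ! Suc i\<close> the coordinate is at least s * lo on the
  support, and for u = hd ws it is at least s/4.\<close>

lemma patch_form_separated:
  assumes supp: "\<And>i x. x \<notin> {lo..hi} \<Longrightarrow> \<kappa> i x = 0" and psi: "\<And>x. x \<notin> {-1/4..1/4} \<Longrightarrow> \<psi> x = 0"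
    and lo: "0 < lo" and hi: "real d * hi \<le> 1 / 2" and G: "G facet_of T" "G \<noteq> F"
  shows "separated (form_support (patch_form a \<kappa> r c \<psi> lT sT T)) G"
proof -
  obtain u where u: "u \<in> insert v (set ws)" "G = convex hull (insert v (set ws) - {u})"
    using G(1) facet_of_convex_hull_affine_independent[OF ind] by blast
  have "u \<noteq> v" using u(2) G(2) v by auto
  let ?X = "{x. patch_form a \<kappa> r c \<psi> lT sT T x \<noteq> (\<lambda>vs. 0)}"
  have psi': "\<psi> x = 0" if "x \<notin> {- (1/4)..1/4}" for x using psi that by simp
  have x: "lam j x \<in> {lo..hi}" if "x \<in> ?X" "j < d" for x j
    by (rule patch_form_support(2)[where \<kappa> = \<kappa> and \<psi> = \<psi>, OF supp psi']) (use that in \<open>blast+\<close>)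
  have xT: "lT (x - hd ws) / sT \<in> {-(1/4)..1/4}" if "x \<in> ?X" for x
    by (rule patch_form_support(3)[where \<kappa> = \<kappa> and \<psi> = \<psi>, OF supp psi']) (use that in \<open>blast+\<close>)
  have li: "l i (x - hd ws) = off i + s * lam i x" for i x using s_pos by (simp add: lam_def)
  have level: "f y = c" if f: "linear f" and vert: "\<And>w. w \<in> insert v (set ws) - {u} \<Longrightarrow> f w = c" and y: "y \<in> G"
    for f :: "'a \<Rightarrow> real" and c y
  proof -
    have "convex (f -` {c})" using convex_linear_vimage[OF f convex_singleton] .
    then have "convex hull (insert v (set ws) - {u}) \<subseteq> f -` {c}" using vert by (intro hull_minimal) auto
    then show ?thesis using y u(2) by blast
  qed
  from u(1) show ?thesis
  proof (cases rule: vertex_cases)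
    case 1
    then show ?thesis using \<open>u \<noteq> v\<close> by simp
  next
    case 2
    \<comment> \<open>Up to a constant this is the barycentric coordinate of hd ws.\<close>
    let ?f = "\<lambda>x. - ((\<Sum>i<d. l i x) + lT x)"
    have f: "linear ?f"
      by (intro linear_compose_neg linear_compose_add linear_compose_sum lT_linear) (use l_linear in simp)
    have f_diff: "?f x = ?f (x - hd ws) + ?f (hd ws)" for x using linear_diff[OF f, of x "hd ws"] by linarith
    show ?thesis unfolding form_support_def
    proof (rule separated_by_linear[OF f, where \<delta> = "s / 4" and c = "?f (hd ws) - 1"])
      show "0 < s / 4" using s_pos by simp
      fix x assume X: "x \<in> ?X"
      have "(\<Sum>i<d. lam i x) \<le> (\<Sum>i<d. hi)" using x[OF X] by (intro sum_mono) auto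
      then have "s * (\<Sum>i<d. lam i x) \<le> s * (1 / 2)" using hi s_pos by (intro mult_left_mono) auto
      moreover have "(\<Sum>i<d. l i (x - hd ws)) = (\<Sum>i<d. off i) + s * (\<Sum>i<d. lam i x)"
        unfolding li by (simp add: sum.distrib sum_distrib_left)
      moreover have "lT (x - hd ws) \<le> sT / 4" using xT[OF X] sT_pos by (auto simp: field_simps)
      \<comment> \<open>The other coordinates sum to at most (1 - s) + s/2 + sT/4, which is at most
        1 - s/4 because \<open>sT \<le> s\<close>.\<close>
      ultimately have "- 1 + s / 4 \<le> ?f (x - hd ws)" using off_sum sT_le by linarith
      then show "?f (hd ws) - 1 + s / 4 \<le> ?f x" using f_diff[of x] by linarith
    next
      fix y assume y: "y \<in> G"
      show "?f y = ?f (hd ws) - 1"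
      proof (rule level[OF f _ y])
        fix w assume w: "w \<in> insert v (set ws) - {u}"
        then have "w \<in> insert v (set ws)" by simp
        then have "?f (w - hd ws) = - 1"
        proof (cases rule: vertex_cases)
          case 1
          then show ?thesis using l_v lT_v by simp
        next
          case (3 j)
          have "(\<Sum>i<d. l i (w - hd ws)) = (\<Sum>i<d. if i = j then 1 else 0)"
            unfolding 3(3) using l_edges[OF _ 3(1)] by simp
          then show ?thesis using 3 lT_edges by simp
        qed (use w 2 in simp)
        then show "?f w = ?f (hd ws) - 1" using f_diff[of w] by linarith
      qed
    qed
  next
    case (3 i)
    have f_diff: "l i x = l i (x - hd ws) + l i (hd ws)" for x
      using linear_diff[OF l_linear[OF 3(1)], of x "hd ws"] by linarith
    show ?thesis unfolding form_support_def
    proof (rule separated_by_linear[OF l_linear[OF 3(1)], where \<delta> = "s * lo" and c = "l i (hd ws)"])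
      show "0 < s * lo" using s_pos lo by simp
      fix x assume X: "x \<in> ?X"
      have "s * lo \<le> s * lam i x" using x[OF X 3(1)] s_pos by simp
      then have "s * lo \<le> l i (x - hd ws)" unfolding li using off_nonneg[OF 3(1)] by simp
      then show "l i (hd ws) + s * lo \<le> l i x" using f_diff[of x] by linarith
    next
      fix y assume y: "y \<in> G"
      show "l i y = l i (hd ws)"
      proof (rule level[OF l_linear[OF 3(1)] _ y])
        fix w assume w: "w \<in> insert v (set ws) - {u}"
        then have "l i (w - hd ws) = 0" using l_vertex[of w i] 3 by simp
        then show "l i w = l i (hd ws)" using f_diff[of w] by linarith
      qed
    qed
  qed
qed

lemma lT_tangent_F: "u \<in> tangent F \<Longrightarrow> lT u = 0"
proof -
  assume "u \<in> tangent F"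
  then have "lT u = lT (\<Sum>i<d. l i u *\<^sub>R (simplex_edges ws ! i))" using tangent_expand by metis
  also have "\<dots> = 0" using lT_edges by (simp add: linear_sum[OF lT_linear] linear_scale[OF lT_linear])
  finally show ?thesis .
qed

end

text \<open>Functionals dual to the edges of F are determined on its tangent space, and \<xi>
  evaluates them only there. So \<xi> may be built with the coordinates of any one simplex over F
  and is still the trace of the extension to every other one.\<close>

lemma facet_form_unique:
  assumes 1: "facet_patch ws d l s off" and 2: "facet_patch ws d l' s off" and a: "a \<le> d"
  shows "facet_patch.facet_form ws d l s off a \<kappa> r c = facet_patch.facet_form ws d l' s off a \<kappa> r c"
proof -
  interpret A: facet_patch ws d l s off by (rule 1)
  interpret B: facet_patch ws d l' s off by (rule 2)
  have l: "l' i u = l i u" if u: "u \<in> tangent A.F" and i: "i < d" for i u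
  proof -
    have "u = (\<Sum>j<d. l j u *\<^sub>R (simplex_edges ws ! j))" by (rule A.tangent_expand[OF u])
    then have "l' i u = l' i (\<Sum>j<d. l j u *\<^sub>R (simplex_edges ws ! j))" by (rule arg_cong)
    also have "\<dots> = (\<Sum>j<d. l j u * (if i = j then 1 else 0))"
      using B.l_edges[OF i] by (simp add: linear_sum[OF B.l_linear[OF i]] linear_scale[OF B.l_linear[OF i]])
    also have "\<dots> = (\<Sum>j<d. if j = i then l j u else 0)" by (rule sum.cong) auto
    also have "\<dots> = l i u" using i by simp
    finally show ?thesis .
  qed
  show ?thesis
  proof (intro ext)
    fix x vs
    show "A.facet_form a \<kappa> r c x vs = B.facet_form a \<kappa> r c x vs"
    proof (cases "x \<in> A.F \<and> set vs \<subseteq> tangent A.F")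
      case True
      have "hd ws \<in> A.F" using A.set_ws_F A.ws_nonempty hd_in_set by blast
      then have "x - hd ws \<in> tangent A.F" using True diff_in_tangent by blast
      then have "B.lam j x = A.lam j x" if "j < d" for j
        using l that by (simp add: A.lam_def B.lam_def)
      then have bc: "B.bump_coef \<kappa> r c x = A.bump_coef \<kappa> r c x"
        by (intro ext) (simp add: A.bump_coef_def B.bump_coef_def)
      have "prod_list (map2 (\<lambda>i v. l' i v / s) (map \<tau> [0..<length vs]) vs) =
          prod_list (map2 (\<lambda>i v. l i v / s) (map \<tau> [0..<length vs]) vs)"
        if t: "\<tau> permutes {..<d}" and len: "length vs = a" for \<tau>
      proof -
        have "l' (\<tau> i) (vs ! i) = l (\<tau> i) (vs ! i)" if "i < length vs" for i
        proof -
          have "i \<in> {..<d}" using that a len by simp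
          then have "\<tau> i \<in> {..<d}" using permutes_in_image[OF t] by blast
          moreover have "vs ! i \<in> tangent A.F" using True that nth_mem by blast
          ultimately show ?thesis using l by simp
        qed
        then show ?thesis by (simp add: prod_list_map2_nth)
      qed
      then have "coef_form d a g (\<lambda>i v. l' i v / s) vs = coef_form d a g (\<lambda>i v. l i v / s) vs" for g
        by (auto simp: coef_form_def intro!: sum.cong)
      then show ?thesis using True by (simp add: A.facet_form_def B.facet_form_def bc)
    next
      case False
      then show ?thesis by (simp only: A.facet_form_def B.facet_form_def if_False)
    qed
  qed
qed

section \<open>The reference degrees of freedom\<close>

lemma alt_forms_restrict:
  assumes f: "f \<in> alt_forms l UNIV" and V: "subspace V"
  shows "(\<lambda>vs. if set vs \<subseteq> V then f vs else 0) \<in> alt_forms l V"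
proof (rule alt_formsI)
  show "int (length vs) = l \<and> set vs \<subseteq> V" if "(if set vs \<subseteq> V then f vs else 0) \<noteq> 0" for vs
    using alt_forms_supp[OF f, of vs] that by (auto split: if_splits)
next
  fix us ws u v a b
  assume s: "set us \<subseteq> V" "set ws \<subseteq> V" "u \<in> V" "v \<in> V"
  then have "a *\<^sub>R u + b *\<^sub>R v \<in> V" using V subspace_add subspace_scale by blast
  then show "(if set (us @ (a *\<^sub>R u + b *\<^sub>R v) # ws) \<subseteq> V then f (us @ (a *\<^sub>R u + b *\<^sub>R v) # ws) else 0) =
      a * (if set (us @ u # ws) \<subseteq> V then f (us @ u # ws) else 0) +
      b * (if set (us @ v # ws) \<subseteq> V then f (us @ v # ws) else 0)"
    using s alt_forms_linear[OF f, of us ws u v a b] by simp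
qed (simp add: alt_forms_not_distinct[OF f])

text \<open>The common ground of the full and the trimmed polynomial families: such a form is the
  trace of an alternating form on the whole space with continuous components.\<close>

definition ambient_form :: "int \<Rightarrow> 'a::euclidean_space set \<Rightarrow> 'a dform \<Rightarrow> 'a dform \<Rightarrow> bool"
  where "ambient_form l X \<zeta> \<zeta>' \<longleftrightarrow> \<zeta> = form_trace X \<zeta>' \<and>
    (\<forall>x. \<zeta>' x \<in> alt_forms l UNIV) \<and> (\<forall>vs. continuous_on UNIV (\<lambda>x. \<zeta>' x vs))"

lemma poly_forms_continuous: "\<omega> \<in> poly_forms r l \<Longrightarrow> continuous_on UNIV (\<lambda>x. \<omega> x vs)"
  by (rule poly_fun_continuous_on[OF poly_formsD(2)])

lemma poly_forms_on_ambient: "\<zeta> \<in> poly_forms_on r l X \<Longrightarrow> \<exists>\<zeta>'. ambient_form l X \<zeta> \<zeta>'"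
  unfolding poly_forms_on_def ambient_form_def using poly_formsD(1) poly_forms_continuous by blast

lemma trimmed_poly_forms_on_ambient:
  assumes "\<zeta> \<in> trimmed_poly_forms_on r l X" shows "\<exists>\<zeta>'. ambient_form l X \<zeta> \<zeta>'"
proof -
  obtain \<alpha> \<beta> where z: "\<zeta> = form_trace X (\<alpha> + koszul \<beta>)"
    and ab: "\<alpha> \<in> poly_forms (r - 1) l" "\<beta> \<in> poly_forms (r - 1) (l + 1)"
    using assms unfolding trimmed_poly_forms_on_def trimmed_poly_forms_def by blast
  have "(\<alpha> + koszul \<beta>) x \<in> alt_forms l UNIV" for x
    using alt_forms_add[OF poly_formsD(1)[OF ab(1), of x] alt_forms_contract[OF poly_formsD(1)[OF ab(2), of x], of x]]
    by (simp add: koszul_def plus_fun_def)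
  moreover have "continuous_on UNIV (\<lambda>x. (\<alpha> + koszul \<beta>) x vs)" for vs
  proof -
    \<comment> \<open>In the contraction the point is also an argument; expanding it in the basis
      leaves components with fixed arguments.\<close>
    have "\<beta> x (x # vs) = (\<Sum>b\<in>Basis. (x \<bullet> b) * \<beta> x (b # vs))" for x
      using alt_forms_sum[OF poly_formsD(1)[OF ab(2)] subspace_UNIV finite_Basis, of id "[]" vs x "\<lambda>b. x \<bullet> b"]
      by (simp add: euclidean_representation)
    then have "continuous_on UNIV (\<lambda>x. \<beta> x (x # vs))"
      using poly_forms_continuous[OF ab(2)] by (auto intro!: continuous_intros)
    then show ?thesis using poly_forms_continuous[OF ab(1)]
      by (auto simp: koszul_def intro!: continuous_intros)
  qed
  ultimately show ?thesis using z unfolding ambient_form_def by blast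
qed

lemma dof_forms_ambient:
  "\<zeta> \<in> dof_forms fam r k X \<Longrightarrow> \<exists>\<zeta>'. ambient_form (int (sdim X) - int k) X \<zeta> \<zeta>'"
  by (cases fam) (auto intro: poly_forms_on_ambient trimmed_poly_forms_on_ambient)

text \<open>There are finitely many components on basis lists, each continuous on the compact X, and
  arguments that are differences of points of X have norm at most the diameter.\<close>

lemma ambient_form_bound:
  fixes X :: "'a::euclidean_space set"
  assumes z: "ambient_form l X \<zeta> \<zeta>'" and X: "compact X"
  shows "\<exists>B\<ge>0. \<forall>x\<in>X. \<forall>vs. set vs \<subseteq> {u - w |u w. u \<in> X \<and> w \<in> X} \<longrightarrow> \<bar>\<zeta> x vs\<bar> \<le> B"
proof -
  have alt: "\<zeta>' x \<in> alt_forms l UNIV" and cont: "continuous_on UNIV (\<lambda>x. \<zeta>' x vs)" for x vs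
    using z by (auto simp: ambient_form_def)
  define D where "D = max 1 (diameter X)"
  let ?J = "{J. set J \<subseteq> (Basis :: 'a set) \<and> length J = nat l}"
  have fJ: "finite ?J" by (rule finite_lists_length_eq) simp
  have "\<exists>b. \<forall>x\<in>X. \<bar>\<zeta>' x J\<bar> \<le> b" for J
  proof -
    have "compact ((\<lambda>x. \<zeta>' x J) ` X)"
      by (rule compact_continuous_image[OF continuous_on_subset[OF cont] X]) simp
    then show ?thesis using compact_imp_bounded by (fastforce simp: bounded_iff)
  qed
  then obtain b where b: "\<And>x J. x \<in> X \<Longrightarrow> \<bar>\<zeta>' x J\<bar> \<le> b J" by metis
  define B where "B = (\<Sum>J\<in>?J. D ^ nat l * \<bar>b J\<bar>)"
  have D: "0 \<le> D" by (simp add: D_def)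
  have B0: "0 \<le> B" unfolding B_def using D by (intro sum_nonneg) auto
  have "\<bar>\<zeta> x vs\<bar> \<le> B" if x: "x \<in> X" and vs: "set vs \<subseteq> {u - w |u w. u \<in> X \<and> w \<in> X}" for x vs
  proof (cases "\<zeta>' x vs = 0")
    case True
    then show ?thesis using z B0 by (simp add: ambient_form_def form_trace_def)
  next
    case False
    then have len: "length vs = nat l" using alt_forms_supp[OF alt False] by simp
    have nv: "norm v \<le> D" if "v \<in> set vs" for v
    proof -
      obtain u w where "u \<in> X" "w \<in> X" "v = u - w" using vs \<open>v \<in> set vs\<close> by blast
      then show ?thesis using diameter_bounded_bound[OF compact_imp_bounded[OF X], of u w]
        by (simp add: dist_norm D_def)
    qed
    have pl: "\<bar>prod_list (map2 (\<lambda>b v. v \<bullet> b) J us)\<bar> \<le> D ^ length us"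
      if "length J = length us" "set J \<subseteq> Basis" "\<And>v. v \<in> set us \<Longrightarrow> norm v \<le> D" for J :: "'a list" and us
      using that
    proof (induction J us rule: list_induct2)
      case (Cons c J v us)
      have "\<bar>v \<bullet> c\<bar> \<le> D" using Cons.prems Basis_le_norm[of c v] by force
      then have "\<bar>v \<bullet> c\<bar> * \<bar>prod_list (map2 (\<lambda>b v. v \<bullet> b) J us)\<bar> \<le> D * D ^ length us"
        using Cons D by (intro mult_mono) auto
      then show ?case by (simp add: abs_mult)
    qed simp
    have "\<zeta>' x ([] @ vs) = (\<Sum>J | set J \<subseteq> Basis \<and> length J = length vs.
        prod_list (map2 (\<lambda>b v. v \<bullet> b) J vs) * \<zeta>' x ([] @ map id J))"
      by (rule alt_forms_expand[OF alt subspace_UNIV finite_Basis]) (auto simp: euclidean_representation)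
    then have "\<zeta>' x vs = (\<Sum>J\<in>?J. prod_list (map2 (\<lambda>b v. v \<bullet> b) J vs) * \<zeta>' x J)" using len by simp
    also have "\<bar>\<dots>\<bar> \<le> B" unfolding B_def
    proof (rule order_trans[OF sum_abs sum_mono])
      fix J assume J: "J \<in> ?J"
      have "\<bar>prod_list (map2 (\<lambda>b v. v \<bullet> b) J vs)\<bar> \<le> D ^ nat l"
        using pl[of J vs] J len nv by simp
      moreover have "\<bar>\<zeta>' x J\<bar> \<le> \<bar>b J\<bar>" using b[OF x, of J] by linarith
      ultimately show "\<bar>prod_list (map2 (\<lambda>b v. v \<bullet> b) J vs) * \<zeta>' x J\<bar> \<le> D ^ nat l * \<bar>b J\<bar>"
        unfolding abs_mult using D by (intro mult_mono) auto
    qed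
    finally show ?thesis using z B0 by (simp add: ambient_form_def form_trace_def)
  qed
  then show ?thesis using B0 by blast
qed

text \<open>The linear part of the inverse maps differences of points of S to differences of points
  of X. On such arguments the pulled-back form takes values that occur on the reference simplex, so
  the bound B is inherited without any dependence on the size or shape of S.\<close>

lemma pullback_inv_props:
  fixes A :: "'a::euclidean_space \<Rightarrow> 'a"
  assumes X: "convex X" "X \<noteq> {}" and A: "affine_bij A X S" and z: "ambient_form l X \<zeta> \<zeta>'"
    and B: "\<And>x vs. x \<in> X \<Longrightarrow> set vs \<subseteq> {u - w |u w. u \<in> X \<and> w \<in> X} \<Longrightarrow> \<bar>\<zeta> x vs\<bar> \<le> B"
  shows "cont_components S (pullback_inv A X S \<zeta>)"
    "\<And>y vs. y \<in> S \<Longrightarrow> set vs \<subseteq> {u - w |u w. u \<in> S \<and> w \<in> S} \<Longrightarrow> \<bar>pullback_inv A X S \<zeta> y vs\<bar> \<le> B"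
proof -
  obtain c L c' L' where L: "linear L" "A = (\<lambda>x. c + L x)" "bij_betw A X S"
    "linear L'" "\<And>x. x \<in> X \<Longrightarrow> c' + L' (A x) = x" "\<And>v. v \<in> tangent X \<Longrightarrow> L' (L v) = v"
    "tangent S = L ` tangent X" "inj_on L (tangent X)"
    by (rule affine_bij_inverse[OF X A], rule that; assumption)
  have im: "A ` X = S" and inj: "inj_on A X" using L(3) by (auto simp: bij_betw_def)
  have inv: "inv_into X A y = c' + L' y" "c' + L' y \<in> X" if y: "y \<in> S" for y
  proof -
    obtain x where x: "x \<in> X" "y = A x" using y im by blast
    then show "inv_into X A y = c' + L' y" "c' + L' y \<in> X" using L(5)[OF x(1)] inv_into_f_f[OF inj x(1)] by auto
  qed
  have A0: "(\<lambda>v. A v - A 0) = L" using L(2) linear_0[OF L(1)] by auto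
  have invL: "inv_into (tangent X) (\<lambda>v. A v - A 0) v = L' v" "L' v \<in> tangent X" if "v \<in> tangent S" for v
  proof -
    obtain w where w: "w \<in> tangent X" "v = L w" using \<open>v \<in> tangent S\<close> L(7) by blast
    then show "inv_into (tangent X) (\<lambda>v. A v - A 0) v = L' v" "L' v \<in> tangent X"
      unfolding A0 using L(6)[OF w(1)] inv_into_f_f[OF L(8) w(1)] by auto
  qed
  have eq: "pullback_inv A X S \<zeta> y vs = \<zeta> (c' + L' y) (map L' vs)" if "y \<in> S" "set vs \<subseteq> tangent S" for y vs
  proof -
    have "map (inv_into (tangent X) (\<lambda>v. A v - A 0)) vs = map L' vs"
      using that(2) invL(1) by (intro map_cong) auto
    then show ?thesis by (simp only: pullback_inv_def inv(1)[OF that(1)] that simp_thms if_True)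
  qed
  show "cont_components S (pullback_inv A X S \<zeta>)" unfolding cont_components_def
  proof (intro allI impI)
    fix vs :: "'a list" assume vs: "set vs \<subseteq> tangent S"
    have "continuous_on UNIV (\<lambda>x. \<zeta>' x (map L' vs))" using z by (simp add: ambient_form_def)
    moreover have "continuous_on UNIV (\<lambda>y. c' + L' y)"
      using L(4) by (intro continuous_intros linear_continuous_on) (simp add: linear_conv_bounded_linear)
    ultimately have "continuous_on UNIV (\<lambda>y. \<zeta>' (c' + L' y) (map L' vs))"
      by (rule continuous_on_compose2) simp
    moreover have "pullback_inv A X S \<zeta> y vs = \<zeta>' (c' + L' y) (map L' vs)" if "y \<in> S" for y
    proof -
      have "set (map L' vs) \<subseteq> tangent X" using invL(2) vs by auto
      then show ?thesis using eq[OF that vs] inv(2)[OF that] z by (simp add: ambient_form_def form_trace_def)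
    qed
    ultimately show "\<exists>g. continuous_on UNIV g \<and> (\<forall>y\<in>S. pullback_inv A X S \<zeta> y vs = g y)" by blast
  qed
  show "\<bar>pullback_inv A X S \<zeta> y vs\<bar> \<le> B" if y: "y \<in> S" and vs: "set vs \<subseteq> {u - w |u w. u \<in> S \<and> w \<in> S}" for y vs
  proof -
    have "set vs \<subseteq> tangent S" using vs diff_in_tangent[of _ S] by blast
    moreover have "set (map L' vs) \<subseteq> {u - w |u w. u \<in> X \<and> w \<in> X}"
    proof
      fix v assume "v \<in> set (map L' vs)"
      then obtain u w where "u \<in> S" "w \<in> S" "v = L' (u - w)" using vs by auto
      then show "v \<in> {u - w |u w. u \<in> X \<and> w \<in> X}"
        using inv(2) linear_diff[OF L(4), of u w] by (intro CollectI exI[of _ "c' + L' u"] exI[of _ "c' + L' w"]) simp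
    qed
    ultimately show ?thesis using eq[OF y] B[OF inv(2)[OF y]] by simp
  qed
qed

text \<open>For form degrees and simplex dimensions up to n there are finitely many reference forms,
  so the sum of their individual bounds serves all of them. This makes the final constant uniform in
  the family and in k.\<close>

lemma reference_dofs_bound:
  fixes R :: "nat \<Rightarrow> 'a::euclidean_space set"
  assumes "reference_dofs r R \<eta>"
  obtains B where "0 \<le> B" "\<And>fam k m i x vs. admissible_family DIM('a) fam k \<Longrightarrow> k \<le> DIM('a) \<Longrightarrow> m \<le> DIM('a) \<Longrightarrow>
    i \<in> fe_index fam r k (R m) \<Longrightarrow> x \<in> R m \<Longrightarrow> set vs \<subseteq> {u - w |u w. u \<in> R m \<and> w \<in> R m} \<Longrightarrow>
    \<bar>\<eta> fam k m i x vs\<bar> \<le> B"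
proof -
  let ?n = "DIM('a)"
  let ?Q = "SIGMA fam:{Full, Trimmed}. SIGMA k:{..?n}. SIGMA m:{..?n}. fe_index fam r k (R m)"
  let ?ok = "\<lambda>fam k m i B. 0 \<le> B \<and> (\<forall>x\<in>R m. \<forall>vs. set vs \<subseteq> {u - w |u w. u \<in> R m \<and> w \<in> R m} \<longrightarrow> \<bar>\<eta> fam k m i x vs\<bar> \<le> B)"
  have ex: "\<exists>B. ?ok fam k m i B"
    if adm: "admissible_family ?n fam k" "m \<le> ?n" "i \<in> fe_index fam r k (R m)" for fam k m i
  proof -
    have "\<eta> fam k m i \<in> span (\<eta> fam k m ` fe_index fam r k (R m))" using adm(3) by (intro span_base) auto
    then have "\<eta> fam k m i \<in> dof_forms fam r k (R m)" using assms adm unfolding reference_dofs_def by blast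
    then obtain \<zeta>' where "ambient_form (int (sdim (R m)) - int k) (R m) (\<eta> fam k m i) \<zeta>'"
      using dof_forms_ambient by blast
    moreover have "compact (R m)" using assms adm(2) compact_simplex unfolding reference_dofs_def by blast
    ultimately show ?thesis using ambient_form_bound by blast
  qed
  \<comment> \<open>The value 0 is a default for inadmissible families, for which no reference basis
    is given; it keeps all summands nonnegative.\<close>
  define b where "b = (\<lambda>(fam, k, m, i). if admissible_family ?n fam k then SOME B. ?ok fam k m i B else (0::real))"
  have b: "?ok fam k m i (b (fam, k, m, i))"
    if "admissible_family ?n fam k" "m \<le> ?n" "i \<in> fe_index fam r k (R m)" for fam k m i
    using someI_ex[OF ex[OF that]] that(1) by (simp add: b_def)
  have fin: "finite ?Q" by (intro finite_SigmaI) (auto simp: fe_index_def)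
  have nn: "0 \<le> b q" if q: "q \<in> ?Q" for q
  proof -
    obtain fam k m i where q': "q = (fam, k, m, i)" by (metis surj_pair)
    then show ?thesis using q b[of fam k m i] by (cases "admissible_family ?n fam k") (auto simp: b_def)
  qed
  show ?thesis
  proof (rule that[of "\<Sum>q\<in>?Q. b q"])
    show "0 \<le> (\<Sum>q\<in>?Q. b q)" by (rule sum_nonneg) (rule nn)
    fix fam k m i x vs
    assume h: "admissible_family ?n fam k" "k \<le> ?n" "m \<le> ?n" "i \<in> fe_index fam r k (R m)" "x \<in> R m"
      "set vs \<subseteq> {u - w |u w. u \<in> R m \<and> w \<in> R m}"
    have "\<bar>\<eta> fam k m i x vs\<bar> \<le> b (fam, k, m, i)" using b[OF h(1,3,4)] h(5,6) by blast
    also have "\<dots> \<le> (\<Sum>q\<in>?Q. b q)"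
    proof (rule member_le_sum[OF _ _ fin])
      show "(fam, k, m, i) \<in> ?Q" using h by (cases fam) auto
      show "0 \<le> b q" if "q \<in> ?Q - {(fam, k, m, i)}" for q using nn that by blast
    qed
    finally show "\<bar>\<eta> fam k m i x vs\<bar> \<le> (\<Sum>q\<in>?Q. b q)" .
  qed
qed

text \<open>If k exceeds the dimension of S, all alternating k-forms on its tangent space vanish and
  the trace-free space has dimension 0. A nonempty index set thus forces k \<le> dim S, which for a
  face of F makes n - k - 1 a natural number.\<close>

lemma fe_index_degree:
  fixes S :: "'a::euclidean_space set"
  assumes i: "i \<in> fe_index fam r k S" and ws: "ws \<noteq> []" "distinct ws" "\<not> affine_dependent (set ws)"
    "S = convex hull (set ws)"
  shows "k < length ws"
proof (rule ccontr)
  assume k: "\<not> k < length ws"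
  let ?m = "length ws - 1" and ?es = "simplex_edges ws"
  note es = simplex_edges_independent[OF ws(2,1,3)]
  have les: "length ?es = ?m" by (simp add: simplex_edges_def)
  obtain f :: "nat \<Rightarrow> 'a \<Rightarrow> real" where f: "\<And>i. i < length ?es \<Longrightarrow> linear (f i)"
    "\<And>i j. i < length ?es \<Longrightarrow> j < length ?es \<Longrightarrow> f i (?es ! j) = (if i = j then 1 else 0)"
    by (rule dual_functionals[OF es], rule that; assumption)
  \<comment> \<open>Scale 1 and offset 0 make the patch the whole simplex; the interpretation
    provides the expansion of tangent vectors in the edges.\<close>
  interpret facet_patch ws ?m f 1 "\<lambda>_. 0"
    by (rule facet_patch.intro) (use ws(1) f les in auto)
  have "\<omega> = 0" if w: "\<omega> \<in> fe_forms0 fam r k S" for \<omega>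
  proof -
    have "\<exists>\<omega>'. ambient_form (int k) S \<omega> \<omega>'"
      using w poly_forms_on_ambient trimmed_poly_forms_on_ambient by (cases fam) (auto simp: fe_forms0_def)
    then obtain \<omega>' where w': "\<omega> = form_trace S \<omega>'" "\<And>x. \<omega>' x \<in> alt_forms (int k) UNIV"
      by (auto simp: ambient_form_def)
    have "(\<lambda>vs. if set vs \<subseteq> tangent F then \<omega>' x vs else 0) = (\<lambda>vs. 0)" for x
    proof (rule alt_forms_eq_zero[OF alt_forms_restrict[OF w'(2) subspace_tangent] subspace_tangent _ tangent_expand])
      show "?es ! i \<in> tangent F" if "i < ?m" for i
        using simplex_edges_tangent[OF ws_nonempty set_ws_F] that les nth_mem by (metis subsetD)
      show "?m < k" using k ws(1) by (cases ws) auto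
    qed
    then have z: "(if set vs \<subseteq> tangent F then \<omega>' x vs else 0) = 0" for x vs by (rule fun_cong)
    show ?thesis
    proof (intro ext)
      fix x vs
      show "\<omega> x vs = 0 x vs" using z[of vs x] by (auto simp: form_trace_def w'(1) ws(4))
    qed
  qed
  then have "fe_forms0 fam r k S \<subseteq> {0}" by blast
  then have "dim (fe_forms0 fam r k S) \<le> 0"
    using dim_le_card[of "fe_forms0 fam r k S" "{}"] by simp
  then show False using i by (simp add: fe_index_def)
qed

lemma prod_list_map2_le_1:
  fixes l :: "nat \<Rightarrow> 'a \<Rightarrow> real"
  assumes "\<And>i v. i \<in> set J \<Longrightarrow> v \<in> set vs \<Longrightarrow> \<bar>l i v\<bar> \<le> 1"
  shows "\<bar>prod_list (map2 l J vs)\<bar> \<le> 1"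
  using assms
proof (induction vs arbitrary: J)
  case (Cons v vs)
  show ?case
  proof (cases J)
    case (Cons i K)
    have "\<bar>l i v\<bar> * \<bar>prod_list (map2 l K vs)\<bar> \<le> 1 * 1"
      using Cons.IH[of K] Cons.prems \<open>J = i # K\<close> by (intro mult_mono) auto
    then show ?thesis using Cons by (simp add: abs_mult)
  qed simp
qed simp

context facet_patch
begin

text \<open>On a difference of points of S the covector \<open>l i\<close> divided by s is a
  difference of values of \<open>lam i\<close>. So all that matters is that the patch coordinates
  stay in [0, 1] on S, whether S is a single vertex or spans an edge.\<close>

lemma monomial_form_bound:
  assumes y: "y \<in> S" and lam: "\<And>j y. j < d \<Longrightarrow> y \<in> S \<Longrightarrow> lam j y \<in> {0..1}"
    and us: "set us \<subseteq> {u - w |u w. u \<in> S \<and> w \<in> S}" and t: "\<tau> permutes {..<d}"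
  shows "\<bar>monomial_form a k \<tau> \<beta> y us\<bar> \<le> 1"
proof (cases "length us = k")
  case True
  have "\<bar>\<Prod>j<d. lam j y ^ \<beta> j\<bar> \<le> 1"
  proof -
    have "(\<Prod>j<d. \<bar>lam j y ^ \<beta> j\<bar>) \<le> (\<Prod>j<d. 1)"
      using lam[OF _ y] by (intro prod_mono) (auto simp: power_abs intro!: power_le_one)
    then show ?thesis by (simp add: abs_prod)
  qed
  moreover have "\<bar>prod_list (map2 (\<lambda>i v. l i v / s) (map \<tau> [a..<d]) us)\<bar> \<le> 1"
  proof (rule prod_list_map2_le_1)
    fix i v assume i: "i \<in> set (map \<tau> [a..<d])" and v: "v \<in> set us"
    obtain j where "i = \<tau> j" "j \<in> {..<d}" using i by auto
    then have i': "i < d" using permutes_in_image[OF t] by blast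
    obtain u w where uw: "u \<in> S" "w \<in> S" "v = u - w" using us v by blast
    have "l i v / s = lam i u - lam i w"
      unfolding uw(3) using linear_diff[OF l_linear[OF i']] lam_eq_affine[OF i'] by (simp add: diff_divide_distrib)
    then show "\<bar>l i v / s\<bar> \<le> 1" using lam[OF i' uw(1)] lam[OF i' uw(2)] by auto
  qed
  ultimately have "\<bar>\<Prod>j<d. lam j y ^ \<beta> j\<bar> * \<bar>prod_list (map2 (\<lambda>i v. l i v / s) (map \<tau> [a..<d]) us)\<bar> \<le> 1 * 1"
    by (intro mult_mono) auto
  then show ?thesis using True by (simp add: monomial_form_def abs_mult)
qed (simp add: monomial_form_def)

text \<open>Supplies the symmetry of the weights under permutations of the head, which makes \<xi>
  alternating.\<close>

lemma monomial_form_tail: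
  assumes "i < a" "j < a"
  shows "monomial_form a k (\<tau> \<circ> Transposition.transpose i j) = monomial_form a k \<tau>"
proof -
  have "map (\<tau> \<circ> Transposition.transpose i j) [a..<d] = map \<tau> [a..<d]"
    using assms by (intro map_cong) (auto simp: Transposition.transpose_def)
  then show ?thesis by (simp only: monomial_form_def[abs_def])
qed

end

section \<open>Geometry of the complex\<close>

lemma simplex_vertices:
  fixes S :: "'a::euclidean_space set"
  assumes "simplicial_complex \<T>" "S \<in> \<T>"
  shows "\<not> affine_dependent (vertices S)" "S = convex hull (vertices S)"
    "int (card (vertices S)) = aff_dim S + 1" "finite (vertices S)"
proof -
  obtain n where "n simplex S" using assms by (auto simp: simplicial_complex_def)
  then obtain C where C: "\<not> affine_dependent C" "int (card C) = n + 1" "S = convex hull C"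
    by (auto simp: simplex_def)
  have "vertices S = C"
    unfolding vertices_def C(3) extreme_point_of_convex_hull_affine_independent[OF C(1)] by simp
  moreover have "aff_dim S = int (card C) - 1"
    using aff_dim_affine_independent[OF C(1)] by (simp add: C(3) aff_dim_convex_hull)
  ultimately show "\<not> affine_dependent (vertices S)" "S = convex hull (vertices S)"
    "int (card (vertices S)) = aff_dim S + 1" "finite (vertices S)"
    using C aff_independent_finite[OF C(1)] by simp_all
qed

lemma vertices_subset:
  fixes S :: "'a::euclidean_space set"
  assumes "simplicial_complex \<T>" "S \<in> \<T>" "G \<in> \<T>" "S \<subseteq> G"
  shows "vertices S \<subseteq> vertices G"
proof -
  have "(G \<inter> S) face_of G" using assms unfolding simplicial_complex_def by blast
  moreover have "G \<inter> S = S" using assms(4) by blast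
  ultimately have "S face_of G" by simp
  then show ?thesis by (auto simp: vertices_def extreme_point_of_face)
qed

lemma compact_simplex_complex:
  "simplicial_complex \<T> \<Longrightarrow> S \<in> \<T> \<Longrightarrow> compact S"
  by (auto simp: simplicial_complex_def intro: compact_simplex)

text \<open>S is a vertex V of G, and G has a second vertex w. The edge from V to w is a face of G,
  hence belongs to the complex and competes in the minimum. Positivity holds because the minimum is
  attained by an edge with two distinct points.\<close>

lemma mesh_size_vertex:
  fixes S :: "'a::euclidean_space set"
  assumes cx: "simplicial_complex \<T>" and S: "S \<in> \<T>" "aff_dim S = 0" and G: "G \<in> \<T>" "S \<subseteq> G" "1 \<le> aff_dim G"
  shows "0 < mesh_size \<T> S" "mesh_size \<T> S \<le> diameter G"
proof -
  let ?D = "{diameter E |E. E \<in> \<T> \<and> aff_dim E = 1 \<and> S \<subseteq> E}"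
  have m: "mesh_size \<T> S = Min ?D" using S(2) by (simp add: mesh_size_def)
  have "finite \<T>" using cx by (simp add: simplicial_complex_def)
  then have fin: "finite ?D" by simp
  note SV = simplex_vertices[OF cx S(1)] and GV = simplex_vertices[OF cx G(1)]
  have "card (vertices S) = 1" using SV(3) S(2) by simp
  then obtain V where V: "vertices S = {V}" by (auto simp: card_1_singleton_iff)
  then have SV': "S = {V}" using SV(2) by simp
  have VG: "V \<in> vertices G" using vertices_subset[OF cx S(1) G(1,2)] V by simp
  have "1 < card (vertices G)" using GV(3) G(3) by simp
  then have "vertices G \<noteq> {V}" by auto
  then obtain w where w: "w \<in> vertices G" "w \<noteq> V" using VG by blast
  let ?E = "convex hull {V, w}"
  have "?E face_of convex hull (vertices G)"
    unfolding face_of_convex_hull_affine_independent[OF GV(1)] using VG w(1) by (intro exI[of _ "{V, w}"]) simp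
  then have face: "?E face_of G" using GV(2) by simp
  have "?E \<in> \<T>" using cx G(1) face by (auto simp: simplicial_complex_def)
  moreover have "aff_dim ?E = 1" using w(2) by (simp add: aff_dim_convex_hull aff_dim_2)
  moreover have "S \<subseteq> ?E" unfolding SV' using hull_subset[of "{V, w}" convex] by auto
  ultimately have E: "diameter ?E \<in> ?D" by blast
  have "Min ?D \<in> ?D" using E by (intro Min_in fin) auto
  then obtain E' where E': "Min ?D = diameter E'" "E' \<in> \<T>" "aff_dim E' = 1" by blast
  have "\<not> E' \<subseteq> {x}" for x
  proof
    assume "E' \<subseteq> {x}"
    then have "aff_dim E' \<le> aff_dim {x}" by (rule aff_dim_subset)
    then show False using E'(3) by simp
  qed
  then obtain x y where xy: "x \<in> E'" "y \<in> E'" "x \<noteq> y" by blast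
  have "dist x y \<le> diameter E'"
    using diameter_bounded_bound[OF compact_imp_bounded[OF compact_simplex_complex[OF cx E'(2)]] xy(1,2)] .
  then show "0 < mesh_size \<T> S" unfolding m E'(1) using xy(3) by (meson less_le_trans zero_less_dist_iff)
  have "Min ?D \<le> diameter ?E" by (rule Min_le[OF fin E])
  also have "\<dots> \<le> diameter G"
    by (rule diameter_subset[OF face_of_imp_subset[OF face] compact_imp_bounded[OF compact_simplex_complex[OF cx G(1)]]])
  finally show "mesh_size \<T> S \<le> diameter G" unfolding m .
qed

lemma shape_measure_upper:
  fixes T :: "'a::euclidean_space set"
  assumes cx: "simplicial_complex \<T>" and T: "T \<in> top_simplices \<T>"
  shows "diameter T ^ DIM('a) / simplex_volume T \<le> shape_measure \<T>"
proof -
  have "finite \<T>" using cx by (simp add: simplicial_complex_def)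
  then have "finite {diameter T ^ sdim T / simplex_volume T |T. T \<in> \<T> \<and> 1 \<le> aff_dim T}" by simp
  moreover have "sdim T = DIM('a)" "1 \<le> aff_dim T"
    using T DIM_positive[where 'a='a] by (auto simp: top_simplices_def sdim_def)
  then have "diameter T ^ DIM('a) / simplex_volume T \<in>
      {diameter T ^ sdim T / simplex_volume T |T. T \<in> \<T> \<and> 1 \<le> aff_dim T}"
    using T by (intro CollectI exI[of _ T]) (simp add: top_simplices_def)
  ultimately show ?thesis unfolding shape_measure_def by (intro cSup_upper bdd_above_finite)
qed

lemma simplex_patch_exists:
  fixes ws :: "'a::euclidean_space list"
  assumes "DIM('a) = Suc d" "length ws = Suc d" "distinct ws" "v \<notin> set ws"
    "\<not> affine_dependent (insert v (set ws))" "0 < s" "\<And>j. j < d \<Longrightarrow> 0 \<le> off j" "(\<Sum>j<d. off j) \<le> 1 - s"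
    "0 < sT" "sT \<le> s"
  obtains l lT where "simplex_patch ws d l s off v lT sT"
proof -
  let ?es = "simplex_edges (ws @ [v])"
  have ws: "ws \<noteq> []" using assms(2) by auto
  have e: "distinct ?es" "independent (set ?es)"
    using simplex_edges_independent[of "ws @ [v]"] assms(3-5) by auto
  have es: "?es = simplex_edges ws @ [v - hd ws]" by (rule simplex_edges_snoc[OF ws])
  have ls: "length (simplex_edges ws) = d" using assms(2) by (simp add: simplex_edges_def)
  have le: "length ?es = Suc d" using ls by (simp add: es)
  obtain f :: "nat \<Rightarrow> 'a \<Rightarrow> real" where f: "\<And>i. i < length ?es \<Longrightarrow> linear (f i)"
    "\<And>i j. i < length ?es \<Longrightarrow> j < length ?es \<Longrightarrow> f i (?es ! j) = (if i = j then 1 else 0)"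
    by (rule dual_functionals[OF e], rule that; assumption)
  have nth: "simplex_edges ws ! j = ?es ! j" if "j < d" for j using that ls by (simp add: es nth_append)
  have nv: "v - hd ws = ?es ! d" using ls by (simp add: es nth_append)
  have "simplex_patch ws d f s off v (f d) sT"
  proof (intro simplex_patch.intro facet_patch.intro simplex_patch_axioms.intro)
    show "f i (simplex_edges ws ! j) = (if i = j then 1 else 0)" if "i < d" "j < d" for i j
      using f(2)[of i j] that le nth by simp
    show "f i (v - hd ws) = 0" if "i < d" for i using f(2)[of i d] that le by (simp add: nv)
    show "f d (simplex_edges ws ! j) = 0" if "j < d" for j using f(2)[of d j] that le nth by simp
    show "f d (v - hd ws) = 1" using f(2)[of d d] le by (simp add: nv)
  qed (use assms f(1) le in auto)
  then show ?thesis by (rule that)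
qed


section \<open>Shape regularity: gradients of coordinates and lengths of edges\<close>

context simplex_patch
begin

lemma card_vertices: "card (insert v (set ws)) = DIM('a) + 1"
  using distinct_card[OF distinct_ws] v length_ws dim by simp

lemma gradient_bounds:
  assumes mu: "diameter T ^ DIM('a) / simplex_volume T \<le> \<mu>" and L: "L = max 1 (real DIM('a) * (fact DIM('a) * \<mu>\<^sup>2))"
  shows "0 < diameter T" "\<And>i x. i < d \<Longrightarrow> \<bar>l i x\<bar> \<le> L * norm x / diameter T"
    "\<And>x. \<bar>lT x\<bar> \<le> L * norm x / diameter T"
proof -
  note G = simplex_gradient_bound[OF ind card_vertices mu]
  show d: "0 < diameter T" by (rule G(1)[OF lT_linear lT_diff_le])
  have le: "real DIM('a) * (fact DIM('a) * \<mu>\<^sup>2) * norm x / diameter T \<le> L * norm x / diameter T" for x :: 'a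
    using d by (intro divide_right_mono mult_right_mono) (auto simp: L)
  show "\<bar>l i x\<bar> \<le> L * norm x / diameter T" if "i < d" for i x
    using G(2)[OF l_linear[OF that] l_diff_le[OF _ _ that], of x] le[of x] by linarith
  show "\<bar>lT x\<bar> \<le> L * norm x / diameter T" for x
    using G(2)[OF lT_linear lT_diff_le, of x] le[of x] by linarith
qed

text \<open>The barycentric coordinate of x changes by 1 between x and any other vertex, while its
  gradient is at most L / diameter T. The base vertex hd ws has no functional \<open>l i\<close> of
  its own, so for u = hd ws the roles are exchanged.\<close>

lemma diameter_le_vertex_distance:
  assumes mu: "diameter T ^ DIM('a) / simplex_volume T \<le> \<mu>" and L: "L = max 1 (real DIM('a) * (fact DIM('a) * \<mu>\<^sup>2))"
    and uw: "u \<in> set ws" "w \<in> set ws" "u \<noteq> w"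
  shows "diameter T \<le> L * norm (u - w)"
proof -
  note G = gradient_bounds[OF mu L]
  have *: "diameter T \<le> L * norm (x - y)" if x: "x \<in> set ws" "x \<noteq> hd ws" and y: "y \<in> set ws" "x \<noteq> y" for x y
  proof -
    have "x \<in> insert v (set ws)" using x by simp
    then obtain i where i: "i < d" "x = ws ! Suc i"
      using x v by (cases rule: vertex_cases) auto
    have "l i (x - hd ws) = 1" "l i (y - hd ws) = 0"
      using l_vertex[of x i] l_vertex[of y i] x y i by auto
    then have "l i (x - y) = 1" using linear_diff[OF l_linear[OF i(1)], of "x - hd ws" "y - hd ws"] by simp
    then have "1 \<le> L * norm (x - y) / diameter T" using G(2)[OF i(1), of "x - y"] by simp
    then show ?thesis using G(1) by (simp add: field_simps)
  qed
  show ?thesis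
  proof (cases "u = hd ws")
    case True
    then have "diameter T \<le> L * norm (w - u)" using uw by (intro *) auto
    then show ?thesis by (simp only: norm_minus_commute)
  qed (use * uw in blast)
qed

end

text \<open>The constant E of \<open>patch_form_estimates\<close> for d = n - 1 and \<rho> = n * L;
  a triangulation enters only through L.\<close>

definition patch_const :: "nat \<Rightarrow> nat \<Rightarrow> real \<Rightarrow> real \<Rightarrow> real \<Rightarrow> real"
  where "patch_const n r B M L =
    real (n ^ n) * (real n * (fact (n - 1) * real (Suc r ^ (n - 1)) * B * (real n * M ^ n * L ^ n)))
      * (1 + unit_ball_vol (real n) * (real n * L) ^ n)"

text \<open>The analytic data fixed once for given r and d. The margins d * hi \<le> 1/2 and
  [-1/4, 1/4] add up to 3/4, which keeps the support away from the facet opposite the base vertex.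
  Bounds on kernels are demanded for i \<le> r, the range of the exponents.\<close>

locale mollifiers =
  fixes r d :: nat and \<kappa> \<kappa>' :: "nat \<Rightarrow> real \<Rightarrow> real" and \<psi> \<psi>' :: "real \<Rightarrow> real" and lo hi M :: real
  assumes smooth: "\<And>i. smooth_fun (\<kappa> i)" "smooth_fun \<psi>"
    and \<kappa>_supp: "\<And>i x. x \<notin> {lo..hi} \<Longrightarrow> \<kappa> i x = 0" "\<And>i x. x \<notin> {lo..hi} \<Longrightarrow> \<kappa>' i x = 0"
    and \<psi>_supp: "\<And>x. x \<notin> {-1/4..1/4} \<Longrightarrow> \<psi> x = 0" "\<And>x. x \<notin> {-1/4..1/4} \<Longrightarrow> \<psi>' x = 0"
    and moments: "\<And>i j. i \<le> r \<Longrightarrow> j \<le> r \<Longrightarrow> (LINT x|lborel. \<kappa> i x * x ^ j) = (if i = j then 1 else 0)"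
    and lo: "0 < lo" and hi: "real d * hi \<le> 1 / 2" "hi \<le> 1"
    and \<psi>_0: "\<psi> 0 = 1"
    and deriv: "\<And>i x. (\<kappa> i has_real_derivative \<kappa>' i x) (at x)" "\<And>x. (\<psi> has_real_derivative \<psi>' x) (at x)"
    and bound: "\<And>i x. i \<le> r \<Longrightarrow> \<bar>\<kappa> i x\<bar> \<le> M" "\<And>i x. i \<le> r \<Longrightarrow> \<bar>\<kappa>' i x\<bar> \<le> M"
      "\<And>x. \<bar>\<psi> x\<bar> \<le> M" "\<And>x. \<bar>\<psi>' x\<bar> \<le> M" "1 \<le> M"
begin

lemma zero_outside:
  "x \<notin> {-1..1} \<Longrightarrow> \<kappa> i x = 0" "x \<notin> {-1..1} \<Longrightarrow> \<kappa>' i x = 0"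
  "x \<notin> {-1..1} \<Longrightarrow> \<psi> x = 0" "x \<notin> {-1..1} \<Longrightarrow> \<psi>' x = 0"
proof -
  assume "x \<notin> {-1..1}"
  then have "x \<notin> {lo..hi}" "x \<notin> {-1/4..1/4}" using lo hi(2) by auto
  then show "\<kappa> i x = 0" "\<kappa>' i x = 0" "\<psi> x = 0" "\<psi>' x = 0" using \<kappa>_supp \<psi>_supp by blast+
qed

text \<open>The patch size is controlled from both sides. The lower bounds on s * diameter T and sT
  * diameter T turn gradients L / diameter T into L / h after rescaling, and the upper bounds on the
  patch edges put the support into a ball of radius n * L * h.\<close>

lemma patch_estimates:
  fixes ws :: "'a::euclidean_space list"
  assumes P: "simplex_patch ws d l s off v lT sT" and a: "a \<le> d"
    and c: "\<And>\<tau> i j \<beta>. \<tau> permutes {..<d} \<Longrightarrow> i < a \<Longrightarrow> j < a \<Longrightarrow>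
        c (\<tau> \<circ> Transposition.transpose i j) \<beta> = c \<tau> \<beta>"
    and B: "\<And>\<tau> \<beta>. \<tau> permutes {..<d} \<Longrightarrow> \<bar>c \<tau> \<beta>\<bar> \<le> B" "0 \<le> B"
    and T: "T = convex hull (insert v (set ws))"
    and mu: "diameter T ^ DIM('a) / simplex_volume T \<le> \<mu>" and L: "L = max 1 (real DIM('a) * (fact DIM('a) * \<mu>\<^sup>2))"
    and h: "0 < h" "0 < d \<Longrightarrow> h \<le> s * diameter T" "h \<le> sT * diameter T"
    and e: "\<And>i. i < d \<Longrightarrow> s * norm (simplex_edges ws ! i) \<le> L * h" "sT * norm (v - hd ws) \<le> L * h"
    and p: "1 \<le> p"
  shows "Lp_norm p (int a) T (facet_patch.patch_form ws d l s off a \<kappa> r c \<psi> lT sT T)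
      \<le> ereal (patch_const DIM('a) r B M L * h powr (dim_over DIM('a) p - real a))"
    "Lp_norm p (int a + 1) T (ext_deriv T (facet_patch.patch_form ws d l s off a \<kappa> r c \<psi> lT sT T))
      \<le> ereal (patch_const DIM('a) r B M L * h powr (dim_over DIM('a) p - real a - 1))"
proof -
  interpret simplex_patch ws d l s off v lT sT by (rule P)
  note G = gradient_bounds[OF mu[unfolded T] L, folded T]
  have L1: "1 \<le> L" by (simp add: L)
  have sc: "y / t \<le> L / h * m" if y: "y \<le> L * m / diameter T" and t: "0 < t" "h \<le> t * diameter T" and m: "0 \<le> m" for y t m
  proof -
    have "y / t \<le> L * m / diameter T / t" using y t(1) by (intro divide_right_mono) auto
    also have "\<dots> = L * m / (t * diameter T)" by simp
    also have "\<dots> \<le> L * m / h" using t m L1 h(1) by (intro divide_left_mono) auto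
    finally show ?thesis by simp
  qed
  have l_bd: "\<bar>l i x / s\<bar> \<le> L / h * norm x" if "i < d" for i x
    using sc[OF G(2)[OF that, of x] s_pos] h(2) that s_pos by simp
  have lT_bd: "\<bar>lT x / sT\<bar> \<le> L / h * norm x" for x
    using sc[OF G(3)[of x] sT_pos h(3)] sT_pos by simp
  let ?q = "hd ws + (\<Sum>i<d. off i *\<^sub>R (simplex_edges ws ! i))"
  have K: "x \<in> cball ?q (real DIM('a) * L * h)" if "\<And>i. i < Suc d \<Longrightarrow> coord lT sT i x \<in> {-1..1}" for x
    using coord_cball[OF that e] by (simp only: dim mult.assoc)
  have T': "tangent T = UNIV" "compact T" "convex T"
    using tangent_T by (auto simp: T intro: finite_imp_compact_convex_hull convex_convex_hull)
  have rho: "0 \<le> real DIM('a) * L" using L1 by simp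
  have E: "real (DIM('a) ^ DIM('a)) * (real DIM('a) * (fact d * real (Suc r ^ d) * B * (real DIM('a) * M ^ DIM('a) * L ^ DIM('a))))
      * (1 + unit_ball_vol (real DIM('a)) * (real DIM('a) * L) ^ DIM('a)) = patch_const DIM('a) r B M L"
    by (simp only: patch_const_def dim diff_Suc_1)
  show "Lp_norm p (int a) T (patch_form a \<kappa> r c \<psi> lT sT T)
      \<le> ereal (patch_const DIM('a) r B M L * h powr (dim_over DIM('a) p - real a))"
    unfolding E[symmetric]
    by (rule patch_form_estimates(1)[where L = L and \<rho> = "real DIM('a) * L" and h = h and q = ?q and B = B and M = M and \<kappa>' = \<kappa>' and \<psi>' = \<psi>'];
        fact smooth a dim c lT_linear T' B deriv bound zero_outside h(1) L1 l_bd lT_bd K rho p)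
  show "Lp_norm p (int a + 1) T (ext_deriv T (patch_form a \<kappa> r c \<psi> lT sT T))
      \<le> ereal (patch_const DIM('a) r B M L * h powr (dim_over DIM('a) p - real a - 1))"
    unfolding E[symmetric]
    by (rule patch_form_estimates(2)[where L = L and \<rho> = "real DIM('a) * L" and h = h and q = ?q and B = B and M = M and \<kappa>' = \<kappa>' and \<psi>' = \<psi>'];
        fact smooth a dim c lT_linear T' B deriv bound zero_outside h(1) L1 l_bd lT_bd K rho p)
qed


end

context facet_patch
begin

lemma pairing_coef_bound:
  assumes a: "a \<le> d" and S: "convex S" "compact S" and wsS: "wsS \<noteq> []" "set wsS \<subseteq> S" "length wsS \<le> n"
    and \<alpha>: "cont_components S \<alpha>" and b: "0 \<le> b"
      "\<And>y vs. y \<in> S \<Longrightarrow> set vs \<subseteq> {u - w |u w. u \<in> S \<and> w \<in> S} \<Longrightarrow> \<bar>\<alpha> y vs\<bar> \<le> b"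
    and lam: "\<And>j y. j < d \<Longrightarrow> y \<in> S \<Longrightarrow> lam j y \<in> {0..1}" and t: "\<tau> permutes {..<d}"
  shows "\<bar>form_integral wsS (wedge \<alpha> (form_trace S (monomial_form a k \<tau> \<beta>)))\<bar> \<le> real n * fact n * b"
proof -
  have e: "set (simplex_edges wsS) \<subseteq> {u - w |u w. u \<in> S \<and> w \<in> S}"
  proof
    fix x assume "x \<in> set (simplex_edges wsS)"
    then obtain w where "w \<in> set (tl wsS)" "x = w - hd wsS" by (auto simp: simplex_edges_def)
    moreover have "w \<in> S" "hd wsS \<in> S" using wsS(1,2) \<open>w \<in> set (tl wsS)\<close> by (auto dest: list.set_sel(2) hd_in_set)
    ultimately show "x \<in> {u - w |u w. u \<in> S \<and> w \<in> S}" by blast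
  qed
  have "\<bar>form_integral wsS (wedge \<alpha> (form_trace S (monomial_form a k \<tau> \<beta>)))\<bar>
      \<le> real (length wsS) * fact (length wsS) * (b * 1)"
  proof (rule form_integral_wedge_bound[OF wsS(1,2) S \<alpha> cont_components_monomial_form[OF a]])
    show "\<bar>\<alpha> y vs\<bar> \<le> b" if "y \<in> S" "set vs \<subseteq> set (simplex_edges wsS)" for y vs
      using b(2)[OF that(1) subset_trans[OF that(2) e]] .
    show "\<bar>monomial_form a k \<tau> \<beta> y vs\<bar> \<le> 1" if "y \<in> S" "set vs \<subseteq> set (simplex_edges wsS)" for y vs
      by (rule monomial_form_bound[OF that(1) lam subset_trans[OF that(2) e] t])
  qed (use b in auto)
  also have "\<dots> \<le> real n * fact n * (b * 1)"
    using wsS(3) b(1) by (intro mult_right_mono mult_mono fact_mono) auto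
  finally show ?thesis by simp
qed

end

section \<open>Assembly for one facet and one of its faces\<close>

context mollifiers
begin

text \<open>An arbitrary weight \<alpha> stands in for the reference form; only continuity and a
  bound on differences of points of S enter. \<xi> is chosen before T, and its pairing is claimed
  for polynomial forms on the whole space, so that it involves no T.\<close>

lemma patch_family:
  fixes \<T> :: "'a::euclidean_space set set"
  assumes cx: "simplicial_complex \<T>" and top: "\<forall>S\<in>\<T>. \<exists>T\<in>top_simplices \<T>. S \<subseteq> T"
    and ori: "orientation \<T> orient" and F: "F \<in> \<T>" "aff_dim F = int DIM('a) - 1"
    and S: "S \<in> \<T>" "S \<noteq> {}" "S \<subseteq> F" and dim: "DIM('a) = Suc d" and ak: "d = a + k"
    and \<alpha>: "cont_components S \<alpha>" and b: "0 \<le> b"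
      "\<forall>y\<in>S. \<forall>vs. set vs \<subseteq> {u - w |u w. u \<in> S \<and> w \<in> S} \<longrightarrow> \<bar>\<alpha> y vs\<bar> \<le> b"
    and L: "L = max 1 (real DIM('a) * (fact DIM('a) * (shape_measure \<T>)\<^sup>2))"
  shows "\<exists>\<xi>\<in>smooth_forms_c (int a) F.
    (\<forall>\<omega>\<in>poly_forms (int r) (int k). form_integral (orient F) (wedge \<xi> (form_trace F \<omega>)) =
       form_integral (orient S) (wedge \<alpha> (form_trace S \<omega>))) \<and>
    (\<forall>T\<in>top_simplices \<T>. F \<subseteq> T \<longrightarrow> (\<exists>\<Xi>\<in>smooth_forms (int a) T. form_trace F \<Xi> = \<xi> \<and>
       (\<forall>G. G facet_of T \<and> G \<noteq> F \<longrightarrow> separated (form_support \<Xi>) G) \<and>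
       (\<forall>p. 1 \<le> p \<longrightarrow>
          Lp_norm p (int a) T \<Xi> \<le> ereal (patch_const DIM('a) r (real DIM('a) * fact DIM('a) * b) M L *
             mesh_size \<T> S powr (dim_over DIM('a) p - real a)) \<and>
          Lp_norm p (int a + 1) T (ext_deriv T \<Xi>) \<le> ereal (patch_const DIM('a) r (real DIM('a) * fact DIM('a) * b) M L *
             mesh_size \<T> S powr (dim_over DIM('a) p - real a - 1)))))"
proof -
  define h where "h = mesh_size \<T> S"
  define W where "W = orient F"
  \<comment> \<open>For a vertex this makes the patch edges at most h long, while s * diameter T is
    at least h since F is contained in T. For d = 0 the facet is a point of diameter 0 and there is
    nothing to contract along it.\<close>
  define s where "s = (if aff_dim S = 0 \<and> 0 < d then h / diameter F else 1)"
  \<comment> \<open>Centres the contraction at S: the coordinate belonging to the vertex S stays 1.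
    If S is the base vertex \<open>hd W\<close>, all relevant offsets are 0.\<close>
  define off where "off = (\<lambda>j. if aff_dim S = 0 \<and> W ! Suc j \<in> S then 1 - s else 0)"
  define sT where "sT = (\<lambda>T::'a set. if aff_dim S = 0 then h / diameter T else 1)"
  let ?up = "\<lambda>T. T \<in> top_simplices \<T> \<and> F \<subseteq> T"
  note FV = simplex_vertices[OF cx F(1)] and SV = simplex_vertices[OF cx S(1)]
  have F0: "F \<noteq> {}" using S by auto
  have ws: "distinct W" "set W = vertices F" using ori F(1) F0 by (auto simp: orientation_def W_def)
  have wsS: "distinct (orient S)" "set (orient S) = vertices S" using ori S by (auto simp: orientation_def)
  have len: "length W = Suc d" using FV(3) F(2) dim distinct_card[OF ws(1)] ws(2) by simp
  have ws0: "W \<noteq> []" using len by auto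
  have FH: "F = convex hull (set W)" using FV(2) ws(2) by simp
  have SF: "vertices S \<subseteq> set W" using vertices_subset[OF cx S(1) F(1) S(3)] ws(2) by simp
  have VS: "vertices S \<subseteq> S" by (auto simp: vertices_def extreme_point_of_def)
  have cp: "compact S" "compact F" using compact_simplex_complex[OF cx] S(1) F(1) by auto
  have cv: "convex S" using SV(2) convex_convex_hull by metis
  have S0: "orient S \<noteq> []" using wsS(2) SV(2) S(2) by auto
  have lenS: "length (orient S) \<le> DIM('a)"
    using distinct_card[OF wsS(1)] wsS(2) card_mono[OF _ SF] distinct_card[OF ws(1)] len dim by simp
  have vtx: "\<exists>V. S = {V} \<and> V \<in> set W" if "aff_dim S = 0"
  proof -
    have "card (vertices S) = 1" using SV(3) that by simp
    then obtain V where "vertices S = {V}" by (auto simp: card_1_singleton_iff)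
    then show ?thesis using SV(2) SF by simp
  qed
  have edge: "\<exists>u w. u \<in> vertices S \<and> w \<in> vertices S \<and> u \<noteq> w" if "aff_dim S \<noteq> 0"
  proof (rule ccontr)
    assume "\<nexists>u w. u \<in> vertices S \<and> w \<in> vertices S \<and> u \<noteq> w"
    then have "card (vertices S) \<le> 1" using SV(4) by (auto simp: card_le_Suc0_iff_eq)
    moreover have "0 \<le> aff_dim S" using S(2) aff_dim_negative_iff[of S] by linarith
    ultimately show False using SV(3) that by simp
  qed
  have upT: "T \<in> \<T>" "compact T" "diameter F \<le> diameter T" "aff_dim T = int DIM('a)" "S \<subseteq> T" if "?up T" for T
    using that compact_simplex_complex[OF cx, of T] S(3)
    by (auto simp: top_simplices_def intro: diameter_subset compact_imp_bounded)
  obtain T0 where T0: "?up T0" using top F(1) by blast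
  have h: "0 < h" "0 < d \<Longrightarrow> h \<le> diameter F" "?up T \<Longrightarrow> h \<le> diameter T" for T
  proof -
    show 1: "0 < h"
    proof (cases "aff_dim S = 0")
      case True
      show ?thesis unfolding h_def
        by (rule mesh_size_vertex(1)[OF cx S(1) True upT(1)[OF T0] upT(5)[OF T0]]) (use upT(4)[OF T0] dim in simp)
    next
      case False
      then obtain u w where uw: "u \<in> vertices S" "w \<in> vertices S" "u \<noteq> w" using edge by blast
      then have "dist u w \<le> diameter S" using VS cp(1)
        by (intro diameter_bounded_bound compact_imp_bounded) auto
      then have "0 < diameter S" using uw(3) by (meson less_le_trans zero_less_dist_iff)
      then show ?thesis using False by (simp add: h_def mesh_size_def)
    qed
    have le: "h \<le> diameter G" if "G \<in> \<T>" "S \<subseteq> G" "1 \<le> aff_dim G" "compact G" for G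
    proof (cases "aff_dim S = 0")
      case True
      show ?thesis unfolding h_def by (rule mesh_size_vertex(2)[OF cx S(1) True that(1-3)])
    next
      case False
      then show ?thesis using diameter_subset[OF that(2) compact_imp_bounded[OF that(4)]]
        by (simp add: h_def mesh_size_def)
    qed
    show "h \<le> diameter F" if "0 < d" by (rule le[OF F(1) S(3) _ cp(2)]) (use that F(2) dim in simp)
    show "h \<le> diameter T" if "?up T" by (rule le[OF upT(1,5) _ upT(2)]) (use that upT(4)[OF that] dim in auto)
  qed
  have s: "0 < s" "s \<le> 1"
  proof -
    have "0 < d \<Longrightarrow> 0 < diameter F" using h(1,2) by linarith
    then show "0 < s" "s \<le> 1" using h(1,2) by (auto simp: s_def field_simps)
  qed
  have off0: "0 \<le> off j" for j using s by (simp add: off_def)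
  have offsum: "(\<Sum>j<d. off j) \<le> 1 - s"
  proof (cases "\<exists>j<d. aff_dim S = 0 \<and> W ! Suc j \<in> S")
    case True
    then obtain i where i: "i < d" "aff_dim S = 0" "W ! Suc i \<in> S" by blast
    then have Si: "S = {W ! Suc i}" using vtx by blast
    have "off j = (if j = i then 1 - s else 0)" if "j < d" for j
      using i that ws(1) len by (simp add: off_def Si nth_eq_iff_index_eq)
    then have "(\<Sum>j<d. off j) = (\<Sum>j<d. if j = i then 1 - s else 0)" by (intro sum.cong) auto
    then show ?thesis using i(1) by simp
  next
    case False
    then have "(\<Sum>j<d. off j) = 0" by (intro sum.neutral) (auto simp: off_def)
    then show ?thesis using s by simp
  qed
  have sT: "0 < sT T" "sT T \<le> s" "h \<le> sT T * diameter T" "0 < d \<Longrightarrow> h \<le> s * diameter T" if T: "?up T" for T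
  proof -
    have D: "0 < diameter T" "h \<le> diameter T" using h(1) h(3)[OF T] by auto
    show "0 < sT T" using D h(1) by (simp add: sT_def)
    have FT: "diameter F \<le> diameter T" by (rule upT(3)[OF T])
    show "sT T \<le> s"
    proof (cases "aff_dim S = 0 \<and> 0 < d")
      case True
      then have "0 < diameter F" using h(1,2) by linarith
      then show ?thesis using True FT h(1) by (simp add: sT_def s_def frac_le)
    next
      case False
      then show ?thesis using D by (auto simp: sT_def s_def)
    qed
    show "h \<le> sT T * diameter T" using D by (simp add: sT_def)
    then show "h \<le> s * diameter T" using \<open>sT T \<le> s\<close> D(1) by (meson mult_right_mono less_imp_le order_trans)
  qed
  have patch: "\<exists>v l lT. T = convex hull (insert v (set W)) \<and> simplex_patch W d l s off v lT (sT T)" if T: "?up T" for T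
  proof -
    note TV = simplex_vertices[OF cx upT(1)[OF T]]
    have sub: "set W \<subseteq> vertices T" using vertices_subset[OF cx F(1) upT(1)[OF T]] T ws(2) by simp
    have "card (vertices T - set W) = 1"
      using card_Diff_subset[OF _ sub] distinct_card[OF ws(1)] TV(3) upT(4)[OF T] len dim by simp
    then obtain v where "vertices T - set W = {v}" by (auto simp: card_1_singleton_iff)
    then have v: "vertices T = insert v (set W)" "v \<notin> set W" using sub by auto
    obtain l lT where "simplex_patch W d l s off v lT (sT T)"
      by (rule simplex_patch_exists[OF dim len ws(1) v(2) TV(1)[unfolded v(1)] s(1) off0 offsum sT(1)[OF T] sT(2)[OF T]])
    then show ?thesis using TV(2) v(1) by auto
  qed
  \<comment> \<open>Any n-simplex over F supplies the functionals from which \<xi> is built;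
    \<open>facet_form_unique\<close> later replaces them by those of T.\<close>
  obtain v0 l0 lT0 where P0: "simplex_patch W d l0 s off v0 lT0 (sT T0)" using patch[OF T0] by blast
  interpret P: simplex_patch W d l0 s off v0 lT0 "sT T0" by (rule P0)
  \<comment> \<open>For a vertex the patch coordinates of S are 0 or 1 by the choice of
    \<open>off\<close>. Otherwise the patch is F itself and these are barycentric
    coordinates.\<close>
  have lam: "P.lam j y \<in> {0..1}" if j: "j < d" and y: "y \<in> S" for j y
  proof (cases "aff_dim S = 0")
    case True
    then obtain V where V: "S = {V}" "V \<in> set W" using vtx by blast
    then have "l0 j (V - hd W) = (if V = W ! Suc j then 1 else 0)" using P.l_vertex[OF _ j] by simp
    then show ?thesis using y V s unfolding P.lam_def by (auto simp: off_def True)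
  next
    case False
    let ?H = "l0 j -` {l0 j (hd W)..l0 j (hd W) + 1}"
    have "u \<in> ?H" if "u \<in> set W" for u
      using P.l_vertex[OF insertI2[OF that] j] linear_diff[OF P.l_linear[OF j], of u "hd W"] by (auto split: if_splits)
    moreover have "convex ?H" by (rule convex_linear_vimage[OF P.l_linear[OF j]]) simp
    ultimately have "F \<subseteq> ?H" unfolding FH by (intro hull_minimal) auto
    then have "y \<in> ?H" using y S(3) by blast
    moreover have "P.lam j y = l0 j y - l0 j (hd W)"
      unfolding P.lam_def using False linear_diff[OF P.l_linear[OF j], of y "hd W"] by (simp add: off_def s_def)
    ultimately show ?thesis by simp
  qed
  define c where "c = (\<lambda>\<tau> \<beta>. form_integral (orient S) (wedge \<alpha> (form_trace S (P.monomial_form a k \<tau> \<beta>))))"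
  have c: "c \<tau> \<beta> = form_integral (orient S) (wedge \<alpha> (form_trace S (P.monomial_form a k \<tau> \<beta>)))" for \<tau> \<beta>
    by (simp only: c_def)
  have a: "a \<le> d" using ak by simp
  have tail: "c (\<tau> \<circ> Transposition.transpose i j) \<beta> = c \<tau> \<beta>" if "\<tau> permutes {..<d}" "i < a" "j < a" for \<tau> i j \<beta>
    using P.monomial_form_tail[OF that(2,3)] by (simp only: c_def)
  let ?B = "real DIM('a) * fact DIM('a) * b"
  have wsSS: "set (orient S) \<subseteq> S" using wsS(2) VS by simp
  have cB: "\<bar>c \<tau> \<beta>\<bar> \<le> ?B" if "\<tau> permutes {..<d}" for \<tau> \<beta>
    unfolding c_def by (rule P.pairing_coef_bound[OF a cv cp(1) S0 wsSS lenS \<alpha> b(1) b(2)[rule_format] lam that])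
  have B0: "0 \<le> ?B" using b(1) by simp
  let ?\<xi> = "P.facet_form a \<kappa> r c"
  have hi1: "real d * hi \<le> 1" using hi(1) by simp
  have "?\<xi> \<in> smooth_forms_c (int a) F"
    by (rule P.facet_form_smooth_c[where \<kappa> = \<kappa> and c = c, OF smooth(1) \<kappa>_supp(1) lo hi(1) a tail ws(1), folded FH])
      (use FV(1) ws(2) in simp_all)
  moreover have "form_integral W (wedge ?\<xi> (form_trace F \<omega>)) = form_integral (orient S) (wedge \<alpha> (form_trace S \<omega>))"
    if w: "\<omega> \<in> poly_forms (int r) (int k)" for \<omega>
    by (rule P.facet_form_pairing[where lo = lo and hi = hi and wsS = "orient S" and \<alpha> = \<alpha> and S = S and c = c, folded FH];
        fact smooth(1) \<kappa>_supp(1) moments less_imp_le[OF lo] hi1 ak w cv cp(1) S(3) S0 wsSS \<alpha> c)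
  moreover have "\<exists>\<Xi>\<in>smooth_forms (int a) T. form_trace F \<Xi> = ?\<xi> \<and>
       (\<forall>G. G facet_of T \<and> G \<noteq> F \<longrightarrow> separated (form_support \<Xi>) G) \<and>
       (\<forall>p. 1 \<le> p \<longrightarrow>
          Lp_norm p (int a) T \<Xi> \<le> ereal (patch_const DIM('a) r ?B M L * h powr (dim_over DIM('a) p - real a)) \<and>
          Lp_norm p (int a + 1) T (ext_deriv T \<Xi>) \<le> ereal (patch_const DIM('a) r ?B M L * h powr (dim_over DIM('a) p - real a - 1)))"
    if T: "?up T" for T
  proof -
    obtain v l lT where TH: "T = convex hull (insert v (set W))" and Q0: "simplex_patch W d l s off v lT (sT T)"
      using patch[OF T] by blast
    interpret Q: simplex_patch W d l s off v lT "sT T" by (rule Q0)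
    let ?\<Xi> = "Q.patch_form a \<kappa> r c \<psi> lT (sT T) T"
    have tT: "tangent T = UNIV" using Q.tangent_T by (simp only: TH)
    have mu: "diameter T ^ DIM('a) / simplex_volume T \<le> shape_measure \<T>"
      using shape_measure_upper[OF cx] T by blast
    note bd = compact_imp_bounded[OF upT(2)[OF T]]
    have L1: "1 \<le> L" by (simp add: L)
    have vT: "x \<in> T" if "x \<in> insert v (set W)" for x using that hull_subset[of "insert v (set W)" convex] TH by auto
    have WF: "x \<in> F" if "x \<in> set W" for x using that hull_subset[of "set W" convex] FH by auto
    have hdT: "hd W \<in> insert v (set W)" using ws0 by simp
    \<comment> \<open>S has at least two vertices. Their distance is at most h and at least diameter
      T / L, so all of T has size at most L * h.\<close>
    have big: "norm (x - y) \<le> L * h" if S1: "aff_dim S \<noteq> 0" and xy: "x \<in> insert v (set W)" "y \<in> insert v (set W)" for x y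
    proof -
      obtain u w where uw: "u \<in> vertices S" "w \<in> vertices S" "u \<noteq> w" using edge[OF S1] by blast
      have "norm (x - y) \<le> diameter T" using diameter_bounded_bound[OF bd vT[OF xy(1)] vT[OF xy(2)]] by (simp add: dist_norm)
      also have "\<dots> \<le> L * norm (u - w)"
        unfolding TH by (rule Q.diameter_le_vertex_distance[OF mu[unfolded TH] L _ _ uw(3)]) (use uw SF in auto)
      also have "\<dots> \<le> L * h"
      proof (rule mult_left_mono)
        have "u \<in> S" "w \<in> S" using uw VS by auto
        then show "norm (u - w) \<le> h"
          using diameter_bounded_bound[OF compact_imp_bounded[OF cp(1)], of u w] S1
          by (simp add: dist_norm h_def mesh_size_def)
      qed (use L1 in simp)
      finally show ?thesis .
    qed
    have hL: "h \<le> L * h" using mult_right_mono[OF L1, of h] h(1) by simp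
    have e1: "s * norm (simplex_edges W ! i) \<le> L * h" if i: "i < d" for i
    proof -
      have w: "simplex_edges W ! i = W ! Suc i - hd W" "W ! Suc i \<in> set W" using Q.edge_nth[OF i] i len by auto
      show ?thesis
      proof (cases "aff_dim S = 0")
        case True
        have "0 < diameter F" "s = h / diameter F" using h(1,2) i True by (auto simp: s_def)
        moreover have "norm (W ! Suc i - hd W) \<le> diameter F"
          using diameter_bounded_bound[OF compact_imp_bounded[OF cp(2)] WF[OF w(2)] WF[OF hd_in_set[OF ws0]]]
          by (simp add: dist_norm)
        then have "h * norm (W ! Suc i - hd W) \<le> h * diameter F" using h(1) by simp
        ultimately have "s * norm (W ! Suc i - hd W) \<le> h" by (simp add: pos_divide_le_eq)
        then show ?thesis using hL w(1) by simp
      next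
        case False
        then show ?thesis using big[OF False insertI2[OF w(2)] hdT] by (simp add: w(1) s_def)
      qed
    qed
    have e2: "sT T * norm (v - hd W) \<le> L * h"
    proof (cases "aff_dim S = 0")
      case True
      have "norm (v - hd W) \<le> diameter T"
        using diameter_bounded_bound[OF bd vT[OF insertI1] vT[OF hdT]] by (simp add: dist_norm)
      then have "h * norm (v - hd W) \<le> h * diameter T" using h(1) by simp
      moreover have "0 < diameter T" using h(1) h(3)[OF T] by linarith
      ultimately have "sT T * norm (v - hd W) \<le> h" using True by (simp add: sT_def field_simps)
      then show ?thesis using hL by linarith
    next
      case False
      then show ?thesis using big[OF False insertI1 hdT] by (simp add: sT_def)
    qed
    have "?\<Xi> \<in> smooth_forms (int a) T" by (rule Q.patch_form_smooth(2)[where \<kappa> = \<kappa> and c = c, OF smooth a tail Q.lT_linear tT])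
    moreover have "form_trace F ?\<Xi> = ?\<xi>"
    proof -
      have "form_trace F ?\<Xi> = Q.facet_form a \<kappa> r c"
        by (rule Q.patch_form_trace[folded FH, where \<psi> = \<psi>, OF conjunct2[OF T]])
          (fact Q.lT_tangent_F[folded FH] \<psi>_0)+
      also have "\<dots> = ?\<xi>"
        by (rule facet_form_unique[OF Q.facet_patch_axioms P.facet_patch_axioms a])
      finally show ?thesis .
    qed
    moreover have "separated (form_support ?\<Xi>) G" if "G facet_of T" "G \<noteq> F" for G
      using Q.patch_form_separated[folded TH FH, where \<kappa> = \<kappa> and \<psi> = \<psi>, OF \<kappa>_supp(1) \<psi>_supp(1) lo hi(1) that] .
    moreover have "Lp_norm p (int a) T ?\<Xi> \<le> ereal (patch_const DIM('a) r ?B M L * h powr (dim_over DIM('a) p - real a))"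
      "Lp_norm p (int a + 1) T (ext_deriv T ?\<Xi>) \<le> ereal (patch_const DIM('a) r ?B M L * h powr (dim_over DIM('a) p - real a - 1))"
      if p: "1 \<le> p" for p
      by (rule patch_estimates[where c = c and p = p, OF Q0 a tail cB B0 TH mu L h(1) sT(4)[OF T] sT(3)[OF T] e1 e2 p]; assumption)+
    ultimately show ?thesis by blast
  qed
  ultimately show ?thesis unfolding h_def[symmetric] W_def[symmetric] by blast
qed

end


section \<open>Existence of the kernels and of the cutoff\<close>

lemma mollifiers_exist:
  obtains \<kappa> \<kappa>' \<psi> \<psi>' lo hi M where "mollifiers r d \<kappa> \<kappa>' \<psi> \<psi>' lo hi M"
proof -
  \<comment> \<open>Dividing by d + 1 covers d = 0; the factors 4 and 2 ensure 0 < lo < hi and d *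
    hi \<le> 1/2.\<close>
  define lo hi :: real where "lo = 1 / (4 * (real d + 1))" and "hi = 1 / (2 * (real d + 1))"
  have lohi: "0 < lo" "lo < hi" "real d * hi \<le> 1 / 2" "hi \<le> 1" by (simp_all add: lo_def hi_def field_simps)
  obtain \<kappa> :: "nat \<Rightarrow> real \<Rightarrow> real" where \<kappa>: "\<And>i. smooth_fun (\<kappa> i)" "\<And>i x. x \<notin> {lo..hi} \<Longrightarrow> \<kappa> i x = 0"
    "\<And>i j. i \<le> r \<Longrightarrow> j \<le> r \<Longrightarrow> (LINT x|lborel. \<kappa> i x * x ^ j) = (if i = j then 1 else 0)"
    by (rule dual_kernel_exists[OF lohi(2)], rule that; assumption)
  let ?ok = "\<lambda>f a b f' M. (\<forall>x. (f has_real_derivative f' x) (at x)) \<and> (\<forall>x. x \<notin> {a..b} \<longrightarrow> f' x = 0) \<and>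
      (\<forall>x. \<bar>f x\<bar> \<le> M) \<and> (\<forall>x. \<bar>f' x\<bar> \<le> M)"
  have bd: "\<exists>f' M. ?ok f a b f' M" if f: "smooth_fun f" and z: "\<And>x. x \<notin> {a..b} \<Longrightarrow> f x = 0"
    for f :: "real \<Rightarrow> real" and a b
  proof -
    obtain f' M where fM: "\<And>x. (f has_real_derivative f' x) (at x)" "\<And>x. x \<notin> {a..b} \<Longrightarrow> f' x = 0"
      "\<And>x. \<bar>f x\<bar> \<le> M" "\<And>x. \<bar>f' x\<bar> \<le> M"
      by (rule smooth_bounded_derivative[OF f z], assumption, rule that; assumption)
    show ?thesis by (intro exI conjI allI impI) (rule fM; assumption?)+
  qed
  have "\<forall>i. \<exists>f' M. ?ok (\<kappa> i) lo hi f' M" using bd[OF \<kappa>(1,2)] by blast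
  from choice[OF this] obtain \<kappa>' where "\<forall>i. \<exists>M. ?ok (\<kappa> i) lo hi (\<kappa>' i) M" by blast
  from choice[OF this] obtain N where N: "\<And>i. ?ok (\<kappa> i) lo hi (\<kappa>' i) (N i)" by blast
  define \<psi> where "\<psi> = (\<lambda>x. bump (-1/4) (1/4) x * (1 / bump (-1/4) (1/4) 0 :: real))"
  have b0: "0 < bump (-1/4) (1/4) 0" by (rule bump_pos) simp_all
  have \<psi>: "smooth_fun \<psi>" "\<psi> 0 = 1"
    unfolding \<psi>_def by (rule smooth_fun_mult[OF smooth_fun_bump smooth_fun_const]) (use b0 in simp)
  have \<psi>z: "\<psi> x = 0" if "x \<notin> {-1/4..1/4}" for x
  proof -
    have "bump (-1/4) (1/4) x = 0" by (rule bump_eq_0) (use that in auto)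
    then show ?thesis by (simp add: \<psi>_def)
  qed
  obtain \<psi>' N' where N': "?ok \<psi> (-1/4) (1/4) \<psi>' N'" using bd[OF \<psi>(1) \<psi>z] by blast
  \<comment> \<open>A maximum over the finitely many kernels with index at most r, together with the
    cutoff and the required lower bound 1.\<close>
  define M where "M = max 1 (max N' (Max (N ` {..r})))"
  have "N i \<le> M" if "i \<le> r" for i
  proof -
    have "N i \<le> Max (N ` {..r})" by (rule Max_ge) (use that in auto)
    then show ?thesis by (simp add: M_def le_max_iff_disj)
  qed
  then have \<kappa>M: "\<bar>\<kappa> i x\<bar> \<le> M" "\<bar>\<kappa>' i x\<bar> \<le> M" if "i \<le> r" for i x
    using N[of i] that by (auto intro: order_trans[of _ "N i"])
  have NM: "N' \<le> M" "1 \<le> M" by (simp_all add: M_def)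
  have \<psi>M: "\<bar>\<psi> x\<bar> \<le> M" "\<bar>\<psi>' x\<bar> \<le> M" for x
    using N' NM(1) by (auto intro: order_trans[of _ N'])
  have der: "(\<kappa> i has_real_derivative \<kappa>' i x) (at x)" "x \<notin> {lo..hi} \<Longrightarrow> \<kappa>' i x = 0"
    "(\<psi> has_real_derivative \<psi>' x) (at x)" "x \<notin> {-1/4..1/4} \<Longrightarrow> \<psi>' x = 0" for i x
    using N[of i] N' by simp_all
  have "mollifiers r d \<kappa> \<kappa>' \<psi> \<psi>' lo hi M"
    by (rule mollifiers.intro; fact \<kappa> \<psi> \<psi>z lohi \<kappa>M NM \<psi>M der)
  then show ?thesis by (rule that)
qed

section \<open>The theorem and its constant\<close>

lemma patch_const_nonneg: "0 \<le> B \<Longrightarrow> 0 \<le> M \<Longrightarrow> 0 \<le> L \<Longrightarrow> 0 \<le> patch_const n r B M L"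
  unfolding patch_const_def by (intro mult_nonneg_nonneg add_nonneg_nonneg zero_le_power) auto

text \<open>Traces of a polynomial form on T to F and to S are traces of one polynomial form on the
  whole space, for which the pairing is already known.\<close>

lemma form_trace_subset: "X \<subseteq> Y \<Longrightarrow> form_trace X (form_trace Y \<omega>) = form_trace X \<omega>"
  using tangent_mono[of X Y] by (auto simp: form_trace_def fun_eq_iff)

theorem theorem7p1:
  fixes r :: nat
    and R :: "nat \<Rightarrow> 'a::euclidean_space set"
    and \<eta> :: "fe_family \<Rightarrow> nat \<Rightarrow> nat \<Rightarrow> nat \<Rightarrow> 'a dform"
  assumes "1 \<le> r" and "reference_dofs r R \<eta>"
  shows "\<exists>C :: ereal \<Rightarrow> real \<Rightarrow> real. (\<forall>p \<mu>. 0 < C p \<mu>) \<and>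
    (\<forall>fam k (\<T> :: 'a set set) \<Omega> orient A.
       admissible_family DIM('a) fam k \<and>
       triangulates \<T> \<Omega> \<and> face_connected \<T> \<and> orientation \<T> orient \<and>
       (\<forall>S\<in>\<T>. S \<noteq> {} \<longrightarrow> affine_bij (A S) (R (sdim S)) S) \<longrightarrow>
       (\<forall>S\<in>\<T>. \<forall>F\<in>\<T>. \<forall>i\<in>fe_index fam r k S.
          S \<noteq> {} \<and> S \<subseteq> F \<and> aff_dim F = int DIM('a) - 1 \<longrightarrow>
          (\<exists>\<xi>\<in>smooth_forms_c (int DIM('a) - int k - 1) F.
             (\<forall>T\<in>top_simplices \<T>. F \<subseteq> T \<longrightarrow>
                (\<forall>\<omega>\<in>poly_forms_on (int r) (int k) T.
                   form_integral (orient F) (wedge \<xi> (form_trace F \<omega>)) =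
                   dof R (\<eta> fam k) orient A S i \<omega>)) \<and>
             (\<forall>T\<in>top_simplices \<T>. F \<subseteq> T \<longrightarrow>
                (\<exists>\<Xi>\<in>smooth_forms (int DIM('a) - int k - 1) T.
                   form_trace F \<Xi> = \<xi> \<and>
                   (\<forall>G. G facet_of T \<and> G \<noteq> F \<longrightarrow> separated (form_support \<Xi>) G) \<and>
                   (\<forall>p. 1 \<le> p \<longrightarrow>
                      Lp_norm p (int DIM('a) - int k - 1) T \<Xi>
                        \<le> ereal (C p (shape_measure \<T>) *
                            mesh_size \<T> S powr (dim_over DIM('a) p - real DIM('a) + real k + 1)) \<and>
                      Lp_norm p (int DIM('a) - int k) T (ext_deriv T \<Xi>)
                        \<le> ereal (C p (shape_measure \<T>) *
                            mesh_size \<T> S powr (dim_over DIM('a) p - real DIM('a) + real k))))))))"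
proof -
  let ?n = "DIM('a)"
  obtain d where dim: "?n = Suc d" using DIM_positive[where 'a='a] gr0_conv_Suc by blast
  obtain b where b: "0 \<le> b" "\<And>fam k m i x vs. admissible_family ?n fam k \<Longrightarrow> k \<le> ?n \<Longrightarrow> m \<le> ?n \<Longrightarrow>
    i \<in> fe_index fam r k (R m) \<Longrightarrow> x \<in> R m \<Longrightarrow> set vs \<subseteq> {u - w |u w. u \<in> R m \<and> w \<in> R m} \<Longrightarrow>
    \<bar>\<eta> fam k m i x vs\<bar> \<le> b"
    by (rule reference_dofs_bound[OF assms(2)], rule that; assumption)
  obtain \<kappa> \<kappa>' \<psi> \<psi>' lo hi M where mol: "mollifiers r d \<kappa> \<kappa>' \<psi> \<psi>' lo hi M" by (rule mollifiers_exist)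
  interpret mollifiers r d \<kappa> \<kappa>' \<psi> \<psi>' lo hi M by (rule mol)
  define L where "L = (\<lambda>\<mu>. max 1 (real ?n * (fact ?n * \<mu>\<^sup>2)))"
  \<comment> \<open>Adding 1 makes the constant positive even if the bound b of the reference forms
    is 0.\<close>
  define C where "C = (\<lambda>(p :: ereal) \<mu>. patch_const ?n r (real ?n * fact ?n * b) M (L \<mu>) + 1)"
  have E0: "0 \<le> patch_const ?n r (real ?n * fact ?n * b) M (L \<mu>)" for \<mu>
    using b(1) bound(5) by (intro patch_const_nonneg) (auto simp: L_def)
  have C0: "0 < C p \<mu>" for p \<mu> using E0[of \<mu>] by (simp add: C_def)
  have EC: "x \<le> ereal (C p \<mu> * y)" if "x \<le> ereal (patch_const ?n r (real ?n * fact ?n * b) M (L \<mu>) * y)" "0 \<le> y" for x p \<mu> y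
  proof -
    have "patch_const ?n r (real ?n * fact ?n * b) M (L \<mu>) * y \<le> C p \<mu> * y"
      using that(2) by (intro mult_right_mono) (auto simp: C_def)
    then show ?thesis by (intro order_trans[OF that(1)]) simp
  qed
  show ?thesis
  proof (intro exI[of _ C] conjI allI impI ballI C0, elim conjE)
    fix fam k \<Omega> orient A S F i and \<T> :: "'a set set"
    assume adm: "admissible_family ?n fam k" and tri: "triangulates \<T> \<Omega>" and ori: "orientation \<T> orient"
      and A: "\<forall>S\<in>\<T>. S \<noteq> {} \<longrightarrow> affine_bij (A S) (R (sdim S)) S" and S: "S \<in> \<T>" and F: "F \<in> \<T>"
      and i: "i \<in> fe_index fam r k S" and S0: "S \<noteq> {}" and SF: "S \<subseteq> F" and dF: "aff_dim F = int ?n - 1"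
    let ?m = "sdim S" and ?h = "mesh_size \<T> S"
    have cx: "simplicial_complex \<T>" and top: "\<forall>S\<in>\<T>. \<exists>T\<in>top_simplices \<T>. S \<subseteq> T"
      using tri by (auto simp: triangulates_def)
    note SV = simplex_vertices[OF cx S]
    have wsS: "distinct (orient S)" "set (orient S) = vertices S" using ori S S0 by (auto simp: orientation_def)
    have m: "?m \<le> ?n" using aff_dim_le_DIM[of S] by (simp add: sdim_def)
    have Rm: "int ?m simplex R ?m" using assms(2) m by (simp add: reference_dofs_def)
    then obtain X where X: "int (card X) = int ?m + 1" "R ?m = convex hull X" by (auto simp: simplex_def)
    then have "X \<noteq> {}" by auto
    then have R: "convex (R ?m)" "R ?m \<noteq> {}" using X(2) by simp_all
    have aff: "affine_bij (A S) (R ?m) S" using A S S0 by blast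
    have iR: "i \<in> fe_index fam r k (R ?m)" using fe_index_affine[OF R aff] i by simp
    \<comment> \<open>The existence of the index i forces k \<le> dim S \<le> n - 1 = d, so that a =
      d - k is a natural number.\<close>
    have "k < length (orient S)"
      by (rule fe_index_degree[OF i _ wsS(1)]) (use SV wsS(2) S0 in auto)
    moreover have "int (length (orient S)) \<le> int ?n"
      using distinct_card[OF wsS(1)] wsS(2) SV(3) aff_dim_subset[OF SF] dF by simp
    ultimately have k: "k \<le> d" using dim by simp
    obtain a where a: "d = a + k" using k by (metis le_Suc_ex add.commute)
    let ?\<alpha> = "pullback_inv (A S) (R ?m) S (\<eta> fam k ?m i)"
    have "\<eta> fam k ?m i \<in> span (\<eta> fam k ?m ` fe_index fam r k (R ?m))" using iR by (intro span_base) auto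
    then have "\<eta> fam k ?m i \<in> dof_forms fam r k (R ?m)" using assms(2) adm m unfolding reference_dofs_def by blast
    then obtain \<zeta> where z: "ambient_form (int (sdim (R ?m)) - int k) (R ?m) (\<eta> fam k ?m i) \<zeta>"
      using dof_forms_ambient by blast
    have kn: "k \<le> ?n" using k dim by simp
    have \<alpha>: "cont_components S ?\<alpha>"
      by (rule pullback_inv_props(1)[OF R aff z b(2)[OF adm kn m iR]])
    have \<alpha>b: "\<forall>y\<in>S. \<forall>vs. set vs \<subseteq> {u - w |u w. u \<in> S \<and> w \<in> S} \<longrightarrow> \<bar>?\<alpha> y vs\<bar> \<le> b"
      by (intro ballI allI impI) (rule pullback_inv_props(2)[OF R aff z b(2)[OF adm kn m iR]])
    have Leq: "L (shape_measure \<T>) = max 1 (real ?n * (fact ?n * (shape_measure \<T>)\<^sup>2))" by (simp only: L_def)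
    obtain \<xi> where \<xi>: "\<xi> \<in> smooth_forms_c (int a) F"
      "\<And>\<omega>. \<omega> \<in> poly_forms (int r) (int k) \<Longrightarrow> form_integral (orient F) (wedge \<xi> (form_trace F \<omega>)) =
         form_integral (orient S) (wedge ?\<alpha> (form_trace S \<omega>))"
      "\<And>T. T \<in> top_simplices \<T> \<Longrightarrow> F \<subseteq> T \<Longrightarrow> \<exists>\<Xi>\<in>smooth_forms (int a) T. form_trace F \<Xi> = \<xi> \<and>
         (\<forall>G. G facet_of T \<and> G \<noteq> F \<longrightarrow> separated (form_support \<Xi>) G) \<and>
         (\<forall>p. 1 \<le> p \<longrightarrow>
            Lp_norm p (int a) T \<Xi> \<le> ereal (patch_const ?n r (real ?n * fact ?n * b) M (L (shape_measure \<T>)) *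
               ?h powr (dim_over ?n p - real a)) \<and>
            Lp_norm p (int a + 1) T (ext_deriv T \<Xi>) \<le> ereal (patch_const ?n r (real ?n * fact ?n * b) M (L (shape_measure \<T>)) *
               ?h powr (dim_over ?n p - real a - 1)))"
      using patch_family[where S = S and F = F and orient = orient and \<alpha> = ?\<alpha> and \<T> = \<T>,
          OF cx top ori F dF S S0 SF dim a \<alpha> b(1) \<alpha>b Leq]
      by (elim bexE conjE) (rule that, assumption, blast, blast)
    have "int ?n = int a + int k + 1" "real ?n = real a + real k + 1" by (simp_all only: dim a of_nat_Suc of_nat_add)
    then have deg: "int ?n - int k - 1 = int a" "int ?n - int k = int a + 1"
      "dim_over ?n p - real ?n + real k + 1 = dim_over ?n p - real a"
      "dim_over ?n p - real ?n + real k = dim_over ?n p - real a - 1" for p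
      by linarith+
    show "\<exists>\<xi>\<in>smooth_forms_c (int ?n - int k - 1) F.
       (\<forall>T\<in>top_simplices \<T>. F \<subseteq> T \<longrightarrow> (\<forall>\<omega>\<in>poly_forms_on (int r) (int k) T.
          form_integral (orient F) (wedge \<xi> (form_trace F \<omega>)) = dof R (\<eta> fam k) orient A S i \<omega>)) \<and>
       (\<forall>T\<in>top_simplices \<T>. F \<subseteq> T \<longrightarrow> (\<exists>\<Xi>\<in>smooth_forms (int ?n - int k - 1) T. form_trace F \<Xi> = \<xi> \<and>
          (\<forall>G. G facet_of T \<and> G \<noteq> F \<longrightarrow> separated (form_support \<Xi>) G) \<and>
          (\<forall>p. 1 \<le> p \<longrightarrow>
             Lp_norm p (int ?n - int k - 1) T \<Xi>
               \<le> ereal (C p (shape_measure \<T>) * ?h powr (dim_over ?n p - real ?n + real k + 1)) \<and>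
             Lp_norm p (int ?n - int k) T (ext_deriv T \<Xi>)
               \<le> ereal (C p (shape_measure \<T>) * ?h powr (dim_over ?n p - real ?n + real k)))))"
      unfolding deg(1,3) unfolding deg(2,4)
    proof (rule bexI[OF _ \<xi>(1)], intro conjI ballI impI)
      fix T \<omega> assume T: "F \<subseteq> T" and w: "\<omega> \<in> poly_forms_on (int r) (int k) T"
      obtain \<omega>' where w': "\<omega> = form_trace T \<omega>'" "\<omega>' \<in> poly_forms (int r) (int k)"
        using w by (auto simp: poly_forms_on_def)
      then show "form_integral (orient F) (wedge \<xi> (form_trace F \<omega>)) = dof R (\<eta> fam k) orient A S i \<omega>"
        using \<xi>(2)[OF w'(2)] T SF by (simp add: dof_def form_trace_subset)
    next
      fix T assume T: "T \<in> top_simplices \<T>" "F \<subseteq> T"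
      obtain \<Xi> where X: "\<Xi> \<in> smooth_forms (int a) T" "form_trace F \<Xi> = \<xi>"
         "\<forall>G. G facet_of T \<and> G \<noteq> F \<longrightarrow> separated (form_support \<Xi>) G"
         "\<And>p. 1 \<le> p \<Longrightarrow> Lp_norm p (int a) T \<Xi> \<le> ereal (patch_const ?n r (real ?n * fact ?n * b) M (L (shape_measure \<T>)) *
               ?h powr (dim_over ?n p - real a))"
         "\<And>p. 1 \<le> p \<Longrightarrow> Lp_norm p (int a + 1) T (ext_deriv T \<Xi>) \<le> ereal (patch_const ?n r (real ?n * fact ?n * b) M (L (shape_measure \<T>)) *
               ?h powr (dim_over ?n p - real a - 1))"
        using \<xi>(3)[OF T] by blast
      show "\<exists>\<Xi>\<in>smooth_forms (int a) T. form_trace F \<Xi> = \<xi> \<and>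
          (\<forall>G. G facet_of T \<and> G \<noteq> F \<longrightarrow> separated (form_support \<Xi>) G) \<and>
          (\<forall>p. 1 \<le> p \<longrightarrow>
             Lp_norm p (int a) T \<Xi> \<le> ereal (C p (shape_measure \<T>) * ?h powr (dim_over ?n p - real a)) \<and>
             Lp_norm p (int a + 1) T (ext_deriv T \<Xi>)
               \<le> ereal (C p (shape_measure \<T>) * ?h powr (dim_over ?n p - real a - 1)))"
        by (intro bexI[OF _ X(1)] conjI allI impI X(2) EC[OF X(4)] EC[OF X(5)]) (use X(3) in auto)
    qed
  qed
qed

end
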